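(* Assume that $f$ is uniformly Lipschitz continuous with respect to its second variable. Let $(m,\phi)$ be the unique weak solution of the mean field game system such that $-\partial_t\phi+H(x,D\phi)\ge0$ in $(0,T)\times\mathbb{T}^d$ in the viscosity sense, and let $\bar\eta\in\widetilde M(\Gamma)$ be such that (C1) $m(t)=e_t\sharp\bar\eta$ for any $t\in[0,T]$; (C2) $\displaystyle\int_{\mathbb{T}^d}\phi(0,x)m(0,x)dx=\int_{\mathbb{T}^d}\phi_T(x)m(T,x)dx+\int_\Gamma\int_0^TL(\gamma(s),\dot\gamma(s))\,ds\,d\bar\eta(\gamma)+\int_{\mathbb{T}^d}\int_0^Tf(x,m(s,x))m(s,x)\,ds\,dx.$ Then for any $\epsilon>0$ there exist $N_0\in\mathbb{N}$ and $\delta,\sigma>0$ such that, if $N\ge N_0$, the family of open-loop strategies $(\bar\eta,\dots,\bar\eta)$ is an $\epsilon$-Nash equilibrium for the $N$-player game with parameters $\delta,\sigma$: namely, for every player $i\in\{1,\dots,N\}$ and any strategy $\beta^i$ of player $i$, $$\mathbf{J}^N_i((\bar\eta)_{j\ne i},\beta^i)\ \ge\ \mathbf{J}^N_i((\bar\eta)_{j\ne i},\bar\eta)-\epsilon .$$ Moreover, $$\Big|\mathbf{J}^N_i((\bar\eta)_{j\ne i},\bar\eta)-\int_{\mathbb{T}^d}\phi(0,x)m_0(x)dx\Big|\le\epsilon .$$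
   Context: Fix $T>0$ and let $\mathbb{T}^d=\mathbb{R}^d/\mathbb{Z}^d$. $D$ is the space gradient; $L^p$, $BV$ etc. are over $(0,T)\times\mathbb{T}^d$ unless stated. $P(\mathbb{T}^d)$ is the set of Borel probability measures on $\mathbb{T}^d$ with weak convergence. Standing assumptions. (Coupling) $f:\mathbb{T}^d\times[0,\infty)\to\mathbb{R}$ is continuous, strictly increasing in its second variable, $f(x,0)=0$ for all $x$, and there are $q>1$, $C>0$ with $\frac1C m^{q-1}-C\le f(x,m)\le Cm^{q-1}+C$ for all $m\ge0$. (Hamiltonian) $H:\mathbb{T}^d\times\mathbb{R}^d\to\mathbb{R}$ is continuous, convex and differentiable in the second variable, $D_pH$ (derivative in the second variable) is continuous in both variables, and there are $r>\max\{d(q-1),1\}$ and $C>0$ with $\frac{1}{rC}|\xi|^r-C\le H(x,\xi)\le\frac Cr|\xi|^r+C$ for all $(x,\xi)$. Let $\frac1r+\frac1{r'}=1$. ($x$-dependence) There are $\theta\in[0,\frac{r}{d+1})$ and $C>0$ with $|H(x,\xi)-H(y,\xi)|\le C|x-y|\max(|\xi|,1)^\theta$ for all $x,y\in\mathbb{T}^d$, $\xi\in\mathbb{R}^d$. (Data) $\phi_T:\mathbb{T}^d\to\mathbb{R}$ is $C^1$; $m_0:\mathbb{T}^d\to\mathbb{R}$ is continuous, $m_0\ge0$, $\int_{\mathbb{T}^d}m_0\,dx=1$. $L(x,\xi)=H^*(x,-\xi)$, where $H^*$ is the convex conjugate of $H$ in the second variable. The mean field game system is $$-\partial_t\phi+H(x,D\phi)=f(x,m(t,x)),\quad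 \partial_t m-\mathrm{div}(mD_pH(x,D\phi))=0,\quad m(0)=m_0,\ \phi(T,x)=\phi_T(x).$$ For $\phi\in BV$, $\partial_t\phi^{ac}$ is the absolutely continuous part of $\partial_t\phi$. Weak solution. $(m,\phi)\in L^q\times BV$ with $m\ge0$ a.e. is a weak solution if: (i) $\phi$ is continuous in $[0,T]\times\mathbb{T}^d$, $D\phi\in L^r$, $mD_pH(x,D\phi)\in L^1$ and $(\partial_t\phi^{ac}-\langle D\phi,D_pH(x,D\phi)\rangle)m\in L^1$; (ii) $-\partial_t\phi^{ac}+H(x,D\phi)=f(x,m)$ a.e. in $\{m>0\}$, and $-\partial_t\phi+H(x,D\phi)\le f(x,m)$ in the sense of distributions in $(0,T)\times\mathbb{T}^d$, with $\phi(T,\cdot)=\phi_T$ in the sense of traces; (iii) $\partial_tm-\mathrm{div}(mD_pH(x,D\phi))=0$, $m(0)=m_0$, in the sense of distributions; (iv) $\int_0^T\!\int_{\mathbb{T}^d}m(\partial_t\phi^{ac}-\langle D\phi,D_pH(x,D\phi)\rangle)=\int_{\mathbb{T}^d}\big(m(T)\phi_T-m_0\phi(0)\big)$, where $m$ is identified with its representative continuous from $[0,T]$ to $P(\mathbb{T}^d)$. Under the standing assumptions there is exactly one weak solution satisfying in addition $-\partial_t\phi+H(x,D\phi)\ge0$ in the viscosity sense in $(0,T)\times\mathbb{T}^d$. Measures on curves. $\Gamma$ is the set of continuous curves $\gamma:[0,T]\to\mathbb{T}^d$ with uniform convergence; $e_t(\gamma)=\gamma(t)$; $\sharp$ denotes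 push-forward. $\widetilde M(\Gamma)$ is the set of Borel probability measures $\eta$ on $\Gamma$ with $\int_\Gamma\int_0^T|\dot\gamma(s)|^{r'}ds\,d\eta(\gamma)<\infty$ and such that $m'(t):=e_t\sharp\eta$ is absolutely continuous for every $t\in[0,T]$ (density still written $m'(t,\cdot)$) with $m'\in L^q((0,T)\times\mathbb{T}^d)$. Regularized coupling. Fix a regularization kernel $\xi:\mathbb{R}^d\to\mathbb{R}$ (smooth, symmetric, nonnegative, compactly supported, $\int\xi=1$), and set $\xi^\delta(x)=\delta^{-d}\xi(x/\delta)$. For $\delta,\sigma>0$, $x\in\mathbb{T}^d$ and $\mu\in P(\mathbb{T}^d)$, $$f^\delta(x,\mu)=f(x,(\xi^\delta\star\mu)(x)),\qquad f^{\delta,\sigma}(x,\mu)=(f^\delta(\cdot,\mu)\star\xi^\sigma)(x).$$ The $N$-player game with parameters $\delta,\sigma$. The initial positions $x_0^1,\dots,x_0^N$ are i.i.d. with law $m_0$. If the players use trajectories $\gamma^1,\dots,\gamma^N\in\Gamma$ with $\gamma^i(0)=x_0^i$, the cost of player $i$ is $$J^N_i(\gamma^1,\dots,\gamma^N)=\int_0^T\Big(L(\gamma^i(s),\dot\gamma^i(s))+f^{\delta,\sigma}\Big(\gamma^i(s),\frac1{N-1}\sum_{j\ne i}\delta_{\gamma^j(s)}\Big)\Big)ds+\phi_T(\gamma^i(T)),$$ with value $+\infty$ if $\gamma^i\notin W^{1,r'}([0,T])$. Let $(\Omega,\mathcal{F},\mathbb{P})$ be $[0,1]$ with its Borel $\sigma$-algebra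 and Lebesgue measure. A strategy of player $i$ is a Borel measurable map $\beta^i:\Omega\times\mathbb{T}^d\times\Gamma^{N-1}\to\Gamma$ such that (1) $\beta^i(\omega,x,(\gamma^j)_{j\ne i})(0)=x$ always, and (2) there is a delay $\tau>0$ such that for any $(\omega,x)$, any $t$, and any $(\gamma^{1,j})_{j\neq i}$, $(\gamma^{2,j})_{j\ne i}$ with $\gamma^{1,j}=\gamma^{2,j}$ on $[0,t]$ for all $j\neq i$, the responses $\beta^i(\omega,x,(\gamma^{1,j})_{j\ne i})$ and $\beta^i(\omega,x,(\gamma^{2,j})_{j\ne i})$ coincide on $[0,t+\tau]$. Given strategies $(\beta^1,\dots,\beta^N)$, there is a unique family of Borel maps $\gamma^i:\Omega^N\times(\mathbb{T}^d)^N\to\Gamma$ with $\beta^i(\omega^i,x_0^i,(\gamma^j(\omega,x_0))_{j\ne i})=\gamma^i(\omega,x_0)$ for all $i$, where $\omega=(\omega^1,\dots,\omega^N)$, $x_0=(x_0^1,\dots,x_0^N)$. The cost of player $i$ is $$\mathbf{J}_i^N(\beta^1,\dots,\beta^N)=\int_{\Omega^N\times(\mathbb{T}^d)^N}J^N_i(\gamma^1(\omega,x_0),\dots,\gamma^N(\omega,x_0))\prod_{j=1}^N\mathbb{P}(d\omega^j)\,m_0(dx_0^j),$$ also written $\mathbf{J}^N_i((\beta^j)_{j\ne i},\beta^i)$. Open-loop strategy $\bar\eta$. Since $e_0\sharp\bar\eta=m_0$, there is a measurable map $\beta:\Omega\times\mathbb{T}^d\to\Gamma$ with $\beta(\omega,x)(0)=x$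 and $\int_\Gamma G\,d\bar\eta=\int_{\Omega\times\mathbb{T}^d}G(\beta(\omega,x))\,\mathbb{P}(d\omega)m_0(dx)$ for all bounded continuous $G:\Gamma\to\mathbb{R}$. "Player $j$ plays $\bar\eta$" means that player $j$ uses the strategy $(\omega,x,(\gamma^k)_{k\ne j})\mapsto\beta(\omega,x)$. *)

theory Defs
  imports "HOL-Probability.Probability"
begin

section \<open>The flat torus\<close>

quotient_type (overloaded) 'd torus = "real ^ 'd::finite" / "\<lambda>x y. \<forall>i. x $ i - y $ i \<in> \<int>"
  morphisms rep_torus to_torus
proof (rule equivpI)
  show "reflp (\<lambda>x y :: real ^ 'd. \<forall>i. x $ i - y $ i \<in> \<int>)"
    by (simp add: reflp_def)
  show "symp (\<lambda>x y :: real ^ 'd. \<forall>i. x $ i - y $ i \<in> \<int>)"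
    by (auto simp: symp_def) (metis Ints_minus minus_diff_eq)
  show "transp (\<lambda>x y :: real ^ 'd. \<forall>i. x $ i - y $ i \<in> \<int>)"
  proof (rule transpI, rule allI)
    fix x y z :: "real ^ 'd" and i
    assume "\<forall>i. x $ i - y $ i \<in> \<int>" "\<forall>i. y $ i - z $ i \<in> \<int>"
    then have "(x $ i - y $ i) + (y $ i - z $ i) \<in> \<int>" by (intro Ints_add) auto
    then show "x $ i - z $ i \<in> \<int>" by simp
  qed
qed

lemma to_torus_eq_iff: "to_torus x = to_torus y \<longleftrightarrow> (\<forall>i. x $ i - y $ i \<in> \<int>)"
  by (rule torus.abs_eq_iff)

lemma to_torus_surj: "\<exists>w. to_torus w = x"
  by (induct x rule: torus.abs_induct) auto

lemma Ints_diff_cong: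
  fixes a b c d :: real
  assumes "a - b \<in> \<int>" "c - d \<in> \<int>"
  shows "a + c - (b + d) \<in> \<int>" and "a - c - (b - d) \<in> \<int>" and "- a - (- b) \<in> \<int>"
proof -
  have "a + c - (b + d) = (a - b) + (c - d)" "a - c - (b - d) = (a - b) - (c - d)"
    "- a - (- b) = - (a - b)" by simp_all
  with assms show "a + c - (b + d) \<in> \<int>" and "a - c - (b - d) \<in> \<int>" and "- a - (- b) \<in> \<int>"
    by (metis Ints_add, metis Ints_diff, metis Ints_minus)
qed

instantiation torus :: (finite) ab_group_add
begin

lift_definition zero_torus :: "'a torus" is 0 .

lift_definition plus_torus :: "'a torus \<Rightarrow> 'a torus \<Rightarrow> 'a torus" is "(+)"
  unfolding vector_add_component using Ints_diff_cong(1) by blast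

lift_definition uminus_torus :: "'a torus \<Rightarrow> 'a torus" is "uminus"
  unfolding vector_uminus_component using Ints_diff_cong(3) by blast

lift_definition minus_torus :: "'a torus \<Rightarrow> 'a torus \<Rightarrow> 'a torus" is "(-)"
  unfolding vector_minus_component using Ints_diff_cong(2) by blast

instance
  by standard (transfer; simp add: algebra_simps)+

end

lemma to_torus_0: "to_torus 0 = 0"
  by (simp add: zero_torus_def)

lemma to_torus_add: "to_torus (x + y) = to_torus x + to_torus y"
  by (simp add: plus_torus.abs_eq)

lemma to_torus_minus: "to_torus (- x) = - to_torus x"
  by (simp add: uminus_torus.abs_eq)

lemma to_torus_diff: "to_torus (x - y) = to_torus x - to_torus y"
  by (simp add: minus_torus.abs_eq)

lemma closed_to_torus_fibre: "closed {w. to_torus w = z}"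
proof -
  obtain u where u: "to_torus u = z" using to_torus_surj by blast
  have "{w. to_torus w = z} = (\<Inter>i. (\<lambda>w. w $ i - u $ i) -` \<int>)"
    by (auto simp: u[symmetric] to_torus_eq_iff)
  moreover have "closed ((\<lambda>w::real ^ 'a. w $ i - u $ i) -` \<int>)" for i
    by (intro continuous_closed_vimage closed_Ints) (auto intro!: continuous_intros)
  ultimately show ?thesis by auto
qed

instantiation torus :: (finite) metric_space
begin

definition dist_torus :: "'a torus \<Rightarrow> 'a torus \<Rightarrow> real" where
  "dist_torus x y = (INF w\<in>{w. to_torus w = x - y}. norm w)"

definition uniformity_torus :: "('a torus \<times> 'a torus) filter" where
  "uniformity_torus = (INF e\<in>{0<..}. principal {(x, y). dist x y < e})"

definition open_torus :: "'a torus set \<Rightarrow> bool" where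
  "open_torus U \<longleftrightarrow> (\<forall>x\<in>U. eventually (\<lambda>(x', y). x' = x \<longrightarrow> y \<in> U) uniformity)"

lemma dist_torus_le: "to_torus w = x - y \<Longrightarrow> dist x y \<le> norm w"
  unfolding dist_torus_def by (rule cINF_lower) (simp_all add: bdd_below_norm_image)

lemma dist_torus_attained: "\<exists>w. to_torus w = x - y \<and> dist x y = norm w"
proof -
  obtain u where "to_torus u = x - y" using to_torus_surj by blast
  then have ne: "{w. to_torus w = x - y} \<noteq> {}" by blast
  obtain w where w: "w \<in> {w. to_torus w = x - y}"
    "\<And>v. v \<in> {w. to_torus w = x - y} \<Longrightarrow> dist 0 w \<le> dist 0 v"
    using distance_attains_inf[OF closed_to_torus_fibre ne, of 0] by metis
  have "norm w \<le> (INF w\<in>{w. to_torus w = x - y}. norm w)"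
    using w(2) by (intro cINF_greatest[OF ne]) simp
  moreover have "dist x y \<le> norm w" using w(1) by (intro dist_torus_le) simp
  ultimately have "dist x y = norm w" unfolding dist_torus_def by linarith
  with w(1) show ?thesis by blast
qed

instance
proof
  fix x y z :: "'a torus"
  obtain u where u: "to_torus u = x - y" "dist x y = norm u" using dist_torus_attained by blast
  show "dist x y = 0 \<longleftrightarrow> x = y"
  proof
    assume "dist x y = 0"
    with u(2) have "u = 0" by simp
    with u(1) have "x - y = 0" by (simp add: to_torus_0)
    then show "x = y" by simp
  next
    assume "x = y"
    then have "dist x y \<le> norm (0 :: real ^ 'a)" by (intro dist_torus_le) (simp add: to_torus_0)
    with u(2) show "dist x y = 0" by simp
  qed
  obtain v where v: "to_torus v = x - z" "dist x z = norm v" using dist_torus_attained by blast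
  obtain w where w: "to_torus w = y - z" "dist y z = norm w" using dist_torus_attained by blast
  have "to_torus (v - w) = x - y" by (simp add: to_torus_diff v w)
  then have "dist x y \<le> norm (v - w)" by (rule dist_torus_le)
  also have "\<dots> \<le> dist x z + dist y z" unfolding v w by (rule norm_triangle_ineq4)
  finally show "dist x y \<le> dist x z + dist y z" .
qed (simp_all add: uniformity_torus_def open_torus_def)

end

lemma continuous_to_torus: "continuous_on UNIV to_torus"
proof (rule continuous_onI)
  fix x :: "real ^ 'a" and e :: real assume "e > 0"
  moreover have "dist (to_torus y) (to_torus x) \<le> dist y x" for y
    using dist_torus_le[of "y - x"] by (simp add: to_torus_diff dist_norm)
  ultimately show "\<exists>d>0. \<forall>x'\<in>UNIV. dist x' x < d \<longrightarrow> dist (to_torus x') (to_torus x) \<le> e"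
    by (metis less_eq_real_def order.trans)
qed

text \<open>The metric topology is the quotient topology.\<close>

lemma open_torus_iff: "open U \<longleftrightarrow> open (to_torus -` U)"
proof
  assume "open U"
  then show "open (to_torus -` U)"
    by (rule open_vimage) (rule continuous_to_torus)
next
  assume op: "open (to_torus -` U)"
  show "open U"
    unfolding open_dist
  proof
    fix x assume "x \<in> U"
    obtain u where u: "to_torus u = x" using to_torus_surj by blast
    with \<open>x \<in> U\<close> op obtain e where e: "e > 0" "\<And>v. dist v u < e \<Longrightarrow> to_torus v \<in> U"
      unfolding open_dist by auto
    have "y \<in> U" if "dist y x < e" for y
    proof -
      obtain w where w: "to_torus w = y - x" "dist y x = norm w"
        using dist_torus_attained by blast
      have "to_torus (u + w) \<in> U" using w that by (intro e) (simp add: dist_norm)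
      then show ?thesis by (simp add: to_torus_add u w)
    qed
    then show "\<exists>e>0. \<forall>y. dist y x < e \<longrightarrow> y \<in> U" using e(1) by blast
  qed
qed

definition torus_vol :: "'d::finite torus measure" where
  "torus_vol = distr (restrict_space lborel {w. \<forall>i. 0 \<le> w $ i \<and> w $ i < 1}) borel to_torus"

section \<open>Function spaces\<close>

definition Lp :: "real \<Rightarrow> 'a measure \<Rightarrow> ('a \<Rightarrow> 'b::{banach, second_countable_topology}) \<Rightarrow> bool" where
  "Lp p M u \<longleftrightarrow> u \<in> borel_measurable M \<and> integrable M (\<lambda>z. norm (u z) powr p)"

definition gradient :: "(real ^ 'd::finite \<Rightarrow> real) \<Rightarrow> real ^ 'd \<Rightarrow> real ^ 'd" where
  "gradient g p = (\<chi> i. frechet_derivative g (at p) (axis i 1))"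

text \<open>\<open>Ck_on k g S\<close> is meant for open \<open>S\<close>.\<close>

primrec Ck_on :: "nat \<Rightarrow> ('a::real_normed_vector \<Rightarrow> real) \<Rightarrow> 'a set \<Rightarrow> bool" where
  "Ck_on 0 g S \<longleftrightarrow> continuous_on S g"
| "Ck_on (Suc k) g S \<longleftrightarrow>
     (\<forall>x\<in>S. g differentiable at x) \<and> (\<forall>v. Ck_on k (\<lambda>x. frechet_derivative g (at x) v) S)"

text \<open>Functions on time-space are functions on \<^typ>\<open>real \<times> 'd torus\<close>; only their values for times in
  \<open>[0,T]\<close> (or \<open>(0,T)\<close>) matter. Regularity is that of the lift to \<^typ>\<open>real \<times> (real ^ 'd)\<close>.\<close>

definition st_lift :: "(real \<times> 'd::finite torus \<Rightarrow> real) \<Rightarrow> real \<times> (real ^ 'd) \<Rightarrow> real" where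
  "st_lift \<psi> = (\<lambda>(t, y). \<psi> (t, to_torus y))"

definition st_smooth :: "(real \<times> 'd::finite torus \<Rightarrow> real) \<Rightarrow> bool" where
  "st_smooth \<psi> \<longleftrightarrow> (\<forall>k. Ck_on k (st_lift \<psi>) UNIV)"

definition dt :: "(real \<times> 'd::finite torus \<Rightarrow> real) \<Rightarrow> real \<times> 'd torus \<Rightarrow> real" where
  "dt \<psi> = (\<lambda>(t, x). deriv (\<lambda>s. \<psi> (s, x)) t)"

definition Dx :: "(real \<times> 'd::finite torus \<Rightarrow> real) \<Rightarrow> real \<times> 'd torus \<Rightarrow> real ^ 'd" where
  "Dx \<psi> = (\<lambda>(t, x). gradient (\<lambda>y. \<psi> (t, x + to_torus y)) 0)"

definition st_vol :: "real \<Rightarrow> (real \<times> 'd::finite torus) measure" where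
  "st_vol T = restrict_space lborel {0<..<T} \<Otimes>\<^sub>M torus_vol"

definition test_funs :: "real \<Rightarrow> (real \<times> 'd::finite torus \<Rightarrow> real) set" where
  "test_funs T = {\<psi>. st_smooth \<psi> \<and>
     (\<exists>a b. 0 < a \<and> b < T \<and> (\<forall>t x. t < a \<or> b < t \<longrightarrow> \<psi> (t, x) = 0))}"

text \<open>Test functions that need not vanish at time \<open>0\<close>, respectively at time \<open>T\<close>.\<close>

definition test_funs_init :: "real \<Rightarrow> (real \<times> 'd::finite torus \<Rightarrow> real) set" where
  "test_funs_init T = {\<psi>. st_smooth \<psi> \<and> (\<exists>b<T. \<forall>t x. b < t \<longrightarrow> \<psi> (t, x) = 0)}"

definition test_funs_term :: "(real \<times> 'd::finite torus \<Rightarrow> real) set" where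
  "test_funs_term = {\<psi>. st_smooth \<psi> \<and> (\<exists>a>0. \<forall>t x. t < a \<longrightarrow> \<psi> (t, x) = 0)}"

text \<open>A finite signed measure on \<open>(0,T) \<times> \<T>\<^sup>d\<close> is given as the difference of two finite
  measures \<open>P\<close> and \<open>M\<close>. \<open>deriv_measure T D u P M\<close> says that \<open>P - M\<close> is the distributional
  derivative of \<open>u\<close> associated with the partial derivative \<open>D\<close>.\<close>

definition st_finite_measure :: "real \<Rightarrow> (real \<times> 'd::finite torus) measure \<Rightarrow> bool" where
  "st_finite_measure T P \<longleftrightarrow>
     sets P = sets (st_vol T :: (real \<times> 'd torus) measure) \<and> finite_measure P"

definition deriv_measure ::
  "real \<Rightarrow> ((real \<times> 'd::finite torus \<Rightarrow> real) \<Rightarrow> real \<times> 'd torus \<Rightarrow> real) \<Rightarrow>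
   (real \<times> 'd torus \<Rightarrow> real) \<Rightarrow> (real \<times> 'd torus) measure \<Rightarrow> (real \<times> 'd torus) measure \<Rightarrow> bool"
  where
  "deriv_measure T D u P M \<longleftrightarrow> st_finite_measure T P \<and> st_finite_measure T M \<and>
     (\<forall>\<psi>\<in>test_funs T. (\<integral>z. u z * D \<psi> z \<partial>st_vol T) = - ((\<integral>z. \<psi> z \<partial>P) - (\<integral>z. \<psi> z \<partial>M)))"

definition BV :: "real \<Rightarrow> (real \<times> 'd::finite torus \<Rightarrow> real) \<Rightarrow> bool" where
  "BV T u \<longleftrightarrow> integrable (st_vol T) u \<and> (\<exists>P M. deriv_measure T dt u P M) \<and>
     (\<forall>i. \<exists>P M. deriv_measure T (\<lambda>\<psi> z. Dx \<psi> z $ i) u P M)"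

definition st_singular :: "real \<Rightarrow> (real \<times> 'd::finite torus) measure \<Rightarrow> bool" where
  "st_singular T P \<longleftrightarrow> st_finite_measure T P \<and>
     (\<exists>A\<in>null_sets (st_vol T). emeasure P (space P - A) = 0)"

text \<open>\<open>g\<close> is (the density of) the absolutely continuous part of \<open>\<partial>\<^sub>t u\<close>: the Lebesgue
  decomposition is \<open>\<partial>\<^sub>t u = g dt dx + (P - M)\<close> with \<open>P\<close>, \<open>M\<close> singular.\<close>

definition dt_ac :: "real \<Rightarrow> (real \<times> 'd::finite torus \<Rightarrow> real) \<Rightarrow> (real \<times> 'd torus \<Rightarrow> real) \<Rightarrow> bool" where
  "dt_ac T u g \<longleftrightarrow> integrable (st_vol T) g \<and>
     (\<exists>P M. st_singular T P \<and> st_singular T M \<and>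
       (\<forall>\<psi>\<in>test_funs T. (\<integral>z. u z * dt \<psi> z \<partial>st_vol T) =
          - ((\<integral>z. g z * \<psi> z \<partial>st_vol T) + (\<integral>z. \<psi> z \<partial>P) - (\<integral>z. \<psi> z \<partial>M))))"

definition weak_grad ::
  "real \<Rightarrow> (real \<times> 'd::finite torus \<Rightarrow> real) \<Rightarrow> (real \<times> 'd torus \<Rightarrow> real ^ 'd) \<Rightarrow> bool" where
  "weak_grad T u G \<longleftrightarrow> integrable (st_vol T) G \<and>
     (\<forall>\<psi>\<in>test_funs T. \<forall>i. (\<integral>z. u z * Dx \<psi> z $ i \<partial>st_vol T) = - (\<integral>z. G z $ i * \<psi> z \<partial>st_vol T))"

text \<open>The trace of a \<open>BV\<close> function at \<open>t = T\<close>, characterised by the Green formula.\<close>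

definition trace_at_T ::
  "real \<Rightarrow> (real \<times> 'd::finite torus \<Rightarrow> real) \<Rightarrow> ('d torus \<Rightarrow> real) \<Rightarrow> bool" where
  "trace_at_T T u h \<longleftrightarrow> integrable torus_vol h \<and>
     (\<exists>P M. deriv_measure T dt u P M \<and>
       (\<forall>\<psi>\<in>test_funs_term.
          (\<integral>z. u z * dt \<psi> z \<partial>st_vol T) + ((\<integral>z. \<psi> z \<partial>P) - (\<integral>z. \<psi> z \<partial>M))
            = (\<integral>x. h x * \<psi> (T, x) \<partial>torus_vol)))"

section \<open>Standing assumptions\<close>

definition coupling_cond :: "real \<Rightarrow> ('d::finite torus \<Rightarrow> real \<Rightarrow> real) \<Rightarrow> bool" where
  "coupling_cond q f \<longleftrightarrow>
     continuous_on (UNIV \<times> {0..}) (\<lambda>(x, m). f x m) \<and>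
     (\<forall>x. strict_mono_on {0..} (f x)) \<and> (\<forall>x. f x 0 = 0) \<and> q > 1 \<and>
     (\<exists>C>0. \<forall>x. \<forall>m\<ge>0. m powr (q - 1) / C - C \<le> f x m \<and> f x m \<le> C * m powr (q - 1) + C)"

definition hamiltonian_cond ::
  "real \<Rightarrow> real \<Rightarrow> ('d::finite torus \<Rightarrow> real ^ 'd \<Rightarrow> real) \<Rightarrow> bool" where
  "hamiltonian_cond q r H \<longleftrightarrow>
     continuous_on UNIV (\<lambda>(x, p). H x p) \<and>
     (\<forall>x. convex_on UNIV (H x)) \<and> (\<forall>x p. H x differentiable at p) \<and>
     continuous_on UNIV (\<lambda>(x, p). gradient (H x) p) \<and>
     r > max (real CARD('d) * (q - 1)) 1 \<and>
     (\<exists>C>0. \<forall>x p. norm p powr r / (r * C) - C \<le> H x p \<and> H x p \<le> C / r * norm p powr r + C)"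

definition x_dependence_cond :: "real \<Rightarrow> ('d::finite torus \<Rightarrow> real ^ 'd \<Rightarrow> real) \<Rightarrow> bool" where
  "x_dependence_cond r H \<longleftrightarrow>
     (\<exists>\<theta> C. 0 \<le> \<theta> \<and> \<theta> < r / (real CARD('d) + 1) \<and> C > 0 \<and>
       (\<forall>x y p. \<bar>H x p - H y p\<bar> \<le> C * dist x y * max (norm p) 1 powr \<theta>))"

definition data_cond :: "('d::finite torus \<Rightarrow> real) \<Rightarrow> ('d torus \<Rightarrow> real) \<Rightarrow> bool" where
  "data_cond \<phi>T m0 \<longleftrightarrow>
     Ck_on 1 (\<lambda>y. \<phi>T (to_torus y)) UNIV \<and>
     continuous_on UNIV m0 \<and> (\<forall>x. m0 x \<ge> 0) \<and> (\<integral>x. m0 x \<partial>torus_vol) = 1"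

text \<open>A supremum in the reals: for superlinear \<open>h\<close> the set is bounded above.\<close>

definition convex_conj :: "(real ^ 'd::finite \<Rightarrow> real) \<Rightarrow> real ^ 'd \<Rightarrow> real" where
  "convex_conj h v = (SUP p. inner p v - h p)"

definition lagrangian :: "('d::finite torus \<Rightarrow> real ^ 'd \<Rightarrow> real) \<Rightarrow> 'd torus \<Rightarrow> real ^ 'd \<Rightarrow> real" where
  "lagrangian H x v = convex_conj (H x) (- v)"

section \<open>Weak solutions\<close>

text \<open>\<open>\<mu>\<close> is the representative of the density \<open>m\<close> that is continuous from \<open>[0,T]\<close> to the
  probability measures on the torus with weak convergence.\<close>

definition continuous_rep ::
  "real \<Rightarrow> (real \<times> 'd::finite torus \<Rightarrow> real) \<Rightarrow> (real \<Rightarrow> 'd torus measure) \<Rightarrow> bool" where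
  "continuous_rep T m \<mu> \<longleftrightarrow>
     (\<forall>t\<in>{0..T}. prob_space (\<mu> t) \<and> sets (\<mu> t) = sets borel) \<and>
     (\<forall>h :: 'd torus \<Rightarrow> real. continuous_on UNIV h \<longrightarrow>
        continuous_on {0..T} (\<lambda>t. \<integral>x. h x \<partial>\<mu> t)) \<and>
     (AE t in restrict_space lborel {0<..<T}. \<mu> t = density torus_vol (\<lambda>x. ennreal (m (t, x))))"

text \<open>The Borel functions \<open>m\<close>, \<open>g\<close>, \<open>G\<close> stand for their classes modulo null sets, with
  \<open>g = \<partial>\<^sub>t \<phi>\<^sup>a\<^sup>c\<close> and \<open>G = D\<phi>\<close> (these are determined up to null sets by \<open>\<phi>\<close>, and \<open>\<mu>\<close> on
  \<open>[0,T]\<close> by \<open>m\<close>). As \<open>f x\<close> lives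
  on \<open>[0,\<infinity>)\<close> and \<open>m \<ge> 0\<close> holds only almost everywhere, \<open>f(x,m)\<close> is written with \<open>max 0 m\<close>.\<close>

definition weak_solution ::
  "real \<Rightarrow> real \<Rightarrow> real \<Rightarrow> ('d::finite torus \<Rightarrow> real \<Rightarrow> real) \<Rightarrow> ('d torus \<Rightarrow> real ^ 'd \<Rightarrow> real) \<Rightarrow>
   ('d torus \<Rightarrow> real) \<Rightarrow> ('d torus \<Rightarrow> real) \<Rightarrow>
   (real \<times> 'd torus \<Rightarrow> real) \<Rightarrow> (real \<times> 'd torus \<Rightarrow> real) \<Rightarrow> bool" where
  "weak_solution T q r f H \<phi>T m0 m \<phi> \<longleftrightarrow>
     Lp q (st_vol T) m \<and> BV T \<phi> \<and> (AE z in st_vol T. m z \<ge> 0) \<and>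
     continuous_on ({0..T} \<times> UNIV) \<phi> \<and>
     (\<exists>g G \<mu>. dt_ac T \<phi> g \<and> weak_grad T \<phi> G \<and> continuous_rep T m \<mu> \<and>
       Lp r (st_vol T) G \<and>
       integrable (st_vol T) (\<lambda>z. m z *\<^sub>R gradient (H (snd z)) (G z)) \<and>
       integrable (st_vol T) (\<lambda>z. (g z - inner (G z) (gradient (H (snd z)) (G z))) * m z) \<and>
       (AE z in st_vol T. m z > 0 \<longrightarrow> - g z + H (snd z) (G z) = f (snd z) (m z)) \<and>
       (\<forall>\<psi>\<in>test_funs T. (\<forall>z. \<psi> z \<ge> 0) \<longrightarrow>
          (\<integral>z. \<phi> z * dt \<psi> z \<partial>st_vol T) + (\<integral>z. H (snd z) (G z) * \<psi> z \<partial>st_vol T)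
            \<le> (\<integral>z. f (snd z) (max 0 (m z)) * \<psi> z \<partial>st_vol T)) \<and>
       trace_at_T T \<phi> \<phi>T \<and>
       (\<forall>\<psi>\<in>test_funs_init T.
          (\<integral>z. m z * (dt \<psi> z - inner (Dx \<psi> z) (gradient (H (snd z)) (G z))) \<partial>st_vol T)
            + (\<integral>x. \<psi> (0, x) * m0 x \<partial>torus_vol) = 0) \<and>
       (\<integral>z. m z * (g z - inner (G z) (gradient (H (snd z)) (G z))) \<partial>st_vol T)
         = (\<integral>x. \<phi>T x \<partial>\<mu> T) - (\<integral>x. \<phi> (0, x) * m0 x \<partial>torus_vol))"

definition viscosity_supersolution ::
  "real \<Rightarrow> ('d::finite torus \<Rightarrow> real ^ 'd \<Rightarrow> real) \<Rightarrow> (real \<times> 'd torus \<Rightarrow> real) \<Rightarrow> bool" where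
  "viscosity_supersolution T H \<phi> \<longleftrightarrow>
     (\<forall>\<psi> z. Ck_on 1 (st_lift \<psi>) ({0<..<T} \<times> UNIV) \<and> fst z \<in> {0<..<T} \<and>
        (\<forall>\<^sub>F w in nhds z. \<phi> z - \<psi> z \<le> \<phi> w - \<psi> w) \<longrightarrow>
        - dt \<psi> z + H (snd z) (Dx \<psi> z) \<ge> 0)"

section \<open>Measures on curves\<close>

text \<open>\<open>\<Gamma>\<close> is the subspace of \<^typ>\<open>(real, 'd torus) bcontfun\<close>, with its sup-distance, of curves that
  are constant before \<open>0\<close> and after \<open>T\<close>; restriction to \<open>[0,T]\<close> is an isometry of it onto the
  continuous curves on \<open>[0,T]\<close> with uniform convergence.\<close>

type_synonym 'd curve = "(real, 'd torus) bcontfun"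

definition curves :: "real \<Rightarrow> 'd::finite curve set" where
  "curves T = {\<gamma>. \<forall>s. apply_bcontfun \<gamma> s = apply_bcontfun \<gamma> (max 0 (min T s))}"

definition curve_space :: "real \<Rightarrow> 'd::finite curve measure" where
  "curve_space T = restrict_space borel (curves T)"

text \<open>Absolutely continuous curves and their derivative (unique up to null sets). A curve is in
  \<open>W\<^sup>1\<^sup>,\<^sup>p\<close> if its derivative is in \<open>L\<^sup>p\<close>.\<close>

definition has_velocity :: "real \<Rightarrow> 'd::finite curve \<Rightarrow> (real \<Rightarrow> real ^ 'd) \<Rightarrow> bool" where
  "has_velocity T \<gamma> v \<longleftrightarrow> set_integrable lborel {0..T} v \<and>
     (\<forall>t\<in>{0..T}. apply_bcontfun \<gamma> t = apply_bcontfun \<gamma> 0 + to_torus (LINT s:{0..t}|lborel. v s))"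

definition velocity :: "real \<Rightarrow> 'd::finite curve \<Rightarrow> real \<Rightarrow> real ^ 'd" where
  "velocity T \<gamma> = (SOME v. has_velocity T \<gamma> v)"

definition sobolev_curve :: "real \<Rightarrow> real \<Rightarrow> 'd::finite curve \<Rightarrow> bool" where
  "sobolev_curve T p \<gamma> \<longleftrightarrow> (\<exists>v. has_velocity T \<gamma> v) \<and>
     set_integrable lborel {0..T} (\<lambda>s. norm (velocity T \<gamma> s) powr p)"

text \<open>The integral of \<open>l(s, \<gamma>(s), \<gamma>'(s))\<close> over \<open>[0,T]\<close>, with value \<open>\<infinity>\<close> outside \<open>W\<^sup>1\<^sup>,\<^sup>p\<close>.\<close>

definition path_integral ::
  "real \<Rightarrow> real \<Rightarrow> (real \<Rightarrow> 'd::finite torus \<Rightarrow> real ^ 'd \<Rightarrow> real) \<Rightarrow> 'd curve \<Rightarrow> ereal" where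
  "path_integral T p l \<gamma> =
     (if sobolev_curve T p \<gamma>
      then ereal (LINT s:{0..T}|lborel. l s (apply_bcontfun \<gamma> s) (velocity T \<gamma> s))
      else \<infinity>)"

text \<open>Only meaningful if one of the two parts is finite, as is the case for the costs below, which
  are bounded from below.\<close>

definition ext_integral :: "'a measure \<Rightarrow> ('a \<Rightarrow> ereal) \<Rightarrow> ereal" where
  "ext_integral M X =
     enn2ereal (\<integral>\<^sup>+x. e2ennreal (X x) \<partial>M) - enn2ereal (\<integral>\<^sup>+x. e2ennreal (- X x) \<partial>M)"

definition eval_law :: "'d::finite curve measure \<Rightarrow> real \<Rightarrow> 'd torus measure" where
  "eval_law \<eta> t = distr \<eta> borel (\<lambda>\<gamma>. apply_bcontfun \<gamma> t)"

definition curve_measures :: "real \<Rightarrow> real \<Rightarrow> real \<Rightarrow> 'd::finite curve measure set" where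
  "curve_measures T q r' = {\<eta>. prob_space \<eta> \<and> sets \<eta> = sets (curve_space T) \<and>
     ext_integral \<eta> (path_integral T r' (\<lambda>s x v. norm v powr r')) < \<infinity> \<and>
     (\<forall>t\<in>{0..T}. absolutely_continuous torus_vol (eval_law \<eta> t)) \<and>
     (\<exists>m'. Lp q (st_vol T) m' \<and> (\<forall>t\<in>{0<..<T}.
        eval_law \<eta> t = density torus_vol (\<lambda>x. ennreal (m' (t, x)))))}"

section \<open>Regularized coupling\<close>

definition reg_kernel :: "(real ^ 'd::finite \<Rightarrow> real) \<Rightarrow> bool" where
  "reg_kernel \<xi> \<longleftrightarrow> (\<forall>k. Ck_on k \<xi> UNIV) \<and> (\<forall>x. \<xi> (- x) = \<xi> x) \<and> (\<forall>x. \<xi> x \<ge> 0) \<and>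
     compact (closure {x. \<xi> x \<noteq> 0}) \<and> (\<integral>x. \<xi> x \<partial>lborel) = 1"

definition scaled_kernel :: "(real ^ 'd::finite \<Rightarrow> real) \<Rightarrow> real \<Rightarrow> real ^ 'd \<Rightarrow> real" where
  "scaled_kernel \<xi> \<delta> x = \<xi> (x /\<^sub>R \<delta>) / \<delta> ^ CARD('d)"

text \<open>Convolution of a compactly supported kernel on \<open>\<real>\<^sup>d\<close> with a measure on the torus
  (through the periodization of the kernel) and with a function on the torus.\<close>

definition periodize :: "(real ^ 'd::finite \<Rightarrow> real) \<Rightarrow> 'd torus \<Rightarrow> real" where
  "periodize k z = infsum k {w. to_torus w = z}"

definition conv_measure :: "(real ^ 'd::finite \<Rightarrow> real) \<Rightarrow> 'd torus measure \<Rightarrow> 'd torus \<Rightarrow> real" where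
  "conv_measure k \<mu> x = (\<integral>y. periodize k (x - y) \<partial>\<mu>)"

definition conv_fun :: "('d::finite torus \<Rightarrow> real) \<Rightarrow> (real ^ 'd \<Rightarrow> real) \<Rightarrow> 'd torus \<Rightarrow> real" where
  "conv_fun u k x = (\<integral>y. u (x - to_torus y) * k y \<partial>lborel)"

definition reg_coupling ::
  "('d::finite torus \<Rightarrow> real \<Rightarrow> real) \<Rightarrow> (real ^ 'd \<Rightarrow> real) \<Rightarrow> real \<Rightarrow> 'd torus \<Rightarrow> 'd torus measure \<Rightarrow> real"
  where
  "reg_coupling f \<xi> \<delta> x \<mu> = f x (conv_measure (scaled_kernel \<xi> \<delta>) \<mu> x)"

definition reg_coupling2 ::
  "('d::finite torus \<Rightarrow> real \<Rightarrow> real) \<Rightarrow> (real ^ 'd \<Rightarrow> real) \<Rightarrow> real \<Rightarrow> real \<Rightarrow>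
   'd torus \<Rightarrow> 'd torus measure \<Rightarrow> real" where
  "reg_coupling2 f \<xi> \<delta> \<sigma> x \<mu> = conv_fun (\<lambda>z. reg_coupling f \<xi> \<delta> z \<mu>) (scaled_kernel \<xi> \<sigma>) x"

section \<open>The $N$-player game\<close>

text \<open>The empirical measure of the players \<open>j \<in> {1..N} - {i}\<close> at time \<open>s\<close> (for \<open>N \<ge> 2\<close>).\<close>

definition empirical :: "nat \<Rightarrow> nat \<Rightarrow> (nat \<Rightarrow> 'd::finite curve) \<Rightarrow> real \<Rightarrow> 'd torus measure" where
  "empirical N i \<gamma> s =
     distr (uniform_count_measure ({1..N} - {i})) borel (\<lambda>j. apply_bcontfun (\<gamma> j) s)"

definition player_cost ::
  "real \<Rightarrow> real \<Rightarrow> ('d::finite torus \<Rightarrow> real \<Rightarrow> real) \<Rightarrow> ('d torus \<Rightarrow> real ^ 'd \<Rightarrow> real) \<Rightarrow>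
   ('d torus \<Rightarrow> real) \<Rightarrow> (real ^ 'd \<Rightarrow> real) \<Rightarrow> real \<Rightarrow> real \<Rightarrow> nat \<Rightarrow> nat \<Rightarrow>
   (nat \<Rightarrow> 'd curve) \<Rightarrow> ereal" where
  "player_cost T r' f H \<phi>T \<xi> \<delta> \<sigma> N i \<gamma> =
     path_integral T r'
       (\<lambda>s x v. lagrangian H x v + reg_coupling2 f \<xi> \<delta> \<sigma> x (empirical N i \<gamma> s)) (\<gamma> i)
     + ereal (\<phi>T (apply_bcontfun (\<gamma> i) T))"

definition rand_space :: "real measure" where
  "rand_space = restrict_space lborel {0..1}"

definition init_law :: "('d::finite torus \<Rightarrow> real) \<Rightarrow> 'd torus measure" where
  "init_law m0 = density torus_vol (\<lambda>x. ennreal (m0 x))"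

text \<open>A strategy of player \<open>i\<close> takes the family of the other players' curves as a function on
  \<open>{1..N} - {i}\<close> (undefined elsewhere). All spaces involved are separable, so the product
  sigma-algebra is the Borel one.\<close>

type_synonym 'd strategy = "real \<times> 'd torus \<times> (nat \<Rightarrow> 'd curve) \<Rightarrow> 'd curve"

definition strategies :: "real \<Rightarrow> nat \<Rightarrow> nat \<Rightarrow> 'd::finite strategy set" where
  "strategies T N i = {\<beta>.
     \<beta> \<in> rand_space \<Otimes>\<^sub>M borel \<Otimes>\<^sub>M (\<Pi>\<^sub>M j\<in>{1..N} - {i}. curve_space T) \<rightarrow>\<^sub>M curve_space T \<and>
     (\<forall>\<omega>\<in>{0..1}. \<forall>x. \<forall>\<gamma>\<in>{1..N} - {i} \<rightarrow>\<^sub>E curves T. apply_bcontfun (\<beta> (\<omega>, x, \<gamma>)) 0 = x) \<and>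
     (\<exists>\<tau>>0. \<forall>\<omega>\<in>{0..1}. \<forall>x. \<forall>t\<in>{0..T}.
        \<forall>\<gamma>1\<in>{1..N} - {i} \<rightarrow>\<^sub>E curves T. \<forall>\<gamma>2\<in>{1..N} - {i} \<rightarrow>\<^sub>E curves T.
          (\<forall>j\<in>{1..N} - {i}. \<forall>s\<in>{0..t}. apply_bcontfun (\<gamma>1 j) s = apply_bcontfun (\<gamma>2 j) s) \<longrightarrow>
          (\<forall>s\<in>{0..T}. s \<le> t + \<tau> \<longrightarrow>
             apply_bcontfun (\<beta> (\<omega>, x, \<gamma>1)) s = apply_bcontfun (\<beta> (\<omega>, x, \<gamma>2)) s))}"

text \<open>For each \<open>(\<omega>, x0)\<close> the delays make the trajectory profile unique.\<close>

definition outcome ::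
  "real \<Rightarrow> nat \<Rightarrow> (nat \<Rightarrow> 'd::finite strategy) \<Rightarrow> (nat \<Rightarrow> real) \<Rightarrow> (nat \<Rightarrow> 'd torus) \<Rightarrow> nat \<Rightarrow> 'd curve"
  where
  "outcome T N \<beta> \<omega> x0 = (THE \<gamma>. \<gamma> \<in> {1..N} \<rightarrow>\<^sub>E curves T \<and>
     (\<forall>i\<in>{1..N}. \<beta> i (\<omega> i, x0 i, restrict \<gamma> ({1..N} - {i})) = \<gamma> i))"

definition expected_cost ::
  "real \<Rightarrow> real \<Rightarrow> ('d::finite torus \<Rightarrow> real \<Rightarrow> real) \<Rightarrow> ('d torus \<Rightarrow> real ^ 'd \<Rightarrow> real) \<Rightarrow>
   ('d torus \<Rightarrow> real) \<Rightarrow> ('d torus \<Rightarrow> real) \<Rightarrow> (real ^ 'd \<Rightarrow> real) \<Rightarrow> real \<Rightarrow> real \<Rightarrow> nat \<Rightarrow> nat \<Rightarrow>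
   (nat \<Rightarrow> 'd strategy) \<Rightarrow> ereal" where
  "expected_cost T r' f H \<phi>T m0 \<xi> \<delta> \<sigma> N i \<beta> =
     ext_integral ((\<Pi>\<^sub>M j\<in>{1..N}. rand_space) \<Otimes>\<^sub>M (\<Pi>\<^sub>M j\<in>{1..N}. init_law m0))
       (\<lambda>(\<omega>, x0). player_cost T r' f H \<phi>T \<xi> \<delta> \<sigma> N i (outcome T N \<beta> \<omega> x0))"

definition realizes ::
  "real \<Rightarrow> ('d::finite torus \<Rightarrow> real) \<Rightarrow> 'd curve measure \<Rightarrow> (real \<times> 'd torus \<Rightarrow> 'd curve) \<Rightarrow> bool" where
  "realizes T m0 \<eta> b \<longleftrightarrow>
     b \<in> rand_space \<Otimes>\<^sub>M borel \<rightarrow>\<^sub>M curve_space T \<and>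
     (\<forall>\<omega>\<in>{0..1}. \<forall>x. apply_bcontfun (b (\<omega>, x)) 0 = x) \<and>
     (\<forall>h :: 'd curve \<Rightarrow> real. continuous_on (curves T) h \<and> bounded (h ` curves T) \<longrightarrow>
        (\<integral>\<gamma>. h \<gamma> \<partial>\<eta>) = (\<integral>z. h (b z) \<partial>(rand_space \<Otimes>\<^sub>M init_law m0)))"

definition open_loop :: "(real \<times> 'd::finite torus \<Rightarrow> 'd curve) \<Rightarrow> 'd strategy" where
  "open_loop b = (\<lambda>(\<omega>, x, \<gamma>). b (\<omega>, x))"

end

theory Submission
  imports Defs
begin

text \<open>Let \<open>F = f(x, m)\<close> and let \<open>V\<close> be the integral of \<open>\<phi>(0, x)\<close> against \<open>m0\<close>. Up to small errors, no strategy
can cost a player less than \<open>V\<close>, while the open-loop strategy costs \<open>V\<close>.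

The lower bound is a verification argument for a value function that is only a distributional
subsolution. The inequality \<open>- \<partial>\<^sub>t\<phi> + H(x, D\<phi>) \<le> F\<close> is tested with a smooth kernel that travels along
an arbitrary curve \<open>\<gamma>\<close>; Fenchel's inequality in the support of the kernel yields
\<open>\<phi>(0, \<gamma>(0)) \<le> \<phi>T(\<gamma>(T)) + \<integral> L(\<gamma>, \<gamma>') ds + \<integral> (F \<star> \<xi>\<^sup>\<sigma>)(s, \<gamma>(s)) ds + o(1)\<close>, where the error vanishes with
\<open>\<sigma>\<close> uniformly in \<open>\<gamma>\<close> (\<open>uniform_curve_bound\<close>, \<open>value_below_cost\<close>). Uniformity rests on the exponent
\<open>\<theta> < r / (d + 1)\<close>: moving the base point of \<open>H\<close> by the width \<open>\<sigma>\<close> of a kernel of height \<open>\<sigma>\<^sup>-\<^sup>d\<close> costs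
\<open>\<sigma>\<^sup>d\<^sup>+\<^sup>1 \<sigma>\<^sup>-\<^sup>d\<close> times the integral of \<open>|D\<phi>|\<^sup>r\<close> (\<open>fenchel_nearby\<close>).

In the game a player feels \<open>f(x, \<xi>\<^sup>\<delta> \<star> empirical) \<star> \<xi>\<^sup>\<sigma>\<close> in place of \<open>F \<star> \<xi>\<^sup>\<sigma>\<close>. As \<open>f\<close> is Lipschitz continuous, the
difference is at most the \<open>L\<^sup>1\<close> distance between the smoothed empirical density of the other players
and \<open>m\<close>, times a constant that depends on \<open>\<sigma>\<close> (\<open>player_cost_between\<close>). The others play independent curves with
law \<open>\<eta>\<close>, so the expectation of this distance tends to zero as \<open>N \<rightarrow> \<infinity>\<close> and then \<open>\<delta> \<rightarrow> 0\<close>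
(\<open>expected_spread\<close>). The distance does not depend on the curve of the player in question, so adaptive
strategies gain nothing.

For the upper bound, the identity \<open>C2\<close> says that the mean over \<open>\<eta>\<close> of action and final cost is \<open>V\<close> minus
the integral of \<open>F m\<close>, and the mean of the smoothed coupling along the curves is at most the integral of
\<open>F m\<close> up to a small error (\<open>expected_coupling_cost\<close>). As \<open>F\<close> and \<open>m\<close> need not be bounded, this
rests on the uniform integrability of the translated products (\<open>shifted_pairing\<close>).

Measurability of the action is not automatic, since the velocity of a curve is chosen arbitrarily among its
versions; \<open>path_integral_measurable\<close> replaces it by limits of difference quotients.\<close>

section \<open>Differentiability of integrals of translates\<close>

lemma Ck_on_SucD:
  assumes "Ck_on (Suc k) g S" "x \<in> S"
  shows "(g has_derivative frechet_derivative g (at x)) (at x)" using assms frechet_derivative_works by auto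

lemma Ck_on_cong:
  assumes "Ck_on k g S" "open S" "\<And>x. x \<in> S \<Longrightarrow> g x = h x"
  shows "Ck_on k h S" using assms
proof (induction k arbitrary: g h)
  case 0
  then show ?case by (auto cong: continuous_on_cong)
next
  case (Suc k)
  have d: "(h has_derivative frechet_derivative g (at x)) (at x)" if "x \<in> S" for x
    using has_derivative_transform_within_open[OF Ck_on_SucD[OF Suc.prems(1) that] Suc.prems(2) that] Suc.prems(3) by auto
  then have eq: "frechet_derivative h (at x) = frechet_derivative g (at x)" if "x \<in> S" for x using frechet_derivative_at that by metis
  have "Ck_on k (\<lambda>x. frechet_derivative h (at x) v) S" for v
    by (rule Suc.IH[where g="\<lambda>x. frechet_derivative g (at x) v", OF _ Suc.prems(2)])
      (use Suc.prems(1) in \<open>simp_all add: eq\<close>)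
  moreover have "\<forall>x\<in>S. h differentiable at x" using d by (meson differentiable_def)
  ultimately show ?case by simp
qed

lemma Ck_on_SucI:
  assumes "open S" "\<And>x. x \<in> S \<Longrightarrow> (g has_derivative g' x) (at x)" "\<And>v. Ck_on k (\<lambda>x. g' x v) S"
  shows "Ck_on (Suc k) g S"
proof -
  have eq: "frechet_derivative g (at x) = g' x" if "x \<in> S" for x using assms(2)[OF that] frechet_derivative_at by metis
  have "Ck_on k (\<lambda>x. frechet_derivative g (at x) v) S" for v by (rule Ck_on_cong[OF assms(3)[of v] assms(1)]) (simp add: eq)
  moreover have "\<forall>x\<in>S. g differentiable at x" using assms(2) by (meson differentiable_def)
  ultimately show ?thesis by simp
qed

lemma Ck_on_Suc_imp: "Ck_on (Suc k) g S \<Longrightarrow> Ck_on k g S"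
proof (induction k arbitrary: g)
  case 0
  then have "\<forall>x\<in>S. isCont g x" using differentiable_imp_continuous_within by (simp only: Ck_on.simps) blast
  then show ?case using continuous_at_imp_continuous_on by simp
next
  case (Suc k)
  have "Ck_on k (\<lambda>x. frechet_derivative g (at x) v) S" for v
    by (rule Suc.IH) (rule Suc.prems[THEN Ck_on.simps(2)[THEN iffD1], THEN conjunct2, THEN spec])
  moreover have "\<forall>x\<in>S. g differentiable at x" by (rule Suc.prems[THEN Ck_on.simps(2)[THEN iffD1], THEN conjunct1])
  ultimately show ?case by simp
qed

lemma Ck_on_le: "Ck_on k g S \<Longrightarrow> j \<le> k \<Longrightarrow> Ck_on j g S"
proof (induction k)
  case (Suc k)
  then show ?case using Ck_on_Suc_imp[of k g S] by (cases "j = Suc k") (simp_all only: le_Suc_eq simp_thms)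
qed simp

lemma Ck_on_subset: "Ck_on k g S \<Longrightarrow> S' \<subseteq> S \<Longrightarrow> Ck_on k g S'"
proof (induction k arbitrary: g)
  case (Suc k)
  then show ?case by (simp add: subset_iff)
qed (auto intro: continuous_on_subset)

lemma Ck_on_const: "Ck_on k (\<lambda>x. c) S"
proof (induction k arbitrary: c)
  case (Suc k)
  have "frechet_derivative (\<lambda>x::'a. c) (at x) = (\<lambda>v. 0)" for x by (simp add: frechet_derivative_const)
  with Suc show ?case by simp
qed simp

lemma Ck_on_sum:
  assumes "finite I" "open S" "\<And>i. i \<in> I \<Longrightarrow> Ck_on k (g i) S"
  shows "Ck_on k (\<lambda>x. \<Sum>i\<in>I. g i x) S" using assms(3)
proof (induction k arbitrary: g)
  case 0
  then show ?case by (simp add: continuous_on_sum)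
next
  case (Suc k)
  have "((\<lambda>x. \<Sum>i\<in>I. g i x) has_derivative (\<lambda>v. \<Sum>i\<in>I. frechet_derivative (g i) (at x) v)) (at x)"
    if "x \<in> S" for x using Suc.prems that by (intro has_derivative_sum) (metis Ck_on_SucD)
  moreover have "Ck_on k (\<lambda>x. \<Sum>i\<in>I. frechet_derivative (g i) (at x) v) S" for v by (rule Suc.IH) (use Suc.prems in simp)
  ultimately show ?case by (rule Ck_on_SucI[OF assms(2)])
qed

lemma Ck_on_add:
  assumes "open S" "Ck_on k g S" "Ck_on k h S"
  shows "Ck_on k (\<lambda>x. g x + h x) S"
proof -
  have "Ck_on k (\<lambda>x. \<Sum>i\<in>(UNIV::bool set). (if i then g x else h x)) S"
  proof (rule Ck_on_sum[OF _ assms(1)])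
    show "Ck_on k (\<lambda>x. if i then g x else h x) S" for i by (cases i) (simp_all add: assms)
  qed simp
  then show ?thesis by (simp add: UNIV_bool add.commute)
qed

lemma Ck_on_mult:
  assumes "open S" "Ck_on k g S" "Ck_on k h S"
  shows "Ck_on k (\<lambda>x. g x * h x) S" using assms(2,3)
proof (induction k arbitrary: g h)
  case 0
  then show ?case by (simp add: continuous_on_mult)
next
  case (Suc k)
  have "((\<lambda>x. g x * h x) has_derivative
     (\<lambda>v. g x * frechet_derivative h (at x) v + frechet_derivative g (at x) v * h x)) (at x)"
    if "x \<in> S" for x using that Suc.prems by (intro has_derivative_mult Ck_on_SucD)
  moreover have "Ck_on k (\<lambda>x. g x * frechet_derivative h (at x) v + frechet_derivative g (at x) v * h x) S" for v
    using Suc.prems Ck_on_Suc_imp[OF Suc.prems(1)] Ck_on_Suc_imp[OF Suc.prems(2)] by (intro Ck_on_add[OF assms(1)]) (rule Suc.IH; simp)+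
  ultimately show ?case by (rule Ck_on_SucI[OF assms(1)])
qed

lemma Ck_on_affine:
  assumes "bounded_linear A" "Ck_on k g UNIV"
  shows "Ck_on k (\<lambda>x. g (A x + c)) UNIV" using assms(2)
proof (induction k arbitrary: g)
  case 0
  then show ?case using bounded_linear.continuous_on[OF assms(1)] by (auto intro!: continuous_on_compose2[of UNIV g] continuous_intros)
next
  case (Suc k)
  have "((\<lambda>x. g (A x + c)) has_derivative (\<lambda>v. frechet_derivative g (at (A x + c)) (A v))) (at x)" for x
  proof (rule has_derivative_compose[where f="\<lambda>x. A x + c"])
    show "((\<lambda>x. A x + c) has_derivative A) (at x)" using assms(1) by (auto intro!: derivative_eq_intros bounded_linear_imp_has_derivative)
  qed (use Suc.prems Ck_on_SucD in blast)
  moreover have "Ck_on k (\<lambda>x. frechet_derivative g (at (A x + c)) (A v)) UNIV" for v by (rule Suc.IH) (use Suc.prems in simp)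
  ultimately show ?case by (intro Ck_on_SucI[OF open_UNIV])
qed

lemma continuous_blinfun_derivative:
  fixes g :: "'a::euclidean_space \<Rightarrow> real"
  assumes "Ck_on (Suc 0) g UNIV"
  shows "continuous_on UNIV (\<lambda>x. Blinfun (frechet_derivative g (at x)))"
    and "blinfun_apply (Blinfun (frechet_derivative g (at x))) = frechet_derivative g (at x)"
proof -
  show *: "blinfun_apply (Blinfun (frechet_derivative g (at x))) = frechet_derivative g (at x)" for x
    using Ck_on_SucD[OF assms, of x] by (auto intro!: bounded_linear_Blinfun_apply has_derivative_bounded_linear)
  show "continuous_on UNIV (\<lambda>x. Blinfun (frechet_derivative g (at x)))"
    by (rule continuous_on_blinfun_componentwise) (use assms in \<open>auto simp: *\<close>)
qed

text \<open>Functions accumulated along a curve are smooth even when the curve is merely continuous,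
because the derivative falls on the kernel.\<close>

lemma has_derivative_integral_translates:
  fixes g :: "'a::euclidean_space \<Rightarrow> real" and c :: "real \<Rightarrow> 'a"
  assumes g: "Ck_on (Suc 0) g UNIV" and c: "continuous_on {a..b} c"
  shows "((\<lambda>z. integral {a..b} (\<lambda>t. g (z - c t))) has_derivative
           (\<lambda>v. integral {a..b} (\<lambda>t. frechet_derivative g (at (z - c t)) v))) (at z)"
proof -
  let ?B = "\<lambda>x. Blinfun (frechet_derivative g (at x))"
  note B = continuous_blinfun_derivative[OF g]
  have gc: "continuous_on UNIV g" using Ck_on_Suc_imp[OF g] by simp
  have Bc: "continuous_on {a..b} (\<lambda>t. ?B (z - c t))" for z by (rule continuous_on_compose2[OF B(1)]) (auto intro!: continuous_intros c)
  have "((\<lambda>z. integral (cbox a b) (\<lambda>t. g (z - c t))) has_derivative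
      integral (cbox a b) (\<lambda>t. ?B (z - c t))) (at z within UNIV)"
  proof (rule leibniz_rule)
    fix x t
    have "((\<lambda>x. g (x - c t)) has_derivative frechet_derivative g (at (x - c t))) (at x)"
      by (rule has_derivative_compose[where f="\<lambda>x. x - c t" and f'="\<lambda>x. x", simplified])
        (use Ck_on_SucD[OF g] in \<open>auto intro!: derivative_eq_intros\<close>)
    then show "((\<lambda>x. g (x - c t)) has_derivative blinfun_apply (?B (x - c t))) (at x within UNIV)" by (simp add: B(2))
  next
    fix x show "(\<lambda>t. g (x - c t)) integrable_on cbox a b" by (intro integrable_continuous continuous_on_compose2[OF gc])
        (use c in \<open>auto intro!: continuous_intros\<close>)
  next
    show "continuous_on (UNIV \<times> cbox a b) (\<lambda>(x, t). ?B (x - c t))" unfolding split_beta by (rule continuous_on_compose2[OF B(1)])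
         (use c in \<open>auto intro!: continuous_intros continuous_on_compose2[of "{a..b}" c]\<close>)
  qed auto
  moreover have "blinfun_apply (integral {a..b} (\<lambda>t. ?B (z - c t)))
      = (\<lambda>v. integral {a..b} (\<lambda>t. frechet_derivative g (at (z - c t)) v))"
  proof
    fix v
    have "blinfun_apply (integral {a..b} (\<lambda>t. ?B (z - c t))) v = integral {a..b} (\<lambda>t. ?B (z - c t) v)"
      using Bc[of z] by (intro blinfun_apply_integral integrable_continuous_real)
    then show "blinfun_apply (integral {a..b} (\<lambda>t. ?B (z - c t))) v
        = integral {a..b} (\<lambda>t. frechet_derivative g (at (z - c t)) v)" by (simp add: B(2))
  qed
  ultimately show ?thesis by simp
qed

text \<open>The derivative of an integral of translates is again one, so the order of smoothness can be
raised by induction.\<close>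

lemma Ck_on_integral_translates:
  fixes g :: "'a::euclidean_space \<Rightarrow> real" and c :: "real \<Rightarrow> 'a"
  assumes "Ck_on k g UNIV" and c: "continuous_on {a..b} c"
  shows "Ck_on k (\<lambda>z. integral {a..b} (\<lambda>t. g (z - c t))) UNIV" using assms(1)
proof (induction k arbitrary: g)
  case 0
  have "continuous_on UNIV (\<lambda>z. integral (cbox a b) (\<lambda>t. g (z - c t)))"
  proof (rule integral_continuous_on_param)
    show "continuous_on (UNIV \<times> cbox a b) (\<lambda>(x, t). g (x - c t))" unfolding split_beta by (rule continuous_on_compose2[of UNIV g])
         (use c 0 in \<open>auto intro!: continuous_intros continuous_on_compose2[of "{a..b}" c]\<close>)
  qed
  then show ?case by simp
next
  case (Suc k)
  have "Ck_on (Suc 0) g UNIV" using Suc.prems by (rule Ck_on_le) simp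
  note has_derivative_integral_translates[OF this c]
  moreover have "Ck_on k (\<lambda>z. integral {a..b} (\<lambda>t. frechet_derivative g (at (z - c t)) v)) UNIV" for v
    by (rule Suc.IH) (use Suc.prems in simp)
  ultimately show ?case by (intro Ck_on_SucI[OF open_UNIV])
qed

section \<open>Topology and measure of the torus\<close>

lemma dist_torus_diff: "dist x y = dist (x - y) (0::'d::finite torus)"
  by (simp add: dist_torus_def)

lemma dist_torus_add_le:
  "dist (a + b) (a' + b') \<le> dist a a' + dist b (b'::'d::finite torus)"
proof -
  have "dist (a + b) (a' + b) = dist a a'" "dist (a' + b) (a' + b') = dist b b'" by (simp_all add: dist_torus_def)
  then show ?thesis using dist_triangle[of "a + b" "a' + b'" "a' + b"] by simp
qed

lemma dist_torus_uminus: "dist (- a) (- a') = dist a (a'::'d::finite torus)"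
proof -
  have "dist (- a) (- a') = dist a' a" by (simp add: dist_torus_def)
  then show ?thesis by (simp add: dist_commute)
qed

instance torus :: (finite) topological_ab_group_add
proof
  fix a b :: "'a torus"
  show "LIM x nhds a \<times>\<^sub>F nhds b. fst x + snd x :> nhds (a + b)"
  proof (rule tendstoI)
    fix e :: real assume "0 < e"
    then have "\<forall>\<^sub>F x in nhds a. dist x a < e/2" "\<forall>\<^sub>F x in nhds b. dist x b < e/2"
      by (auto simp: eventually_nhds_metric intro!: exI[of _ "e/2"])
    then have "\<forall>\<^sub>F x in nhds a \<times>\<^sub>F nhds b. dist (fst x) a < e/2 \<and> dist (snd x) b < e/2"
      by (auto simp: eventually_prod_filter)
    then show "\<forall>\<^sub>F x in nhds a \<times>\<^sub>F nhds b. dist (fst x + snd x) (a + b) < e"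
      by (rule eventually_mono) (use dist_torus_add_le in \<open>smt (verit) field_sum_of_halves\<close>)
  qed
  show "(uminus \<longlongrightarrow> - a) (nhds a)" by (rule tendstoI) (auto simp: dist_torus_uminus eventually_nhds_metric)
qed

definition lattice :: "(real ^ 'd::finite) set" where
  "lattice = {w. \<forall>i. w $ i \<in> \<int>}"

lemma to_torus_eq_lattice: "to_torus x = to_torus y \<longleftrightarrow> x - y \<in> lattice"
  by (simp add: to_torus_eq_iff lattice_def)

lemma lattice_closed: "0 \<in> lattice" "w \<in> lattice \<Longrightarrow> v \<in> lattice \<Longrightarrow> w + v \<in> lattice"
  "w \<in> lattice \<Longrightarrow> - w \<in> lattice" "w \<in> lattice \<Longrightarrow> v \<in> lattice \<Longrightarrow> w - v \<in> lattice"
  by (auto simp: lattice_def)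

lemma to_torus_add_lattice: "w \<in> lattice \<Longrightarrow> to_torus (y + w) = to_torus y"
  by (simp add: to_torus_eq_lattice)

lemma to_torus_lattice_add: "w \<in> lattice \<Longrightarrow> to_torus (w + y) = to_torus y"
  by (simp add: to_torus_eq_lattice)

lemma countable_lattice: "countable (lattice :: (real ^ 'd::finite) set)"
proof -
  have "lattice \<subseteq> (\<lambda>f. \<chi> i. f i) ` (PiE UNIV (\<lambda>_::'d. \<int>::real set))"
  proof
    fix w :: "real ^ 'd" assume "w \<in> lattice"
    then show "w \<in> (\<lambda>f. \<chi> i. f i) ` (PiE UNIV (\<lambda>_::'d. \<int>::real set))"
      by (intro image_eqI[of _ _ "\<lambda>i. w $ i"]) (auto simp: lattice_def)
  qed
  moreover have "countable (\<int>::real set)" by (simp add: Ints_def)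
  ultimately show ?thesis by (meson countable_PiE countable_image countable_subset finite_class.finite_UNIV)
qed

lemma finite_lattice_bounded: "finite {w \<in> (lattice :: (real ^ 'd::finite) set). norm w \<le> r}"
proof -
  let ?Z = "{z::real. z \<in> \<int> \<and> \<bar>z\<bar> \<le> r}"
  have "?Z = real_of_int ` {z. \<bar>real_of_int z\<bar> \<le> r}" by (auto simp: Ints_def)
  moreover have "{z. \<bar>real_of_int z\<bar> \<le> r} \<subseteq> {- \<lceil>r\<rceil>..\<lceil>r\<rceil>}" by (auto simp: abs_le_iff) linarith+
  ultimately have "finite ?Z" by (metis finite_atLeastAtMost_int finite_imageI finite_subset)
  moreover have "{w \<in> (lattice :: (real ^ 'd) set). norm w \<le> r} \<subseteq> (\<lambda>f. \<chi> i. f i) ` (PiE UNIV (\<lambda>_::'d. ?Z))"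
  proof
    fix w :: "real ^ 'd" assume w: "w \<in> {w \<in> lattice. norm w \<le> r}"
    then have "\<bar>w $ i\<bar> \<le> r" for i using component_le_norm_cart[of w i] by auto
    with w show "w \<in> (\<lambda>f. \<chi> i. f i) ` (PiE UNIV (\<lambda>_::'d. ?Z))"
      by (intro image_eqI[of _ _ "\<lambda>i. w $ i"]) (auto simp: lattice_def)
  qed
  ultimately show ?thesis by (meson finite_PiE finite_imageI finite_subset finite_class.finite_UNIV)
qed

lemma infinite_lattice: "infinite (lattice :: (real ^ 'd::finite) set)"
proof
  assume "finite (lattice :: (real ^ 'd) set)"
  moreover have "(\<lambda>n. \<chi> i. real n) ` UNIV \<subseteq> (lattice :: (real ^ 'd) set)" by (auto simp: lattice_def)
  moreover have "inj (\<lambda>n. (\<chi> i. real n) :: real ^ 'd)" by (auto simp: inj_on_def vec_eq_iff)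
  ultimately show False using finite_subset range_inj_infinite by blast
qed

lemma open_to_torus_image: "open U \<Longrightarrow> open (to_torus ` U)"
proof -
  assume "open U"
  have "to_torus -` (to_torus ` U) = (\<Union>w\<in>lattice. (+) w ` U)"
  proof (intro equalityI subsetI)
    fix y assume "y \<in> to_torus -` (to_torus ` U)"
    then obtain u where "u \<in> U" "y - u \<in> lattice" by (auto simp: to_torus_eq_lattice)
    then show "y \<in> (\<Union>w\<in>lattice. (+) w ` U)" by (intro UN_I[of "y - u"]) (auto intro: image_eqI[of _ _ u])
  next
    fix y assume "y \<in> (\<Union>w\<in>lattice. (+) w ` U)"
    then obtain w u where "w \<in> lattice" "u \<in> U" "y = w + u" by blast
    then have "to_torus y = to_torus u" by (simp add: to_torus_lattice_add)
    then show "y \<in> to_torus -` (to_torus ` U)" using \<open>u \<in> U\<close> by simp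
  qed
  then show ?thesis using \<open>open U\<close> by (auto simp: open_torus_iff open_translation)
qed

instance torus :: (finite) second_countable_topology
proof
  obtain B :: "(real ^ 'a) set set" where B: "countable B" "topological_basis B" using ex_countable_basis by blast
  have "topological_basis ((\<lambda>U. (to_torus ` U :: 'a torus set)) ` B)"
  proof (rule topological_basisI)
    show "open B'" if "B' \<in> (\<lambda>U. to_torus ` U) ` B" for B' :: "'a torus set"
      using that B(2) by (auto intro!: open_to_torus_image dest: topological_basis_open)
  next
    fix O' :: "'a torus set" and x assume "open O'" "x \<in> O'"
    obtain y where y: "to_torus y = x" using to_torus_surj by blast
    have "open (to_torus -` O')" "y \<in> to_torus -` O'"
      using \<open>open O'\<close> \<open>x \<in> O'\<close> y by (auto simp: open_torus_iff[symmetric])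
    then obtain U where "U \<in> B" "y \<in> U" "U \<subseteq> to_torus -` O'" by (rule topological_basisE[OF B(2)])
    then have "x \<in> to_torus ` U" "to_torus ` U \<subseteq> O'" using y by auto
    then show "\<exists>B'\<in>(\<lambda>U. to_torus ` U) ` B. x \<in> B' \<and> B' \<subseteq> O'"
      using \<open>U \<in> B\<close> by (intro bexI[of _ "to_torus ` U"] conjI imageI)
  qed
  then show "\<exists>B::'a torus set set. countable B \<and> open = generate_topology B" using B(1) topological_basis_imp_subbasis by blast
qed

definition cell :: "(real ^ 'd::finite) set" where
  "cell = {w. \<forall>i. 0 \<le> w $ i \<and> w $ i < 1}"

lemma cell_ex1: "\<exists>!w. w \<in> lattice \<and> y - w \<in> (cell :: (real ^ 'd::finite) set)"
proof (rule ex1I[of _ "\<chi> i. of_int \<lfloor>y $ i\<rfloor>"])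
  show "(\<chi> i. of_int \<lfloor>y $ i\<rfloor>) \<in> lattice \<and> y - (\<chi> i. of_int \<lfloor>y $ i\<rfloor>) \<in> cell"
    by (auto simp: lattice_def cell_def) linarith+
  fix w assume w: "w \<in> lattice \<and> y - w \<in> cell"
  show "w = (\<chi> i. of_int \<lfloor>y $ i\<rfloor>)"
  proof (rule vec_eq_iff[THEN iffD2, rule_format])
    fix i
    from w obtain k where "w $ i = of_int k" by (auto simp: lattice_def Ints_def)
    moreover have "0 \<le> y $ i - w $ i" "y $ i - w $ i < 1" using w by (auto simp: cell_def)
    ultimately have "\<lfloor>y $ i\<rfloor> = k" by (intro floor_unique) linarith+
    then show "w $ i = (\<chi> i. of_int \<lfloor>y $ i\<rfloor>) $ i" using \<open>w $ i = of_int k\<close> by simp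
  qed
qed

lemma cell_borel[measurable]: "cell \<in> sets (borel :: (real ^ 'd::finite) measure)"
proof -
  have eq: "cell = (\<Inter>i. {w :: real ^ 'd. 0 \<le> w $ i} \<inter> {w. w $ i < 1})" by (auto simp: cell_def)
  have m: "{w :: real ^ 'd. 0 \<le> w $ i} \<inter> {w. w $ i < 1} \<in> sets borel" for i
    by (intro sets.Int borel_closed closed_Collect_le borel_open open_Collect_less continuous_intros)
  show ?thesis unfolding eq by (rule sets.finite_INT) (simp, simp, rule m)
qed

lemma cell_subset_cbox: "cell \<subseteq> cbox 0 (1 :: real ^ 'd::finite)"
  by (auto simp: cell_def mem_box_cart less_imp_le)

lemma emeasure_cell: "emeasure lborel (cell :: (real ^ 'd::finite) set) = 1"
proof -
  have b: "(\<Prod>b\<in>Basis. (1 - 0 :: real ^ 'd) \<bullet> b) = 1" by (rule prod.neutral) (auto simp: Basis_vec_def inner_axis)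
  have "emeasure lborel (box 0 (1 :: real ^ 'd)) = 1" "emeasure lborel (cbox 0 (1 :: real ^ 'd)) = 1"
    using b by (subst emeasure_lborel_box_eq emeasure_lborel_cbox_eq; auto simp: Basis_vec_def inner_axis)+
  moreover have "box 0 (1 :: real ^ 'd) \<subseteq> cell" by (auto simp: cell_def mem_box_cart less_imp_le)
  ultimately show ?thesis using emeasure_mono[of "box 0 (1 :: real ^ 'd)" cell lborel]
      emeasure_mono[OF cell_subset_cbox[where 'd='d], of lborel] by (auto intro: antisym)
qed

lemma compact_torus: "compact (UNIV :: 'd::finite torus set)"
proof -
  have "to_torus ` cbox 0 1 = (UNIV :: 'd torus set)"
  proof (intro equalityI subsetI)
    fix x :: "'d torus"
    obtain y where y: "to_torus y = x" using to_torus_surj by blast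
    obtain w where "w \<in> lattice" "y - w \<in> cell" using cell_ex1[of y] by blast
    then show "x \<in> to_torus ` cbox 0 1"
      using y cell_subset_cbox by (intro image_eqI[of _ _ "y - w"]) (auto simp: to_torus_eq_lattice lattice_closed)
  qed simp
  then show ?thesis by (metis compact_cbox compact_continuous_image continuous_on_subset continuous_to_torus subset_UNIV)
qed

lemma continuous_torus_iff:
  fixes u :: "'d::finite torus \<Rightarrow> 'b::topological_space"
  shows "continuous_on UNIV u \<longleftrightarrow> continuous_on UNIV (\<lambda>y. u (to_torus y))"
proof
  assume "continuous_on UNIV (\<lambda>y. u (to_torus y))"
  then show "continuous_on UNIV u" by (auto simp: continuous_on_open_vimage open_torus_iff vimage_def)
qed (auto intro: continuous_on_compose2[OF _ continuous_to_torus])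

lemma to_torus_measurable[measurable]: "to_torus \<in> borel_measurable borel"
  by (rule borel_measurable_continuous_onI[OF continuous_to_torus])

text \<open>Centring the representative at \<open>0\<close> makes every vector with entries in \<open>[-1/2, 1/2)\<close> the
representative of its own class; short increments of a curve are recovered this way.\<close>

definition crep :: "'d::finite torus \<Rightarrow> real ^ 'd" where
  "crep z = (\<chi> i. rep_torus z $ i - of_int \<lfloor>rep_torus z $ i + 1/2\<rfloor>)"

lemma to_torus_rep: "to_torus (rep_torus z) = z"
  by (rule Quotient3_abs_rep[OF Quotient3_torus])

lemma to_torus_crep[simp]: "to_torus (crep z) = z"
proof -
  have "to_torus (crep z) = to_torus (rep_torus z)" by (auto simp: to_torus_eq_iff crep_def)
  then show ?thesis by (simp add: to_torus_rep)
qed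

lemma crep_range: "- 1/2 \<le> crep z $ i \<and> crep z $ i < 1/2"
  unfolding crep_def by simp linarith

lemma crep_to_torus:
  assumes "\<And>i. - 1/2 \<le> y $ i \<and> y $ i < 1/2"
  shows "crep (to_torus y) = y"
proof (rule vec_eq_iff[THEN iffD2, rule_format])
  fix i
  have "to_torus (crep (to_torus y)) = to_torus y" by simp
  then have "crep (to_torus y) $ i - y $ i \<in> \<int>" by (simp only: to_torus_eq_iff)
  then obtain k where k: "crep (to_torus y) $ i - y $ i = of_int k" by (auto simp: Ints_def)
  have "\<bar>crep (to_torus y) $ i - y $ i\<bar> < 1" using assms[of i] crep_range[of "to_torus y" i] by linarith
  with k have "k = 0" by simp
  with k show "crep (to_torus y) $ i = y $ i" by simp
qed

lemma crep_measurable[measurable]: "crep \<in> borel_measurable (borel :: 'd::finite torus measure)"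
  unfolding borel_eq_closed[where 'a="real ^ 'd"]
proof (safe intro!: measurable_measure_of)
  fix A :: "(real ^ 'd) set" assume "closed A"
  let ?C = "\<lambda>n::nat. cbox (\<chi> i. - 1/2) (\<chi> i. 1/2 - 1 / Suc n) :: (real ^ 'd) set"
  have "crep -` A = (\<Union>n. to_torus ` (A \<inter> ?C n))"
  proof (intro equalityI subsetI)
    fix z assume z: "z \<in> crep -` A"
    have "\<forall>i. \<exists>n. crep z $ i \<le> 1/2 - 1 / Suc n"
    proof
      fix i
      obtain n where "inverse (real (Suc n)) < 1/2 - crep z $ i" using reals_Archimedean[of "1/2 - crep z $ i"] crep_range[of z i] by auto
      then show "\<exists>n. crep z $ i \<le> 1/2 - 1 / Suc n" by (intro exI[of _ n]) (simp add: inverse_eq_divide)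
    qed
    then obtain n where n: "\<And>i. crep z $ i \<le> 1/2 - 1 / Suc (n i)" by metis
    let ?N = "Max (range n)"
    have "crep z $ i \<le> 1/2 - 1 / Suc ?N" for i
    proof -
      have "n i \<le> ?N" by simp
      then have "1 / real (Suc ?N) \<le> 1 / Suc (n i)" by (simp add: frac_le)
      with n[of i] show ?thesis by linarith
    qed
    then have "crep z \<in> ?C ?N" using crep_range[of z] by (auto simp: mem_box_cart)
    with z show "z \<in> (\<Union>n. to_torus ` (A \<inter> ?C n))" by (intro UN_I[of ?N]) (auto intro: image_eqI[of _ _ "crep z"])
  next
    fix z assume "z \<in> (\<Union>n. to_torus ` (A \<inter> ?C n))"
    then obtain n y where y: "y \<in> A" "y \<in> ?C n" "z = to_torus y" by auto
    have "y $ i < 1/2" for i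
    proof -
      have "y $ i \<le> 1/2 - 1 / Suc n" using y(2) by (simp add: mem_box_cart)
      also have "\<dots> < 1/2" by simp
      finally show ?thesis .
    qed
    then have "crep z = y" using y by (auto simp: mem_box_cart intro!: crep_to_torus)
    then show "z \<in> crep -` A" using y by simp
  qed
  moreover have "closed (to_torus ` (A \<inter> ?C n))" for n
    using \<open>closed A\<close> closed_Int_compact compact_cbox compact_continuous_image[of "A \<inter> ?C n" to_torus]
      continuous_on_subset[OF continuous_to_torus] compact_imp_closed by blast
  ultimately have "crep -` A \<in> sets borel" by (simp add: sets.countable_UN')
  then show "crep -` A \<inter> space (borel :: 'd torus measure) \<in> sets borel" by simp
qed auto

lemma sets_torus_vol[simp, measurable_cong]: "sets torus_vol = sets borel"
  by (simp add: torus_vol_def)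

lemma space_torus_vol[simp]: "space torus_vol = UNIV"
  by (simp add: torus_vol_def)

lemma nn_integral_torus:
  assumes [measurable]: "u \<in> borel_measurable borel"
  shows "(\<integral>\<^sup>+z. u z \<partial>torus_vol) = (\<integral>\<^sup>+y. u (to_torus y) * indicator cell y \<partial>lborel)"
  unfolding torus_vol_def cell_def[symmetric] by (subst nn_integral_distr) (auto intro!: measurable_restrict_space1 simp: nn_integral_restrict_space)

interpretation torus_vol: prob_space "torus_vol :: 'd::finite torus measure"
proof
  have "emeasure torus_vol (space torus_vol :: 'd torus set) = (\<integral>\<^sup>+z. 1 \<partial>(torus_vol :: 'd torus measure))" by simp
  also have "\<dots> = 1" by (subst nn_integral_torus) (simp_all add: emeasure_cell)
  finally show "emeasure torus_vol (space torus_vol :: 'd torus set) = 1" .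
qed

lemma nn_integral_lborel_translate:
  fixes g :: "real ^ 'd::finite \<Rightarrow> ennreal"
  assumes [measurable]: "g \<in> borel_measurable borel"
  shows "(\<integral>\<^sup>+y. g (c + y) \<partial>lborel) = (\<integral>\<^sup>+y. g y \<partial>lborel)"
  by (subst (2) lborel_distr_plus[symmetric, of c]) (simp add: nn_integral_distr)

text \<open>Periodization as a sum in \<open>[0, \<infinity>]\<close>, where it always exists and commutes with integrals.\<close>

definition eper :: "(real ^ 'd::finite \<Rightarrow> ennreal) \<Rightarrow> 'd torus \<Rightarrow> ennreal" where
  "eper k z = (\<integral>\<^sup>+w. k w \<partial>count_space {w. to_torus w = z})"

lemma bij_betw_fibre: "bij_betw (\<lambda>w. y + w) lattice {w. to_torus w = to_torus y}"
proof (rule bij_betwI[where g="\<lambda>w. w - y"])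
qed (auto simp: to_torus_eq_lattice lattice_closed algebra_simps)

lemma eper_to_torus: "eper k (to_torus y) = (\<integral>\<^sup>+w. k (y + w) \<partial>count_space lattice)"
  unfolding eper_def by (rule nn_integral_bij_count_space[OF bij_betw_fibre, symmetric])

lemma eper_suminf:
  fixes y :: "real ^ 'd::finite"
  shows "eper k (to_torus y) = (\<Sum>n. k (y + from_nat_into lattice n))"
proof -
  have "bij_betw (from_nat_into lattice) UNIV (lattice :: (real ^ 'd) set)" by (rule bij_betw_from_nat_into[OF countable_lattice infinite_lattice])
  from nn_integral_bij_count_space[OF this, of "\<lambda>w. k (y + w)"] show ?thesis by (simp add: eper_to_torus nn_integral_count_space_nat)
qed

lemma eper_measurable[measurable]:
  assumes [measurable]: "k \<in> borel_measurable borel"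
  shows "eper k \<in> borel_measurable (borel :: 'd::finite torus measure)"
proof -
  have eq: "eper k = (\<lambda>z::'d torus. \<Sum>n. k (crep z + from_nat_into lattice n))" using eper_suminf[of k "crep _"] by (intro ext) simp
  show ?thesis unfolding eq by measurable
qed

lemma nn_integral_count_unique:
  assumes "\<exists>!w. w \<in> B \<and> w \<in> S"
  shows "(\<integral>\<^sup>+w. indicator B w \<partial>count_space S) = 1"
proof -
  from assms obtain w0 where w0: "B \<inter> S = {w0}" by (auto elim!: ex1E)
  have "(\<integral>\<^sup>+w. indicator B w \<partial>count_space S) = (\<integral>\<^sup>+w. indicator (B \<inter> S) w \<partial>count_space S)"
    by (intro nn_integral_cong) (simp add: indicator_def)
  also have "\<dots> = 1" unfolding w0 using w0 by (subst nn_integral_indicator) (auto intro!: emeasure_count_space_finite[THEN trans])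
  finally show ?thesis .
qed

lemma eper_indicator_fundamental:
  assumes "\<And>y. \<exists>!w. w \<in> B \<and> to_torus w = to_torus (y :: real ^ 'd::finite)"
  shows "eper (indicator B) z = 1"
proof -
  obtain y where y: "to_torus y = z" using to_torus_surj by blast
  then show ?thesis unfolding eper_def using assms[of y] by (intro nn_integral_count_unique) simp
qed

text \<open>Unfolding: the lattice translates of \<open>cell\<close> tile the space, so an integral over the space
collects, over each point of the torus, the sum of \<open>k\<close> over its fibre.\<close>

lemma nn_integral_unfold:
  fixes u :: "'d::finite torus \<Rightarrow> ennreal"
  assumes u[measurable]: "u \<in> borel_measurable borel" and k[measurable]: "k \<in> borel_measurable borel"
  shows "(\<integral>\<^sup>+y. u (to_torus y) * k y \<partial>lborel) = (\<integral>\<^sup>+z. u z * eper k z \<partial>torus_vol)"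
proof -
  let ?g = "\<lambda>y. u (to_torus y) * k y"
  let ?e = "from_nat_into (lattice :: (real ^ 'd) set)"
  have el: "?e n \<in> lattice" for n using infinite_lattice from_nat_into[of lattice n] by (metis finite.emptyI)
  have one: "(\<Sum>n. indicator cell (y - ?e n)) = (1 :: ennreal)" for y
  proof -
    have "(\<Sum>n. indicator ((\<lambda>w. y - w) -` cell) (0 + ?e n)) = eper (indicator ((\<lambda>w. y - w) -` cell)) (to_torus (0 :: real ^ 'd) :: 'd torus)"
      by (rule eper_suminf[symmetric])
    also have "\<dots> = (\<integral>\<^sup>+w. indicator ((\<lambda>w. y - w) -` cell) w \<partial>count_space lattice)"
      by (subst eper_to_torus) simp
    also have "\<dots> = 1" using cell_ex1[of y] by (intro nn_integral_count_unique) (simp add: conj_commute)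
    finally show ?thesis by (simp add: indicator_def)
  qed
  have "(\<integral>\<^sup>+y. ?g y \<partial>lborel) = (\<integral>\<^sup>+y. (\<Sum>n. ?g y * indicator cell (y - ?e n)) \<partial>lborel)"
    by (simp add: one)
  also have "\<dots> = (\<Sum>n. \<integral>\<^sup>+y. ?g y * indicator cell (y - ?e n) \<partial>lborel)" by (rule nn_integral_suminf) measurable
  also have "\<dots> = (\<Sum>n. \<integral>\<^sup>+y. ?g (?e n + y) * indicator cell y \<partial>lborel)"
  proof (rule suminf_cong)
    fix n
    have "(\<lambda>y. ?g y * indicator cell (y - ?e n)) \<in> borel_measurable borel" by measurable
    from nn_integral_lborel_translate[OF this, of "?e n"]
    show "(\<integral>\<^sup>+y. ?g y * indicator cell (y - ?e n) \<partial>lborel) = (\<integral>\<^sup>+y. ?g (?e n + y) * indicator cell y \<partial>lborel)"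
      by simp
  qed
  also have "\<dots> = (\<integral>\<^sup>+y. (\<Sum>n. ?g (?e n + y) * indicator cell y) \<partial>lborel)"
    by (rule nn_integral_suminf[symmetric]) measurable
  also have "\<dots> = (\<integral>\<^sup>+y. u (to_torus y) * eper k (to_torus y) * indicator cell y \<partial>lborel)" by (intro nn_integral_cong)
      (simp add: eper_suminf to_torus_add_lattice[OF el] add.commute[of "?e _"] ennreal_suminf_cmult ennreal_suminf_multc)
  also have "\<dots> = (\<integral>\<^sup>+z. u z * eper k z \<partial>torus_vol)" by (subst nn_integral_torus) measurable
  finally show ?thesis .
qed

text \<open>A set that meets every fibre exactly once computes the same integral as \<open>cell\<close>. Translated and
reflected cells are such sets, which gives the invariance of the measure on the torus.\<close>

lemma nn_integral_fundamental:
  fixes u :: "'d::finite torus \<Rightarrow> ennreal"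
  assumes [measurable]: "u \<in> borel_measurable borel" "B \<in> sets borel"
    and "\<And>y. \<exists>!w. w \<in> B \<and> to_torus w = to_torus (y :: real ^ 'd::finite)"
  shows "(\<integral>\<^sup>+y. u (to_torus y) * indicator B y \<partial>lborel) = (\<integral>\<^sup>+z. u z \<partial>torus_vol)"
  by (subst nn_integral_unfold) (simp_all add: eper_indicator_fundamental[OF assms(3)])

lemma cell_representative: "\<exists>!w. w \<in> cell \<and> to_torus w = to_torus (y :: real ^ 'd::finite)"
proof -
  obtain w0 where "w0 \<in> lattice \<and> y - w0 \<in> cell" "\<forall>w. w \<in> lattice \<and> y - w \<in> cell \<longrightarrow> w = w0"
    by (rule ex1E[OF cell_ex1[of y]])
  then have w0: "w0 \<in> lattice" "y - w0 \<in> cell" "\<And>w. w \<in> lattice \<Longrightarrow> y - w \<in> cell \<Longrightarrow> w = w0"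
    by blast+
  show ?thesis
  proof (rule ex1I[of _ "y - w0"])
    show "y - w0 \<in> cell \<and> to_torus (y - w0) = to_torus y" using w0(1,2) by (auto simp: to_torus_eq_lattice lattice_closed)
    fix w assume w: "w \<in> cell \<and> to_torus w = to_torus y"
    then have "y - w \<in> lattice" "y - (y - w) \<in> cell" by (auto simp: to_torus_eq_lattice[symmetric])
    from w0(3)[OF this] show "w = y - w0" by (simp add: algebra_simps)
  qed
qed

lemma nn_integral_torus_translate:
  fixes u :: "'d::finite torus \<Rightarrow> ennreal"
  assumes [measurable]: "u \<in> borel_measurable borel"
  shows "(\<integral>\<^sup>+z. u (a + z) \<partial>torus_vol) = (\<integral>\<^sup>+z. u z \<partial>torus_vol)"
proof -
  obtain \<alpha> where \<alpha>: "to_torus \<alpha> = a" using to_torus_surj by blast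
  have "(\<integral>\<^sup>+z. u (a + z) \<partial>torus_vol) = (\<integral>\<^sup>+y. u (to_torus (\<alpha> + y)) * indicator cell ((\<alpha> + y) - \<alpha>) \<partial>lborel)"
    by (subst nn_integral_torus) (simp_all add: to_torus_add \<alpha>)
  also have "\<dots> = (\<integral>\<^sup>+y. u (to_torus y) * indicator cell (y - \<alpha>) \<partial>lborel)"
    by (rule nn_integral_lborel_translate) measurable
  also have "\<dots> = (\<integral>\<^sup>+y. u (to_torus y) * indicator ((\<lambda>y. y - \<alpha>) -` cell) y \<partial>lborel)"
    by (simp add: indicator_def)
  also have "\<dots> = (\<integral>\<^sup>+z. u z \<partial>torus_vol)"
  proof (rule nn_integral_fundamental)
    show "(\<lambda>y. y - \<alpha>) -` cell \<in> sets borel" using measurable_sets[of "\<lambda>y. y - \<alpha>" borel borel cell] by simp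
    fix y
    show "\<exists>!w. w \<in> (\<lambda>y. y - \<alpha>) -` cell \<and> to_torus w = to_torus y"
    proof -
      obtain w0 where "w0 \<in> cell \<and> to_torus w0 = to_torus (y - \<alpha>)"
        "\<forall>w. w \<in> cell \<and> to_torus w = to_torus (y - \<alpha>) \<longrightarrow> w = w0"
        by (rule ex1E[OF cell_representative[of "y - \<alpha>"]])
        then have w0: "w0 \<in> cell" "to_torus w0 = to_torus (y - \<alpha>)"
          "\<And>w. w \<in> cell \<Longrightarrow> to_torus w = to_torus (y - \<alpha>) \<Longrightarrow> w = w0" by blast+
      show ?thesis
      proof (rule ex1I[of _ "w0 + \<alpha>"])
        show "w0 + \<alpha> \<in> (\<lambda>y. y - \<alpha>) -` cell \<and> to_torus (w0 + \<alpha>) = to_torus y"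
          using w0(1,2) by (simp add: to_torus_add to_torus_diff)
        fix w assume "w \<in> (\<lambda>y. y - \<alpha>) -` cell \<and> to_torus w = to_torus y"
        then have "w - \<alpha> = w0" by (intro w0(3)) (simp_all add: to_torus_diff)
        then show "w = w0 + \<alpha>" by (simp add: algebra_simps)
      qed
    qed
  qed simp
  finally show ?thesis .
qed

lemma nn_integral_torus_uminus:
  fixes u :: "'d::finite torus \<Rightarrow> ennreal"
  assumes [measurable]: "u \<in> borel_measurable borel"
  shows "(\<integral>\<^sup>+z. u (- z) \<partial>torus_vol) = (\<integral>\<^sup>+z. u z \<partial>torus_vol)"
proof -
  have m: "(\<lambda>z. u (- z)) \<in> borel_measurable borel"
    by (rule measurable_compose[OF _ assms]) (auto intro!: borel_measurable_continuous_onI continuous_intros)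
  have "(\<integral>\<^sup>+z. u (- z) \<partial>torus_vol) = (\<integral>\<^sup>+y. u (to_torus (- y)) * indicator cell (- (- y)) \<partial>lborel)"
    by (subst nn_integral_torus[OF m]) (simp_all add: to_torus_minus)
  also have "\<dots> = (\<integral>\<^sup>+y. u (to_torus y) * indicator (uminus -` cell) y \<partial>distr lborel borel uminus)"
    by (subst nn_integral_distr) (auto intro!: nn_integral_cong simp: indicator_def)
  also have "\<dots> = (\<integral>\<^sup>+y. u (to_torus y) * indicator (uminus -` cell) y \<partial>lborel)"
    using lborel_affine[of "-1" "0 :: real ^ 'd"] by (simp add: density_1 one_ennreal_def[symmetric])
  also have "\<dots> = (\<integral>\<^sup>+z. u z \<partial>torus_vol)"
  proof (rule nn_integral_fundamental)
    show "uminus -` cell \<in> sets (borel :: (real ^ 'd) measure)"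
      using measurable_sets[of "uminus :: real ^ 'd \<Rightarrow> _" borel borel cell] by simp
    fix y :: "real ^ 'd"
    obtain w0 where "w0 \<in> cell \<and> to_torus w0 = to_torus (- y)"
      "\<forall>w. w \<in> cell \<and> to_torus w = to_torus (- y) \<longrightarrow> w = w0" by (rule ex1E[OF cell_representative[of "- y"]])
      then have w0: "w0 \<in> cell" "to_torus w0 = to_torus (- y)"
        "\<And>w. w \<in> cell \<Longrightarrow> to_torus w = to_torus (- y) \<Longrightarrow> w = w0" by blast+
    show "\<exists>!w. w \<in> uminus -` cell \<and> to_torus w = to_torus y"
    proof (rule ex1I[of _ "- w0"])
      show "- w0 \<in> uminus -` cell \<and> to_torus (- w0) = to_torus y" using w0(1,2) by (simp add: to_torus_minus)
      fix w assume "w \<in> uminus -` cell \<and> to_torus w = to_torus y"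
      then have "- w = w0" by (intro w0(3)) (simp_all add: to_torus_minus)
      then show "w = - w0" by (metis minus_minus)
    qed
  qed simp
  finally show ?thesis .
qed

lemma torus_diff_measurable[measurable (raw)]:
  fixes f g :: "'a \<Rightarrow> 'd::finite torus"
  assumes [measurable]: "f \<in> borel_measurable M" "g \<in> borel_measurable M"
  shows "(\<lambda>x. f x - g x) \<in> borel_measurable M" by (rule borel_measurable_continuous_Pair[OF assms]) (intro continuous_intros)

lemma distr_torus_translate: "distr torus_vol borel (\<lambda>z. a + z) = (torus_vol :: 'd::finite torus measure)"
proof (rule measure_eqI)
  fix A :: "'d torus set" assume "A \<in> sets (distr torus_vol borel (\<lambda>z. a + z))"
  then have A[measurable]: "A \<in> sets borel" by simp
  show "emeasure (distr torus_vol borel (\<lambda>z. a + z)) A = emeasure torus_vol A"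
    using nn_integral_torus_translate[of "indicator A" a] by (simp add: nn_integral_distr flip: nn_integral_indicator)
qed simp

lemma distr_torus_reflect: "distr torus_vol borel (\<lambda>z. a - z) = (torus_vol :: 'd::finite torus measure)"
proof (rule measure_eqI)
  fix A :: "'d torus set" assume "A \<in> sets (distr torus_vol borel (\<lambda>z. a - z))"
  then have A[measurable]: "A \<in> sets borel" by simp
  have "(\<integral>\<^sup>+z. indicator A (a - z) \<partial>torus_vol) = (\<integral>\<^sup>+z. indicator A z \<partial>(torus_vol :: 'd torus measure))"
    using nn_integral_torus_uminus[of "\<lambda>z. indicator A (a + z)"] nn_integral_torus_translate[of "indicator A" a] by simp
  then show "emeasure (distr torus_vol borel (\<lambda>z. a - z)) A = emeasure torus_vol A"
    by (simp add: nn_integral_distr flip: nn_integral_indicator)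
qed simp

section \<open>Smooth kernels on the torus and in time\<close>

definition torus_kernel :: "real \<Rightarrow> ('d::finite torus \<Rightarrow> real) \<Rightarrow> bool" where
  "torus_kernel s K \<longleftrightarrow> (\<forall>k. Ck_on k (\<lambda>y. K (to_torus y)) UNIV) \<and> (\<forall>z. 0 \<le> K z) \<and>
     (\<forall>z. K (- z) = K z) \<and> (\<integral>z. K z \<partial>torus_vol) = 1 \<and> (\<forall>z. K z \<noteq> 0 \<longrightarrow> dist z 0 < s)"

lemma torus_kernel_continuous: "torus_kernel s K \<Longrightarrow> continuous_on UNIV K"
  unfolding torus_kernel_def continuous_torus_iff using Ck_on.simps(1) by metis

lemma torus_kernel_measurable: "torus_kernel s K \<Longrightarrow> K \<in> borel_measurable borel"
  by (intro borel_measurable_continuous_onI torus_kernel_continuous)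

lemma infsum_eq_sum_support:
  fixes f :: "'a \<Rightarrow> real"
  assumes "finite W" "W \<subseteq> A" "\<And>w. w \<in> A \<Longrightarrow> w \<notin> W \<Longrightarrow> f w = 0"
  shows "infsum f A = sum f W"
proof -
  have "infsum f A = infsum f W" by (rule infsum_cong_neutral) (use assms in auto)
  then show ?thesis using assms(1) by simp
qed

lemma Ck_on_local:
  assumes "\<And>x. \<exists>S. open S \<and> x \<in> S \<and> Ck_on k g S"
  shows "Ck_on k g UNIV" using assms
proof (induction k arbitrary: g)
  case 0
  have "isCont g x" for x using 0[of x] by (auto simp: continuous_on_eq_continuous_at)
  then show ?case by (simp add: continuous_at_imp_continuous_on)
next
  case (Suc k)
  have "g differentiable at x" for x using Suc.prems[of x] by auto
  moreover have "Ck_on k (\<lambda>x. frechet_derivative g (at x) v) UNIV" for v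
  proof (rule Suc.IH)
    fix x show "\<exists>S. open S \<and> x \<in> S \<and> Ck_on k (\<lambda>x. frechet_derivative g (at x) v) S" using Suc.prems[of x] by auto
  qed
  ultimately show ?case by simp
qed

locale ball_kernel =
  fixes k :: "real ^ 'd::finite \<Rightarrow> real" and \<rho> :: real
  assumes smooth: "\<And>j. Ck_on j k UNIV" and nonneg: "\<And>y. 0 \<le> k y"
    and support: "\<And>y. k y \<noteq> 0 \<Longrightarrow> norm y < \<rho>"
    and even: "\<And>y. k (- y) = k y" and mass: "(\<integral>\<^sup>+y. ennreal (k y) \<partial>lborel) = 1"
begin

text \<open>Only these lattice points contribute to the periodization at a point of norm at most \<open>M\<close>; the
infinite sum becomes a finite one, locally uniformly.\<close>

definition near :: "real \<Rightarrow> (real ^ 'd) set" where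
  "near M = {v \<in> lattice. norm v \<le> \<rho> + M}"

lemma finite_near: "finite (near M)"
  unfolding near_def by (rule finite_lattice_bounded)

lemma outside_near:
  assumes "norm y \<le> M" "v \<in> lattice" "v \<notin> near M"
  shows "k (y + v) = 0"
proof (rule ccontr)
  assume "k (y + v) \<noteq> 0"
  then have "norm (y + v) < \<rho>" by (rule support)
  moreover have "norm v \<le> norm (y + v) + norm y" using norm_triangle_ineq4[of "y + v" y] by simp
  ultimately show False using assms by (auto simp: near_def)
qed

lemma k_measurable: "k \<in> borel_measurable borel"
  using smooth[of 0] by (intro borel_measurable_continuous_onI) simp

lemma periodize_to_torus:
  assumes "norm y \<le> M"
  shows "periodize k (to_torus y) = (\<Sum>v\<in>near M. k (y + v))"
proof -
  have "periodize k (to_torus y) = infsum (\<lambda>v. k (y + v)) lattice"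
    unfolding periodize_def by (rule infsum_reindex_bij_betw[OF bij_betw_fibre, symmetric])
  also have "\<dots> = (\<Sum>v\<in>near M. k (y + v))" by (rule infsum_eq_sum_support[OF finite_near])
      (use outside_near[OF assms] in \<open>auto simp: near_def\<close>)
  finally show ?thesis .
qed

lemma eper_kernel: "eper (\<lambda>y. ennreal (k y)) z = ennreal (periodize k z)"
proof -
  obtain y where y: "to_torus y = z" using to_torus_surj by blast
  let ?W = "near (norm y)"
  have "eper (\<lambda>y. ennreal (k y)) z = (\<integral>\<^sup>+v. ennreal (k (y + v)) \<partial>count_space lattice)"
    unfolding y[symmetric] by (rule eper_to_torus)
  also have "\<dots> = (\<Sum>v\<in>?W. ennreal (k (y + v)))" by (rule nn_integral_count_space'[OF finite_near])
      (use outside_near[OF order_refl] in \<open>auto simp: near_def\<close>)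
  also have "\<dots> = ennreal (\<Sum>v\<in>?W. k (y + v))" by (simp add: nonneg)
  also have "\<dots> = ennreal (periodize k z)" using periodize_to_torus[OF order_refl, of y] y by simp
  finally show ?thesis .
qed

lemma periodize_nonneg: "0 \<le> periodize k z"
  unfolding periodize_def by (rule infsum_nonneg) (rule nonneg)

lemma periodize_smooth: "Ck_on j (\<lambda>y. periodize k (to_torus y)) UNIV"
proof -
  have ball: "Ck_on j (\<lambda>y. periodize k (to_torus y)) (ball 0 M)" for M
  proof (rule Ck_on_cong)
    have shift: "Ck_on j (\<lambda>y. k (y + v)) UNIV" for v by (rule Ck_on_affine[OF bounded_linear_ident smooth])
    show "Ck_on j (\<lambda>y. \<Sum>v\<in>near M. k (y + v)) (ball 0 M)"
      by (rule Ck_on_sum[OF finite_near open_ball]) (rule Ck_on_subset[OF shift subset_UNIV])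
  qed (use periodize_to_torus[of _ M] in \<open>simp_all add: less_imp_le\<close>)
  show ?thesis
  proof (rule Ck_on_local)
    fix y show "\<exists>S. open S \<and> y \<in> S \<and> Ck_on j (\<lambda>y. periodize k (to_torus y)) S"
      by (intro exI[of _ "ball 0 (norm y + 1)"]) (simp add: ball)
  qed
qed

lemma periodize_even: "periodize k (- z) = periodize k z"
proof -
  have "bij_betw uminus {w. to_torus w = z} {w. to_torus w = - z}" by (rule bij_betwI[where g=uminus]) (auto simp: to_torus_minus)
  from infsum_reindex_bij_betw[OF this, of k] show ?thesis unfolding periodize_def by (simp add: even)
qed

lemma periodize_support: "periodize k z \<noteq> 0 \<Longrightarrow> dist z 0 < \<rho>"
proof -
  assume nz: "periodize k z \<noteq> 0"
  have "\<exists>w. to_torus w = z \<and> k w \<noteq> 0"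
  proof (rule ccontr)
    assume "\<not> ?thesis"
    then have "periodize k z = infsum (\<lambda>_. 0) {w. to_torus w = z}" unfolding periodize_def by (intro infsum_cong) auto
    with nz show False by simp
  qed
  then obtain w where "to_torus w = z" "k w \<noteq> 0" by blast
  then show ?thesis using dist_torus_le[of w z 0] support[of w] by simp
qed

lemma torus_kernel_periodize: "torus_kernel \<rho> (periodize k)"
proof -
  have m: "periodize k \<in> borel_measurable borel" using periodize_smooth[of 0]
    by (intro borel_measurable_continuous_onI) (simp add: continuous_torus_iff)
  have "(\<integral>\<^sup>+z. ennreal (periodize k z) \<partial>torus_vol) = (\<integral>\<^sup>+y. ennreal (k y) \<partial>lborel)"
    using nn_integral_unfold[of "\<lambda>_. 1" "\<lambda>y. ennreal (k y)"] k_measurable by (simp add: eper_kernel)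
  then have "(\<integral>z. periodize k z \<partial>torus_vol) = 1" using m periodize_nonneg by (subst integral_eq_nn_integral) (simp_all add: mass)
  then show ?thesis unfolding torus_kernel_def using periodize_smooth periodize_nonneg periodize_even periodize_support by auto
qed

lemma conv_fun_periodize:
  assumes u[measurable]: "u \<in> borel_measurable borel" and u0: "\<And>z. 0 \<le> u z"
  shows "conv_fun u k x = (\<integral>z. u z * periodize k (x - z) \<partial>torus_vol)"
proof -
  note [measurable] = k_measurable torus_kernel_measurable[OF torus_kernel_periodize]
  have "conv_fun u k x = enn2real (\<integral>\<^sup>+y. ennreal (u (x - to_torus y)) * ennreal (k y) \<partial>lborel)"
    unfolding conv_fun_def using u0 nonneg by (subst integral_eq_nn_integral) (auto simp: ennreal_mult)
  also have "(\<integral>\<^sup>+y. ennreal (u (x - to_torus y)) * ennreal (k y) \<partial>lborel)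
      = (\<integral>\<^sup>+z. ennreal (u (x - z)) * ennreal (periodize k z) \<partial>torus_vol)"
    using nn_integral_unfold[of "\<lambda>z. ennreal (u (x - z))" "\<lambda>y. ennreal (k y)"] by (simp add: eper_kernel)
  also have "\<dots> = (\<integral>\<^sup>+z. ennreal (u (x - z)) * ennreal (periodize k z) \<partial>distr torus_vol borel (\<lambda>z. x - z))"
    by (simp add: distr_torus_reflect)
  also have "\<dots> = (\<integral>\<^sup>+z. ennreal (u z * periodize k (x - z)) \<partial>torus_vol)"
    by (subst nn_integral_distr) (auto simp: ennreal_mult u0 periodize_nonneg)
  also have "enn2real \<dots> = (\<integral>z. u z * periodize k (x - z) \<partial>torus_vol)"
    by (subst integral_eq_nn_integral) (auto simp: u0 periodize_nonneg)
  finally show ?thesis .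
qed

end

lemma reg_kernel_support:
  assumes "reg_kernel \<xi>"
  obtains R where "R > 0" "\<And>x. \<xi> x \<noteq> 0 \<Longrightarrow> norm x < R"
proof -
  have "bounded {x. \<xi> x \<noteq> 0}" using assms unfolding reg_kernel_def by (meson bounded_subset closure_subset compact_imp_bounded)
  then obtain B where "\<forall>x\<in>{x. \<xi> x \<noteq> 0}. norm x \<le> B" by (auto simp: bounded_iff)
  then show ?thesis by (intro that[of "\<bar>B\<bar> + 1"]) force+
qed

lemma scaled_kernel_ball_kernel:
  fixes \<xi> :: "real ^ 'd::finite \<Rightarrow> real"
  assumes reg: "reg_kernel \<xi>" and R: "\<And>x. \<xi> x \<noteq> 0 \<Longrightarrow> norm x < R" and \<sigma>: "0 < \<sigma>"
  shows "ball_kernel (scaled_kernel \<xi> \<sigma>) (R * \<sigma>)"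
proof
  fix j
  have "Ck_on j (\<lambda>x. \<xi> ((1 / \<sigma>) *\<^sub>R x + 0)) UNIV"
    by (rule Ck_on_affine) (use reg in \<open>auto simp: reg_kernel_def intro: bounded_linear_scaleR_right\<close>)
  then have "Ck_on j (\<lambda>x. \<xi> (x /\<^sub>R \<sigma>) * (1 / \<sigma> ^ CARD('d))) UNIV"
    by (intro Ck_on_mult Ck_on_const) (auto simp: inverse_eq_divide)
  then show "Ck_on j (scaled_kernel \<xi> \<sigma>) UNIV" unfolding scaled_kernel_def by simp
next
  fix y
  show "0 \<le> scaled_kernel \<xi> \<sigma> y" using reg \<sigma> by (auto simp: scaled_kernel_def reg_kernel_def)
  show "scaled_kernel \<xi> \<sigma> (- y) = scaled_kernel \<xi> \<sigma> y" using reg by (simp add: scaled_kernel_def reg_kernel_def)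
  show "norm y < R * \<sigma>" if "scaled_kernel \<xi> \<sigma> y \<noteq> 0"
  proof -
    have "norm (y /\<^sub>R \<sigma>) < R" using that by (intro R) (simp add: scaled_kernel_def)
    then show ?thesis using \<sigma> by (simp add: field_simps)
  qed
next
  have xm[measurable]: "\<xi> \<in> borel_measurable borel"
    using reg unfolding reg_kernel_def by (metis Ck_on.simps(1) borel_measurable_continuous_onI)
  have x0: "0 \<le> \<xi> x" for x using reg by (simp add: reg_kernel_def)
  have one: "(\<integral>x. \<xi> x \<partial>lborel) = 1" using reg by (simp add: reg_kernel_def)
  then have "integrable lborel \<xi>" using not_integrable_integral_eq by fastforce
  then have n1: "(\<integral>\<^sup>+x. ennreal (\<xi> x) \<partial>lborel) = 1" using one x0 by (subst nn_integral_eq_integral) auto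
  let ?D = "\<sigma> ^ CARD('d)"
  have D: "?D > 0" using \<sigma> by simp
  have "(\<integral>\<^sup>+y. ennreal (scaled_kernel \<xi> \<sigma> y) \<partial>lborel)
      = (\<integral>\<^sup>+y. ennreal (\<xi> (y /\<^sub>R \<sigma>) / ?D) \<partial>density (distr lborel borel (\<lambda>x. 0 + \<sigma> *\<^sub>R x)) (\<lambda>_. ennreal (\<bar>\<sigma>\<bar> ^ DIM(real ^ 'd))))"
    unfolding scaled_kernel_def using lborel_affine[of \<sigma> "0 :: real ^ 'd"] \<sigma> by simp
  also have "\<dots> = (\<integral>\<^sup>+x. ennreal ?D * ennreal (\<xi> x / ?D) \<partial>lborel)"
    using \<sigma> by (subst nn_integral_density) (auto simp: nn_integral_distr)
  also have "\<dots> = (\<integral>\<^sup>+x. ennreal (\<xi> x) \<partial>lborel)"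
    using \<sigma> by (intro nn_integral_cong) (simp add: ennreal_mult'[symmetric] x0)
  finally show "(\<integral>\<^sup>+y. ennreal (scaled_kernel \<xi> \<sigma> y) \<partial>lborel) = 1" using n1 by simp
qed

text \<open>For \<open>\<sigma> \<le> 1\<close> a bounded number of lattice points contributes to the periodization. The power of
\<open>\<sigma>\<close> is the one that \<open>fenchel_nearby\<close> can compensate.\<close>

lemma scaled_kernel_periodize_bound:
  fixes \<xi> :: "real ^ 'd::finite \<Rightarrow> real"
  assumes reg: "reg_kernel \<xi>" and R: "R > 0" "\<And>x. \<xi> x \<noteq> 0 \<Longrightarrow> norm x < R"
  obtains C where "C > 0"
    "\<And>\<sigma> z. 0 < \<sigma> \<Longrightarrow> \<sigma> \<le> 1 \<Longrightarrow> periodize (scaled_kernel \<xi> \<sigma>) z \<le> C / \<sigma> ^ CARD('d)"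
proof -
  have "continuous_on (cball 0 R) \<xi>" using reg unfolding reg_kernel_def by (metis Ck_on.simps(1) continuous_on_subset subset_UNIV)
  then have "bounded (\<xi> ` cball 0 R)" by (intro compact_imp_bounded compact_continuous_image) auto
  then obtain B0 where B0': "\<forall>x\<in>cball 0 R. \<bar>\<xi> x\<bar> \<le> B0" unfolding bounded_iff by auto
  note B0 = bspec[OF B0']
  define B where "B = \<bar>B0\<bar>"
  have B: "\<xi> x \<le> B" for x using B0[of x] R(2)[of x] unfolding B_def by (cases "\<xi> x = 0") (auto simp: dist_norm)
  define n where "n = card {v \<in> (lattice :: (real ^ 'd) set). norm v \<le> R + real CARD('d)}"
  show thesis
  proof (rule that[of "real n * B + 1"])
    show "0 < real n * B + 1" by (simp add: B_def add_nonneg_pos)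
    fix \<sigma> :: real and z :: "'d torus" assume \<sigma>: "0 < \<sigma>" "\<sigma> \<le> 1"
    interpret ball_kernel "scaled_kernel \<xi> \<sigma>" "R * \<sigma>" by (rule scaled_kernel_ball_kernel[OF reg R(2) \<sigma>(1)])
    let ?y = "crep z"
    have "norm ?y \<le> (\<Sum>i\<in>UNIV. \<bar>?y $ i\<bar>)" by (rule norm_le_l1_cart)
    also have "\<dots> \<le> (\<Sum>i\<in>(UNIV::'d set). 1)"
    proof (rule sum_mono)
      fix i show "\<bar>?y $ i\<bar> \<le> 1" using crep_range[of z i] by linarith
    qed
    finally have y: "norm ?y \<le> real CARD('d)" by simp
    have "periodize (scaled_kernel \<xi> \<sigma>) z = (\<Sum>v\<in>near (real CARD('d)). scaled_kernel \<xi> \<sigma> (?y + v))"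
      using periodize_to_torus[OF y] by simp
    also have "\<dots> \<le> (\<Sum>v\<in>near (real CARD('d)). B / \<sigma> ^ CARD('d))"
      using \<sigma> B by (intro sum_mono) (simp add: scaled_kernel_def divide_right_mono)
    also have "\<dots> = real (card (near (real CARD('d)))) * (B / \<sigma> ^ CARD('d))" by simp
    also have "\<dots> \<le> real n * (B / \<sigma> ^ CARD('d))"
    proof (rule mult_right_mono)
      have "R * \<sigma> \<le> R" using \<sigma> R by simp
      then have "near (real CARD('d)) \<subseteq> {v \<in> (lattice :: (real ^ 'd) set). norm v \<le> R + real CARD('d)}" by (auto simp: near_def)
      then show "real (card (near (real CARD('d)))) \<le> real n" unfolding n_def using card_mono[OF finite_lattice_bounded] by auto
    qed (use \<sigma> in \<open>simp add: B_def\<close>)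
    also have "\<dots> \<le> (real n * B + 1) / \<sigma> ^ CARD('d)" using \<sigma> by (simp add: divide_right_mono)
    finally show "periodize (scaled_kernel \<xi> \<sigma>) z \<le> (real n * B + 1) / \<sigma> ^ CARD('d)" .
  qed
qed

definition time_kernel :: "real \<Rightarrow> (real \<Rightarrow> real) \<Rightarrow> bool" where
  "time_kernel h \<rho> \<longleftrightarrow> (\<forall>k. Ck_on k \<rho> UNIV) \<and> (\<forall>s. 0 \<le> \<rho> s) \<and> (\<forall>s. \<rho> s \<noteq> 0 \<longrightarrow> \<bar>s\<bar> < h) \<and>
     (\<integral>\<^sup>+s. ennreal (\<rho> s) \<partial>lborel) = 1"

text \<open>A restriction of \<open>\<xi>\<close> to a line through a point where it is positive, rescaled and normalised.\<close>

lemma time_kernel_exists: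
  fixes \<xi> :: "real ^ 'd::finite \<Rightarrow> real"
  assumes reg: "reg_kernel \<xi>" and h: "0 < h"
  shows "\<exists>\<rho>. time_kernel h \<rho>"
proof -
  obtain R where R: "R > 0" "\<And>x. \<xi> x \<noteq> 0 \<Longrightarrow> norm x < R" using reg_kernel_support[OF reg] by blast
  have x0: "0 \<le> \<xi> x" for x using reg by (simp add: reg_kernel_def)
  have "\<exists>x. \<xi> x \<noteq> 0"
  proof (rule ccontr)
    assume "\<nexists>x. \<xi> x \<noteq> 0"
    then have "(\<integral>x. \<xi> x \<partial>lborel) = 0" by simp
    then show False using reg by (simp add: reg_kernel_def)
  qed
  then obtain a where a: "\<xi> a > 0" using x0 by (metis order_le_less)
  define e where "e = (axis undefined 1 :: real ^ 'd)"
  have e: "norm e = 1" by (simp add: e_def norm_axis_1)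
  define R' where "R' = norm a + R"
  have R': "R' > 0" using R unfolding R'_def by (simp add: add_nonneg_pos)
  define \<rho>0 where "\<rho>0 = (\<lambda>s. \<xi> ((s * (R' / h)) *\<^sub>R e + a))"
  have bl: "bounded_linear (\<lambda>s. (s * (R' / h)) *\<^sub>R e)" by (intro bounded_linear_intros)
  have sm: "Ck_on k \<rho>0 UNIV" for k unfolding \<rho>0_def by (rule Ck_on_affine[OF bl]) (use reg in \<open>simp add: reg_kernel_def\<close>)
  have supp: "\<bar>s\<bar> < h" if "\<rho>0 s \<noteq> 0" for s
  proof -
    have "norm ((s * (R' / h)) *\<^sub>R e + a) < R" using that R(2) unfolding \<rho>0_def by blast
    moreover have "norm ((s * (R' / h)) *\<^sub>R e) \<le> norm ((s * (R' / h)) *\<^sub>R e + a) + norm a"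
      using norm_triangle_ineq4[of "(s * (R' / h)) *\<^sub>R e + a" a] by simp
    ultimately have "\<bar>s\<bar> * (R' / h) < R'" using R' h by (simp add: e R'_def abs_mult)
    then show ?thesis using R' h by (simp add: field_simps)
  qed
  have n0: "0 \<le> \<rho>0 s" for s by (simp add: \<rho>0_def x0)
  have c0: "continuous_on UNIV \<rho>0" using sm[of 0] by simp
  note [measurable] = borel_measurable_continuous_onI[OF c0]
  define c where "c = (\<integral>\<^sup>+s. ennreal (\<rho>0 s) \<partial>lborel)"
  have "c < \<infinity>"
  proof -
    have "bounded (\<rho>0 ` {-h..h})" using c0 by (intro compact_imp_bounded compact_continuous_image) (auto intro: continuous_on_subset)
    then obtain B where B': "\<forall>s\<in>{-h..h}. \<bar>\<rho>0 s\<bar> \<le> B" unfolding bounded_iff by auto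
    note B = bspec[OF B']
    have "c \<le> (\<integral>\<^sup>+s. ennreal B * indicator {-h..h} s \<partial>lborel)" unfolding c_def
    proof (rule nn_integral_mono)
      fix s show "ennreal (\<rho>0 s) \<le> ennreal B * indicator {-h..h} s" using supp[of s] B[of s] n0[of s]
        by (cases "\<rho>0 s = 0") (auto simp: abs_if indicator_def split: if_splits intro!: ennreal_leI)
    qed
    also have "\<dots> < \<infinity>" using h by (subst nn_integral_cmult_indicator) (auto simp: ennreal_mult_less_top)
    finally show ?thesis .
  qed
  moreover have "c > 0"
  proof -
    have "\<rho>0 0 > 0" using a by (simp add: \<rho>0_def)
    moreover have "isCont \<rho>0 0" using c0 by (simp add: continuous_on_eq_continuous_at)
    ultimately have "\<forall>\<^sub>F s in nhds 0. \<rho>0 s > \<rho>0 0 / 2"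
      by (intro order_tendstoD(1)[of \<rho>0 "\<rho>0 0"]) (auto simp: isCont_def tendsto_at_iff_tendsto_nhds)
    then obtain d where d: "d > 0" "\<And>s. \<bar>s\<bar> < d \<Longrightarrow> \<rho>0 s > \<rho>0 0 / 2" by (auto simp: eventually_nhds_metric)
    have "0 < ennreal (\<rho>0 0 / 2) * ennreal d" using d(1) \<open>\<rho>0 0 > 0\<close> by (simp add: ennreal_zero_less_mult_iff)
    also have "\<dots> = (\<integral>\<^sup>+s. ennreal (\<rho>0 0 / 2) * indicator {0<..<d} s \<partial>lborel)"
      using d(1) by (subst nn_integral_cmult_indicator) auto
    also have "\<dots> \<le> c" unfolding c_def
    proof (rule nn_integral_mono)
      fix s show "ennreal (\<rho>0 0 / 2) * indicator {0<..<d} s \<le> ennreal (\<rho>0 s)"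
        using d(2)[of s] by (cases "s \<in> {0<..<d}") (auto simp: ennreal_leI)
    qed
    finally show ?thesis .
  qed
  ultimately obtain r where r: "c = ennreal r" "r > 0" by (cases c) auto
  have "time_kernel h (\<lambda>s. \<rho>0 s * (1 / r))" unfolding time_kernel_def
  proof (intro conjI allI impI)
    show "Ck_on k (\<lambda>s. \<rho>0 s * (1 / r)) UNIV" for k by (intro Ck_on_mult sm Ck_on_const open_UNIV)
    have "(\<integral>\<^sup>+s. ennreal (\<rho>0 s * (1 / r)) \<partial>lborel) = (\<integral>\<^sup>+s. ennreal (\<rho>0 s) \<partial>lborel) * ennreal (1 / r)"
      using r n0 by (subst nn_integral_multc[symmetric]) (auto simp: ennreal_mult'[symmetric] ennreal_mult)
    also have "\<dots> = 1" using r by (simp add: c_def[symmetric] ennreal_mult'[symmetric])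
    finally show "(\<integral>\<^sup>+s. ennreal (\<rho>0 s * (1 / r)) \<partial>lborel) = 1" .
  qed (use supp r n0 in auto)
  then show ?thesis by blast
qed

section \<open>Bumps moving along an absolutely continuous curve\<close>

lemma set_integrable_continuous_mult:
  fixes g v :: "real \<Rightarrow> real"
  assumes v: "set_integrable lborel {a..b} v" and g: "continuous_on {a..b} g"
  shows "set_integrable lborel {a..b} (\<lambda>r. g r * v r)"
proof -
  have "bounded (g ` {a..b})" using g by (intro compact_imp_bounded compact_continuous_image) auto
  then obtain B where B': "\<forall>r\<in>{a..b}. \<bar>g r\<bar> \<le> B" unfolding bounded_iff by auto
  have m: "(\<lambda>r. indicator {a..b} r *\<^sub>R g r) \<in> borel_measurable borel"
    by (rule borel_measurable_continuous_on_indicator) (use g in auto)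
  have eq: "(\<lambda>r. indicator {a..b} r *\<^sub>R (g r * v r)) = (\<lambda>r. (indicator {a..b} r *\<^sub>R g r) * (indicator {a..b} r *\<^sub>R v r))"
    by (auto simp: indicator_def)
  show ?thesis unfolding set_integrable_def
  proof (rule Bochner_Integration.integrable_bound)
    show "integrable lborel (\<lambda>r. \<bar>B\<bar> * (indicator {a..b} r *\<^sub>R v r))" using v by (simp add: set_integrable_def)
    show "(\<lambda>r. indicator {a..b} r *\<^sub>R (g r * v r)) \<in> borel_measurable lborel"
      unfolding eq using v m by (intro borel_measurable_times) (auto simp: set_integrable_def)
    show "AE r in lborel. norm (indicator {a..b} r *\<^sub>R (g r * v r)) \<le> norm (\<bar>B\<bar> * (indicator {a..b} r *\<^sub>R v r))"
    proof (rule AE_I2)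
      fix r
      show "norm (indicator {a..b} r *\<^sub>R (g r * v r)) \<le> norm (\<bar>B\<bar> * (indicator {a..b} r *\<^sub>R v r))"
      proof (cases "r \<in> {a..b}")
        case True
        then have "\<bar>g r\<bar> \<le> \<bar>B\<bar>" using B' by force
        then show ?thesis using True by (simp add: abs_mult mult_right_mono)
      qed simp
    qed
  qed
qed

lemma local_to_global_bound:
  fixes E W :: "real \<Rightarrow> real"
  assumes ab: "a \<le> b" and d: "0 < d"
    and loc: "\<And>s t. a \<le> s \<Longrightarrow> s \<le> t \<Longrightarrow> t \<le> b \<Longrightarrow> t - s < d \<Longrightarrow> \<bar>E t - E s\<bar> \<le> W t - W s"
  shows "\<bar>E b - E a\<bar> \<le> W b - W a"
proof -
  obtain n where n: "(b - a) / d < real n" using reals_Archimedean2 by blast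
  then have n0: "0 < n" using ab d by (cases n) (auto simp: field_simps intro: gr0I)
  define t where "t = (\<lambda>k::nat. a + (b - a) * real k / real n)"
  have t0: "t 0 = a" "t n = b" using n0 by (auto simp: t_def)
  have step: "t (Suc k) - t k = (b - a) / n" for k by (simp add: t_def diff_divide_distrib[symmetric] algebra_simps)
  have lt: "(b - a) / n < d" using n n0 d by (simp add: field_simps)
  have rng: "a \<le> t k \<and> t k \<le> b" if "k \<le> n" for k
  proof -
    have "(b - a) * real k / real n \<le> (b - a) * 1" using that n0 ab by (subst times_divide_eq_right[symmetric], intro mult_left_mono) auto
    then show ?thesis using ab by (simp add: t_def)
  qed
  have "E b - E a = (\<Sum>k<n. E (t (Suc k)) - E (t k))" by (subst sum_lessThan_telescope) (simp add: t0)
  then have "\<bar>E b - E a\<bar> \<le> (\<Sum>k<n. \<bar>E (t (Suc k)) - E (t k)\<bar>)" by (simp add: sum_abs)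
  also have "\<dots> \<le> (\<Sum>k<n. W (t (Suc k)) - W (t k))"
  proof (rule sum_mono)
    fix k assume "k \<in> {..<n}"
    then have "k \<le> n" "Suc k \<le> n" by auto
    moreover have "0 \<le> (b - a) / n" using ab by simp
    ultimately show "\<bar>E (t (Suc k)) - E (t k)\<bar> \<le> W (t (Suc k)) - W (t k)"
      using rng[of k] rng[of "Suc k"] step[of k] lt by (intro loc) linarith+
  qed
  also have "\<dots> = W b - W a" by (subst sum_lessThan_telescope) (simp add: t0)
  finally show ?thesis .
qed

text \<open>The curve is differentiable only almost everywhere, so the fundamental theorem of calculus is not
applied to the composition. On a short interval, a first-order Taylor expansion along the chord
has an error that is a small multiple of the integral of \<open>norm V\<close>; \<open>local_to_global_bound\<close> adds up
these errors.\<close>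

lemma ac_chain_rule:
  fixes \<Phi> :: "'a::euclidean_space \<Rightarrow> real" and C V :: "real \<Rightarrow> 'a"
  assumes \<Phi>: "Ck_on (Suc 0) \<Phi> UNIV" and ab: "a \<le> b"
    and V: "set_integrable lborel {a..b} V"
    and C: "\<And>t. t \<in> {a..b} \<Longrightarrow> C t = C a + integral {a..t} V"
  shows "set_integrable lborel {a..b} (\<lambda>t. frechet_derivative \<Phi> (at (C t)) (V t))"
    and "integral {a..b} (\<lambda>t. frechet_derivative \<Phi> (at (C t)) (V t)) = \<Phi> (C b) - \<Phi> (C a)"
proof -
  let ?D = "\<lambda>x. frechet_derivative \<Phi> (at x)"
  let ?B = "\<lambda>x. Blinfun (?D x)"
  note B = continuous_blinfun_derivative[OF \<Phi>]
  note D = Ck_on_SucD[OF \<Phi> UNIV_I]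
  have lin: "linear (?D x)" for x using D has_derivative_linear by blast
  have Vi: "V integrable_on {a..b}" by (rule set_borel_integral_eq_integral(1)[OF V])
  have contC: "continuous_on {a..b} C"
  proof -
    have "continuous_on {a..b} (\<lambda>t. C a + integral {a..t} V)" by (intro continuous_intros indefinite_integral_continuous_1 Vi)
    then show ?thesis by (rule continuous_on_eq) (rule C[symmetric])
  qed
  have Db: "?D x w = (\<Sum>i\<in>Basis. ?D x i * (w \<bullet> i))" for x w
  proof -
    have "?D x w = ?D x (\<Sum>i\<in>Basis. (w \<bullet> i) *\<^sub>R i)" by (simp add: euclidean_representation)
    also have "\<dots> = (\<Sum>i\<in>Basis. ?D x i * (w \<bullet> i))" using lin[of x] by (simp add: linear_sum linear_scale mult.commute)
    finally show ?thesis .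
  qed
  have DV: "set_integrable lborel {a..b} (\<lambda>t. ?D (x t) (V t))" if x: "continuous_on {a..b} x" for x
  proof -
    have "set_integrable lborel {a..b} (\<lambda>t. ?D (x t) i * (V t \<bullet> i))" for i
    proof (rule set_integrable_continuous_mult)
      show "set_integrable lborel {a..b} (\<lambda>t. V t \<bullet> i)"
        using V unfolding set_integrable_def by (simp add: inner_scaleR_left[symmetric] del: inner_scaleR_left)
      have "continuous_on UNIV (\<lambda>x. ?D x i)" using \<Phi> by simp
      then show "continuous_on {a..b} (\<lambda>t. ?D (x t) i)" by (rule continuous_on_compose2[OF _ x]) simp
    qed
    then show ?thesis unfolding Db[of _ "V _"] set_integrable_def scaleR_sum_right by (intro Bochner_Integration.integrable_sum)
  qed
  show set: "set_integrable lborel {a..b} (\<lambda>t. ?D (C t) (V t))" by (rule DV[OF contC])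
  note DVi = set_borel_integral_eq_integral(1)[OF set]
  have Ni: "(\<lambda>t. norm (V t)) integrable_on {a..b}" by (rule set_borel_integral_eq_integral(1)[OF set_integrable_norm[OF V]])
  have sub: "f integrable_on {s..t}" if "f integrable_on {a..b}" "a \<le> s" "t \<le> b" for s t and f :: "real \<Rightarrow> 'z::banach"
    by (rule integrable_on_subinterval[OF that(1)]) (use that in auto)
  have add: "integral {a..t} f - integral {a..s} f = integral {s..t} f"
    if "f integrable_on {a..b}" "a \<le> s" "s \<le> t" "t \<le> b" for s t and f :: "real \<Rightarrow> 'z::banach"
    using Henstock_Kurzweil_Integration.integral_combine[OF that(2,3) sub[OF that(1) order_refl that(4)]] by (simp add: algebra_simps)
  define E where "E = (\<lambda>t. \<Phi> (C t) - integral {a..t} (\<lambda>t. ?D (C t) (V t)))"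
  define N where "N = (\<lambda>t. integral {a..t} (\<lambda>t. norm (V t)))"
  have bound: "\<bar>E b - E a\<bar> \<le> (2 * \<epsilon>) * N b - (2 * \<epsilon>) * N a" if \<epsilon>: "0 < \<epsilon>" for \<epsilon>
  proof -
    have "bounded (C ` {a..b})" using contC by (intro compact_imp_bounded compact_continuous_image) auto
    then obtain r where r': "\<forall>t\<in>{a..b}. norm (C t) \<le> r" unfolding bounded_iff by auto
    have "uniformly_continuous_on (cball 0 r) ?B" by (rule compact_uniformly_continuous[OF continuous_on_subset[OF B(1)]]) auto
    then obtain d where d: "d > 0" "\<And>x y. x \<in> cball 0 r \<Longrightarrow> y \<in> cball 0 r \<Longrightarrow> dist y x < d \<Longrightarrow> dist (?B y) (?B x) < \<epsilon>"
      unfolding uniformly_continuous_on_def using \<epsilon> by metis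
    have "uniformly_continuous_on {a..b} C" by (rule compact_uniformly_continuous[OF contC]) simp
    then obtain e where e: "e > 0" "\<And>s t. s \<in> {a..b} \<Longrightarrow> t \<in> {a..b} \<Longrightarrow> dist t s < e \<Longrightarrow> dist (C t) (C s) < d"
      unfolding uniformly_continuous_on_def using d(1) by metis
    have Dd: "\<bar>?D y w - ?D x w\<bar> \<le> \<epsilon> * norm w"
      if "x \<in> cball 0 r" "y \<in> cball 0 r" "dist y x < d" for x y w
    proof -
      have "\<bar>?D y w - ?D x w\<bar> = norm (blinfun_apply (?B y - ?B x) w)" by (simp add: blinfun.diff_left B(2))
      also have "\<dots> \<le> norm (?B y - ?B x) * norm w" by (rule norm_blinfun)
      also have "\<dots> \<le> \<epsilon> * norm w" using d(2)[OF that] by (intro mult_right_mono) (auto simp: dist_norm)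
      finally show ?thesis .
    qed
    show ?thesis
    proof (rule local_to_global_bound[OF ab e(1)])
      fix s t assume st: "a \<le> s" "s \<le> t" "t \<le> b" "t - s < e"
      then have sI: "s \<in> {a..b}" "t \<in> {a..b}" by auto
      have CC: "C t - C s = integral {s..t} V" using C[OF sI(1)] C[OF sI(2)] add[OF Vi st(1-3)] by (simp add: algebra_simps)
      have nV: "norm (C t - C s) \<le> N t - N s" unfolding CC N_def add[OF Ni st(1-3)]
        by (rule integral_norm_bound_integral) (use sub[OF Vi] sub[OF Ni] st in auto)
      have near: "C q \<in> cball 0 r \<and> dist (C q) (C s) < d" if "q \<in> {s..t}" for q using that st r' e(2)[of s q] by (auto simp: dist_norm)
      \<comment> \<open>first-order Taylor expansion of the function along the chord\<close>
      have T: "\<bar>\<Phi> (C t) - \<Phi> (C s) - ?D (C s) (C t - C s)\<bar> \<le> norm (C t - C s) * \<epsilon>"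
      proof -
        have seg: "x \<in> cball 0 r \<and> dist x (C s) < d" if "x \<in> closed_segment (C s) (C t)" for x
        proof
          show "x \<in> cball 0 r"
            using that near[of s] near[of t] st convex_cball[of 0 r] by (meson atLeastAtMost_iff convex_contains_segment order_refl subsetD)
          have "dist x (C s) \<le> dist (C t) (C s)" using segment_bound(1)[OF that] by (simp add: dist_norm norm_minus_commute)
          then show "dist x (C s) < d" using near[of t] st by auto
        qed
        have "norm (\<Phi> (C t) - \<Phi> (C s) - ?D (C s) (C t - C s)) \<le> norm (C t - C s) * \<epsilon>"
        proof (rule differentiable_bound_linearization[where S="closed_segment (C s) (C t)" and f'="?D"])
          show "(\<Phi> has_derivative ?D x) (at x within closed_segment (C s) (C t))" for x using D by (rule has_derivative_at_withinI)
          show "C s + x *\<^sub>R (C t - C s) \<in> closed_segment (C s) (C t)" if "x \<in> {0..1}" for x :: real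
            using that by (auto simp: in_segment algebra_simps intro!: exI[of _ x])
          fix x assume "x \<in> closed_segment (C s) (C t)"
          note sg = seg[OF this]
          show "onorm (?D x - ?D (C s)) \<le> \<epsilon>"
          proof (rule onorm_bound)
            show "norm ((?D x - ?D (C s)) w) \<le> \<epsilon> * norm w" for w using Dd[of "C s" x w] near[of s] st sg by (simp add: fun_diff_def)
          qed (use \<epsilon> in simp)
        qed simp
        then show ?thesis by simp
      qed
      have I: "\<bar>integral {s..t} (\<lambda>q. ?D (C q) (V q)) - ?D (C s) (C t - C s)\<bar> \<le> \<epsilon> * (N t - N s)"
      proof -
        have Ds: "?D (C s) (integral {s..t} V) = integral {s..t} (\<lambda>q. ?D (C s) (V q))"
          using sub[OF Vi st(1,3)] has_derivative_bounded_linear[OF D] by (rule integral_linear[unfolded o_def, symmetric])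
        have Dsi: "(\<lambda>q. ?D (C s) (V q)) integrable_on {s..t}"
          using sub[OF Vi st(1,3)] has_derivative_bounded_linear[OF D] by (rule integrable_linear[unfolded o_def])
        have "norm (integral {s..t} (\<lambda>q. ?D (C q) (V q) - ?D (C s) (V q))) \<le> integral {s..t} (\<lambda>q. \<epsilon> * norm (V q))"
        proof (rule integral_norm_bound_integral)
          show "(\<lambda>q. ?D (C q) (V q) - ?D (C s) (V q)) integrable_on {s..t}"
            using sub[OF DVi st(1,3)] Dsi by (rule Henstock_Kurzweil_Integration.integrable_diff)
          show "(\<lambda>q. \<epsilon> * norm (V q)) integrable_on {s..t}" using sub[OF Ni st(1,3)] by (rule integrable_on_mult_right)
        qed (use Dd near st in auto)
        then show ?thesis unfolding CC Ds N_def add[OF Ni st(1-3)]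
          using Henstock_Kurzweil_Integration.integral_diff[OF sub[OF DVi st(1,3)] Dsi] by simp
      qed
      have "E t - E s = (\<Phi> (C t) - \<Phi> (C s)) - integral {s..t} (\<lambda>q. ?D (C q) (V q))"
        unfolding E_def using add[OF DVi st(1-3)] by simp
      moreover have "norm (C t - C s) * \<epsilon> \<le> \<epsilon> * (N t - N s)" using nV \<epsilon> by (simp add: mult.commute)
      ultimately show "\<bar>E t - E s\<bar> \<le> (2 * \<epsilon>) * N t - (2 * \<epsilon>) * N s"
        using T I by (simp add: algebra_simps abs_le_iff) linarith
    qed
  qed
  have "E b - E a = 0"
  proof (rule ccontr)
    assume nz: "E b - E a \<noteq> 0"
    define X where "X = \<bar>N b - N a\<bar> + 1"
    define \<epsilon> where "\<epsilon> = \<bar>E b - E a\<bar> / (4 * X)"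
    have X: "0 < X" unfolding X_def by linarith
    have "0 < \<epsilon>" using nz X by (simp add: \<epsilon>_def)
    from bound[OF this] have "\<bar>E b - E a\<bar> \<le> 2 * \<epsilon> * (N b - N a)" by (simp add: algebra_simps)
    also have "\<dots> \<le> 2 * \<epsilon> * X" using \<open>0 < \<epsilon>\<close> by (intro mult_left_mono) (auto simp: X_def)
    also have "\<dots> = \<bar>E b - E a\<bar> / 2" using X by (simp add: \<epsilon>_def)
    finally show False using nz by simp
  qed
  then show "integral {a..b} (\<lambda>t. ?D (C t) (V t)) = \<Phi> (C b) - \<Phi> (C a)" unfolding E_def by simp
qed

lemma gradient_inner:
  fixes k :: "real ^ 'd::finite \<Rightarrow> real"
  assumes "k differentiable at x"
  shows "inner (gradient k x) v = frechet_derivative k (at x) v"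
proof -
  have lin: "linear (frechet_derivative k (at x))" using assms by (rule linear_frechet_derivative)
  have "frechet_derivative k (at x) v = frechet_derivative k (at x) (\<Sum>i\<in>UNIV. v $ i *s axis i 1)" by (simp add: basis_expansion)
  also have "\<dots> = (\<Sum>i\<in>UNIV. v $ i * frechet_derivative k (at x) (axis i 1))"
    using lin by (simp add: linear_sum linear_scale scalar_mult_eq_scaleR)
  finally show ?thesis by (simp add: gradient_def inner_vec_def mult.commute)
qed

text \<open>A product kernel in time and space carried along the curve with lift \<open>c\<close> and velocity \<open>v\<close>. Its
integral over the travelling time is an admissible test function, since the curve enters only
through translations.\<close>

locale moving_bump =
  fixes h s :: real and \<rho> :: "real \<Rightarrow> real" and K :: "'d::finite torus \<Rightarrow> real"
    and a b :: real and c v :: "real \<Rightarrow> real ^ 'd"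
  assumes \<rho>: "time_kernel h \<rho>" and K: "torus_kernel s K" and ab: "a \<le> b"
    and v: "set_integrable lborel {a..b} v"
    and c: "\<And>t. t \<in> {a..b} \<Longrightarrow> c t = c a + integral {a..t} v"
begin

definition g :: "real \<times> (real ^ 'd) \<Rightarrow> real" where
  "g = (\<lambda>z. \<rho> (fst z) * K (to_torus (snd z)))"

definition bump :: "real \<Rightarrow> real \<times> 'd torus \<Rightarrow> real" where
  "bump t z = \<rho> (fst z - t) * K (snd z - to_torus (c t))"

definition Bump :: "real \<times> 'd torus \<Rightarrow> real" where
  "Bump z = integral {a..b} (\<lambda>t. bump t z)"

lemma cont_c: "continuous_on {a..b} c"
proof -
  have "continuous_on {a..b} (\<lambda>t. c a + integral {a..t} v)"
    by (intro continuous_intros indefinite_integral_continuous_1 set_borel_integral_eq_integral(1)[OF v])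
  then show ?thesis by (rule continuous_on_eq) (rule c[symmetric])
qed

lemma smooth_g: "Ck_on k g UNIV"
proof -
  have "Ck_on k (\<lambda>z. \<rho> (fst z + 0)) (UNIV :: (real \<times> (real ^ 'd)) set)"
    by (rule Ck_on_affine[OF bounded_linear_fst]) (use \<rho> in \<open>simp add: time_kernel_def\<close>)
  moreover have "Ck_on k (\<lambda>z. K (to_torus (snd z + 0))) (UNIV :: (real \<times> (real ^ 'd)) set)"
    by (rule Ck_on_affine[OF bounded_linear_snd, of k "\<lambda>y. K (to_torus y)"])
       (use K in \<open>simp add: torus_kernel_def\<close>)
  ultimately show ?thesis unfolding g_def by (simp add: Ck_on_mult)
qed

lemma lift_bump: "st_lift (bump t) z = g (z - (t, c t))"
  by (simp add: st_lift_def bump_def g_def split_beta to_torus_diff)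

lemma lift_Bump: "st_lift Bump z = integral {a..b} (\<lambda>t. g (z - (t, c t)))"
proof -
  have "st_lift Bump z = integral {a..b} (\<lambda>t. st_lift (bump t) z)" by (simp add: st_lift_def Bump_def split_beta)
  then show ?thesis by (simp add: lift_bump)
qed

lemma smooth_bump: "st_smooth (bump t)"
  unfolding st_smooth_def
proof
  fix k
  have "Ck_on k (\<lambda>z. g (z + - (t, c t))) UNIV" by (rule Ck_on_affine[OF bounded_linear_ident smooth_g])
  then show "Ck_on k (st_lift (bump t)) UNIV" by (simp only: lift_bump[abs_def] diff_conv_add_uminus)
qed

lemma cont_tc: "continuous_on {a..b} (\<lambda>t. (t, c t))"
  by (intro continuous_on_Pair continuous_on_id cont_c)

lemma smooth_Bump: "st_smooth Bump"
  unfolding st_smooth_def lift_Bump[abs_def] by (intro allI Ck_on_integral_translates smooth_g cont_tc)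

lemma bump_nonneg: "0 \<le> bump t z"
  using \<rho> K by (simp add: bump_def time_kernel_def torus_kernel_def)

lemma bump_eq_0: "h \<le> \<bar>fst z - t\<bar> \<Longrightarrow> bump t z = 0"
  using \<rho> by (auto simp: bump_def time_kernel_def)

lemma cont_rho: "continuous_on UNIV \<rho>"
  using \<rho> unfolding time_kernel_def using Ck_on.simps(1) by metis

lemma cont_bump: "continuous_on UNIV (bump t)"
  unfolding bump_def by (intro continuous_intros continuous_on_compose2[OF cont_rho] continuous_on_compose2[OF torus_kernel_continuous[OF K]]) auto

lemma cont_bump_t: "continuous_on {a..b} (\<lambda>t. bump t z)"
  unfolding bump_def by (intro continuous_intros continuous_on_compose2[OF cont_rho]
     continuous_on_compose2[OF torus_kernel_continuous[OF K]] continuous_on_compose2[OF continuous_to_torus] cont_c) auto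

lemma Bump_nonneg: "0 \<le> Bump z"
  unfolding Bump_def by (intro integral_nonneg integrable_continuous_real cont_bump_t bump_nonneg)

lemma Bump_eq_0: "fst z < a - h \<or> b + h < fst z \<Longrightarrow> Bump z = 0"
proof -
  assume z: "fst z < a - h \<or> b + h < fst z"
  have "integral {a..b} (\<lambda>t. bump t z) = integral {a..b} (\<lambda>t. 0)"
    by (rule Henstock_Kurzweil_Integration.integral_cong) (use z in \<open>auto intro!: bump_eq_0\<close>)
  then show ?thesis by (simp add: Bump_def)
qed

definition DK :: "'d torus \<Rightarrow> real ^ 'd" where
  "DK x = gradient (\<lambda>y. K (x + to_torus y)) 0"

lemma DK_to_torus: "DK (to_torus w) = gradient (\<lambda>y. K (to_torus y)) w"
  and DK_has_derivative: "((\<lambda>y. K (to_torus w + to_torus y)) has_derivative (\<lambda>u. inner (DK (to_torus w)) u)) (at 0)"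
proof -
  let ?k = "\<lambda>y. K (to_torus y)"
  have sm: "Ck_on (Suc 0) ?k UNIV" using K by (simp only: torus_kernel_def)
  have d: "(?k has_derivative frechet_derivative ?k (at w)) (at w)" by (rule Ck_on_SucD[OF sm UNIV_I])
  have "((\<lambda>y. ?k (w + y)) has_derivative (\<lambda>u. frechet_derivative ?k (at w) u)) (at 0)"
    by (rule has_derivative_compose[where f="\<lambda>y. w + y" and f'="\<lambda>u. u"])
      (use d in \<open>auto intro!: derivative_eq_intros\<close>)
  then have d0: "((\<lambda>y. K (to_torus w + to_torus y)) has_derivative frechet_derivative ?k (at w)) (at 0)" by (simp add: to_torus_add)
  then have eq: "frechet_derivative (\<lambda>y. K (to_torus w + to_torus y)) (at 0) = frechet_derivative ?k (at w)"
    using frechet_derivative_at by metis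
  show *: "DK (to_torus w) = gradient ?k w" unfolding DK_def gradient_def eq ..
  have "frechet_derivative ?k (at w) = (\<lambda>u. inner (DK (to_torus w)) u)"
    unfolding * using d by (intro ext gradient_inner[symmetric]) (auto simp: differentiable_def)
  then show "((\<lambda>y. K (to_torus w + to_torus y)) has_derivative (\<lambda>u. inner (DK (to_torus w)) u)) (at 0)" using d0 by simp
qed

lemma cont_DK: "continuous_on UNIV DK"
proof -
  let ?k = "\<lambda>y. K (to_torus y)"
  have sm: "Ck_on (Suc 0) ?k UNIV" using K by (simp only: torus_kernel_def)
  then have "continuous_on UNIV (\<lambda>w. gradient ?k w)" unfolding gradient_def by (auto intro!: continuous_on_vec_lambda)
  then show ?thesis unfolding continuous_torus_iff by (simp add: DK_to_torus)
qed

lemma Dx_bump: "Dx (bump t) z = \<rho> (fst z - t) *\<^sub>R DK (snd z - to_torus (c t))"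
proof -
  obtain \<tau> x where z: "z = (\<tau>, x)" by (cases z)
  obtain w where w: "to_torus w = x - to_torus (c t)" using to_torus_surj by blast
  have "((\<lambda>y. \<rho> (\<tau> - t) * K (to_torus w + to_torus y)) has_derivative (\<lambda>u. \<rho> (\<tau> - t) * inner (DK (to_torus w)) u)) (at 0)"
    by (intro has_derivative_mult_right DK_has_derivative)
  then have "frechet_derivative (\<lambda>y. \<rho> (\<tau> - t) * K (to_torus w + to_torus y)) (at 0)
      = (\<lambda>u. \<rho> (\<tau> - t) * inner (DK (to_torus w)) u)" using frechet_derivative_at by metis
  then have "gradient (\<lambda>y. \<rho> (\<tau> - t) * K (to_torus w + to_torus y)) 0 = \<rho> (\<tau> - t) *\<^sub>R DK (to_torus w)"
    by (simp add: gradient_def vec_eq_iff inner_axis)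
  moreover have "(\<lambda>y. bump t (\<tau>, x + to_torus y)) = (\<lambda>y. \<rho> (\<tau> - t) * K (to_torus w + to_torus y))"
    by (simp add: bump_def w algebra_simps)
  ultimately show ?thesis by (simp add: Dx_def z w)
qed

lemma g_derivative_space:
  "frechet_derivative g (at (\<tau>, w)) (0, u) = \<rho> \<tau> * inner (DK (to_torus w)) u"
proof -
  have d: "(g has_derivative frechet_derivative g (at (\<tau>, w))) (at (\<tau>, w))" by (rule Ck_on_SucD[OF smooth_g[of "Suc 0"] UNIV_I])
  have "((\<lambda>y. g (\<tau>, w + y)) has_derivative (\<lambda>u. frechet_derivative g (at (\<tau>, w)) (0, u))) (at 0)"
    by (rule has_derivative_compose[where f="\<lambda>y. (\<tau>, w + y)" and f'="\<lambda>u. (0, u)"])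
      (use d in \<open>auto intro!: derivative_eq_intros\<close>)
  moreover have "((\<lambda>y. g (\<tau>, w + y)) has_derivative (\<lambda>u. \<rho> \<tau> * inner (DK (to_torus w)) u)) (at 0)"
    unfolding g_def by (simp add: to_torus_add) (intro has_derivative_mult_right DK_has_derivative)
  ultimately show ?thesis using has_derivative_unique by (metis (mono_tags, lifting))
qed

text \<open>For fixed \<open>z\<close> the chain rule along \<open>t \<mapsto> z - (t, c t)\<close> relates the derivative in the
parameter \<open>t\<close>, which integrates to the values at the ends, to the time derivative of the kernel
and to its space derivative in direction \<open>v t\<close>.\<close>

lemma dt_Bump:
  "set_integrable lborel {a..b} (\<lambda>t. inner (Dx (bump t) z) (v t))"
  "dt Bump z = bump a z - bump b z - integral {a..b} (\<lambda>t. inner (Dx (bump t) z) (v t))"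
proof -
  obtain \<tau> x where z: "z = (\<tau>, x)" by (cases z)
  obtain y where y: "to_torus y = x" using to_torus_surj by blast
  let ?C = "\<lambda>t. (\<tau>, y) - (t, c t)" and ?V = "\<lambda>t. (- 1, - v t) :: real \<times> (real ^ 'd)"
  let ?D = "\<lambda>t. frechet_derivative g (at (?C t))"
  note sm = smooth_g[of "Suc 0"]
  have lin: "linear (?D t)" for t using Ck_on_SucD[OF sm UNIV_I] has_derivative_linear by blast
  have blin: "bounded_linear (\<lambda>u. (0 :: real, - u :: real ^ 'd))"
    by (intro bounded_linear_Pair bounded_linear_zero bounded_linear_minus bounded_linear_ident)
  from integrable_bounded_linear[OF blin v[unfolded set_integrable_def]]
  have "set_integrable lborel {a..b} (\<lambda>t. (0 :: real, - v t))" unfolding set_integrable_def by simp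
  moreover have "set_integrable lborel {a..b} (\<lambda>t. (- 1 :: real, 0 :: real ^ 'd))" by (rule borel_integrable_atLeastAtMost') simp
  ultimately have "set_integrable lborel {a..b} (\<lambda>t. (- 1 :: real, 0) + (0, - v t))"
    unfolding set_integrable_def scaleR_add_right by (intro Bochner_Integration.integrable_add)
  then have Vs: "set_integrable lborel {a..b} ?V" by simp
  have vi: "v integrable_on {a..t}" if "t \<in> {a..b}" for t
    by (rule integrable_on_subinterval[OF set_borel_integral_eq_integral(1)[OF v]]) (use that in auto)
  have CV: "?C t = ?C a + integral {a..t} ?V" if t: "t \<in> {a..b}" for t
  proof -
    have "((\<lambda>t. (- 1 :: real, 0 :: real ^ 'd)) has_integral (t - a) *\<^sub>R (- 1, 0)) {a..t}"
      using has_integral_const_real[of "(- 1 :: real, 0 :: real ^ 'd)" a t] t by simp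
    moreover have "((\<lambda>t. (0 :: real, - v t)) has_integral (0, - integral {a..t} v)) {a..t}"
      using has_integral_linear[OF integrable_integral[OF vi[OF t]] blin] by (simp add: o_def)
    ultimately have "((\<lambda>t. (- 1 :: real, 0) + (0, - v t)) has_integral (t - a) *\<^sub>R (- 1, 0) + (0, - integral {a..t} v)) {a..t}"
      by (rule has_integral_add)
    then have "(?V has_integral (- (t - a), - integral {a..t} v)) {a..t}" by simp
    then have "integral {a..t} ?V = (- (t - a), - integral {a..t} v)" by (rule integral_unique)
    then show ?thesis using arg_cong[OF c[OF t], of uminus] by (simp add: algebra_simps)
  qed
  note chain = ac_chain_rule[OF sm ab Vs CV]
  have split: "?D t (?V t) = - ?D t (1, 0) - inner (Dx (bump t) z) (v t)" for t
  proof -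
    have "?V t = - (1, 0) - (0, v t)" by simp
    then have "?D t (?V t) = - ?D t (1, 0) - ?D t (0, v t)" using lin[of t] by (simp only: linear_diff linear_neg)
    moreover have "?D t (0, v t) = inner (Dx (bump t) z) (v t)"
      using g_derivative_space[of "\<tau> - t" "y - c t" "v t"] by (simp add: Dx_bump z to_torus_diff y)
    ultimately show ?thesis by simp
  qed
  have c1: "continuous_on {a..b} (\<lambda>t. ?D t (1, 0))"
  proof (rule continuous_on_compose2[of UNIV "\<lambda>x. frechet_derivative g (at x) (1, 0)"])
    show "continuous_on UNIV (\<lambda>x. frechet_derivative g (at x) (1, 0))" using sm by simp
    show "continuous_on {a..b} ?C" by (intro continuous_intros cont_tc)
  qed simp
  have s1: "set_integrable lborel {a..b} (\<lambda>t. - ?D t (1, 0))" by (intro borel_integrable_atLeastAtMost' continuous_intros c1)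
  have "set_integrable lborel {a..b} (\<lambda>t. - ?D t (1, 0) - ?D t (?V t))" using set_integral_diff(1)[OF s1 chain(1)] .
  then show *: "set_integrable lborel {a..b} (\<lambda>t. inner (Dx (bump t) z) (v t))" unfolding split by simp
  have "(st_lift Bump has_derivative (\<lambda>u. integral {a..b} (\<lambda>t. ?D t u))) (at (\<tau>, y))"
    unfolding lift_Bump[abs_def] by (rule has_derivative_integral_translates[OF sm cont_tc])
  then have der: "((\<lambda>q. st_lift Bump (q, y)) has_derivative (\<lambda>q. integral {a..b} (\<lambda>t. ?D t (q, 0)))) (at \<tau>)"
    by (rule has_derivative_compose[where f="\<lambda>q. (q, y)" and f'="\<lambda>q. (q, 0)", rotated])
      (auto intro!: derivative_eq_intros)
  define I where "I = integral {a..b} (\<lambda>t. ?D t (1, 0))"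
  have "(\<lambda>q. integral {a..b} (\<lambda>t. ?D t (q, 0))) = (*) I"
  proof
    fix q
    have "?D t (q, 0) = q * ?D t (1, 0)" for t using linear_scale[OF lin[of t], of q "(1, 0)"] by simp
    then show "integral {a..b} (\<lambda>t. ?D t (q, 0)) = I * q" by (simp add: I_def)
  qed
  with der have "((\<lambda>q. st_lift Bump (q, y)) has_field_derivative I) (at \<tau>)" by (simp only: has_field_derivative_def)
  moreover have "(\<lambda>q. st_lift Bump (q, y)) = (\<lambda>q. Bump (q, x))" by (simp add: st_lift_def y)
  ultimately have "((\<lambda>q. Bump (q, x)) has_field_derivative integral {a..b} (\<lambda>t. ?D t (1, 0))) (at \<tau>)" by (simp only: I_def)
  then have "dt Bump z = integral {a..b} (\<lambda>t. ?D t (1, 0))" by (simp add: dt_def z DERIV_imp_deriv)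
  moreover have "integral {a..b} (\<lambda>t. ?D t (?V t))
      = - integral {a..b} (\<lambda>t. ?D t (1, 0)) - integral {a..b} (\<lambda>t. inner (Dx (bump t) z) (v t))"
    unfolding split using integrable_continuous_real[OF c1] set_borel_integral_eq_integral(1)[OF *]
    by (subst Henstock_Kurzweil_Integration.integral_diff) (auto intro: integrable_neg)
  moreover have "g (?C b) = bump b z" "g (?C a) = bump a z" using lift_bump[of _ "(\<tau>, y)"] by (simp_all add: st_lift_def y z)
  ultimately show "dt Bump z = bump a z - bump b z - integral {a..b} (\<lambda>t. inner (Dx (bump t) z) (v t))" using chain(2) by simp
qed

end

section \<open>Integration against a moving bump\<close>

lemma (in pair_sigma_finite) integrable_mult_pair:
  fixes f :: "'a \<Rightarrow> real" and g :: "'b \<Rightarrow> real"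
  assumes f: "integrable M1 f" and g: "integrable M2 g"
  shows "integrable (M1 \<Otimes>\<^sub>M M2) (\<lambda>z. f (fst z) * g (snd z))"
    and "(\<integral>z. f (fst z) * g (snd z) \<partial>(M1 \<Otimes>\<^sub>M M2)) = (\<integral>x. f x \<partial>M1) * (\<integral>y. g y \<partial>M2)"
proof -
  have [measurable]: "f \<in> borel_measurable M1" "g \<in> borel_measurable M2" using f g by auto
  show *: "integrable (M1 \<Otimes>\<^sub>M M2) (\<lambda>z. f (fst z) * g (snd z))"
  proof (rule Fubini_integrable)
    show "(\<lambda>z. f (fst z) * g (snd z)) \<in> borel_measurable (M1 \<Otimes>\<^sub>M M2)" by measurable
    show "integrable M1 (\<lambda>x. \<integral>y. norm (f (fst (x, y)) * g (snd (x, y))) \<partial>M2)" using f by (simp add: abs_mult)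
    show "AE x in M1. integrable M2 (\<lambda>y. f (fst (x, y)) * g (snd (x, y)))" using g by simp
  qed
  have "(\<integral>z. f (fst z) * g (snd z) \<partial>(M1 \<Otimes>\<^sub>M M2)) = (\<integral>x. \<integral>y. f x * g y \<partial>M2 \<partial>M1)"
    using integral_fst'[OF *] by simp
  then show "(\<integral>z. f (fst z) * g (snd z) \<partial>(M1 \<Otimes>\<^sub>M M2)) = (\<integral>x. f x \<partial>M1) * (\<integral>y. g y \<partial>M2)" by simp
qed

abbreviation time_vol :: "real \<Rightarrow> real measure" where
  "time_vol T \<equiv> restrict_space lborel {0<..<T}"

lemma finite_restrict_lborel:
  fixes S :: "real set"
  assumes S: "S \<in> sets borel" "bounded S"
  shows "finite_measure (restrict_space lborel S)"
proof -
  obtain r where "\<forall>x\<in>S. norm x \<le> r" using S(2) unfolding bounded_iff by blast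
  then have "S \<subseteq> {- \<bar>r\<bar>..\<bar>r\<bar>}" by (auto simp: abs_le_iff)
  then have "emeasure lborel S \<le> emeasure lborel {- \<bar>r\<bar>..\<bar>r\<bar>}" by (intro emeasure_mono) auto
  also have "\<dots> < \<infinity>" by simp
  finally have fin: "emeasure lborel S \<noteq> \<infinity>" by simp
  have "emeasure (restrict_space lborel S) (space (restrict_space lborel S)) = emeasure lborel S"
    using S(1) by (subst emeasure_restrict_space) (auto simp: space_restrict_space)
  with fin show ?thesis by (intro finite_measureI) simp
qed

lemma finite_time_vol: "finite_measure (time_vol T)"
  by (rule finite_restrict_lborel) auto

lemma finite_st_vol: "finite_measure (st_vol T)"
  unfolding st_vol_def by (intro finite_measure_pair_measure finite_time_vol torus_vol.finite_measure_axioms)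

lemma pair_st_vol: "pair_sigma_finite (time_vol T) torus_vol"
  unfolding pair_sigma_finite_def using finite_time_vol torus_vol.sigma_finite_measure_axioms finite_measure.axioms(1) by blast

lemma space_st_vol: "space (st_vol T) = {0<..<T} \<times> UNIV"
  by (simp add: st_vol_def space_pair_measure space_restrict_space)

lemma fst_st_vol[measurable]: "fst \<in> st_vol T \<rightarrow>\<^sub>M borel"
  unfolding st_vol_def by (rule measurable_compose[OF measurable_fst]) (auto intro: measurable_restrict_space1)

lemma snd_st_vol[measurable]: "snd \<in> st_vol T \<rightarrow>\<^sub>M borel"
  unfolding st_vol_def by simp

lemma ident_st_vol: "(\<lambda>z. z) \<in> (st_vol T :: (real \<times> 'd::finite torus) measure) \<rightarrow>\<^sub>M borel"
proof -
  have "(\<lambda>z. (fst z, snd z)) \<in> (st_vol T :: (real \<times> 'd torus) measure) \<rightarrow>\<^sub>M borel \<Otimes>\<^sub>M borel"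
    by measurable
  then show ?thesis by (simp add: borel_prod)
qed

lemma st_vol_borel_measurable: "f \<in> borel_measurable borel \<Longrightarrow> f \<in> borel_measurable (st_vol T)"
  using measurable_compose[OF ident_st_vol] by blast

lemma st_vol_continuous_measurable:
  fixes u :: "real \<times> 'd::finite torus \<Rightarrow> real"
  assumes "continuous_on ({0..T} \<times> UNIV) u"
  shows "u \<in> borel_measurable (st_vol T)"
proof -
  have "u \<in> borel_measurable (restrict_space borel ({0..T} \<times> UNIV))" using assms by (rule borel_measurable_continuous_on_restrict)
  moreover have "(\<lambda>z. z) \<in> st_vol T \<rightarrow>\<^sub>M restrict_space borel ({0..T} \<times> (UNIV :: 'd torus set))"
    by (rule measurable_restrict_space2[OF _ ident_st_vol]) (auto simp: space_st_vol)
  ultimately show ?thesis using measurable_compose by blast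
qed

lemma bounded_on_st:
  fixes u :: "real \<times> 'd::finite torus \<Rightarrow> real"
  assumes "continuous_on ({0..T} \<times> UNIV) u"
  obtains B where "0 \<le> B" "\<And>z. z \<in> {0..T} \<times> UNIV \<Longrightarrow> \<bar>u z\<bar> \<le> B"
proof -
  have "compact ({0..T} \<times> (UNIV :: 'd torus set))" by (intro compact_Times compact_torus) simp
  then have "bounded (u ` ({0..T} \<times> UNIV))" using assms by (intro compact_imp_bounded compact_continuous_image)
  then obtain B where B: "\<forall>z\<in>{0..T} \<times> UNIV. norm (u z) \<le> B" unfolding bounded_iff by blast
  show ?thesis
  proof (rule that[of "\<bar>B\<bar>"])
    show "\<bar>u z\<bar> \<le> \<bar>B\<bar>" if "z \<in> {0..T} \<times> UNIV" for z using bspec[OF B that] by simp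
  qed simp
qed

lemma bounded_torus:
  fixes u :: "'d::finite torus \<Rightarrow> 'b::real_normed_vector"
  assumes "continuous_on UNIV u"
  obtains B where "0 \<le> B" "\<And>z. norm (u z) \<le> B"
proof -
  have "bounded (range u)" using assms compact_torus by (intro compact_imp_bounded compact_continuous_image)
  then obtain B where B: "\<forall>z\<in>UNIV. norm (u z) \<le> B" unfolding bounded_iff by blast
  show ?thesis
  proof (rule that[of "\<bar>B\<bar>"])
    show "norm (u z) \<le> \<bar>B\<bar>" for z using bspec[OF B UNIV_I, of z] by simp
  qed simp
qed

lemma uniformly_continuous_torus:
  fixes u :: "'d::finite torus \<Rightarrow> real"
  assumes "continuous_on UNIV u" "0 < e"
  obtains d where "0 < d" "\<And>x y. dist x y < d \<Longrightarrow> \<bar>u x - u y\<bar> < e"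
  using compact_uniformly_continuous[OF assms(1) compact_torus] assms(2) unfolding uniformly_continuous_on_def dist_real_def by (metis UNIV_I)

lemma integrable_st_vol_bounded:
  fixes u w :: "real \<times> 'd::finite torus \<Rightarrow> real"
  assumes u: "integrable (st_vol T) u" and w: "w \<in> borel_measurable (st_vol T)"
    and B: "\<And>z. z \<in> {0<..<T} \<times> UNIV \<Longrightarrow> \<bar>w z\<bar> \<le> B"
  shows "integrable (st_vol T) (\<lambda>z. u z * w z)"
proof (rule Bochner_Integration.integrable_bound)
  show "integrable (st_vol T) (\<lambda>z. B * u z)" using u by simp
  show "(\<lambda>z. u z * w z) \<in> borel_measurable (st_vol T)" using u w by measurable
  show "AE z in st_vol T. norm (u z * w z) \<le> norm (B * u z)"
  proof (rule AE_I2)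
    fix z :: "real \<times> 'd torus" assume "z \<in> space (st_vol T)"
    then have "\<bar>w z\<bar> \<le> B" using B by (simp add: space_st_vol)
    then have "\<bar>u z\<bar> * \<bar>w z\<bar> \<le> \<bar>u z\<bar> * \<bar>B\<bar>" by (intro mult_left_mono) auto
    then show "norm (u z * w z) \<le> norm (B * u z)" by (simp add: abs_mult mult.commute)
  qed
qed

lemma integrable_st_vol_const: "integrable (st_vol T) (\<lambda>z. c :: real)"
  using finite_measure.integrable_const[OF finite_st_vol] .

context moving_bump
begin

abbreviation "\<gamma> t \<equiv> to_torus (c t)"

abbreviation Iab :: "real measure" where "Iab \<equiv> restrict_space lborel {a..b}"

lemma finite_Iab: "finite_measure Iab"
  by (rule finite_restrict_lborel) auto

lemma c_measurable[measurable]: "c \<in> borel_measurable Iab"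
  using borel_measurable_continuous_on_restrict[OF cont_c] by (simp cong: measurable_cong_sets add: sets_restrict_space_cong[OF sets_lborel])

lemma integral_Iab:
  fixes f :: "real \<Rightarrow> real"
  assumes "set_integrable lborel {a..b} f"
  shows "integrable Iab f" "(\<integral>t. f t \<partial>Iab) = integral {a..b} f" using assms set_borel_integral_eq_integral(2)[OF assms]
  by (simp_all add: set_integrable_def set_lebesgue_integral_def integrable_restrict_space integral_restrict_space)

lemma norm_v_integrable: "integrable Iab (\<lambda>t. norm (v t))"
  using integral_Iab(1)[OF set_integrable_norm[OF v]] .

lemma v_measurable[measurable]: "v \<in> borel_measurable Iab"
  using v borel_measurable_integrable[of Iab v] by (simp add: set_integrable_def integrable_restrict_space)

lemma bump_measurable[measurable]: "(\<lambda>q. bump (fst q) (snd q)) \<in> borel_measurable (Iab \<Otimes>\<^sub>M st_vol T)"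
proof -
  have [measurable]: "\<rho> \<in> borel_measurable borel" "K \<in> borel_measurable borel"
    using cont_rho torus_kernel_measurable[OF K] by (auto intro: borel_measurable_continuous_onI)
  have [measurable]: "(\<lambda>q. fst q) \<in> borel_measurable (Iab \<Otimes>\<^sub>M st_vol T)"
    by (rule measurable_compose[OF measurable_fst]) (auto intro: measurable_restrict_space1)
  show ?thesis unfolding bump_def by measurable
qed

lemma bump_measurable_st[measurable]: "bump t \<in> borel_measurable (st_vol T)"
  by (intro st_vol_borel_measurable borel_measurable_continuous_onI cont_bump)

lemma Bump_measurable_st[measurable]: "Bump \<in> borel_measurable (st_vol T)"
proof -
  have "continuous_on UNIV Bump"
  proof -
    have "continuous_on UNIV (st_lift Bump)" using smooth_Bump unfolding st_smooth_def by (metis Ck_on.simps(1))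
    have "open (Bump -` U)" if "open U" for U
    proof -
      have "Bump -` U = (\<lambda>p. (fst p, to_torus (snd p))) ` (st_lift Bump -` U)"
      proof (intro equalityI subsetI)
        fix z assume "z \<in> Bump -` U"
        obtain y where "to_torus y = snd z" using to_torus_surj by blast
        then show "z \<in> (\<lambda>p. (fst p, to_torus (snd p))) ` (st_lift Bump -` U)"
          using \<open>z \<in> Bump -` U\<close> by (intro image_eqI[of _ _ "(fst z, y)"]) (auto simp: st_lift_def)
      qed (auto simp: st_lift_def)
      moreover have "open (st_lift Bump -` U)" using \<open>continuous_on UNIV (st_lift Bump)\<close> that open_vimage by blast
      moreover have "open ((\<lambda>p. (fst p, to_torus (snd p))) ` S)" if "open S" for S :: "(real \<times> (real ^ 'd)) set"
      proof (subst open_subopen, rule ballI)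
        fix z assume "z \<in> (\<lambda>p. (fst p, to_torus (snd p))) ` S"
        then obtain t y where ty: "(t, y) \<in> S" "z = (t, to_torus y)" by auto
        from \<open>open S\<close> ty(1) obtain A B where "open A" "open B" "(t, y) \<in> A \<times> B" "A \<times> B \<subseteq> S"
          unfolding open_prod_def by meson
        have "A \<times> to_torus ` B \<subseteq> (\<lambda>p. (fst p, to_torus (snd p))) ` S"
        proof
          fix p assume "p \<in> A \<times> to_torus ` B"
          then obtain q x where "p = (q, to_torus x)" "q \<in> A" "x \<in> B" by auto
          then show "p \<in> (\<lambda>p. (fst p, to_torus (snd p))) ` S"
            using \<open>A \<times> B \<subseteq> S\<close> by (intro image_eqI[of _ _ "(q, x)"]) auto
        qed
        moreover have "open (A \<times> (to_torus ` B :: 'd torus set))"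
          by (intro open_Times open_to_torus_image \<open>open A\<close> \<open>open B\<close>)
        moreover have "z \<in> A \<times> to_torus ` B" using ty(2) \<open>(t, y) \<in> A \<times> B\<close> by auto
        ultimately show "\<exists>V. open V \<and> z \<in> V \<and> V \<subseteq> (\<lambda>p. (fst p, to_torus (snd p))) ` S" by blast
      qed
      ultimately show ?thesis by simp
    qed
    then show ?thesis by (simp add: continuous_on_open_vimage)
  qed
  then show ?thesis by (intro st_vol_borel_measurable borel_measurable_continuous_onI)
qed

lemma bump_bounded: obtains B where "0 \<le> B" "\<And>t z. bump t z \<le> B"
proof -
  obtain B1 where B1: "0 \<le> B1" "\<And>z. norm (K z) \<le> B1" using bounded_torus[OF torus_kernel_continuous[OF K]] by metis
  have "bounded (\<rho> ` {-h..h})" by (intro compact_imp_bounded compact_continuous_image continuous_on_subset[OF cont_rho]) auto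
  then obtain B2 where B2: "\<forall>s\<in>{-h..h}. \<bar>\<rho> s\<bar> \<le> B2" unfolding bounded_iff by auto
  have B2': "\<rho> s \<le> \<bar>B2\<bar>" for s
  proof (cases "\<rho> s = 0")
    case False
    then have "s \<in> {-h..h}" using \<rho> unfolding time_kernel_def by fastforce
    then show ?thesis using B2 by force
  qed simp
  have "0 \<le> \<rho> s" "0 \<le> K z" for s z using \<rho> K by (auto simp: time_kernel_def torus_kernel_def)
  then have "bump t z \<le> \<bar>B2\<bar> * B1" for t z unfolding bump_def using B2' B1 by (intro mult_mono) auto
  then show ?thesis using that[of "\<bar>B2\<bar> * B1"] B1 by simp
qed

lemma Dx_bump_bounded: obtains B where "0 \<le> B" "\<And>t z. norm (Dx (bump t) z) \<le> B"
proof -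
  obtain B1 where B1: "0 \<le> B1" "\<And>z. norm (DK z) \<le> B1" using bounded_torus[OF cont_DK] by metis
  have "bounded (\<rho> ` {-h..h})" by (intro compact_imp_bounded compact_continuous_image continuous_on_subset[OF cont_rho]) auto
  then obtain B2 where B2: "\<forall>s\<in>{-h..h}. \<bar>\<rho> s\<bar> \<le> B2" unfolding bounded_iff by auto
  have B2': "\<bar>\<rho> s\<bar> \<le> \<bar>B2\<bar>" for s
  proof (cases "\<rho> s = 0")
    case False
    then have "s \<in> {-h..h}" using \<rho> unfolding time_kernel_def by fastforce
    then show ?thesis using B2 by force
  qed simp
  have "norm (Dx (bump t) z) \<le> \<bar>B2\<bar> * B1" for t z unfolding Dx_bump using B2' B1 by (simp) (intro mult_mono, auto)
  then show ?thesis using that[of "\<bar>B2\<bar> * B1"] B1 by simp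
qed

lemma integral_rho_le: "integral {a..b} (\<lambda>t. \<rho> (\<tau> - t)) \<le> 1"
  and integral_rho_eq: "a + h \<le> \<tau> \<Longrightarrow> \<tau> + h \<le> b \<Longrightarrow> integral {a..b} (\<lambda>t. \<rho> (\<tau> - t)) = 1"
  and integral_rho: "(\<integral>\<^sup>+t. ennreal (\<rho> (\<tau> - t)) \<partial>lborel) = 1"
proof -
  have [measurable]: "\<rho> \<in> borel_measurable borel" using cont_rho by (auto intro: borel_measurable_continuous_onI)
  have n: "0 \<le> \<rho> s" for s using \<rho> by (simp add: time_kernel_def)
  show one: "(\<integral>\<^sup>+t. ennreal (\<rho> (\<tau> - t)) \<partial>lborel) = 1"
    using nn_integral_real_affine[of "\<lambda>s. ennreal (\<rho> s)" "-1" \<tau>] \<rho> by (simp add: time_kernel_def)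
  have "set_integrable lborel {a..b} (\<lambda>t. \<rho> (\<tau> - t))"
    by (intro borel_integrable_atLeastAtMost' continuous_on_compose2[OF cont_rho] continuous_intros) auto
  from set_borel_integral_eq_integral(2)[OF this]
  have eq: "integral {a..b} (\<lambda>t. \<rho> (\<tau> - t)) = enn2real (\<integral>\<^sup>+t. ennreal (indicator {a..b} t * \<rho> (\<tau> - t)) \<partial>lborel)"
    unfolding set_lebesgue_integral_def by (subst (asm) integral_eq_nn_integral) (auto simp: n)
  have "(\<integral>\<^sup>+t. ennreal (indicator {a..b} t * \<rho> (\<tau> - t)) \<partial>lborel) \<le> 1"
    unfolding one[symmetric] using n by (intro nn_integral_mono) (auto simp: indicator_def)
  then show "integral {a..b} (\<lambda>t. \<rho> (\<tau> - t)) \<le> 1" unfolding eq by (metis enn2real_1 enn2real_mono ennreal_one_less_top)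
  assume \<tau>: "a + h \<le> \<tau>" "\<tau> + h \<le> b"
  have "(\<integral>\<^sup>+t. ennreal (indicator {a..b} t * \<rho> (\<tau> - t)) \<partial>lborel) = (\<integral>\<^sup>+t. ennreal (\<rho> (\<tau> - t)) \<partial>lborel)"
  proof (rule nn_integral_cong)
    fix t
    have "t \<in> {a..b}" if "\<rho> (\<tau> - t) \<noteq> 0"
    proof -
      have "\<bar>\<tau> - t\<bar> < h" using \<rho> that by (simp add: time_kernel_def)
      then show ?thesis using \<tau> by auto
    qed
    then show "ennreal (indicator {a..b} t * \<rho> (\<tau> - t)) = ennreal (\<rho> (\<tau> - t))" by (cases "\<rho> (\<tau> - t) = 0") auto
  qed
  then show "integral {a..b} (\<lambda>t. \<rho> (\<tau> - t)) = 1" unfolding eq one by simp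
qed

lemma Bump_le:
  assumes "0 \<le> k0" "\<And>t. t \<in> {a..b} \<Longrightarrow> \<bar>fst z - t\<bar> < h \<Longrightarrow> K (snd z - \<gamma> t) \<le> k0"
  shows "Bump z \<le> k0"
proof -
  have n: "0 \<le> \<rho> s" for s using \<rho> by (simp add: time_kernel_def)
  have "Bump z \<le> integral {a..b} (\<lambda>t. \<rho> (fst z - t) * k0)" unfolding Bump_def
  proof (rule integral_le)
    show "(\<lambda>t. \<rho> (fst z - t) * k0) integrable_on {a..b}"
      by (intro integrable_continuous_real continuous_intros continuous_on_compose2[OF cont_rho]) auto
    fix t assume t: "t \<in> {a..b}"
    show "bump t z \<le> \<rho> (fst z - t) * k0"
    proof (cases "\<bar>fst z - t\<bar> < h")
      case True
      then show ?thesis unfolding bump_def using assms(2)[OF t] n by (intro mult_left_mono) auto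
    next
      case False
      then show ?thesis using bump_eq_0[of z t] n assms(1) by simp
    qed
  qed (intro integrable_continuous_real cont_bump_t)
  also have "\<dots> = integral {a..b} (\<lambda>t. \<rho> (fst z - t)) * k0" by simp
  also have "\<dots> \<le> 1 * k0" by (intro mult_right_mono integral_rho_le assms(1))
  finally show ?thesis by simp
qed

lemma bump_mass:
  assumes "0 \<le> t - h" "t + h \<le> T"
  shows "integrable (st_vol T) (bump t)" "(\<integral>z. bump t z \<partial>st_vol T) = 1"
proof -
  interpret pair_sigma_finite "time_vol T" "torus_vol :: 'd torus measure" by (rule pair_st_vol)
  have [measurable]: "\<rho> \<in> borel_measurable borel" "K \<in> borel_measurable borel"
    using cont_rho torus_kernel_measurable[OF K] by (auto intro: borel_measurable_continuous_onI)
  have n: "0 \<le> \<rho> s" for s using \<rho> by (simp add: time_kernel_def)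
  have [measurable]: "(\<lambda>\<tau>. \<rho> (\<tau> - t)) \<in> borel_measurable (time_vol T)" by (rule measurable_restrict_space1) simp
  have "(\<integral>\<^sup>+\<tau>. ennreal (\<rho> (\<tau> - t)) \<partial>time_vol T) = (\<integral>\<^sup>+\<tau>. ennreal (\<rho> (- t + \<tau>)) \<partial>lborel)"
    unfolding nn_integral_restrict_space[of "{0<..<T}" lborel, simplified]
  proof (rule nn_integral_cong)
    fix \<tau>
    have "\<tau> \<in> {0<..<T}" if "\<rho> (\<tau> - t) \<noteq> 0"
    proof -
      have "\<bar>\<tau> - t\<bar> < h" using \<rho> that by (simp add: time_kernel_def)
      then show ?thesis using assms by auto
    qed
    then show "ennreal (\<rho> (\<tau> - t)) * indicator {0<..<T} \<tau> = ennreal (\<rho> (- t + \<tau>))"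
      by (cases "\<rho> (\<tau> - t) = 0") (auto simp: algebra_simps)
  qed
  also have "\<dots> = 1" using nn_integral_real_affine[of "\<lambda>s. ennreal (\<rho> s)" 1 "- t"] \<rho> by (simp add: time_kernel_def)
  finally have one: "(\<integral>\<^sup>+\<tau>. ennreal (\<rho> (\<tau> - t)) \<partial>time_vol T) = 1" .
  then have i1: "integrable (time_vol T) (\<lambda>\<tau>. \<rho> (\<tau> - t))" by (intro integrableI_nonneg) (auto simp: n)
  have m1: "(\<integral>\<tau>. \<rho> (\<tau> - t) \<partial>time_vol T) = 1" using one by (subst integral_eq_nn_integral) (auto simp: n)
  have tr: "distr torus_vol borel (\<lambda>x. x - \<gamma> t) = (torus_vol :: 'd torus measure)"
    using distr_torus_translate[of "- \<gamma> t"] by simp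
  obtain BK where "\<And>z. norm (K z) \<le> BK" using bounded_torus[OF torus_kernel_continuous[OF K]] by metis
  then have "integrable torus_vol K" by (intro torus_vol.integrable_const_bound[where B=BK]) auto
  then have "integrable (distr torus_vol borel (\<lambda>x. x - \<gamma> t)) K" by (simp only: tr)
  then have i2: "integrable torus_vol (\<lambda>x. K (x - \<gamma> t))" by (subst (asm) integrable_distr_eq) auto
  have "(\<integral>x. K (x - \<gamma> t) \<partial>torus_vol) = (\<integral>x. K x \<partial>distr torus_vol borel (\<lambda>x. x - \<gamma> t))"
    by (subst integral_distr) auto
  also have "\<dots> = 1" unfolding tr using K by (simp add: torus_kernel_def)
  finally have m2: "(\<integral>x. K (x - \<gamma> t) \<partial>torus_vol) = 1" .
  show "integrable (st_vol T) (bump t)" "(\<integral>z. bump t z \<partial>st_vol T) = 1"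
    unfolding bump_def[abs_def] st_vol_def using integrable_mult_pair[OF i1 i2] by (simp_all add: m1 m2)
qed

text \<open>\<open>bump t\<close> is a probability density concentrated near \<open>(t, \<gamma> t)\<close> as soon as its time support lies
inside \<open>[0, T]\<close>.\<close>

lemma bump_average:
  assumes t: "0 \<le> t - h" "t + h \<le> T" and \<phi>: "continuous_on ({0..T} \<times> UNIV) \<phi>"
    and e: "\<And>\<tau> x. \<tau> \<in> {0..T} \<Longrightarrow> \<bar>\<tau> - t\<bar> < h \<Longrightarrow> dist x (\<gamma> t) < s \<Longrightarrow> \<bar>\<phi> (\<tau>, x) - \<phi> (t, \<gamma> t)\<bar> \<le> e"
  shows "integrable (st_vol T) (\<lambda>z. \<phi> z * bump t z)"
    "\<bar>(\<integral>z. \<phi> z * bump t z \<partial>st_vol T) - \<phi> (t, \<gamma> t)\<bar> \<le> e"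
proof -
  note m = bump_mass[OF t]
  obtain B where B: "0 \<le> B" "\<And>z. z \<in> {0..T} \<times> UNIV \<Longrightarrow> \<bar>\<phi> z\<bar> \<le> B" using bounded_on_st[OF \<phi>] by metis
  have "integrable (st_vol T) (\<lambda>z. bump t z * \<phi> z)"
    by (rule integrable_st_vol_bounded[OF m(1) st_vol_continuous_measurable[OF \<phi>], of B]) (use B in auto)
  then show i: "integrable (st_vol T) (\<lambda>z. \<phi> z * bump t z)" by (simp add: mult.commute)
  have "(\<integral>z. \<phi> z * bump t z \<partial>st_vol T) - \<phi> (t, \<gamma> t) = (\<integral>z. \<phi> z * bump t z - \<phi> (t, \<gamma> t) * bump t z \<partial>st_vol T)"
    using i m by simp
  also have "\<bar>\<dots>\<bar> \<le> (\<integral>z. e * bump t z \<partial>st_vol T)"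
  proof (rule order_trans[OF integral_abs_bound integral_mono])
    fix z :: "real \<times> 'd torus" assume "z \<in> space (st_vol T)"
    then obtain \<tau> x where z: "z = (\<tau>, x)" "0 < \<tau>" "\<tau> < T" by (auto simp: space_st_vol)
    show "\<bar>\<phi> z * bump t z - \<phi> (t, \<gamma> t) * bump t z\<bar> \<le> e * bump t z"
    proof (cases "bump t z = 0")
      case False
      then have "\<bar>\<tau> - t\<bar> < h" using bump_eq_0[of z t] z by force
      moreover have "dist x (\<gamma> t) < s" using False K unfolding bump_def torus_kernel_def z by (subst dist_torus_diff) auto
      ultimately have "\<bar>\<phi> z - \<phi> (t, \<gamma> t)\<bar> \<le> e" using z by (auto intro: e)
      then show ?thesis using bump_nonneg[of t z] by (simp add: left_diff_distrib[symmetric] abs_mult mult_right_mono)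
    qed simp
  qed (use i m in auto)
  also have "\<dots> = e" using m by simp
  finally show "\<bar>(\<integral>z. \<phi> z * bump t z \<partial>st_vol T) - \<phi> (t, \<gamma> t)\<bar> \<le> e" .
qed

end

section \<open>Subsolutions tested along a curve\<close>

text \<open>If \<open>s * Y\<close> exceeds \<open>\<alpha>\<close>, multiplication by \<open>(s * Y / \<alpha>) ^ n\<close> only increases it.\<close>

lemma young_power:
  fixes \<alpha> s Y :: real
  assumes "0 < \<alpha>" "0 \<le> s" "0 \<le> Y"
  shows "s * Y \<le> \<alpha> + s ^ Suc n / \<alpha> ^ n * Y ^ Suc n"
proof (cases "s * Y \<le> \<alpha>")
  case True
  moreover have "0 \<le> s ^ Suc n / \<alpha> ^ n * Y ^ Suc n" using assms by simp
  ultimately show ?thesis by linarith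
next
  case False
  then have "\<alpha> ^ n \<le> (s * Y) ^ n" using assms by (intro power_mono) auto
  then have "s * Y * \<alpha> ^ n \<le> s * Y * (s * Y) ^ n" using assms by (intro mult_left_mono) auto
  then have "s * Y \<le> (s * Y) ^ Suc n / \<alpha> ^ n" using assms(1) by (simp add: field_simps)
  also have "\<dots> = s ^ Suc n / \<alpha> ^ n * Y ^ Suc n" by (simp add: power_mult_distrib)
  finally show ?thesis using assms(1) by simp
qed

text \<open>The Hamilton-Jacobi inequality with a given right-hand side \<open>F\<close>, without reference to the density
that produces \<open>F\<close>.\<close>

locale subsolution =
  fixes T r Cx :: real and H :: "'d::finite torus \<Rightarrow> real ^ 'd \<Rightarrow> real"
    and \<phi> F :: "real \<times> 'd torus \<Rightarrow> real" and G :: "real \<times> 'd torus \<Rightarrow> real ^ 'd"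
  assumes T: "0 < T" and \<phi>: "continuous_on ({0..T} \<times> UNIV) \<phi>"
    and weak_gradient: "\<And>\<psi> i. \<psi> \<in> test_funs T \<Longrightarrow>
        (\<integral>z. \<phi> z * Dx \<psi> z $ i \<partial>st_vol T) = - (\<integral>z. G z $ i * \<psi> z \<partial>st_vol T)"
    and Gi: "integrable (st_vol T) G"
    and Gr: "integrable (st_vol T) (\<lambda>z. max (norm (G z)) 1 powr r)"
    and Hi: "integrable (st_vol T) (\<lambda>z. H (snd z) (G z))"
    and Fi: "integrable (st_vol T) F" and F0: "\<And>z. 0 \<le> F z"
    and sub: "\<And>\<psi>. \<psi> \<in> test_funs T \<Longrightarrow> (\<And>z. 0 \<le> \<psi> z) \<Longrightarrow>
        (\<integral>z. \<phi> z * dt \<psi> z \<partial>st_vol T) + (\<integral>z. H (snd z) (G z) * \<psi> z \<partial>st_vol T)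
          \<le> (\<integral>z. F z * \<psi> z \<partial>st_vol T)"
    and fenchel: "\<And>x p v. - inner p v - H x p \<le> lagrangian H x v"
    and Cx: "0 \<le> Cx"
    and x_dep: "\<And>x y p. \<bar>H x p - H y p\<bar> \<le> Cx * dist x y * max (norm p) 1 powr (r / (real CARD('d) + 1))"
begin

text \<open>The gradient \<open>p\<close> belongs to a point \<open>x\<close> near the point \<open>y\<close> of the curve, and the dependence of \<open>H\<close>
on its first argument costs \<open>s * norm p powr (r / (d + 1))\<close>. By \<open>young_power\<close> with exponent \<open>d + 1\<close> the
unbounded part of this cost is \<open>norm p powr r\<close>, which is integrable, with a factor \<open>s ^ (d + 1)\<close>,
which outweighs the height \<open>s powr (- d)\<close> of a kernel of width \<open>s\<close>.\<close>

lemma fenchel_nearby: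
  assumes "0 < \<alpha>" "dist x y \<le> s"
  shows "- lagrangian H y v - Cx * (\<alpha> + s ^ Suc CARD('d) / \<alpha> ^ CARD('d) * max (norm p) 1 powr r)
    \<le> H x p + inner p v"
proof -
  let ?Y = "max (norm p) 1 powr (r / (real CARD('d) + 1))"
  have s: "0 \<le> s" using assms(2) zero_le_dist[of x y] by linarith
  have "?Y ^ Suc CARD('d) = ?Y powr real (Suc CARD('d))" by (rule powr_realpow[symmetric]) simp
  also have "\<dots> = max (norm p) 1 powr r" by (simp add: powr_powr add.commute)
  finally have Y: "?Y ^ Suc CARD('d) = max (norm p) 1 powr r" .
  have "dist x y * ?Y \<le> s * ?Y" using assms(2) by (intro mult_right_mono) auto
  also have "\<dots> \<le> \<alpha> + s ^ Suc CARD('d) / \<alpha> ^ CARD('d) * ?Y ^ Suc CARD('d)" by (rule young_power) (use assms s in auto)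
  finally have "Cx * (dist x y * ?Y) \<le> Cx * (\<alpha> + s ^ Suc CARD('d) / \<alpha> ^ CARD('d) * max (norm p) 1 powr r)"
    unfolding Y using Cx by (rule mult_left_mono)
  then show ?thesis using x_dep[of x p y] fenchel[of p v y] by (simp add: mult.assoc abs_le_iff)
qed

text \<open>The inequality is tested with the accumulated bump. Integration by parts in space turns the
transport term of \<open>dt_Bump\<close> into the average of \<open>inner G v\<close>; together with \<open>H\<close> it is bounded below
by the Lagrangian through \<open>fenchel_nearby\<close>.\<close>

lemma along_curve:
  assumes mb: "moving_bump h s \<rho> K a b c v" and h: "0 < h" "h < a" "b + h < T"
    and \<kappa>: "\<And>z. K z \<le> \<kappa>" and \<alpha>: "0 < \<alpha>"
    and L: "set_integrable lborel {a..b} (\<lambda>t. lagrangian H (to_torus (c t)) (v t))"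
  shows "(\<integral>z. \<phi> z * moving_bump.bump \<rho> K c a z \<partial>st_vol T) - (\<integral>z. \<phi> z * moving_bump.bump \<rho> K c b z \<partial>st_vol T)
      - integral {a..b} (\<lambda>t. lagrangian H (to_torus (c t)) (v t))
      - Cx * (\<alpha> * T + s ^ Suc CARD('d) / \<alpha> ^ CARD('d) * (\<kappa> * (\<integral>z. max (norm (G z)) 1 powr r \<partial>st_vol T)))
    \<le> (\<integral>z. F z * moving_bump.Bump \<rho> K a b c z \<partial>st_vol T)"
proof -
  interpret moving_bump h s \<rho> K a b c v by (rule mb)
  interpret I: finite_measure Iab by (rule finite_Iab)
  interpret S: finite_measure "st_vol T :: (real \<times> 'd torus) measure" by (rule finite_st_vol)
  interpret N: pair_sigma_finite Iab "st_vol T :: (real \<times> 'd torus) measure" ..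
  let ?N = "Iab \<Otimes>\<^sub>M (st_vol T :: (real \<times> 'd torus) measure)"
  let ?L = "\<lambda>t. lagrangian H (\<gamma> t) (v t)"
  let ?Gr = "\<lambda>z. max (norm (G z)) 1 powr r"
  let ?H = "\<lambda>z. H (snd z) (G z)"
  let ?\<beta> = "s ^ Suc CARD('d) / \<alpha> ^ CARD('d)"
  have spI: "space Iab = {a..b}" by (simp add: space_restrict_space)
  obtain B where B: "0 \<le> B" "\<And>t z. bump t z \<le> B" using bump_bounded by metis
  then have aB: "\<bar>bump t z\<bar> \<le> B" for t z using bump_nonneg[of t z] by simp
  obtain BD where BD: "0 \<le> BD" "\<And>t z. norm (Dx (bump t) z) \<le> BD" using Dx_bump_bounded by metis
  obtain B\<phi> where B\<phi>: "0 \<le> B\<phi>" "\<And>z. z \<in> {0..T} \<times> UNIV \<Longrightarrow> \<bar>\<phi> z\<bar> \<le> B\<phi>" using bounded_on_st[OF \<phi>] by metis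
  have \<phi>st[measurable]: "\<phi> \<in> borel_measurable (st_vol T)" by (rule st_vol_continuous_measurable[OF \<phi>])
  have [measurable]: "G \<in> borel_measurable (st_vol T)" "?H \<in> borel_measurable (st_vol T)" "?Gr \<in> borel_measurable (st_vol T)"
    using Gi Hi Gr by auto
  note Li = integral_Iab[OF L]
  have [measurable]: "?L \<in> borel_measurable Iab" using Li(1) by auto
  have Dxm[measurable]: "(\<lambda>q. Dx (bump (fst q)) (snd q)) \<in> borel_measurable ?N"
  proof -
    have [measurable]: "\<rho> \<in> borel_measurable borel" "DK \<in> borel_measurable borel"
      using cont_rho cont_DK by (auto intro: borel_measurable_continuous_onI)
    have [measurable]: "(\<lambda>q. fst q) \<in> borel_measurable ?N"
      by (rule measurable_compose[OF measurable_fst]) (auto intro: measurable_restrict_space1)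
    show ?thesis unfolding Dx_bump by measurable
  qed
  have dominated: "integrable ?N f"
    if "f \<in> borel_measurable ?N" "integrable Iab g" "integrable (st_vol T) k"
      "\<And>t z. z \<in> {0<..<T} \<times> UNIV \<Longrightarrow> \<bar>f (t, z)\<bar> \<le> \<bar>g t * k z\<bar>" for f :: "_ \<Rightarrow> real" and g k
  proof (rule Bochner_Integration.integrable_bound[OF N.integrable_mult_pair(1)[OF that(2,3)] that(1)])
    show "AE q in ?N. norm (f q) \<le> norm (g (fst q) * k (snd q))" using that(4) by (intro AE_I2) (auto simp: space_pair_measure space_st_vol)
  qed
  have i1: "integrable ?N (\<lambda>q. \<phi> (snd q) * inner (Dx (bump (fst q)) (snd q)) (v (fst q)))"
  proof (rule dominated[OF _ norm_v_integrable integrable_st_vol_const[of T "B\<phi> * BD"]])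
    fix t and z :: "real \<times> 'd torus" assume "z \<in> {0<..<T} \<times> UNIV"
    then have "\<bar>\<phi> z\<bar> \<le> B\<phi>" by (intro B\<phi>(2)) auto
    moreover have "\<bar>inner (Dx (bump t) z) (v t)\<bar> \<le> BD * norm (v t)" using Cauchy_Schwarz_ineq2[of "Dx (bump t) z" "v t"] BD(2)[of t z]
      by (meson mult_right_mono norm_ge_zero order_trans)
    ultimately have "\<bar>\<phi> z\<bar> * \<bar>inner (Dx (bump t) z) (v t)\<bar> \<le> B\<phi> * (BD * norm (v t))"
      using B\<phi>(1) by (intro mult_mono) auto
    then show "\<bar>\<phi> (snd (t, z)) * inner (Dx (bump (fst (t, z))) (snd (t, z))) (v (fst (t, z)))\<bar> \<le> \<bar>norm (v t) * (B\<phi> * BD)\<bar>"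
      using B\<phi>(1) BD(1) by (simp add: abs_mult mult_ac)
  qed measurable
  have i2: "integrable ?N (\<lambda>q. inner (G (snd q)) (v (fst q)) * bump (fst q) (snd q))"
  proof (rule dominated[OF _ norm_v_integrable integrable_mult_right[OF integrable_norm[OF Gi], of B]])
    fix t and z :: "real \<times> 'd torus" assume "z \<in> {0<..<T} \<times> UNIV"
    have "\<bar>inner (G z) (v t)\<bar> * \<bar>bump t z\<bar> \<le> (norm (G z) * norm (v t)) * B" by (intro mult_mono Cauchy_Schwarz_ineq2 aB) auto
    then show "\<bar>inner (G (snd (t, z))) (v (fst (t, z))) * bump (fst (t, z)) (snd (t, z))\<bar> \<le> \<bar>norm (v t) * (B * norm (G z))\<bar>"
      using B(1) by (simp add: abs_mult mult_ac)
  qed measurable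
  have i3: "integrable ?N (\<lambda>q. w (snd q) * bump (fst q) (snd q))" if w: "integrable (st_vol T) w" for w
  proof (rule dominated[OF _ I.integrable_const[of 1] integrable_mult_right[OF w, of B]])
    show "(\<lambda>q. w (snd q) * bump (fst q) (snd q)) \<in> borel_measurable ?N" using w by measurable
    fix t and z :: "real \<times> 'd torus"
    have "\<bar>w z\<bar> * \<bar>bump t z\<bar> \<le> \<bar>w z\<bar> * B" by (intro mult_left_mono aB) auto
    then show "\<bar>w (snd (t, z)) * bump (fst (t, z)) (snd (t, z))\<bar> \<le> \<bar>1 * (B * w z)\<bar>" using B(1) by (simp add: abs_mult mult_ac)
  qed
  have i4: "integrable ?N (\<lambda>q. ?L (fst q) * bump (fst q) (snd q))"
  proof (rule dominated[OF _ Li(1) integrable_st_vol_const[of T B]])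
    fix t and z :: "real \<times> 'd torus"
    have "\<bar>?L t\<bar> * \<bar>bump t z\<bar> \<le> \<bar>?L t\<bar> * B" by (intro mult_left_mono aB) auto
    then show "\<bar>?L (fst (t, z)) * bump (fst (t, z)) (snd (t, z))\<bar> \<le> \<bar>?L t * B\<bar>" using B(1) by (simp add: abs_mult)
  qed measurable
  have Bump_Iab: "Bump z = (\<integral>t. bump t z \<partial>Iab)" for z
    unfolding Bump_def by (rule integral_Iab(2)[symmetric]) (intro borel_integrable_atLeastAtMost' cont_bump_t)
  have swap: "(\<integral>z. w z * Bump z \<partial>st_vol T) = (\<integral>q. w (snd q) * bump (fst q) (snd q) \<partial>?N)"
    if w: "integrable (st_vol T) w" for w using N.integral_snd[of "\<lambda>t z. w z * bump t z"] i3[OF w] by (simp add: Bump_Iab case_prod_unfold)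
  have mem: "\<psi> \<in> test_funs T" if "st_smooth \<psi>" "\<And>z. fst z < a - h \<or> b + h < fst z \<Longrightarrow> \<psi> z = 0" for \<psi> :: "real \<times> 'd torus \<Rightarrow> real"
    unfolding test_funs_def using that h by (intro CollectI conjI exI[of _ "a - h"] exI[of _ "b + h"]) auto
  have bump_mem: "bump t \<in> test_funs T" if "t \<in> {a..b}" for t
    by (rule mem[OF smooth_bump]) (use that in \<open>auto intro!: bump_eq_0\<close>)
  have Bump_mem: "Bump \<in> test_funs T" by (rule mem[OF smooth_Bump Bump_eq_0])
  have unit: "integrable (st_vol T) (bump t)" "(\<integral>z. bump t z \<partial>st_vol T) = 1" if "t \<in> {a..b}" for t
    using bump_mass[of t T] that h by auto
  have ends: "integrable (st_vol T) (\<lambda>z. \<phi> z * bump t z)" if "t \<in> {a..b}" for t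
    using integrable_st_vol_bounded[OF unit(1)[OF that] \<phi>st, of B\<phi>] B\<phi>(2) by (auto simp: mult.commute)

  \<comment> \<open>the transport term, integrated by parts in space\<close>
  have transport: "(\<integral>z. \<phi> z * dt Bump z \<partial>st_vol T)
      = (\<integral>z. \<phi> z * bump a z \<partial>st_vol T) - (\<integral>z. \<phi> z * bump b z \<partial>st_vol T)
        + (\<integral>q. inner (G (snd q)) (v (fst q)) * bump (fst q) (snd q) \<partial>?N)"
  proof -
    let ?f = "\<lambda>t z. \<phi> z * inner (Dx (bump t) z) (v t)"
    have inner_t: "(\<integral>t. ?f t z \<partial>Iab) = \<phi> z * integral {a..b} (\<lambda>t. inner (Dx (bump t) z) (v t))" for z
      using integral_Iab(2)[OF dt_Bump(1)[of z]] by simp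
    have eq: "\<phi> z * dt Bump z = \<phi> z * bump a z - \<phi> z * bump b z - (\<integral>t. ?f t z \<partial>Iab)" for z
      unfolding inner_t dt_Bump(2) by (simp add: algebra_simps)
    have i_t: "integrable (st_vol T) (\<lambda>z. \<integral>t. ?f t z \<partial>Iab)"
      using N.integrable_snd[of ?f] i1 by (simp add: case_prod_unfold)
    have "(\<integral>z. \<integral>t. ?f t z \<partial>Iab \<partial>st_vol T) = (\<integral>t. \<integral>z. ?f t z \<partial>st_vol T \<partial>Iab)"
      by (rule N.Fubini_integral) (use i1 in \<open>simp add: case_prod_unfold\<close>)
    also have "\<dots> = (\<integral>t. - (\<integral>z. inner (G z) (v t) * bump t z \<partial>st_vol T) \<partial>Iab)"
    proof (rule Bochner_Integration.integral_cong[OF refl])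
      fix t assume "t \<in> space Iab"
      then have t: "t \<in> {a..b}" by (simp add: spI)
      have id: "integrable (st_vol T) (\<lambda>z. \<phi> z * Dx (bump t) z $ i)" for i
      proof (rule integrable_st_vol_bounded[OF _ _])
        show "integrable (st_vol T) \<phi>"
          using integrable_st_vol_bounded[OF integrable_st_vol_const[of T 1] \<phi>st, of B\<phi>] B\<phi>(2) by auto
        have "t \<in> space Iab" using t spI by simp
        from measurable_Pair2[OF Dxm this] have "(\<lambda>z. Dx (bump t) z) \<in> borel_measurable (st_vol T)" by simp
        then show "(\<lambda>z. Dx (bump t) z $ i) \<in> borel_measurable (st_vol T)"
          by (rule measurable_compose) (auto intro!: borel_measurable_continuous_onI continuous_intros)
        show "\<bar>Dx (bump t) z $ i\<bar> \<le> BD" for z using component_le_norm_cart[of "Dx (bump t) z" i] BD(2)[of t z] by linarith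
      qed
      have ig: "integrable (st_vol T) (\<lambda>z. G z $ i * bump t z)" for i
      proof (rule integrable_st_vol_bounded[OF _ bump_measurable_st])
        show "integrable (st_vol T) (\<lambda>z. G z $ i)" using integrable_bounded_linear[OF bounded_linear_vec_nth Gi] .
      qed (rule aB)
      have "(\<integral>z. ?f t z \<partial>st_vol T) = (\<integral>z. (\<Sum>i\<in>UNIV. v t $ i * (\<phi> z * Dx (bump t) z $ i)) \<partial>st_vol T)"
        by (intro Bochner_Integration.integral_cong refl) (simp add: inner_vec_def sum_distrib_left mult_ac)
      also have "\<dots> = (\<Sum>i\<in>UNIV. v t $ i * (\<integral>z. \<phi> z * Dx (bump t) z $ i \<partial>st_vol T))"
        using id by (subst Bochner_Integration.integral_sum) auto
      also have "\<dots> = - (\<Sum>i\<in>UNIV. v t $ i * (\<integral>z. G z $ i * bump t z \<partial>st_vol T))"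
        by (simp add: weak_gradient[OF bump_mem[OF t]] sum_negf)
      also have "(\<Sum>i\<in>UNIV. v t $ i * (\<integral>z. G z $ i * bump t z \<partial>st_vol T))
          = (\<integral>z. (\<Sum>i\<in>UNIV. v t $ i * (G z $ i * bump t z)) \<partial>st_vol T)"
        using ig by (subst Bochner_Integration.integral_sum) auto
      also have "\<dots> = (\<integral>z. inner (G z) (v t) * bump t z \<partial>st_vol T)"
        by (intro Bochner_Integration.integral_cong refl) (simp add: inner_vec_def sum_distrib_left sum_distrib_right mult_ac)
      finally show "(\<integral>z. ?f t z \<partial>st_vol T) = - (\<integral>z. inner (G z) (v t) * bump t z \<partial>st_vol T)" .
    qed
    also have "\<dots> = - (\<integral>q. inner (G (snd q)) (v (fst q)) * bump (fst q) (snd q) \<partial>?N)" using N.integral_fst'[OF i2] by simp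
    finally have "(\<integral>z. \<integral>t. ?f t z \<partial>Iab \<partial>st_vol T) = - (\<integral>q. inner (G (snd q)) (v (fst q)) * bump (fst q) (snd q) \<partial>?N)" .
    then show ?thesis unfolding eq using ends[of a] ends[of b] i_t ab by simp
  qed

  \<comment> \<open>Fenchel's inequality in the support of the bump\<close>
  have pointwise: "- (?L t * bump t z) - Cx * \<alpha> * bump t z - Cx * ?\<beta> * (?Gr z * bump t z)
      \<le> ?H z * bump t z + inner (G z) (v t) * bump t z" for t z
  proof (cases "bump t z = 0")
    case False
    then have "dist (snd z) (\<gamma> t) < s" using K unfolding bump_def torus_kernel_def by (subst dist_torus_diff) auto
    then have "- ?L t - Cx * (\<alpha> + ?\<beta> * ?Gr z) \<le> ?H z + inner (G z) (v t)" by (intro fenchel_nearby \<alpha>) simp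
    from mult_right_mono[OF this bump_nonneg[of t z]] show ?thesis by (simp add: algebra_simps)
  qed simp
  have iH: "integrable ?N (\<lambda>q. ?H (snd q) * bump (fst q) (snd q))" by (rule i3[OF Hi])
  have iG: "integrable ?N (\<lambda>q. ?Gr (snd q) * bump (fst q) (snd q))" by (rule i3[OF Gr])
  have iB: "integrable ?N (\<lambda>q. bump (fst q) (snd q))" using i3[OF integrable_st_vol_const[of T 1]] by simp
  have "- (\<integral>q. ?L (fst q) * bump (fst q) (snd q) \<partial>?N) - Cx * \<alpha> * (\<integral>q. bump (fst q) (snd q) \<partial>?N)
        - Cx * ?\<beta> * (\<integral>q. ?Gr (snd q) * bump (fst q) (snd q) \<partial>?N)
      = (\<integral>q. - (?L (fst q) * bump (fst q) (snd q)) - Cx * \<alpha> * bump (fst q) (snd q)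
          - Cx * ?\<beta> * (?Gr (snd q) * bump (fst q) (snd q)) \<partial>?N)" using i4 iG iB by simp
  also have "\<dots> \<le> (\<integral>q. ?H (snd q) * bump (fst q) (snd q) + inner (G (snd q)) (v (fst q)) * bump (fst q) (snd q) \<partial>?N)"
    using i4 iG iB iH i2 pointwise by (intro integral_mono) auto
  also have "\<dots> = (\<integral>z. ?H z * Bump z \<partial>st_vol T) + (\<integral>q. inner (G (snd q)) (v (fst q)) * bump (fst q) (snd q) \<partial>?N)"
    using iH i2 by (simp add: swap[OF Hi])
  finally have main: "- (\<integral>q. ?L (fst q) * bump (fst q) (snd q) \<partial>?N) - Cx * \<alpha> * (\<integral>q. bump (fst q) (snd q) \<partial>?N)
        - Cx * ?\<beta> * (\<integral>q. ?Gr (snd q) * bump (fst q) (snd q) \<partial>?N)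
      \<le> (\<integral>z. ?H z * Bump z \<partial>st_vol T) + (\<integral>q. inner (G (snd q)) (v (fst q)) * bump (fst q) (snd q) \<partial>?N)" .
  have eL: "(\<integral>q. ?L (fst q) * bump (fst q) (snd q) \<partial>?N) = integral {a..b} ?L"
  proof -
    have "(\<integral>q. ?L (fst q) * bump (fst q) (snd q) \<partial>?N) = (\<integral>t. \<integral>z. ?L t * bump t z \<partial>st_vol T \<partial>Iab)"
      using N.integral_fst'[OF i4] by simp
    also have "\<dots> = (\<integral>t. ?L t \<partial>Iab)" by (rule Bochner_Integration.integral_cong[OF refl]) (simp add: spI unit)
    finally show ?thesis using Li(2) by simp
  qed
  have eB: "(\<integral>q. bump (fst q) (snd q) \<partial>?N) \<le> T"
  proof -
    have "(\<integral>q. bump (fst q) (snd q) \<partial>?N) = (\<integral>t. \<integral>z. bump t z \<partial>st_vol T \<partial>Iab)"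
      using N.integral_fst'[OF iB] by simp
    also have "\<dots> = (\<integral>t. 1 \<partial>Iab)" by (rule Bochner_Integration.integral_cong[OF refl]) (simp add: spI unit)
    also have "\<dots> = integral {a..b} (\<lambda>t. 1)" by (rule integral_Iab(2)) (rule borel_integrable_atLeastAtMost', simp)
    also have "\<dots> = b - a" using ab by simp
    finally show ?thesis using h by linarith
  qed
  have eG: "(\<integral>q. ?Gr (snd q) * bump (fst q) (snd q) \<partial>?N) \<le> \<kappa> * (\<integral>z. ?Gr z \<partial>st_vol T)"
  proof -
    have \<kappa>0: "0 \<le> \<kappa>" using \<kappa>[of 0] K by (meson order_trans torus_kernel_def)
    have "(\<integral>z. ?Gr z * Bump z \<partial>st_vol T) \<le> (\<integral>z. \<kappa> * ?Gr z \<partial>st_vol T)"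
    proof (rule integral_mono)
      show "integrable (st_vol T) (\<lambda>z. ?Gr z * Bump z)"
      proof (rule integrable_st_vol_bounded[OF Gr Bump_measurable_st])
        show "\<bar>Bump z\<bar> \<le> \<kappa>" for z using Bump_le[OF \<kappa>0, of z] \<kappa> Bump_nonneg[of z] by simp
      qed
      show "?Gr z * Bump z \<le> \<kappa> * ?Gr z" for z using Bump_le[OF \<kappa>0, of z] \<kappa> by (simp add: mult.commute mult_right_mono)
    qed (use Gr in simp)
    then show ?thesis using swap[OF Gr] by simp
  qed
  have s0: "0 \<le> s"
  proof -
    have "\<exists>z. K z \<noteq> 0"
    proof (rule ccontr)
      assume "\<nexists>z. K z \<noteq> 0"
      then have "(\<integral>z. K z \<partial>torus_vol) = 0" by simp
      then show False using K by (simp add: torus_kernel_def)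
    qed
    then obtain z where "K z \<noteq> 0" by blast
    then have "dist z 0 < s" using K by (simp add: torus_kernel_def)
    then show ?thesis using zero_le_dist[of z 0] by linarith
  qed
  have "Cx * \<alpha> * (\<integral>q. bump (fst q) (snd q) \<partial>?N) \<le> Cx * \<alpha> * T" using eB Cx \<alpha> by (intro mult_left_mono) auto
  moreover have "Cx * ?\<beta> * (\<integral>q. ?Gr (snd q) * bump (fst q) (snd q) \<partial>?N) \<le> Cx * ?\<beta> * (\<kappa> * (\<integral>z. ?Gr z \<partial>st_vol T))"
    using eG Cx \<alpha> s0 by (intro mult_left_mono) auto
  moreover have "(\<integral>z. \<phi> z * dt Bump z \<partial>st_vol T) + (\<integral>z. ?H z * Bump z \<partial>st_vol T) \<le> (\<integral>z. F z * Bump z \<partial>st_vol T)"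
    by (rule sub[OF Bump_mem Bump_nonneg])
  ultimately show ?thesis using main transport unfolding eL by (simp add: algebra_simps)
qed

end

section \<open>Final values and the bound along every curve\<close>

lemma torus_kernel_mean:
  assumes K: "torus_kernel s K" and u: "continuous_on UNIV u"
    and e: "\<And>x. dist x x0 < s \<Longrightarrow> \<bar>u x - u x0\<bar> \<le> e"
  shows "\<bar>(\<integral>x. u x * K (x - x0) \<partial>torus_vol) - u x0\<bar> \<le> e"
proof -
  have [measurable]: "u \<in> borel_measurable borel" "K \<in> borel_measurable borel"
    using u torus_kernel_measurable[OF K] by (auto intro: borel_measurable_continuous_onI)
  obtain BK where BK0: "0 \<le> BK" and BK: "\<And>z. norm (K z) \<le> BK" using bounded_torus[OF torus_kernel_continuous[OF K]] by metis
  obtain Bu where Bu: "0 \<le> Bu" "\<And>z. norm (u z) \<le> Bu" using bounded_torus[OF u] by metis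
  have tr: "distr torus_vol borel (\<lambda>x. x - x0) = (torus_vol :: 'a torus measure)" using distr_torus_translate[of "- x0"] by simp
  have iK: "integrable torus_vol (\<lambda>x. K (x - x0))" by (rule torus_vol.integrable_const_bound[where B=BK]) (use BK in auto)
  have "\<bar>u x * K (x - x0)\<bar> \<le> Bu * BK" for x using Bu BK[of "x - x0"] by (simp add: abs_mult) (intro mult_mono, auto)
  then have iuK: "integrable torus_vol (\<lambda>x. u x * K (x - x0))" by (intro torus_vol.integrable_const_bound[where B="Bu * BK"]) auto
  have "(\<integral>x. K (x - x0) \<partial>torus_vol) = (\<integral>x. K x \<partial>distr torus_vol borel (\<lambda>x. x - x0))"
    by (subst integral_distr) auto
  then have one: "(\<integral>x. K (x - x0) \<partial>torus_vol) = 1" unfolding tr using K by (simp add: torus_kernel_def)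
  have "(\<integral>x. u x * K (x - x0) \<partial>torus_vol) - u x0 = (\<integral>x. u x * K (x - x0) - u x0 * K (x - x0) \<partial>torus_vol)"
    using iuK iK one by simp
  also have "\<bar>\<dots>\<bar> \<le> (\<integral>x. e * K (x - x0) \<partial>torus_vol)"
  proof (rule order_trans[OF integral_abs_bound integral_mono])
    fix x
    show "\<bar>u x * K (x - x0) - u x0 * K (x - x0)\<bar> \<le> e * K (x - x0)"
    proof (cases "K (x - x0) = 0")
      case False
      then have "dist x x0 < s" using K unfolding torus_kernel_def by (subst dist_torus_diff) auto
      then have "\<bar>u x - u x0\<bar> \<le> e" by (rule e)
      then show ?thesis using K by (simp add: left_diff_distrib[symmetric] abs_mult mult_right_mono torus_kernel_def)
    qed simp
  qed (use iuK iK in auto)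
  also have "\<dots> = e" using one by simp
  finally show ?thesis .
qed

lemma st_uniform_continuity:
  fixes \<phi> :: "real \<times> 'd::finite torus \<Rightarrow> real"
  assumes "continuous_on ({0..T} \<times> UNIV) \<phi>" "0 < e"
  obtains d where "0 < d" "\<And>t x t' x'. t \<in> {0..T} \<Longrightarrow> t' \<in> {0..T} \<Longrightarrow> \<bar>t - t'\<bar> + dist x x' < d \<Longrightarrow>
    \<bar>\<phi> (t, x) - \<phi> (t', x')\<bar> \<le> e"
proof -
  have "uniformly_continuous_on ({0..T} \<times> (UNIV :: 'd torus set)) \<phi>"
    by (intro compact_uniformly_continuous assms compact_Times compact_torus) simp
  then obtain d where d: "0 < d" "\<And>z w. z \<in> {0..T} \<times> UNIV \<Longrightarrow> w \<in> {0..T} \<times> UNIV \<Longrightarrow> dist w z < d \<Longrightarrow> dist (\<phi> w) (\<phi> z) < e"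
    unfolding uniformly_continuous_on_def using assms(2) by metis
  show thesis
  proof (rule that[OF d(1)])
    fix t t' :: real and x x' :: "'d torus"
    assume t: "t \<in> {0..T}" "t' \<in> {0..T}" "\<bar>t - t'\<bar> + dist x x' < d"
    have "dist (t, x) (t', x') \<le> \<bar>t - t'\<bar> + dist x x'"
      unfolding dist_Pair_Pair dist_real_def using sqrt_sum_squares_le_sum_abs[of "\<bar>t - t'\<bar>" "dist x x'"] by simp
    then have "dist (\<phi> (t, x)) (\<phi> (t', x')) < e" using t by (intro d(2)) auto
    then show "\<bar>\<phi> (t, x) - \<phi> (t', x')\<bar> \<le> e" by (simp add: dist_real_def)
  qed
qed

text \<open>Continuity from above of a finite measure on a space in which every time is less than \<open>T\<close>.\<close>

lemma small_near_terminal_time: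
  fixes P :: "(real \<times> 'd::finite torus) measure"
  assumes P: "st_finite_measure T P" and e: "0 < e"
  shows "\<exists>n. \<forall>k\<ge>n. measure P {z \<in> space P. T - 1 / Suc k < fst z} < e"
proof -
  have sets: "sets P = sets (st_vol T :: (real \<times> 'd torus) measure)" and fin: "finite_measure P" using P by (auto simp: st_finite_measure_def)
  interpret finite_measure P by (rule fin)
  have [measurable_cong]: "sets P = sets (st_vol T :: (real \<times> 'd torus) measure)" by (rule sets)
  have sp: "space P = {0<..<T} \<times> UNIV" using sets_eq_imp_space_eq[OF sets] by (simp add: space_st_vol)
  let ?A = "\<lambda>k::nat. {z \<in> space P. T - 1 / Suc k < fst z}"
  have "(\<lambda>k. measure P (?A k)) \<longlonglongrightarrow> measure P (\<Inter>k. ?A k)"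
  proof (rule finite_Lim_measure_decseq)
    show "range ?A \<subseteq> sets P" by auto
    show "decseq ?A"
    proof (rule decseq_SucI)
      fix k :: nat
      have "1 / real (Suc (Suc k)) \<le> 1 / real (Suc k)" by (simp add: frac_le)
      then show "?A (Suc k) \<subseteq> ?A k" by auto
    qed
  qed
  moreover have "(\<Inter>k. ?A k) = {}"
  proof (rule ccontr)
    assume "(\<Inter>k. ?A k) \<noteq> {}"
    then obtain z where z: "\<And>k. z \<in> ?A k" by blast
    have "0 < T - fst z" using z[of 0] by (auto simp: sp)
    then obtain k where "inverse (real (Suc k)) < T - fst z" using reals_Archimedean by blast
    then show False using z[of k] by (simp add: inverse_eq_divide)
  qed
  ultimately have "(\<lambda>k. measure P (?A k)) \<longlonglongrightarrow> 0" by simp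
  from LIMSEQ_D[OF this e] show ?thesis by auto
qed

text \<open>Green's formula with a bump that rests at \<open>x0\<close> and is switched on shortly before \<open>T\<close>. The measures
that represent the time derivative charge its support only little, so the average of \<open>\<phi>\<close> just before
\<open>T\<close> and the average of the trace almost agree.\<close>

lemma trace_value:
  fixes \<phi> :: "real \<times> 'd::finite torus \<Rightarrow> real"
  assumes T: "0 < T" and \<phi>: "continuous_on ({0..T} \<times> UNIV) \<phi>" and tr: "trace_at_T T \<phi> \<phi>T"
    and \<phi>T: "continuous_on UNIV \<phi>T" and reg: "reg_kernel (\<xi> :: real ^ 'd \<Rightarrow> real)"
  shows "\<phi> (T, x0) = \<phi>T x0"
proof -
  have "\<bar>\<phi> (T, x0) - \<phi>T x0\<bar> \<le> 0 + e" if "0 < e" for e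
  proof -
    define e' where "e' = e / 5"
    have e': "0 < e'" using that by (simp add: e'_def)
    obtain P M where PM: "deriv_measure T dt \<phi> P M" and green: "\<And>\<psi>. \<psi> \<in> test_funs_term \<Longrightarrow>
        (\<integral>z. \<phi> z * dt \<psi> z \<partial>st_vol T) + ((\<integral>z. \<psi> z \<partial>P) - (\<integral>z. \<psi> z \<partial>M)) = (\<integral>x. \<phi>T x * \<psi> (T, x) \<partial>torus_vol)"
      using tr unfolding trace_at_T_def by blast
    have fP: "st_finite_measure T P" "st_finite_measure T M" using PM by (auto simp: deriv_measure_def)
    obtain d where d: "0 < d" "\<And>t x t' x'. t \<in> {0..T} \<Longrightarrow> t' \<in> {0..T} \<Longrightarrow> \<bar>t - t'\<bar> + dist x x' < d \<Longrightarrow>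
      \<bar>\<phi> (t, x) - \<phi> (t', x')\<bar> \<le> e'" using st_uniform_continuity[OF \<phi> e'] by metis
    obtain d' where d': "0 < d'" "\<And>x y. dist x y < d' \<Longrightarrow> \<bar>\<phi>T x - \<phi>T y\<bar> < e'"
      using uniformly_continuous_torus[OF \<phi>T e'] by metis
    obtain R where R: "R > 0" "\<And>x. \<xi> x \<noteq> 0 \<Longrightarrow> norm x < R" using reg_kernel_support[OF reg] by metis
    define s where "s = min (d / 2) d'"
    define K where "K = periodize (scaled_kernel \<xi> (s / R))"
    have s: "0 < s" using d(1) d'(1) by (simp add: s_def)
    have K: "torus_kernel s K" using ball_kernel.torus_kernel_periodize[OF scaled_kernel_ball_kernel[OF reg R(2), of "s / R"]] s R(1)
      by (simp add: K_def)
    obtain \<kappa> where \<kappa>: "0 \<le> \<kappa>" "\<And>z. norm (K z) \<le> \<kappa>" using bounded_torus[OF torus_kernel_continuous[OF K]] by metis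
    define e2 where "e2 = e' / (\<kappa> + 1)"
    have e2: "0 < e2" using e' \<kappa>(1) by (simp add: e2_def)
    obtain n1 where n1: "\<forall>k\<ge>n1. measure P {z \<in> space P. T - 1 / Suc k < fst z} < e2"
      using small_near_terminal_time[OF fP(1) e2] by blast
    obtain n2 where n2: "\<forall>k\<ge>n2. measure M {z \<in> space M. T - 1 / Suc k < fst z} < e2"
      using small_near_terminal_time[OF fP(2) e2] by blast
    define n where "n = max n1 n2"
    define h where "h = Min {1 / (4 * real (Suc n)), T / 4, d / 4, 1 / 2}"
    have h: "0 < h" "h \<le> 1 / (4 * real (Suc n))" "h \<le> T / 4" "h \<le> d / 4" "h \<le> 1 / 2" using T d(1) by (auto simp: h_def)
    obtain \<rho> where \<rho>: "time_kernel h \<rho>" using time_kernel_exists[OF reg h(1)] by blast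
    obtain y0 where y0: "to_torus y0 = x0" using to_torus_surj by blast
    define a where "a = T - 2 * h"
    interpret moving_bump h s \<rho> K a "T + 1" "\<lambda>t. y0" "\<lambda>t. 0"
      by unfold_locales (use \<rho> K h in \<open>auto simp: a_def set_integrable_def\<close>)
    have a: "0 \<le> a - h" "a + h \<le> T" "a \<in> {0..T}" "0 < a - h" using h T by (auto simp: a_def)
    have Bt: "Bump \<in> test_funs_term" unfolding test_funs_term_def using smooth_Bump Bump_eq_0 a(4)
      by (intro CollectI conjI exI[of _ "a - h"]) auto
    have "(\<integral>z. \<phi> z * dt Bump z \<partial>st_vol T) = (\<integral>z. \<phi> z * bump a z \<partial>st_vol T)"
    proof (rule Bochner_Integration.integral_cong[OF refl])
      fix z :: "real \<times> 'd torus" assume "z \<in> space (st_vol T)"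
      then have "bump (T + 1) z = 0" using h(5) by (intro bump_eq_0) (auto simp: space_st_vol)
      then show "\<phi> z * dt Bump z = \<phi> z * bump a z" by (simp add: dt_Bump(2))
    qed
    moreover have "\<bar>(\<integral>z. \<phi> z * bump a z \<partial>st_vol T) - \<phi> (a, \<gamma> a)\<bar> \<le> e'"
    proof (rule bump_average(2)[OF a(1,2) \<phi>])
      fix \<tau> x assume "\<tau> \<in> {0..T}" "\<bar>\<tau> - a\<bar> < h" "dist x (\<gamma> a) < s"
      moreover have "s \<le> d / 2" by (simp add: s_def)
      ultimately show "\<bar>\<phi> (\<tau>, x) - \<phi> (a, \<gamma> a)\<bar> \<le> e'" using a(3) h(4) d(1) by (intro d(2)) auto
    qed
    moreover have "\<bar>\<phi> (a, \<gamma> a) - \<phi> (T, x0)\<bar> \<le> e'" using a(3) h d(1) T by (intro d(2)) (auto simp: a_def y0)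
    moreover have small: "\<bar>\<integral>z. Bump z \<partial>Q\<bar> \<le> e'"
      if Q: "st_finite_measure T Q" "measure Q {z \<in> space Q. T - 1 / Suc n < fst z} < e2" for Q
    proof -
      have sets: "sets Q = sets (st_vol T :: (real \<times> 'd torus) measure)" and fin: "finite_measure Q"
        using Q(1) by (auto simp: st_finite_measure_def)
      interpret Q: finite_measure Q by (rule fin)
      have [measurable_cong]: "sets Q = sets (st_vol T :: (real \<times> 'd torus) measure)" by (rule sets)
      let ?A = "{z \<in> space Q. T - 1 / Suc n < fst z}"
      have le: "Bump z \<le> \<kappa> * indicator ?A z" if "z \<in> space Q" for z
      proof (cases "z \<in> ?A")
        case True
        have "K w \<le> \<kappa>" for w using \<kappa>(2)[of w] by simp
        then have "Bump z \<le> \<kappa>" by (intro Bump_le \<kappa>(1))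
        with True show ?thesis by simp
      next
        case False
        have "3 * h < 1 / Suc n" using h(1,2) by (simp add: field_simps)
        then have "fst z < a - h" using False that by (auto simp: a_def)
        then show ?thesis using False by (simp add: Bump_eq_0)
      qed
      have "\<bar>\<integral>z. Bump z \<partial>Q\<bar> \<le> (\<integral>z. \<kappa> * indicator ?A z \<partial>Q)"
      proof (rule order_trans[OF integral_abs_bound integral_mono])
        have ik: "integrable Q (\<lambda>z. \<kappa> * indicator ?A z)" by (simp add: Q.integrable_const_bound[where B=1])
        show "integrable Q (\<lambda>z. \<kappa> * indicator ?A z :: real)" by (rule ik)
        have "integrable Q Bump" by (rule Bochner_Integration.integrable_bound[OF ik])
            (use le Bump_nonneg Bump_measurable_st[of T] in \<open>auto simp: measurable_cong_sets[OF sets refl] intro!: AE_I2 order_trans[OF le]\<close>)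
        then show "integrable Q (\<lambda>z. \<bar>Bump z\<bar>)" by simp
        show "\<bar>Bump z\<bar> \<le> \<kappa> * indicator ?A z" if "z \<in> space Q" for z using le[OF that] Bump_nonneg[of z] by simp
      qed
      also have "\<dots> = \<kappa> * measure Q ?A" by simp
      also have "\<dots> \<le> \<kappa> * e2" using Q(2) \<kappa>(1) by (intro mult_left_mono) auto
      also have "\<dots> \<le> e'" using e' \<kappa>(1) by (simp add: e2_def field_simps)
      finally show ?thesis .
    qed
    moreover have "Bump (T, x) = K (x - x0)" for x
    proof -
      have "Bump (T, x) = integral {a..T + 1} (\<lambda>t. \<rho> (T - t)) * K (x - x0)" by (simp add: Bump_def bump_def y0)
      then show ?thesis using a(2) h by (simp add: integral_rho_eq)
    qed
    moreover have "\<bar>(\<integral>x. \<phi>T x * K (x - x0) \<partial>torus_vol) - \<phi>T x0\<bar> \<le> e'"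
    proof (rule torus_kernel_mean[OF K \<phi>T])
      fix x assume "dist x x0 < s"
      then have "dist x x0 < d'" by (simp add: s_def)
      from d'(2)[OF this] show "\<bar>\<phi>T x - \<phi>T x0\<bar> \<le> e'" by simp
    qed
    ultimately have "\<bar>\<phi> (T, x0) - \<phi>T x0\<bar> \<le> 5 * e'"
      using green[OF Bt] small[OF fP(1) n1[rule_format, of n]] small[OF fP(2) n2[rule_format, of n]] by (simp add: n_def abs_le_iff)
    then show ?thesis by (simp add: e'_def)
  qed
  then have "\<bar>\<phi> (T, x0) - \<phi>T x0\<bar> \<le> 0" by (rule field_le_epsilon)
  then show ?thesis by simp
qed

context subsolution
begin

text \<open>The space kernel stays fixed while the time kernel and the pieces of the curve near the end times
disappear: \<open>along_curve\<close> is applied on \<open>[k, T - k]\<close> with a time kernel of width \<open>k / 2\<close>, and \<open>k\<close> is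
small depending on the curve. The remainder depends on the curve no longer.\<close>

lemma curve_inequality:
  assumes K: "torus_kernel s K" and \<kappa>: "\<And>z. K z \<le> \<kappa>" and \<alpha>: "0 < \<alpha>"
    and e: "\<And>t x t' x'. t \<in> {0..T} \<Longrightarrow> t' \<in> {0..T} \<Longrightarrow> \<bar>t - t'\<bar> + dist x x' < d \<Longrightarrow> \<bar>\<phi> (t, x) - \<phi> (t', x')\<bar> \<le> e"
    and sd: "s < d" and ker: "\<And>h. 0 < h \<Longrightarrow> \<exists>\<rho>. time_kernel h \<rho>"
    and v: "set_integrable lborel {0..T} v" and c: "\<And>t. t \<in> {0..T} \<Longrightarrow> c t = c 0 + integral {0..t} v"
    and L: "set_integrable lborel {0..T} (\<lambda>t. lagrangian H (to_torus (c t)) (v t))"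
    and Lb: "\<And>x p. - CL \<le> lagrangian H x p"
  shows "\<phi> (0, to_torus (c 0)) \<le> \<phi> (T, to_torus (c T)) + integral {0..T} (\<lambda>t. lagrangian H (to_torus (c t)) (v t))
      + (\<integral>z. F z * K (snd z - to_torus (c (fst z))) \<partial>st_vol T) + 2 * e
      + Cx * (\<alpha> * T + s ^ Suc CARD('d) / \<alpha> ^ CARD('d) * (\<kappa> * (\<integral>z. max (norm (G z)) 1 powr r \<partial>st_vol T)))"
proof (rule field_le_epsilon)
  fix \<eta> :: real assume \<eta>: "0 < \<eta>"
  let ?\<gamma> = "\<lambda>t. to_torus (c t)"
  let ?L = "\<lambda>t. lagrangian H (?\<gamma> t) (v t)"
  define \<eta>1 where "\<eta>1 = \<eta> / (4 * ((\<integral>z. F z \<partial>st_vol T) + 1))"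
  have IF: "0 \<le> (\<integral>z. F z \<partial>st_vol T)" by (simp add: F0)
  have \<eta>1: "0 < \<eta>1" using \<eta> IF by (simp add: \<eta>1_def)
  have vi: "v integrable_on {0..T}" by (rule set_borel_integral_eq_integral(1)[OF v])
  have cc: "continuous_on {0..T} c"
  proof -
    have "continuous_on {0..T} (\<lambda>t. c 0 + integral {0..t} v)" by (intro continuous_intros indefinite_integral_continuous_1 vi)
    then show ?thesis by (rule continuous_on_eq) (rule c[symmetric])
  qed
  have c\<gamma>: "continuous_on {0..T} ?\<gamma>" by (rule continuous_on_compose2[OF continuous_to_torus cc]) simp
  obtain d1 where d1: "0 < d1" "\<And>x y. dist x y < d1 \<Longrightarrow> \<bar>K x - K y\<bar> < \<eta>1"
    using uniformly_continuous_torus[OF torus_kernel_continuous[OF K] \<eta>1] by metis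
  have "uniformly_continuous_on {0..T} ?\<gamma>" by (rule compact_uniformly_continuous[OF c\<gamma>]) simp
  then obtain d2 where d2: "0 < d2" "\<And>t t'. t \<in> {0..T} \<Longrightarrow> t' \<in> {0..T} \<Longrightarrow> dist t' t < d2 \<Longrightarrow> dist (?\<gamma> t') (?\<gamma> t) < d1"
    unfolding uniformly_continuous_on_def using d1(1) by metis
  have \<eta>4: "0 < \<eta> / 4" using \<eta> by simp
  have "continuous_on {0..T} (\<lambda>t. \<phi> (t, ?\<gamma> t))"
    by (rule continuous_on_compose2[OF \<phi>]) (auto intro!: continuous_on_Pair continuous_on_id c\<gamma>)
  then have "uniformly_continuous_on {0..T} (\<lambda>t. \<phi> (t, ?\<gamma> t))" by (rule compact_uniformly_continuous) simp
  then obtain d3 where d3: "0 < d3" "\<And>t t'. t \<in> {0..T} \<Longrightarrow> t' \<in> {0..T} \<Longrightarrow> dist t' t < d3 \<Longrightarrow>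
      dist (\<phi> (t', ?\<gamma> t')) (\<phi> (t, ?\<gamma> t)) < \<eta> / 4" unfolding uniformly_continuous_on_def using \<eta>4 by metis
  define k where "k = Min {T / 4, d2 / 2, d3 / 2, d - s, \<eta> / (8 * (\<bar>CL\<bar> + 1))}"
  have k: "0 < k" "k \<le> T / 4" "k \<le> d2 / 2" "k \<le> d3 / 2" "k \<le> d - s" "k \<le> \<eta> / (8 * (\<bar>CL\<bar> + 1))"
    using T d2(1) d3(1) sd \<eta> unfolding k_def by (subst Min_gr_iff, simp, simp, simp add: add_nonneg_pos) (rule Min_le; simp)+
  define h where "h = k / 2"
  have h: "0 < h" "h < k" using k by (auto simp: h_def)
  obtain \<rho> where \<rho>: "time_kernel h \<rho>" using ker[OF h(1)] by blast
  define a b where "a = k" and "b = T - k"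
  have abT: "0 \<le> a" "a \<le> b" "b \<le> T" "h < a" "b + h < T" "a \<in> {0..T}" "b \<in> {0..T}" using k h T by (auto simp: a_def b_def)
  have subset: "{a..b} \<subseteq> {0..T}" using abT by auto
  interpret moving_bump h s \<rho> K a b c v
  proof
    show "set_integrable lborel {a..b} v" by (rule set_integrable_subset[OF v _ subset]) simp
    fix t assume t: "t \<in> {a..b}"
    have "integral {0..a} v + integral {a..t} v = integral {0..t} v" by (rule Henstock_Kurzweil_Integration.integral_combine)
        (use t abT in \<open>auto intro: integrable_on_subinterval[OF vi]\<close>)
    then show "c t = c a + integral {a..t} v" using c[of t] c[of a] t abT by (simp add: algebra_simps)
  qed (use \<rho> K abT in auto)
  have Lab: "set_integrable lborel {a..b} ?L" by (rule set_integrable_subset[OF L _ subset]) simp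
  note main = along_curve[OF moving_bump_axioms h(1) abT(4,5) \<kappa> \<alpha> Lab]
  have avg: "\<bar>(\<integral>z. \<phi> z * bump t z \<partial>st_vol T) - \<phi> (t, ?\<gamma> t)\<bar> \<le> e" if "t \<in> {a..b}" for t
  proof (rule bump_average(2)[OF _ _ \<phi>])
    fix \<tau> x assume "\<tau> \<in> {0..T}" "\<bar>\<tau> - t\<bar> < h" "dist x (?\<gamma> t) < s"
    then show "\<bar>\<phi> (\<tau>, x) - \<phi> (t, ?\<gamma> t)\<bar> \<le> e" using that subset k h by (intro e) auto
  qed (use that abT in auto)
  have end0: "\<bar>\<phi> (a, ?\<gamma> a) - \<phi> (0, ?\<gamma> 0)\<bar> < \<eta> / 4"
    using d3(2)[of 0 a] abT k T by (simp add: dist_real_def a_def)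
  have endT: "\<bar>\<phi> (b, ?\<gamma> b) - \<phi> (T, ?\<gamma> T)\<bar> < \<eta> / 4"
    using d3(2)[of T b] abT k T by (simp add: dist_real_def b_def)
  have Li: "?L integrable_on {0..T}" by (rule set_borel_integral_eq_integral(1)[OF L])
  have Lsub: "?L integrable_on {p..q}" if "0 \<le> p" "q \<le> T" for p q by (rule integrable_on_subinterval[OF Li]) (use that in auto)
  have Lpiece: "- (CL * (q - p)) \<le> integral {p..q} ?L" if "0 \<le> p" "p \<le> q" "q \<le> T" for p q
  proof -
    have "integral {p..q} (\<lambda>t. - CL) \<le> integral {p..q} ?L" by (rule integral_le) (use Lb Lsub that in auto)
    then show ?thesis using that by (simp add: mult.commute)
  qed
  have Lsplit: "integral {0..T} ?L = integral {0..a} ?L + integral {a..b} ?L + integral {b..T} ?L"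
    using Henstock_Kurzweil_Integration.integral_combine[of 0 a T ?L] Henstock_Kurzweil_Integration.integral_combine[of a b T ?L]
      Li Lsub[of a T] abT by simp
  have CLk: "CL * k \<le> \<eta> / 8"
  proof -
    have "CL * k \<le> (\<bar>CL\<bar> + 1) * k" using k(1) by (intro mult_right_mono) auto
    also have "\<dots> \<le> (\<bar>CL\<bar> + 1) * (\<eta> / (8 * (\<bar>CL\<bar> + 1)))" using k(6) by (intro mult_left_mono) auto
    also have "\<dots> = \<eta> / 8"
    proof -
      have "\<bar>CL\<bar> + 1 \<noteq> 0" by linarith
      then show ?thesis by (simp add: field_simps)
    qed
    finally show ?thesis .
  qed
  have Lle: "integral {a..b} ?L \<le> integral {0..T} ?L + \<eta> / 4" using Lsplit Lpiece[of 0 a] Lpiece[of b T] abT CLk by (simp add: a_def b_def)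
  let ?u = "\<lambda>z. K (snd z - ?\<gamma> (fst z))"
  have u_cont: "continuous_on ({0..T} \<times> UNIV) ?u" by (intro continuous_on_compose2[OF torus_kernel_continuous[OF K]] continuous_intros
       continuous_on_compose2[OF c\<gamma>]) auto
  have \<kappa>0: "0 \<le> K z" "\<bar>K z\<bar> \<le> \<kappa>" for z using K \<kappa>[of z] by (auto simp: torus_kernel_def)
  have Fu: "integrable (st_vol T) (\<lambda>z. F z * ?u z)"
    by (rule integrable_st_vol_bounded[OF Fi st_vol_continuous_measurable[OF u_cont] \<kappa>0(2)])
  have "(\<integral>z. F z * Bump z \<partial>st_vol T) \<le> (\<integral>z. F z * ?u z + \<eta>1 * F z \<partial>st_vol T)"
  proof (rule integral_mono)
    have "0 \<le> \<kappa>" using \<kappa>0[of 0] by linarith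
    then have "\<bar>Bump z\<bar> \<le> \<kappa>" for z using Bump_le[of \<kappa> z] \<kappa> Bump_nonneg[of z] by simp
    then show "integrable (st_vol T) (\<lambda>z. F z * Bump z)" by (intro integrable_st_vol_bounded[OF Fi Bump_measurable_st])
    show "integrable (st_vol T) (\<lambda>z. F z * ?u z + \<eta>1 * F z)" using Fu Fi by simp
    fix z :: "real \<times> 'd torus" assume "z \<in> space (st_vol T)"
    then have z: "fst z \<in> {0..T}" by (auto simp: space_st_vol)
    have "Bump z \<le> ?u z + \<eta>1"
    proof (rule Bump_le)
      show "0 \<le> ?u z + \<eta>1" using \<kappa>0(1)[of "snd z - ?\<gamma> (fst z)"] \<eta>1 by simp
      fix t assume t: "t \<in> {a..b}" "\<bar>fst z - t\<bar> < h"
      then have "dist (?\<gamma> t) (?\<gamma> (fst z)) < d1" using subset k h z by (intro d2(2)) (auto simp: dist_real_def abs_minus_commute)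
      moreover have "dist (snd z - ?\<gamma> t) (snd z - ?\<gamma> (fst z)) = dist (?\<gamma> t) (?\<gamma> (fst z))"
      proof -
        have "dist (snd z - ?\<gamma> t) (snd z - ?\<gamma> (fst z)) = dist (?\<gamma> (fst z)) (?\<gamma> t)" by (simp add: dist_torus_def)
        then show ?thesis by (simp add: dist_commute)
      qed
      ultimately have "\<bar>K (snd z - ?\<gamma> t) - ?u z\<bar> < \<eta>1" by (intro d1(2)) simp
      then show "K (snd z - ?\<gamma> t) \<le> ?u z + \<eta>1" by linarith
    qed
    from mult_left_mono[OF this F0[of z]] show "F z * Bump z \<le> F z * ?u z + \<eta>1 * F z" by (simp add: algebra_simps)
  qed
  also have "\<dots> = (\<integral>z. F z * ?u z \<partial>st_vol T) + \<eta>1 * (\<integral>z. F z \<partial>st_vol T)" using Fu Fi by simp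
  also have "\<eta>1 * (\<integral>z. F z \<partial>st_vol T) \<le> \<eta> / 4"
  proof -
    have "\<eta>1 * (\<integral>z. F z \<partial>st_vol T) \<le> \<eta>1 * ((\<integral>z. F z \<partial>st_vol T) + 1)" using \<eta>1 by (intro mult_left_mono) auto
    also have "\<dots> = \<eta> / 4" unfolding \<eta>1_def
      using IF by (subst times_divide_eq_left, subst nonzero_divide_eq_eq) (simp_all add: add_nonneg_pos algebra_simps)
    finally show ?thesis .
  qed
  finally have FB: "(\<integral>z. F z * Bump z \<partial>st_vol T) \<le> (\<integral>z. F z * ?u z \<partial>st_vol T) + \<eta> / 4" by simp
  show "\<phi> (0, ?\<gamma> 0) \<le> \<phi> (T, ?\<gamma> T) + integral {0..T} ?L + (\<integral>z. F z * ?u z \<partial>st_vol T) + 2 * e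
      + Cx * (\<alpha> * T + s ^ Suc CARD('d) / \<alpha> ^ CARD('d) * (\<kappa> * (\<integral>z. max (norm (G z)) 1 powr r \<partial>st_vol T))) + \<eta>"
  proof -
    have "a \<in> {a..b}" "b \<in> {a..b}" using abT(2) by auto
    note avg[OF this(1), unfolded abs_le_iff] avg[OF this(2), unfolded abs_le_iff]
      end0[unfolded abs_less_iff] endT[unfolded abs_less_iff]
    then show ?thesis using main Lle FB by linarith
  qed
qed

text \<open>The width is chosen before the curve. With \<open>\<alpha>\<close> fixed, the remainder in \<open>curve_inequality\<close> for a
kernel of width \<open>R * \<sigma>\<close> and height \<open>C / \<sigma> ^ d\<close> is proportional to \<open>\<sigma>\<close>.\<close>

lemma uniform_curve_bound:
  fixes \<xi> :: "real ^ 'd \<Rightarrow> real"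
  assumes reg: "reg_kernel \<xi>" and Lb: "\<And>x p. - CL \<le> lagrangian H x p" and \<epsilon>: "0 < \<epsilon>"
  obtains \<sigma>0 where "0 < \<sigma>0" "\<And>\<sigma> c v. 0 < \<sigma> \<Longrightarrow> \<sigma> < \<sigma>0 \<Longrightarrow> set_integrable lborel {0..T} v \<Longrightarrow>
    (\<And>t. t \<in> {0..T} \<Longrightarrow> c t = c 0 + integral {0..t} v) \<Longrightarrow>
    set_integrable lborel {0..T} (\<lambda>t. lagrangian H (to_torus (c t)) (v t)) \<Longrightarrow>
    \<phi> (0, to_torus (c 0)) \<le> \<phi> (T, to_torus (c T)) + integral {0..T} (\<lambda>t. lagrangian H (to_torus (c t)) (v t))
      + (\<integral>z. F z * periodize (scaled_kernel \<xi> \<sigma>) (snd z - to_torus (c (fst z))) \<partial>st_vol T) + \<epsilon>"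
proof -
  obtain R where R: "R > 0" "\<And>x. \<xi> x \<noteq> 0 \<Longrightarrow> norm x < R" using reg_kernel_support[OF reg] by metis
  obtain C where C: "C > 0" "\<And>\<sigma> z. 0 < \<sigma> \<Longrightarrow> \<sigma> \<le> 1 \<Longrightarrow> periodize (scaled_kernel \<xi> \<sigma>) z \<le> C / \<sigma> ^ CARD('d)"
    using scaled_kernel_periodize_bound[OF reg R] by metis
  have e: "0 < \<epsilon> / 8" using \<epsilon> by simp
  obtain d where d: "0 < d" "\<And>t x t' x'. t \<in> {0..T} \<Longrightarrow> t' \<in> {0..T} \<Longrightarrow> \<bar>t - t'\<bar> + dist x x' < d \<Longrightarrow>
      \<bar>\<phi> (t, x) - \<phi> (t', x')\<bar> \<le> \<epsilon> / 8" using st_uniform_continuity[OF \<phi> e] by metis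
  define X where "X = Cx * T + 1"
  define \<alpha> where "\<alpha> = \<epsilon> / (8 * X)"
  have CT: "0 < X" using Cx T by (simp add: X_def add_nonneg_pos)
  have \<alpha>: "0 < \<alpha>" using \<epsilon> CT by (simp add: \<alpha>_def)
  have \<alpha>T: "Cx * (\<alpha> * T) \<le> \<epsilon> / 8"
  proof -
    have "Cx * (\<alpha> * T) \<le> \<alpha> * X" using \<alpha> by (simp add: X_def algebra_simps)
    also have "\<dots> = \<epsilon> / 8" using CT by (simp add: \<alpha>_def)
    finally show ?thesis .
  qed
  define IG where "IG = (\<integral>z. max (norm (G z)) 1 powr r \<partial>st_vol T)"
  have IG: "0 \<le> IG" by (simp add: IG_def)
  define D where "D = Cx * (R ^ Suc CARD('d) / \<alpha> ^ CARD('d) * (C * IG))"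
  have D: "0 \<le> D" using Cx R(1) \<alpha> C(1) IG by (simp add: D_def)
  define \<sigma>0 where "\<sigma>0 = Min {1, d / R, \<epsilon> / (8 * (D + 1))}"
  show thesis
  proof (rule that[of \<sigma>0])
    show "0 < \<sigma>0" using d(1) R(1) \<epsilon> D by (simp add: \<sigma>0_def add_nonneg_pos)
    fix \<sigma> c v
    assume \<sigma>: "0 < \<sigma>" "\<sigma> < \<sigma>0" and v: "set_integrable lborel {0..T} v"
      and c: "\<And>t. t \<in> {0..T} \<Longrightarrow> c t = c 0 + integral {0..t} v"
      and L: "set_integrable lborel {0..T} (\<lambda>t. lagrangian H (to_torus (c t)) (v t))"
    have \<sigma>': "\<sigma> \<le> 1" "\<sigma> < d / R" "\<sigma> < \<epsilon> / (8 * (D + 1))" using \<sigma>(2) by (auto simp: \<sigma>0_def)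
    have sd: "R * \<sigma> < d" using \<sigma>'(2) R(1) by (simp add: field_simps)
    note K = ball_kernel.torus_kernel_periodize[OF scaled_kernel_ball_kernel[OF reg R(2) \<sigma>(1)]]
    note ineq = curve_inequality[OF K C(2)[OF \<sigma>(1) \<sigma>'(1)] \<alpha> d(2) sd time_kernel_exists[OF reg] v c L Lb]
    have "(R * \<sigma>) ^ Suc CARD('d) / \<alpha> ^ CARD('d) * (C / \<sigma> ^ CARD('d) * IG) = R ^ Suc CARD('d) / \<alpha> ^ CARD('d) * (C * IG) * \<sigma>"
      using \<sigma>(1) by (simp add: power_mult_distrib)
    then have "Cx * ((R * \<sigma>) ^ Suc CARD('d) / \<alpha> ^ CARD('d) * (C / \<sigma> ^ CARD('d) * IG)) = D * \<sigma>"
      by (simp only: D_def mult.assoc)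
    also have "\<dots> \<le> (D + 1) * (\<epsilon> / (8 * (D + 1)))" using D \<sigma> \<sigma>'(3) by (intro mult_mono) auto
    also have "\<dots> = \<epsilon> / 8"
      using D by (subst times_divide_eq_right, subst nonzero_divide_eq_eq) (simp_all add: add_nonneg_pos algebra_simps)
    finally have "Cx * ((R * \<sigma>) ^ Suc CARD('d) / \<alpha> ^ CARD('d) * (C / \<sigma> ^ CARD('d) * IG)) \<le> \<epsilon> / 8" .
    then have "Cx * (\<alpha> * T + (R * \<sigma>) ^ Suc CARD('d) / \<alpha> ^ CARD('d) * (C / \<sigma> ^ CARD('d) * IG)) \<le> \<epsilon> / 4"
      using \<alpha>T by (simp only: distrib_left)
    with ineq \<epsilon> show "\<phi> (0, to_torus (c 0)) \<le> \<phi> (T, to_torus (c T)) + integral {0..T} (\<lambda>t. lagrangian H (to_torus (c t)) (v t))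
      + (\<integral>z. F z * periodize (scaled_kernel \<xi> \<sigma>) (snd z - to_torus (c (fst z))) \<partial>st_vol T) + \<epsilon>"
      unfolding IG_def by linarith
  qed
qed

end

section \<open>Continuity of translations in the mean\<close>

definition shift_continuous :: "('a::euclidean_space \<Rightarrow> 'b::{banach, second_countable_topology}) \<Rightarrow> bool" where
  "shift_continuous u \<longleftrightarrow> (\<forall>Y. Y \<longlonglongrightarrow> 0 \<longrightarrow> (\<lambda>n. \<integral>x. norm (u (x + Y n) - u x) \<partial>lborel) \<longlonglongrightarrow> 0)"

lemma integrable_lborel_shift:
  fixes u :: "'a::euclidean_space \<Rightarrow> 'b::{banach, second_countable_topology}"
  assumes "integrable lborel u"
  shows "integrable lborel (\<lambda>x. u (x + y))"
    and "(\<integral>x. norm (u (x + y)) \<partial>lborel) = (\<integral>x. norm (u x) \<partial>lborel)"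
proof -
  have [measurable]: "u \<in> borel_measurable borel" using assms by auto
  have d: "distr lborel borel (\<lambda>x. x + y) = lborel"
  proof -
    have "(\<lambda>x. x + y) = (+) y" by (auto simp: add.commute)
    then show ?thesis by (simp add: lborel_distr_plus)
  qed
  have "integrable (distr lborel borel (\<lambda>x. x + y)) u" using assms by (simp only: d)
  then show "integrable lborel (\<lambda>x. u (x + y))" by (subst (asm) integrable_distr_eq) auto
  have "(\<integral>x. norm (u x) \<partial>distr lborel borel (\<lambda>x. x + y)) = (\<integral>x. norm (u (x + y)) \<partial>lborel)"
    by (subst integral_distr) auto
  then show "(\<integral>x. norm (u (x + y)) \<partial>lborel) = (\<integral>x. norm (u x) \<partial>lborel)" by (simp only: d)
qed

text \<open>Translations are isometries of \<open>L\<^sup>1\<close>, so the property passes to limits.\<close>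

lemma shift_continuous_approx:
  fixes u :: "'a::euclidean_space \<Rightarrow> 'b::{banach, second_countable_topology}"
  assumes u: "integrable lborel u"
    and ap: "\<And>e. 0 < e \<Longrightarrow> \<exists>g. integrable lborel g \<and> shift_continuous g \<and> (\<integral>x. norm (u x - g x) \<partial>lborel) < e"
  shows "shift_continuous u" unfolding shift_continuous_def
proof (intro allI impI LIMSEQ_I)
  fix Y :: "nat \<Rightarrow> 'a" and e :: real assume Y: "Y \<longlonglongrightarrow> 0" and e: "0 < e"
  then obtain g where g: "integrable lborel g" "shift_continuous g" "(\<integral>x. norm (u x - g x) \<partial>lborel) < e / 3"
    using ap[of "e / 3"] by auto
  have "(\<lambda>n. \<integral>x. norm (g (x + Y n) - g x) \<partial>lborel) \<longlonglongrightarrow> 0"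
    using g(2) Y by (simp add: shift_continuous_def)
  moreover have "0 < e / 3" using e by simp
  ultimately obtain n0 where n0: "\<forall>n\<ge>n0. norm ((\<integral>x. norm (g (x + Y n) - g x) \<partial>lborel) - 0) < e / 3"
    using LIMSEQ_D by blast
  have "(\<integral>x. norm (u (x + Y n) - u x) \<partial>lborel) < e" if n: "n \<ge> n0" for n
  proof -
    note iu = integrable_lborel_shift(1)[OF u, of "Y n"] and ig = integrable_lborel_shift(1)[OF g(1), of "Y n"]
    have "(\<integral>x. norm (u (x + Y n) - u x) \<partial>lborel)
        \<le> (\<integral>x. norm (u (x + Y n) - g (x + Y n)) + norm (g (x + Y n) - g x) + norm (u x - g x) \<partial>lborel)"
    proof (rule integral_mono)
      fix x
      have "u (x + Y n) - u x = (u (x + Y n) - g (x + Y n)) + (g (x + Y n) - g x) - (u x - g x)" by simp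
      then show "norm (u (x + Y n) - u x) \<le> norm (u (x + Y n) - g (x + Y n)) + norm (g (x + Y n) - g x) + norm (u x - g x)"
        using norm_triangle_ineq4[of "(u (x + Y n) - g (x + Y n)) + (g (x + Y n) - g x)" "u x - g x"]
          norm_triangle_ineq[of "u (x + Y n) - g (x + Y n)" "g (x + Y n) - g x"] by simp
    qed (use u g(1) iu ig in auto)
    also have "\<dots> = (\<integral>x. norm (u x - g x) \<partial>lborel) + (\<integral>x. norm (g (x + Y n) - g x) \<partial>lborel) + (\<integral>x. norm (u x - g x) \<partial>lborel)"
      using u g(1) iu ig integrable_lborel_shift(2)[of "\<lambda>x. u x - g x" "Y n"] by simp
    also have "\<dots> < e" using g(3) n0 n by fastforce
    finally show ?thesis .
  qed
  then show "\<exists>n0. \<forall>n\<ge>n0. norm ((\<integral>x. norm (u (x + Y n) - u x) \<partial>lborel) - 0) < e" by auto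
qed

lemma shift_continuous_indicator_open:
  fixes U :: "'a::euclidean_space set"
  assumes U: "open U" "emeasure lborel U < \<infinity>"
  shows "shift_continuous (indicator U :: 'a \<Rightarrow> real)" unfolding shift_continuous_def
proof (intro allI impI)
  fix Y :: "nat \<Rightarrow> 'a" assume Y: "Y \<longlonglongrightarrow> 0"
  have [measurable]: "U \<in> sets borel" using U by auto
  let ?i = "indicator U :: 'a \<Rightarrow> real"
  have iU: "integrable lborel ?i" using U(2) by (simp add: integrable_real_indicator)
  have lim: "(\<lambda>n. \<integral>x. ?i x * ?i (x + Y n) \<partial>lborel) \<longlonglongrightarrow> (\<integral>x. ?i x \<partial>lborel)"
  proof (rule integral_dominated_convergence[where w="?i"])
    show "AE x in lborel. (\<lambda>n. ?i x * ?i (x + Y n)) \<longlonglongrightarrow> ?i x"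
    proof (rule AE_I2)
      fix x
      show "(\<lambda>n. ?i x * ?i (x + Y n)) \<longlonglongrightarrow> ?i x"
      proof (cases "x \<in> U")
        case True
        have "(\<lambda>n. x + Y n) \<longlonglongrightarrow> x" using tendsto_add[OF tendsto_const Y, of x] by simp
        then have "\<forall>\<^sub>F n in sequentially. x + Y n \<in> U" using U(1) True by (rule topological_tendstoD)
        then have "\<forall>\<^sub>F n in sequentially. ?i x * ?i (x + Y n) = ?i x" by (rule eventually_mono) (simp add: True)
        then show ?thesis by (rule tendsto_eventually)
      qed simp
    qed
    show "AE x in lborel. norm (?i x * ?i (x + Y n)) \<le> ?i x" for n by (auto simp: indicator_def)
  qed (use iU in auto)
  have "(\<integral>x. norm (?i (x + Y n) - ?i x) \<partial>lborel) = 2 * ((\<integral>x. ?i x \<partial>lborel) - (\<integral>x. ?i x * ?i (x + Y n) \<partial>lborel))" for n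
  proof -
    note sh = integrable_lborel_shift[OF iU, of "Y n"]
    have ip: "integrable lborel (\<lambda>x. ?i x * ?i (x + Y n))" by (rule Bochner_Integration.integrable_bound[OF iU]) (auto simp: indicator_def)
    have "(\<integral>x. norm (?i (x + Y n) - ?i x) \<partial>lborel) = (\<integral>x. ?i (x + Y n) + ?i x - 2 * (?i x * ?i (x + Y n)) \<partial>lborel)"
      by (intro Bochner_Integration.integral_cong refl) (auto simp: indicator_def)
    also have "\<dots> = (\<integral>x. ?i (x + Y n) \<partial>lborel) + (\<integral>x. ?i x \<partial>lborel) - 2 * (\<integral>x. ?i x * ?i (x + Y n) \<partial>lborel)"
      using sh(1) iU ip by simp
    also have "(\<integral>x. ?i (x + Y n) \<partial>lborel) = (\<integral>x. ?i x \<partial>lborel)" using sh(2) by simp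
    finally show ?thesis by simp
  qed
  moreover have "(\<lambda>n. 2 * ((\<integral>x. ?i x \<partial>lborel) - (\<integral>x. ?i x * ?i (x + Y n) \<partial>lborel))) \<longlonglongrightarrow> 2 * ((\<integral>x. ?i x \<partial>lborel) - (\<integral>x. ?i x \<partial>lborel))"
    by (intro tendsto_intros lim)
  ultimately show "(\<lambda>n. \<integral>x. norm (?i (x + Y n) - ?i x) \<partial>lborel) \<longlonglongrightarrow> 0" by simp
qed

lemma shift_continuous_scaleR:
  fixes c :: "'b::{banach, second_countable_topology}"
  assumes "shift_continuous (i :: 'a::euclidean_space \<Rightarrow> real)"
  shows "shift_continuous (\<lambda>x. i x *\<^sub>R c)" using assms unfolding shift_continuous_def
  by (auto simp: scaleR_left_diff_distrib[symmetric] intro: tendsto_mult_left_zero)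

text \<open>Outer regularity reduces indicators of measurable sets to those of open sets, and simple functions
are dense.\<close>

lemma integrable_shift_continuous:
  fixes u :: "'a::euclidean_space \<Rightarrow> 'b::{banach, second_countable_topology}"
  assumes "integrable lborel u"
  shows "shift_continuous u" using assms
proof (induction rule: integrable_induct)
  case (base A c)
  have A: "A \<in> sets borel" "emeasure lborel A < \<infinity>" using base by auto
  have iA: "integrable lborel (indicator A :: 'a \<Rightarrow> real)" using A by (simp add: integrable_real_indicator)
  have "shift_continuous (indicator A :: 'a \<Rightarrow> real)"
  proof (rule shift_continuous_approx[OF iA])
    fix e :: real assume e: "0 < e"
    obtain U where U: "open U" "A \<subseteq> U" "emeasure lborel (U - A) < ennreal e" using outer_regular_lborel[OF A(1) e] by blast
    have fU: "emeasure lborel U < \<infinity>"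
    proof -
      have "emeasure lborel U = emeasure lborel (U - A) + emeasure lborel A" using U A by (subst plus_emeasure) (auto simp: Un_absorb2)
      also have "\<dots> < \<infinity>" using U(3) A(2) by (auto simp: less_top[symmetric] ennreal_add_eq_top)
      finally show ?thesis .
    qed
    have iU: "integrable lborel (indicator U :: 'a \<Rightarrow> real)" using U fU by (simp add: integrable_real_indicator)
    have "(\<integral>x. norm (indicator A x - indicator U x :: real) \<partial>lborel) = (\<integral>x. indicator (U - A) x \<partial>lborel)"
      using U(2) by (intro Bochner_Integration.integral_cong refl) (auto simp: indicator_def)
    also have "\<dots> = measure lborel (U - A)" by simp
    also have "\<dots> < e"
    proof -
      have "emeasure lborel (U - A) = ennreal (measure lborel (U - A))" using U(3) by (intro emeasure_eq_ennreal_measure) auto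
      then show ?thesis using U(3) e by (simp add: ennreal_less_iff)
    qed
    finally show "\<exists>g. integrable lborel g \<and> shift_continuous g \<and> (\<integral>x. norm (indicator A x - g x :: real) \<partial>lborel) < e"
      using iU shift_continuous_indicator_open[OF U(1) fU] by blast
  qed
  then show ?case by (rule shift_continuous_scaleR)
next
  case (add f g)
  show ?case unfolding shift_continuous_def
  proof (intro allI impI)
    fix Y :: "nat \<Rightarrow> 'a" assume Y: "Y \<longlonglongrightarrow> 0"
    let ?S = "\<lambda>u n. \<integral>x. norm (u (x + Y n) - u x :: 'b) \<partial>lborel"
    have sum: "(\<lambda>n. ?S f n + ?S g n) \<longlonglongrightarrow> 0"
    proof -
      have "(\<lambda>n. ?S f n) \<longlonglongrightarrow> 0" "(\<lambda>n. ?S g n) \<longlonglongrightarrow> 0"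
        using add(3,4) Y unfolding shift_continuous_def by blast+
      from tendsto_add[OF this] show ?thesis by simp
    qed
    have le: "?S (\<lambda>x. f x + g x) n \<le> ?S f n + ?S g n" for n
    proof -
      note i = integrable_lborel_shift(1)[OF add(1), of "Y n"] integrable_lborel_shift(1)[OF add(2), of "Y n"]
      have "?S (\<lambda>x. f x + g x) n \<le> (\<integral>x. norm (f (x + Y n) - f x) + norm (g (x + Y n) - g x) \<partial>lborel)"
        using add(1,2) i by (intro integral_mono) (auto simp: add_diff_add norm_triangle_ineq)
      also have "\<dots> = ?S f n + ?S g n" using add(1,2) i by simp
      finally show ?thesis .
    qed
    show "?S (\<lambda>x. f x + g x) \<longlonglongrightarrow> 0" by (rule tendsto_sandwich[OF always_eventually always_eventually tendsto_const sum])
        (use le in \<open>simp_all add: Bochner_Integration.integral_nonneg\<close>)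
  qed
next
  case (lim f s)
  show ?case
  proof (rule shift_continuous_approx[OF lim(4)])
    fix e :: real assume e: "0 < e"
    have "(\<lambda>i. \<integral>x. norm (f x - s i x) \<partial>lborel) \<longlonglongrightarrow> (\<integral>x. 0 \<partial>(lborel :: 'a measure))"
    proof (rule integral_dominated_convergence[where w="\<lambda>x. 3 * norm (f x)"])
      show "AE x in lborel. (\<lambda>i. norm (f x - s i x)) \<longlonglongrightarrow> 0"
      proof (rule AE_I2)
        fix x
        have "(\<lambda>i. f x - s i x) \<longlonglongrightarrow> f x - f x" using lim(2)[of x] by (intro tendsto_intros) auto
        then show "(\<lambda>i. norm (f x - s i x)) \<longlonglongrightarrow> 0" by (simp add: tendsto_norm_zero)
      qed
      show "AE x in lborel. norm (norm (f x - s i x)) \<le> 3 * norm (f x)" for i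
      proof (rule AE_I2)
        fix x show "norm (norm (f x - s i x)) \<le> 3 * norm (f x)" using lim(3)[of x i] norm_triangle_ineq4[of "f x" "s i x"] by simp
      qed
    qed (use lim(1,4) in auto)
    then have "(\<lambda>i. \<integral>x. norm (f x - s i x) \<partial>lborel) \<longlonglongrightarrow> 0" by simp
    then obtain i where "norm ((\<integral>x. norm (f x - s i x) \<partial>lborel) - 0) < e" using LIMSEQ_D[OF _ e] by blast
    then show "\<exists>g. integrable lborel g \<and> shift_continuous g \<and> (\<integral>x. norm (f x - g x) \<partial>lborel) < e"
      using lim(1,5) by (intro exI[of _ "s i"]) auto
  qed
qed

lemma shift_continuous_small:
  fixes u :: "'a::euclidean_space \<Rightarrow> 'b::{banach, second_countable_topology}"
  assumes u: "integrable lborel u" and e: "0 < e"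
  shows "\<exists>d>0. \<forall>y. norm y < d \<longrightarrow> (\<integral>x. norm (u (x + y) - u x) \<partial>lborel) < e"
proof (rule ccontr)
  let ?S = "\<lambda>y. \<integral>x. norm (u (x + y) - u x) \<partial>lborel"
  assume neg: "\<not> ?thesis"
  have "\<exists>y. norm y < 1 / real (Suc n) \<and> e \<le> ?S y" for n
  proof -
    have "0 < 1 / real (Suc n)" by simp
    then show ?thesis using neg not_le by blast
  qed
  then obtain Y where Y: "\<And>n. norm (Y n) < 1 / real (Suc n)" "\<And>n. e \<le> ?S (Y n)" by metis
  have "Y \<longlonglongrightarrow> 0" by (rule LIMSEQ_norm_0) (rule Y)
  then have "(\<lambda>n. ?S (Y n)) \<longlonglongrightarrow> 0" using integrable_shift_continuous[OF u] by (simp add: shift_continuous_def)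
  from LIMSEQ_D[OF this e] obtain n where "norm (?S (Y n) - 0) < e" by blast
  then show False using Y(2)[of n] by simp
qed

section \<open>Evaluation of curves\<close>

abbreviation closed_time :: "real \<Rightarrow> real measure" where
  "closed_time T \<equiv> restrict_space lborel {0..T}"

lemma closed_time_measurable: "f \<in> borel_measurable borel \<Longrightarrow> f \<in> borel_measurable (closed_time T)"
  by (rule measurable_restrict_space1) simp

lemma ident_closed_time: "(\<lambda>s. s) \<in> closed_time T \<rightarrow>\<^sub>M borel"
  by (rule measurable_restrict_space1) simp

lemma set_integrable_closed_time:
  fixes f :: "real \<Rightarrow> 'b::{banach, second_countable_topology}"
  shows "set_integrable lborel {0..T} f \<longleftrightarrow> integrable (closed_time T) f"
  by (simp add: set_integrable_def integrable_restrict_space)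

lemma set_integral_closed_time:
  fixes f :: "real \<Rightarrow> 'b::{banach, second_countable_topology}"
  shows "(LINT s:{0..T}|lborel. f s) = (\<integral>s. f s \<partial>closed_time T)" by (simp add: set_lebesgue_integral_def integral_restrict_space)

lemma sobolev_has_velocity:
  assumes "sobolev_curve T p \<gamma>"
  shows "has_velocity T \<gamma> (velocity T \<gamma>)"
proof -
  have "\<exists>v. has_velocity T \<gamma> v" using assms unfolding sobolev_curve_def by blast
  then show ?thesis unfolding velocity_def by (rule someI_ex)
qed

lemma continuous_eval: "continuous_on UNIV (\<lambda>\<gamma> :: 'd::finite curve. apply_bcontfun \<gamma> s)"
proof (rule continuous_onI)
  fix \<gamma> :: "'d curve" and e :: real assume "0 < e"
  then show "\<exists>d>0. \<forall>\<gamma>'\<in>UNIV. dist \<gamma>' \<gamma> < d \<longrightarrow> dist (apply_bcontfun \<gamma>' s) (apply_bcontfun \<gamma> s) \<le> e"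
    using dist_bounded[of _ s \<gamma>] by (intro exI[of _ e]) (auto intro: order_trans less_imp_le)
qed

lemma continuous_curve: "continuous_on S (apply_bcontfun (\<gamma> :: 'd::finite curve))"
  by (rule continuous_on_apply_bcontfun)

lemma space_curve_space: "space (curve_space T) = curves T"
  by (simp add: curve_space_def space_restrict_space)

lemma eval_measurable: "(\<lambda>\<gamma>. apply_bcontfun \<gamma> s) \<in> borel_measurable (curve_space T)"
  unfolding curve_space_def by (intro measurable_restrict_space1 borel_measurable_continuous_onI continuous_eval)

lemma grid_tendsto: "(\<lambda>n. of_int \<lfloor>real (Suc n) * s\<rfloor> / real (Suc n)) \<longlonglongrightarrow> (s :: real)"
proof (rule LIMSEQ_I)
  fix e :: real assume "0 < e"
  then obtain N where N: "inverse (real (Suc N)) < e" using reals_Archimedean by blast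
  have "norm (of_int \<lfloor>real (Suc n) * s\<rfloor> / real (Suc n) - s) < e" if "N \<le> n" for n
  proof -
    have "\<bar>of_int \<lfloor>real (Suc n) * s\<rfloor> - real (Suc n) * s\<bar> \<le> 1" by linarith
    then have "\<bar>(of_int \<lfloor>real (Suc n) * s\<rfloor> - real (Suc n) * s) / real (Suc n)\<bar> \<le> 1 / real (Suc n)"
      unfolding abs_divide by (intro divide_mono) auto
    also have "(of_int \<lfloor>real (Suc n) * s\<rfloor> - real (Suc n) * s) / real (Suc n) = of_int \<lfloor>real (Suc n) * s\<rfloor> / real (Suc n) - s"
      by (simp add: diff_divide_distrib)
    also have "1 / real (Suc n) \<le> inverse (real (Suc N))" using that by (simp add: inverse_eq_divide frac_le)
    finally show ?thesis using N by simp
  qed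
  then show "\<exists>N. \<forall>n\<ge>N. norm (of_int \<lfloor>real (Suc n) * s\<rfloor> / real (Suc n) - s) < e" by blast
qed

text \<open>By continuity a curve is the limit of its values at grid times, and only countably many grid times
are used.\<close>

lemma eval_joint_measurable:
  fixes f :: "'a \<Rightarrow> 'd::finite curve"
  assumes f: "f \<in> M \<rightarrow>\<^sub>M curve_space T" and g[measurable]: "g \<in> borel_measurable M"
  shows "(\<lambda>x. apply_bcontfun (f x) (g x)) \<in> borel_measurable M"
proof (rule borel_measurable_LIMSEQ_metric)
  fix n
  have "(\<lambda>x. \<lfloor>real (Suc n) * g x\<rfloor>) \<in> M \<rightarrow>\<^sub>M count_space UNIV" by measurable
  then show "(\<lambda>x. apply_bcontfun (f x) (of_int \<lfloor>real (Suc n) * g x\<rfloor> / real (Suc n))) \<in> borel_measurable M"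
    by (rule measurable_compose_countable[where f="\<lambda>i x. apply_bcontfun (f x) (of_int i / real (Suc n))", rotated])
       (rule measurable_compose[OF f eval_measurable])
next
  fix x
  have "continuous_on UNIV (apply_bcontfun (f x))" by (rule continuous_curve)
  then have "isCont (apply_bcontfun (f x)) (g x)" using continuous_on_eq_continuous_at[OF open_UNIV] by blast
  then show "(\<lambda>n. apply_bcontfun (f x) (of_int \<lfloor>real (Suc n) * g x\<rfloor> / real (Suc n))) \<longlonglongrightarrow> apply_bcontfun (f x) (g x)"
    by (rule isCont_tendsto_compose[OF _ grid_tendsto])
qed

section \<open>Velocities as limits of difference quotients\<close>

text \<open>The velocity of a curve is chosen arbitrarily up to null sets. Difference quotients provide a
version that depends measurably on the curve; \<open>crep\<close> recovers a short increment from its class.\<close>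

definition diffq :: "nat \<Rightarrow> 'd::finite curve \<Rightarrow> real \<Rightarrow> real ^ 'd" where
  "diffq n \<gamma> s = real (Suc n) *\<^sub>R crep (apply_bcontfun \<gamma> (s + 1 / real (Suc n)) - apply_bcontfun \<gamma> s)"

lemma diffq_measurable:
  fixes f :: "'a \<Rightarrow> 'd::finite curve"
  assumes f: "f \<in> M \<rightarrow>\<^sub>M curve_space T" and g[measurable]: "g \<in> borel_measurable M"
  shows "(\<lambda>x. diffq n (f x) (g x)) \<in> borel_measurable M"
proof -
  have [measurable]: "(\<lambda>x. apply_bcontfun (f x) (g x + 1 / real (Suc n))) \<in> borel_measurable M"
    "(\<lambda>x. apply_bcontfun (f x) (g x)) \<in> borel_measurable M" by (intro eval_joint_measurable[OF f]; measurable)+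
  show ?thesis unfolding diffq_def by measurable
qed

lemma diffq_measurable_time: "\<gamma> \<in> curves T \<Longrightarrow> diffq n \<gamma> \<in> borel_measurable (closed_time T)"
  by (rule diffq_measurable[where f="\<lambda>_. \<gamma>" and T=T])
    (auto simp: space_curve_space intro: ident_closed_time)

text \<open>Eventually all increments are shorter than \<open>1/2\<close>, so that \<open>crep\<close> returns the increment of the lift.
Its difference quotient is an average of translates of \<open>v\<close>, and translation is continuous in the
mean.\<close>

lemma diffq_L1:
  fixes \<gamma> :: "'d::finite curve"
  assumes T: "0 < T" and \<gamma>: "\<gamma> \<in> curves T" and hv: "has_velocity T \<gamma> v" and e: "0 < e"
  obtains n0 where "\<And>n. n0 \<le> n \<Longrightarrow> (\<integral>\<^sup>+s. ennreal (norm (diffq n \<gamma> s - v s)) \<partial>closed_time T) \<le> ennreal e"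
proof -
  define w where "w = (\<lambda>s. indicator {0..T} s *\<^sub>R v s)"
  have w: "integrable lborel w" using hv by (simp add: w_def has_velocity_def set_integrable_def)
  then have [measurable]: "w \<in> borel_measurable borel" by simp
  have curve: "apply_bcontfun \<gamma> t = apply_bcontfun \<gamma> 0 + to_torus (\<integral>x. indicator {0..t} x *\<^sub>R w x \<partial>lborel)" if "0 \<le> t" for t
  proof -
    have "apply_bcontfun \<gamma> t = apply_bcontfun \<gamma> (max 0 (min T t))" using \<gamma> unfolding curves_def by blast
    also have "max 0 (min T t) = min T t" using that T by simp
    also have "apply_bcontfun \<gamma> (min T t) = apply_bcontfun \<gamma> 0 + to_torus (LINT x:{0..min T t}|lborel. v x)"
    proof (rule bspec[of "{0..T}"])
      show "\<forall>t\<in>{0..T}. apply_bcontfun \<gamma> t = apply_bcontfun \<gamma> 0 + to_torus (LINT x:{0..t}|lborel. v x)"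
        using hv unfolding has_velocity_def by blast
    qed (use that T in auto)
    also have "(LINT x:{0..min T t}|lborel. v x) = (\<integral>x. indicator {0..t} x *\<^sub>R w x \<partial>lborel)"
      unfolding set_lebesgue_integral_def w_def by (intro Bochner_Integration.integral_cong refl) (auto simp: indicator_def)
    finally show ?thesis .
  qed
  have iw: "integrable lborel (\<lambda>x. indicator A x *\<^sub>R w x)" if "A \<in> sets borel" for A
    by (rule Bochner_Integration.integrable_bound[OF w]) (use that in \<open>auto simp: indicator_def\<close>)
  have diff: "(\<integral>x. indicator {0..t} x *\<^sub>R w x \<partial>lborel) - (\<integral>x. indicator {0..s} x *\<^sub>R w x \<partial>lborel)
      = (\<integral>x. indicator {s<..t} x *\<^sub>R w x \<partial>lborel)" if "0 \<le> s" "s \<le> t" for s t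
  proof -
    have "(\<integral>x. indicator {0..t} x *\<^sub>R w x \<partial>lborel) - (\<integral>x. indicator {0..s} x *\<^sub>R w x \<partial>lborel)
      = (\<integral>x. indicator {0..t} x *\<^sub>R w x - indicator {0..s} x *\<^sub>R w x \<partial>lborel)"
      using iw by (intro Bochner_Integration.integral_diff[symmetric]) auto
    also have "\<dots> = (\<integral>x. indicator {s<..t} x *\<^sub>R w x \<partial>lborel)"
      using that by (intro Bochner_Integration.integral_cong refl) (auto simp: indicator_def)
    finally show ?thesis .
  qed
  \<comment> \<open>the increments are small, hence seen by the canonical representative\<close>
  define N where "N = (\<lambda>t. integral {0..t} (\<lambda>x. norm (w x)))"
  have Ni: "(\<lambda>x. norm (w x)) integrable_on {0..T + 1}"
  proof -
    have "set_integrable lborel {0..T + 1} (\<lambda>x. norm (w x))" unfolding set_integrable_def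
      by (rule Bochner_Integration.integrable_bound[OF w]) (auto simp: indicator_def)
    then show ?thesis by (rule set_borel_integral_eq_integral(1))
  qed
  have "continuous_on {0..T + 1} N" unfolding N_def by (rule indefinite_integral_continuous_1[OF Ni])
  then have "uniformly_continuous_on {0..T + 1} N" by (rule compact_uniformly_continuous) simp
  moreover have "(0::real) < 1/2" by simp
  ultimately obtain d0 where d0: "0 < d0" "\<And>s t. s \<in> {0..T + 1} \<Longrightarrow> t \<in> {0..T + 1} \<Longrightarrow> dist t s < d0 \<Longrightarrow> dist (N t) (N s) < 1/2"
    unfolding uniformly_continuous_on_def by metis
  obtain d1 where d1: "0 < d1" "\<And>y. norm y < d1 \<Longrightarrow> (\<integral>x. norm (w (x + y) - w x) \<partial>lborel) < e"
    using shift_continuous_small[OF w e] by blast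
  obtain n0 where n0: "inverse (real (Suc n0)) < min d0 d1" using reals_Archimedean[of "min d0 d1"] d0(1) d1(1) by auto
  show thesis
  proof (rule that[of n0])
    fix n assume n: "n0 \<le> n"
    define k where "k = real (Suc n)"
    have k: "1 \<le> k" "1 / k < d0" "1 / k < d1" "0 < k"
    proof -
      have "1 / k \<le> inverse (real (Suc n0))" using n by (simp add: k_def inverse_eq_divide frac_le)
      then show "1 / k < d0" "1 / k < d1" using n0 by auto
    qed (simp_all add: k_def)
    have dq: "diffq n \<gamma> s = k *\<^sub>R (\<integral>x. indicator {s<..s + 1 / k} x *\<^sub>R w x \<partial>lborel)" if s: "s \<in> {0..T}" for s
    proof -
      let ?I = "\<integral>x. indicator {s<..s + 1 / k} x *\<^sub>R w x \<partial>lborel"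
      have k1: "1 / k \<le> 1" "0 \<le> 1 / k" using k by auto
      have "norm ?I \<le> (\<integral>x. norm (indicator {s<..s + 1 / k} x *\<^sub>R w x) \<partial>lborel)" by (rule integral_norm_bound)
      also have "\<dots> \<le> (\<integral>x. indicator {s..s + 1 / k} x *\<^sub>R norm (w x) \<partial>lborel)"
      proof (rule integral_mono)
        show "integrable lborel (\<lambda>x. norm (indicator {s<..s + 1 / k} x *\<^sub>R w x))" by (intro integrable_norm iw) simp
        show "integrable lborel (\<lambda>x. indicator {s..s + 1 / k} x *\<^sub>R norm (w x))"
          by (rule Bochner_Integration.integrable_bound[OF w]) (auto simp: indicator_def)
      qed (auto simp: indicator_def)
      also have "\<dots> = integral {s..s + 1 / k} (\<lambda>x. norm (w x))"
      proof -
        have "set_integrable lborel {s..s + 1 / k} (\<lambda>x. norm (w x))" unfolding set_integrable_def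
          by (rule Bochner_Integration.integrable_bound[OF w]) (auto simp: indicator_def)
        from set_borel_integral_eq_integral(2)[OF this] show ?thesis by (simp add: set_lebesgue_integral_def)
      qed
      also have "\<dots> = N (s + 1 / k) - N s"
      proof -
        have "(\<lambda>x. norm (w x)) integrable_on {0..s + 1 / k}" by (rule integrable_on_subinterval[OF Ni]) (use s k1 in auto)
        from Henstock_Kurzweil_Integration.integral_combine[OF _ _ this, of s] show ?thesis using s k1 by (simp add: N_def)
      qed
      also have "\<dots> < 1/2"
      proof -
        have "dist (N (s + 1 / k)) (N s) < 1/2" using s k1 k(2) by (intro d0(2)) (auto simp: dist_real_def)
        then show ?thesis unfolding dist_real_def by linarith
      qed
      finally have small: "norm ?I < 1/2" .
      have "apply_bcontfun \<gamma> (s + 1 / k) - apply_bcontfun \<gamma> s = to_torus ?I"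
        using s k1 curve[of s] curve[of "s + 1 / k"] diff[of s "s + 1 / k"] by (simp add: to_torus_diff[symmetric])
      moreover have "crep (to_torus ?I) = ?I"
      proof (rule crep_to_torus)
        fix i show "- 1/2 \<le> ?I $ i \<and> ?I $ i < 1/2" using component_le_norm_cart[of ?I i] small by linarith
      qed
      ultimately show ?thesis by (simp add: diffq_def k_def)
    qed
    have bound: "ennreal (norm (diffq n \<gamma> s - v s))
        \<le> ennreal k * (\<integral>\<^sup>+y. ennreal (norm (w (s + y) - w s)) * indicator {0<..1 / k} y \<partial>lborel)" if s: "s \<in> {0..T}" for s
    proof -
      have shift: "(\<integral>x. indicator {s<..s + 1 / k} x *\<^sub>R w x \<partial>lborel) = (\<integral>y. indicator {0<..1 / k} y *\<^sub>R w (s + y) \<partial>lborel)"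
        by (subst lborel_integral_real_affine[of 1 _ s]) (auto intro!: Bochner_Integration.integral_cong simp: indicator_def)
      have i1: "integrable lborel (\<lambda>y. indicator {0<..1 / k} y *\<^sub>R w (s + y))" using integrable_lborel_shift(1)[OF w, of s]
        by (rule Bochner_Integration.integrable_bound) (auto simp: indicator_def add.commute)
      have i2: "integrable lborel (\<lambda>y. indicator {0<..1 / k} y *\<^sub>R w s)"
        using k by (intro integrable_scaleR_left integrable_real_indicator) auto
      have ws: "w s = k *\<^sub>R (\<integral>y. indicator {0<..1 / k} y *\<^sub>R w s \<partial>lborel)" using k by simp
      have "diffq n \<gamma> s - v s = k *\<^sub>R (\<integral>y. indicator {0<..1 / k} y *\<^sub>R w (s + y) - indicator {0<..1 / k} y *\<^sub>R w s \<partial>lborel)"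
      proof -
        have "v s = w s" using s by (simp add: w_def)
        then have "diffq n \<gamma> s - v s = k *\<^sub>R (\<integral>y. indicator {0<..1 / k} y *\<^sub>R w (s + y) \<partial>lborel) - k *\<^sub>R (\<integral>y. indicator {0<..1 / k} y *\<^sub>R w s \<partial>lborel)"
          using dq[OF s] ws by (simp only: shift)
        then show ?thesis by (simp only: scaleR_right_diff_distrib Bochner_Integration.integral_diff[OF i1 i2])
      qed
      then have "ennreal (norm (diffq n \<gamma> s - v s)) = ennreal k * ennreal (norm (\<integral>y. indicator {0<..1 / k} y *\<^sub>R w (s + y) - indicator {0<..1 / k} y *\<^sub>R w s \<partial>lborel))"
        using k by (simp add: ennreal_mult')
      also have "\<dots> \<le> ennreal k * (\<integral>\<^sup>+y. ennreal (norm (indicator {0<..1 / k} y *\<^sub>R w (s + y) - indicator {0<..1 / k} y *\<^sub>R w s)) \<partial>lborel)"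
        using i1 i2 by (intro mult_left_mono integral_norm_bound_ennreal) auto
      also have "(\<integral>\<^sup>+y. ennreal (norm (indicator {0<..1 / k} y *\<^sub>R w (s + y) - indicator {0<..1 / k} y *\<^sub>R w s)) \<partial>lborel)
          = (\<integral>\<^sup>+y. ennreal (norm (w (s + y) - w s)) * indicator {0<..1 / k} y \<partial>lborel)"
        by (intro nn_integral_cong) (auto simp: indicator_def)
      finally show ?thesis .
    qed
    have "(\<integral>\<^sup>+s. ennreal (norm (diffq n \<gamma> s - v s)) \<partial>closed_time T)
        \<le> (\<integral>\<^sup>+s. ennreal k * (\<integral>\<^sup>+y. ennreal (norm (w (s + y) - w s)) * indicator {0<..1 / k} y \<partial>lborel) * indicator {0..T} s \<partial>lborel)"
    proof -
      have "(\<integral>\<^sup>+s. ennreal (norm (diffq n \<gamma> s - v s)) \<partial>closed_time T)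
          = (\<integral>\<^sup>+s. ennreal (norm (diffq n \<gamma> s - v s)) * indicator {0..T} s \<partial>lborel)"
        by (rule nn_integral_restrict_space) simp
      also have "\<dots> \<le> (\<integral>\<^sup>+s. ennreal k * (\<integral>\<^sup>+y. ennreal (norm (w (s + y) - w s)) * indicator {0<..1 / k} y \<partial>lborel) * indicator {0..T} s \<partial>lborel)"
      proof (rule nn_integral_mono)
        fix s
        show "ennreal (norm (diffq n \<gamma> s - v s)) * indicator {0..T} s
            \<le> ennreal k * (\<integral>\<^sup>+y. ennreal (norm (w (s + y) - w s)) * indicator {0<..1 / k} y \<partial>lborel) * indicator {0..T} s"
          using bound[of s] by (cases "s \<in> {0..T}") simp_all
      qed
      finally show ?thesis .
    qed
    also have "\<dots> \<le> (\<integral>\<^sup>+s. ennreal k * (\<integral>\<^sup>+y. ennreal (norm (w (s + y) - w s)) * indicator {0<..1 / k} y \<partial>lborel) \<partial>lborel)"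
      by (intro nn_integral_mono) (auto simp: indicator_def)
    also have "\<dots> = ennreal k * (\<integral>\<^sup>+s. \<integral>\<^sup>+y. ennreal (norm (w (s + y) - w s)) * indicator {0<..1 / k} y \<partial>lborel \<partial>lborel)"
      by (rule nn_integral_cmult) measurable
    also have "(\<integral>\<^sup>+s. \<integral>\<^sup>+y. ennreal (norm (w (s + y) - w s)) * indicator {0<..1 / k} y \<partial>lborel \<partial>lborel)
        = (\<integral>\<^sup>+y. \<integral>\<^sup>+s. ennreal (norm (w (s + y) - w s)) * indicator {0<..1 / k} y \<partial>lborel \<partial>lborel)"
      by (rule lborel_pair.Fubini') measurable
    also have "\<dots> \<le> (\<integral>\<^sup>+y. ennreal e * indicator {0<..1 / k} y \<partial>lborel)"
    proof (rule nn_integral_mono)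
      fix y :: real
      show "(\<integral>\<^sup>+s. ennreal (norm (w (s + y) - w s)) * indicator {0<..1 / k} y \<partial>lborel) \<le> ennreal e * indicator {0<..1 / k} y"
      proof (cases "y \<in> {0<..1 / k}")
        case True
        then have "(\<integral>s. norm (w (s + y) - w s) \<partial>lborel) < e" using k(3) by (intro d1(2)) auto
        moreover have "(\<integral>\<^sup>+s. ennreal (norm (w (s + y) - w s)) \<partial>lborel) = ennreal (\<integral>s. norm (w (s + y) - w s) \<partial>lborel)"
          using integrable_lborel_shift(1)[OF w, of y] w by (intro nn_integral_eq_integral) auto
        ultimately show ?thesis using True by (simp add: ennreal_leI)
      qed simp
    qed
    also have "\<dots> = ennreal e * ennreal (1 / k)" using k by (simp add: nn_integral_cmult_indicator)
    also have "ennreal k * (ennreal e * ennreal (1 / k)) = ennreal e" using k e by (simp add: ennreal_mult'[symmetric])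
    finally show "(\<integral>\<^sup>+s. ennreal (norm (diffq n \<gamma> s - v s)) \<partial>closed_time T) \<le> ennreal e"
      using mult_left_mono by (metis (no_types, lifting) zero_le)
  qed
qed

definition gap :: "real \<Rightarrow> nat \<Rightarrow> nat \<Rightarrow> 'd::finite curve \<Rightarrow> ennreal" where
  "gap T n m \<gamma> = (\<integral>\<^sup>+s. ennreal (norm (diffq n \<gamma> s - diffq m \<gamma> s)) \<partial>closed_time T)"

text \<open>Along these indices the quotients are summably close in the mean, hence converge almost everywhere;
taking the least index keeps the choice measurable in the curve.\<close>

definition rank :: "real \<Rightarrow> nat \<Rightarrow> 'd::finite curve \<Rightarrow> nat" where
  "rank T k \<gamma> = (LEAST n. \<forall>m\<ge>n. gap T n m \<gamma> \<le> ennreal ((1 / 2) ^ k))"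

definition vel :: "real \<Rightarrow> 'd::finite curve \<Rightarrow> real \<Rightarrow> real ^ 'd" where
  "vel T \<gamma> s = lim (\<lambda>k. diffq (rank T k \<gamma>) \<gamma> s)"

lemma sigma_finite_closed_time: "sigma_finite_measure (closed_time T)"
  using finite_restrict_lborel[of "{0..T}"] by (simp add: finite_measure_def)

lemma fst_curve: "fst \<in> curve_space T \<Otimes>\<^sub>M M \<rightarrow>\<^sub>M curve_space T" by simp

lemma snd_time: "snd \<in> N \<Otimes>\<^sub>M closed_time T \<rightarrow>\<^sub>M borel"
  by (rule measurable_compose[OF measurable_snd ident_closed_time])

lemma gap_measurable: "gap T n m \<in> borel_measurable (curve_space T)"
proof -
  interpret sigma_finite_measure "closed_time T" by (rule sigma_finite_closed_time)
  have [measurable]: "(\<lambda>q. diffq n (fst q) (snd q)) \<in> borel_measurable (curve_space T \<Otimes>\<^sub>M closed_time T)" for n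
    by (rule diffq_measurable[OF fst_curve snd_time])
  have "(\<lambda>\<gamma>. \<integral>\<^sup>+s. ennreal (norm (diffq n (fst (\<gamma>, s)) (snd (\<gamma>, s)) - diffq m (fst (\<gamma>, s)) (snd (\<gamma>, s)))) \<partial>closed_time T)
      \<in> borel_measurable (curve_space T)" by (rule borel_measurable_nn_integral) (simp only: case_prod_unfold fst_conv snd_conv, measurable)
  then show ?thesis by (simp add: gap_def[abs_def])
qed

lemma rank_measurable: "rank T k \<in> curve_space T \<rightarrow>\<^sub>M count_space UNIV"
proof -
  note [measurable] = gap_measurable
  show ?thesis unfolding rank_def by measurable
qed

lemma vel_measurable:
  fixes f :: "'a \<Rightarrow> 'd::finite curve"
  assumes f: "f \<in> M \<rightarrow>\<^sub>M curve_space T" and g: "g \<in> borel_measurable M"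
  shows "(\<lambda>x. vel T (f x) (g x)) \<in> borel_measurable M" unfolding vel_def
proof (rule borel_measurable_lim_metric)
  fix k
  show "(\<lambda>x. diffq (rank T k (f x)) (f x) (g x)) \<in> borel_measurable M"
    by (rule measurable_compose_countable[where f="\<lambda>n x. diffq n (f x) (g x)"])
      (rule diffq_measurable[OF f g], rule measurable_compose[OF f rank_measurable])
qed

lemma vel_eq_velocity:
  fixes \<gamma> :: "'d::finite curve"
  assumes T: "0 < T" and \<gamma>: "\<gamma> \<in> curves T" and hv: "has_velocity T \<gamma> v"
  shows "AE s in closed_time T. vel T \<gamma> s = v s"
proof -
  note dm[measurable] = diffq_measurable_time[OF \<gamma>]
  have vi: "integrable (closed_time T) v" using hv by (simp add: has_velocity_def set_integrable_closed_time)
  then have [measurable]: "v \<in> borel_measurable (closed_time T)" by auto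
  let ?I = "\<lambda>n. \<integral>\<^sup>+s. ennreal (norm (diffq n \<gamma> s - v s)) \<partial>closed_time T"
  have tri: "ennreal (norm (a - b)) \<le> ennreal (norm (a - c)) + ennreal (norm (b - c))" for a b c :: "real ^ 'd"
    using norm_triangle_ineq4[of "a - c" "b - c"] by (simp add: ennreal_plus[symmetric] ennreal_leI del: ennreal_plus)
  have "\<exists>n. \<forall>m\<ge>n. gap T n m \<gamma> \<le> ennreal ((1 / 2) ^ k)" for k
  proof -
    have e: "0 < (1 / 2 :: real) ^ k / 2" by simp
    obtain n where n: "\<And>m. n \<le> m \<Longrightarrow> ?I m \<le> ennreal ((1 / 2) ^ k / 2)" using diffq_L1[OF T \<gamma> hv e] by metis
    have "gap T n m \<gamma> \<le> ennreal ((1 / 2) ^ k)" if "n \<le> m" for m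
    proof -
      have "gap T n m \<gamma> \<le> (\<integral>\<^sup>+s. ennreal (norm (diffq n \<gamma> s - v s)) + ennreal (norm (diffq m \<gamma> s - v s)) \<partial>closed_time T)"
        unfolding gap_def by (intro nn_integral_mono tri)
      also have "\<dots> = ?I n + ?I m" by (rule nn_integral_add) measurable
      also have "\<dots> \<le> ennreal ((1 / 2) ^ k / 2) + ennreal ((1 / 2) ^ k / 2)" by (intro add_mono n order_refl that)
      also have "\<dots> = ennreal ((1 / 2) ^ k)" by (simp add: ennreal_plus[symmetric] del: ennreal_plus)
      finally show ?thesis .
    qed
    then show ?thesis by blast
  qed
  then have rank: "\<forall>m\<ge>rank T k \<gamma>. gap T (rank T k \<gamma>) m \<gamma> \<le> ennreal ((1 / 2) ^ k)" for k
    unfolding rank_def by (rule LeastI_ex)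
  have Ir: "?I (rank T k \<gamma>) \<le> ennreal ((1 / 2) ^ k)" for k
  proof (rule ennreal_le_epsilon)
    fix e :: real assume e: "0 < e"
    obtain n where n: "\<And>m. n \<le> m \<Longrightarrow> ?I m \<le> ennreal e" using diffq_L1[OF T \<gamma> hv e] by metis
    define m where "m = max n (rank T k \<gamma>)"
    have "?I (rank T k \<gamma>) \<le> (\<integral>\<^sup>+s. ennreal (norm (diffq (rank T k \<gamma>) \<gamma> s - diffq m \<gamma> s)) + ennreal (norm (diffq m \<gamma> s - v s)) \<partial>closed_time T)"
    proof (rule nn_integral_mono)
      fix s
      show "ennreal (norm (diffq (rank T k \<gamma>) \<gamma> s - v s)) \<le> ennreal (norm (diffq (rank T k \<gamma>) \<gamma> s - diffq m \<gamma> s)) + ennreal (norm (diffq m \<gamma> s - v s))"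
        using tri[of "diffq (rank T k \<gamma>) \<gamma> s" "v s" "diffq m \<gamma> s"] by (simp add: norm_minus_commute)
    qed
    also have "\<dots> = gap T (rank T k \<gamma>) m \<gamma> + ?I m" unfolding gap_def by (rule nn_integral_add) measurable
    also have "\<dots> \<le> ennreal ((1 / 2) ^ k) + ennreal e" using rank[of k] n[of m] by (intro add_mono) (auto simp: m_def)
    finally show "?I (rank T k \<gamma>) \<le> ennreal ((1 / 2) ^ k) + ennreal e" .
  qed
  have "(\<integral>\<^sup>+s. (\<Sum>k. ennreal (norm (diffq (rank T k \<gamma>) \<gamma> s - v s))) \<partial>closed_time T)
      = (\<Sum>k. ?I (rank T k \<gamma>))" by (rule nn_integral_suminf) measurable
  also have "\<dots> \<le> (\<Sum>k. ennreal ((1 / 2) ^ k))" by (intro suminf_le Ir) auto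
  also have "\<dots> = ennreal (\<Sum>k. (1 / 2) ^ k)" by (intro suminf_ennreal2) (auto intro: summable_geometric)
  also have "\<dots> < \<infinity>" by simp
  finally have fin: "(\<integral>\<^sup>+s. (\<Sum>k. ennreal (norm (diffq (rank T k \<gamma>) \<gamma> s - v s))) \<partial>closed_time T) \<noteq> \<infinity>" by simp
  have "AE s in closed_time T. (\<Sum>k. ennreal (norm (diffq (rank T k \<gamma>) \<gamma> s - v s))) \<noteq> \<infinity>"
    by (rule nn_integral_PInf_AE[OF _ fin]) measurable
  then show ?thesis
  proof (rule AE_mp, intro AE_I2 impI)
    fix s assume "(\<Sum>k. ennreal (norm (diffq (rank T k \<gamma>) \<gamma> s - v s))) \<noteq> \<infinity>"
    then have "summable (\<lambda>k. norm (diffq (rank T k \<gamma>) \<gamma> s - v s))" by (intro summable_suminf_not_top) auto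
    then have "(\<lambda>k. norm (diffq (rank T k \<gamma>) \<gamma> s - v s)) \<longlonglongrightarrow> 0" by (rule summable_LIMSEQ_zero)
    then have "(\<lambda>k. diffq (rank T k \<gamma>) \<gamma> s - v s) \<longlonglongrightarrow> 0" by (simp only: tendsto_norm_zero_iff)
    then have "(\<lambda>k. diffq (rank T k \<gamma>) \<gamma> s) \<longlonglongrightarrow> v s" by (rule LIM_zero_cancel)
    then show "vel T \<gamma> s = v s" unfolding vel_def by (rule limI)
  qed
qed

section \<open>Measurability of the action\<close>

definition grid :: "real \<Rightarrow> nat \<Rightarrow> nat \<Rightarrow> real" where
  "grid T i j = min T (real i / real (Suc j))"

lemma grid_dense:
  assumes "t \<in> {0..T}"
  shows "(\<lambda>j. grid T (nat \<lfloor>real (Suc j) * t\<rfloor>) j) \<longlonglongrightarrow> t"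
proof -
  have "(\<lambda>j. min T (of_int \<lfloor>real (Suc j) * t\<rfloor> / real (Suc j))) \<longlonglongrightarrow> min T t"
    by (intro tendsto_min tendsto_const grid_tendsto)
  moreover have "0 \<le> \<lfloor>real (Suc j) * t\<rfloor>" for j using assms by (simp add: zero_le_mult_iff)
  ultimately show ?thesis using assms by (simp add: grid_def min_absorb2)
qed

text \<open>Equality is expressed by a vanishing distance, whose measurability in the curve is immediate.\<close>

definition rides :: "real \<Rightarrow> 'd::finite curve \<Rightarrow> nat \<Rightarrow> nat \<Rightarrow> bool" where
  "rides T \<gamma> i j \<longleftrightarrow> dist (apply_bcontfun \<gamma> (grid T i j))
     (apply_bcontfun \<gamma> 0 + to_torus (\<integral>s. indicator {0..grid T i j} s *\<^sub>R vel T \<gamma> s \<partial>closed_time T)) = 0"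

definition tame :: "real \<Rightarrow> real \<Rightarrow> 'd::finite curve \<Rightarrow> bool" where
  "tame T p \<gamma> \<longleftrightarrow> (\<integral>\<^sup>+s. ennreal (norm (vel T \<gamma> s)) \<partial>closed_time T) < \<infinity> \<and> (\<forall>i j. rides T \<gamma> i j) \<and>
     (\<integral>\<^sup>+s. ennreal (norm (vel T \<gamma> s) powr p) \<partial>closed_time T) < \<infinity>"

lemma vel_measurable_time: "\<gamma> \<in> curves T \<Longrightarrow> vel T \<gamma> \<in> borel_measurable (closed_time T)"
  by (rule vel_measurable[where f="\<lambda>_. \<gamma>" and T=T])
    (auto simp: space_curve_space intro: ident_closed_time)

lemma partial_integral_closed_time:
  fixes v :: "real \<Rightarrow> real ^ 'd::finite"
  assumes "t \<in> {0..T}"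
  shows "(LINT s:{0..t}|lborel. v s) = (\<integral>s. indicator {0..t} s *\<^sub>R v s \<partial>closed_time T)"
  unfolding set_lebesgue_integral_def using assms
  by (subst integral_restrict_space) (auto intro!: Bochner_Integration.integral_cong simp: indicator_def)

text \<open>Both sides of the equation that defines a velocity are continuous in time, so it suffices to test it
at countably many times; with \<open>vel\<close> in place of the chosen velocity this is a measurable condition.\<close>

lemma sobolev_curve_iff_tame:
  fixes \<gamma> :: "'d::finite curve"
  assumes T: "0 < T" and \<gamma>: "\<gamma> \<in> curves T"
  shows "sobolev_curve T p \<gamma> \<longleftrightarrow> tame T p \<gamma>"
proof
  note vm[measurable] = vel_measurable_time[OF \<gamma>]
  have gr: "grid T i j \<in> {0..T}" for i j using T by (auto simp: grid_def)
  {
    assume sob: "sobolev_curve T p \<gamma>"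
    then have hv: "has_velocity T \<gamma> (velocity T \<gamma>)" by (rule sobolev_has_velocity)
    have ae: "AE s in closed_time T. vel T \<gamma> s = velocity T \<gamma> s" by (rule vel_eq_velocity[OF T \<gamma> hv])
    have vi: "integrable (closed_time T) (velocity T \<gamma>)" using hv by (simp add: has_velocity_def set_integrable_closed_time)
    then have [measurable]: "velocity T \<gamma> \<in> borel_measurable (closed_time T)" by auto
    have pi: "integrable (closed_time T) (\<lambda>s. norm (velocity T \<gamma> s) powr p)"
      using sob by (simp add: sobolev_curve_def set_integrable_closed_time)
    have "(\<integral>\<^sup>+s. ennreal (norm (vel T \<gamma> s)) \<partial>closed_time T) = (\<integral>\<^sup>+s. ennreal (norm (velocity T \<gamma> s)) \<partial>closed_time T)"
      by (rule nn_integral_cong_AE) (use ae in auto)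
    moreover have "(\<integral>\<^sup>+s. ennreal (norm (vel T \<gamma> s) powr p) \<partial>closed_time T) = (\<integral>\<^sup>+s. ennreal (norm (velocity T \<gamma> s) powr p) \<partial>closed_time T)"
      by (rule nn_integral_cong_AE) (use ae in auto)
    moreover have "rides T \<gamma> i j" for i j
    proof -
      have "(\<integral>s. indicator {0..grid T i j} s *\<^sub>R vel T \<gamma> s \<partial>closed_time T) = (\<integral>s. indicator {0..grid T i j} s *\<^sub>R velocity T \<gamma> s \<partial>closed_time T)"
      proof (rule integral_cong_AE)
        have [measurable]: "(\<lambda>s. indicator {0..grid T i j} s :: real) \<in> borel_measurable (closed_time T)"
          by (rule closed_time_measurable) simp
        show "(\<lambda>s. indicator {0..grid T i j} s *\<^sub>R vel T \<gamma> s) \<in> borel_measurable (closed_time T)"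
          "(\<lambda>s. indicator {0..grid T i j} s *\<^sub>R velocity T \<gamma> s) \<in> borel_measurable (closed_time T)" by measurable
      qed (use ae in auto)
      then show ?thesis using hv gr[of i j] unfolding has_velocity_def rides_def by (metis dist_self partial_integral_closed_time)
    qed
    ultimately show "tame T p \<gamma>" unfolding tame_def using vi pi by (auto simp: integrable_iff_bounded)
  }
  {
    assume tame: "tame T p \<gamma>"
    then have vi: "integrable (closed_time T) (vel T \<gamma>)" by (auto simp: tame_def integrable_iff_bounded)
    have hv: "has_velocity T \<gamma> (vel T \<gamma>)" unfolding has_velocity_def
    proof (intro conjI ballI)
      show "set_integrable lborel {0..T} (vel T \<gamma>)" using vi by (simp add: set_integrable_closed_time)
      then have hk: "vel T \<gamma> integrable_on {0..T}" by (rule set_borel_integral_eq_integral(1))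
      fix t assume t: "t \<in> {0..T}"
      have LI: "(LINT s:{0..t}|lborel. vel T \<gamma> s) = integral {0..t} (vel T \<gamma>)" if "t \<in> {0..T}" for t
      proof (rule set_borel_integral_eq_integral(2))
        show "set_integrable lborel {0..t} (vel T \<gamma>)"
          by (rule set_integrable_subset[OF \<open>set_integrable lborel {0..T} (vel T \<gamma>)\<close>]) (use that in auto)
      qed
      let ?t = "\<lambda>j. grid T (nat \<lfloor>real (Suc j) * t\<rfloor>) j"
      let ?f = "\<lambda>t. apply_bcontfun \<gamma> 0 + to_torus (integral {0..t} (vel T \<gamma>))"
      have "continuous_on {0..T} ?f"
        by (intro continuous_intros continuous_on_compose2[OF continuous_to_torus] indefinite_integral_continuous_1 hk) auto
      then have "(\<lambda>j. ?f (?t j)) \<longlonglongrightarrow> ?f t"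
        by (rule continuous_on_tendsto_compose[OF _ grid_dense[OF t] t]) (intro always_eventually allI gr)
      moreover have "(\<lambda>j. apply_bcontfun \<gamma> (?t j)) \<longlonglongrightarrow> apply_bcontfun \<gamma> t"
        by (rule continuous_on_tendsto_compose[OF continuous_curve[of "{0..T}"] grid_dense[OF t] t]) (intro always_eventually allI gr)
      moreover have "apply_bcontfun \<gamma> (?t j) = ?f (?t j)" for j
        using tame gr[of "nat \<lfloor>real (Suc j) * t\<rfloor>" j] LI[OF gr] partial_integral_closed_time[where v="vel T \<gamma>", OF gr]
        unfolding tame_def rides_def by simp
      ultimately have "apply_bcontfun \<gamma> t = ?f t" using LIMSEQ_unique by simp
      then show "apply_bcontfun \<gamma> t = apply_bcontfun \<gamma> 0 + to_torus (LINT s:{0..t}|lborel. vel T \<gamma> s)" by (simp add: LI[OF t])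
    qed
    then have hv2: "has_velocity T \<gamma> (velocity T \<gamma>)" unfolding velocity_def by (rule someI[of "has_velocity T \<gamma>"])
    have ae: "AE s in closed_time T. vel T \<gamma> s = velocity T \<gamma> s" by (rule vel_eq_velocity[OF T \<gamma> hv2])
    have "integrable (closed_time T) (velocity T \<gamma>)" using hv2 by (simp add: has_velocity_def set_integrable_closed_time)
    then have [measurable]: "velocity T \<gamma> \<in> borel_measurable (closed_time T)" by auto
    have "integrable (closed_time T) (\<lambda>s. norm (vel T \<gamma> s) powr p)" using tame by (auto simp: tame_def integrable_iff_bounded)
    then have "integrable (closed_time T) (\<lambda>s. norm (velocity T \<gamma> s) powr p)"
      by (subst integrable_cong_AE[of _ _ "\<lambda>s. norm (vel T \<gamma> s) powr p"]) (use ae in auto)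
    then show "sobolev_curve T p \<gamma>" unfolding sobolev_curve_def using hv by (auto simp: set_integrable_closed_time)
  }
qed

lemma tame_measurable: "{\<gamma> \<in> space (curve_space T). tame T p \<gamma>} \<in> sets (curve_space T)"
proof -
  interpret sigma_finite_measure "closed_time T" by (rule sigma_finite_closed_time)
  have vm[measurable]: "(\<lambda>q. vel T (fst q) (snd q)) \<in> borel_measurable (curve_space T \<Otimes>\<^sub>M closed_time T)"
    by (rule vel_measurable[OF fst_curve snd_time])
  have [measurable]: "(\<lambda>q. indicator {0..c} (snd q) :: real) \<in> borel_measurable (curve_space T \<Otimes>\<^sub>M closed_time T)" for c
    by (rule measurable_compose[OF snd_time]) simp
  have [measurable]: "(\<lambda>\<gamma>. \<integral>\<^sup>+s. ennreal (norm (vel T (fst (\<gamma>, s)) (snd (\<gamma>, s)))) \<partial>closed_time T) \<in> borel_measurable (curve_space T)"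
    "(\<lambda>\<gamma>. \<integral>\<^sup>+s. ennreal (norm (vel T (fst (\<gamma>, s)) (snd (\<gamma>, s))) powr p) \<partial>closed_time T) \<in> borel_measurable (curve_space T)"
    by (rule borel_measurable_nn_integral; simp only: case_prod_unfold fst_conv snd_conv; measurable)+
  have Im[measurable]: "(\<lambda>\<gamma>. \<integral>s. indicator {0..c} (snd (\<gamma>, s)) *\<^sub>R vel T (fst (\<gamma>, s)) (snd (\<gamma>, s)) \<partial>closed_time T) \<in> borel_measurable (curve_space T)" for c
    by (rule borel_measurable_lebesgue_integral) (simp only: case_prod_unfold fst_conv snd_conv, measurable)
  note ev[measurable] = eval_measurable
  have "{\<gamma> \<in> space (curve_space T). rides T \<gamma> i j} \<in> sets (curve_space T)" for i j
  proof -
    have "(\<lambda>\<gamma>. to_torus (\<integral>s. indicator {0..grid T i j} (snd (\<gamma>, s)) *\<^sub>R vel T (fst (\<gamma>, s)) (snd (\<gamma>, s)) \<partial>closed_time T)) \<in> borel_measurable (curve_space T)"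
      by (rule measurable_compose[OF Im to_torus_measurable])
    then have "(\<lambda>\<gamma>. apply_bcontfun \<gamma> 0 + to_torus (\<integral>s. indicator {0..grid T i j} (snd (\<gamma>, s)) *\<^sub>R vel T (fst (\<gamma>, s)) (snd (\<gamma>, s)) \<partial>closed_time T)) \<in> borel_measurable (curve_space T)"
      by (intro borel_measurable_add ev)
    then have [measurable]: "(\<lambda>\<gamma>. dist (apply_bcontfun \<gamma> (grid T i j)) (apply_bcontfun \<gamma> 0 + to_torus (\<integral>s. indicator {0..grid T i j} s *\<^sub>R vel T \<gamma> s \<partial>closed_time T))) \<in> borel_measurable (curve_space T)"
      by (intro borel_measurable_dist ev) simp
    show ?thesis unfolding rides_def by measurable
  qed
  then have [measurable]: "Measurable.pred (curve_space T) (\<lambda>\<gamma>. rides T \<gamma> i j)" for i j by (simp add: pred_def)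
  have "Measurable.pred (curve_space T) (\<lambda>\<gamma>. (\<integral>\<^sup>+s. ennreal (norm (vel T (fst (\<gamma>, s)) (snd (\<gamma>, s)))) \<partial>closed_time T) < \<infinity> \<and> (\<forall>i j. rides T \<gamma> i j) \<and>
     (\<integral>\<^sup>+s. ennreal (norm (vel T (fst (\<gamma>, s)) (snd (\<gamma>, s))) powr p) \<partial>closed_time T) < \<infinity>)" by measurable
  then show ?thesis by (simp add: pred_def tame_def)
qed

lemma path_integral_measurable:
  fixes l :: "'d::finite torus \<Rightarrow> real ^ 'd \<Rightarrow> real"
  assumes T: "0 < T" and l: "(\<lambda>z. l (fst z) (snd z)) \<in> borel_measurable borel"
  shows "path_integral T p (\<lambda>s. l) \<in> borel_measurable (curve_space T)"
proof -
  interpret sigma_finite_measure "closed_time T" by (rule sigma_finite_closed_time)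
  let ?X = "\<lambda>\<gamma>. if tame T p \<gamma> then ereal (\<integral>s. l (apply_bcontfun \<gamma> s) (vel T \<gamma> s) \<partial>closed_time T) else \<infinity>"
  have "path_integral T p (\<lambda>s. l) \<gamma> = ?X \<gamma>" if "\<gamma> \<in> space (curve_space T)" for \<gamma>
  proof -
    have \<gamma>: "\<gamma> \<in> curves T" using that by (simp add: space_curve_space)
    note iff = sobolev_curve_iff_tame[OF T \<gamma>, of p]
    show ?thesis
    proof (cases "tame T p \<gamma>")
      case True
      then have sob: "sobolev_curve T p \<gamma>" by (simp add: iff)
      then have hv: "has_velocity T \<gamma> (velocity T \<gamma>)" by (rule sobolev_has_velocity)
      note ae = vel_eq_velocity[OF T \<gamma> hv]
      have "integrable (closed_time T) (velocity T \<gamma>)" using hv by (simp add: has_velocity_def set_integrable_closed_time)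
      then have v1: "velocity T \<gamma> \<in> borel_measurable (closed_time T)" by auto
      have e1: "apply_bcontfun \<gamma> \<in> borel_measurable (closed_time T)"
        by (intro closed_time_measurable borel_measurable_continuous_onI continuous_curve)
      have lm: "(\<lambda>s. l (apply_bcontfun \<gamma> s) (w s)) \<in> borel_measurable (closed_time T)"
        if "w \<in> borel_measurable (closed_time T)" for w using measurable_compose[OF borel_measurable_Pair[OF e1 that] l] by simp
      have "(\<integral>s. l (apply_bcontfun \<gamma> s) (velocity T \<gamma> s) \<partial>closed_time T) = (\<integral>s. l (apply_bcontfun \<gamma> s) (vel T \<gamma> s) \<partial>closed_time T)"
        by (rule integral_cong_AE) (use ae lm[OF v1] lm[OF vel_measurable_time[OF \<gamma>]] in auto)
      then show ?thesis using True sob by (simp add: path_integral_def set_integral_closed_time)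
    next
      case False
      then show ?thesis using iff by (simp add: path_integral_def)
    qed
  qed
  moreover have "?X \<in> borel_measurable (curve_space T)"
  proof -
    have "(\<lambda>q. (apply_bcontfun (fst q) (snd q), vel T (fst q) (snd q))) \<in> borel_measurable (curve_space T \<Otimes>\<^sub>M closed_time T)"
      by (intro borel_measurable_Pair eval_joint_measurable[OF fst_curve snd_time] vel_measurable[OF fst_curve snd_time])
    from measurable_compose[OF this l]
    have "(\<lambda>\<gamma>. \<integral>s. l (apply_bcontfun \<gamma> s) (vel T \<gamma> s) \<partial>closed_time T) \<in> borel_measurable (curve_space T)"
      by (intro borel_measurable_lebesgue_integral) (simp add: case_prod_unfold)
    then show ?thesis by (intro measurable_If tame_measurable) auto
  qed
  ultimately show ?thesis by (subst measurable_cong) auto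
qed

section \<open>Translation and mollification in space\<close>

text \<open>For times outside \<open>(0, T)\<close> the value at time \<open>T / 2\<close> is taken.\<close>

lemma st_vol_borel_version:
  fixes u :: "real \<times> 'd::finite torus \<Rightarrow> real"
  assumes T: "0 < T" and u: "u \<in> borel_measurable (st_vol T)"
  obtains w where "w \<in> borel_measurable borel" "\<And>z. fst z \<in> {0<..<T} \<Longrightarrow> w z = u z" "\<And>z. \<exists>z'\<in>space (st_vol T). w z = u z'"
proof -
  let ?\<theta> = "\<lambda>z :: real \<times> 'd torus. (if fst z \<in> {0<..<T} then fst z else T / 2, snd z)"
  have [measurable]: "(\<lambda>z :: real \<times> 'd torus. fst z) \<in> borel_measurable borel" "(\<lambda>z :: real \<times> 'd torus. snd z) \<in> borel_measurable borel"
    by (auto intro!: borel_measurable_continuous_onI continuous_intros)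
  have "(\<lambda>z :: real \<times> 'd torus. if fst z \<in> {0<..<T} then fst z else T / 2) \<in> borel \<rightarrow>\<^sub>M time_vol T"
  proof (rule measurable_restrict_space2)
    show "(\<lambda>z. if fst z \<in> {0<..<T} then fst z else T / 2) \<in> space borel \<rightarrow> {0<..<T}" using T by auto
    have "(\<lambda>z :: real \<times> 'd torus. if fst z \<in> {0<..<T} then fst z else T / 2) \<in> borel_measurable borel" by measurable
    then show "(\<lambda>z :: real \<times> 'd torus. if fst z \<in> {0<..<T} then fst z else T / 2) \<in> borel \<rightarrow>\<^sub>M lborel" by simp
  qed
  moreover have "snd \<in> (borel :: (real \<times> 'd torus) measure) \<rightarrow>\<^sub>M torus_vol"
    unfolding measurable_cong_sets[OF refl sets_torus_vol] by (auto intro!: borel_measurable_continuous_onI continuous_intros)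
  ultimately have "?\<theta> \<in> borel \<rightarrow>\<^sub>M st_vol T" unfolding st_vol_def by (intro measurable_Pair) auto
  from measurable_compose[OF this u] have "(\<lambda>z. u (?\<theta> z)) \<in> borel_measurable borel" .
  then show thesis by (rule that) (use T in \<open>auto simp: space_st_vol\<close>)
qed

lemma nn_integral_st_vol:
  fixes f :: "real \<times> 'd::finite torus \<Rightarrow> ennreal"
  assumes [measurable]: "f \<in> borel_measurable borel"
  shows "(\<integral>\<^sup>+z. f z \<partial>st_vol T)
    = (\<integral>\<^sup>+p. f (fst p, to_torus (snd p)) * indicator ({0<..<T} \<times> cell) p \<partial>lborel)"
    and "(\<integral>\<^sup>+z. f z \<partial>st_vol T) = (\<integral>\<^sup>+t. \<integral>\<^sup>+x. f (t, x) \<partial>torus_vol \<partial>time_vol T)"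
proof -
  have fb: "f \<in> borel_measurable (borel \<Otimes>\<^sub>M borel)" using assms by (simp add: borel_prod)
  have fm: "f \<in> borel_measurable (time_vol T \<Otimes>\<^sub>M torus_vol)" using st_vol_borel_measurable[OF assms, of T] by (simp add: st_vol_def)
  show *: "(\<integral>\<^sup>+z. f z \<partial>st_vol T) = (\<integral>\<^sup>+t. \<integral>\<^sup>+x. f (t, x) \<partial>torus_vol \<partial>time_vol T)"
    unfolding st_vol_def by (rule torus_vol.nn_integral_fst[OF fm, symmetric])
  have ft[measurable]: "(\<lambda>x. f (t, x)) \<in> borel_measurable borel" for t
    by (rule measurable_compose[OF _ assms]) (auto intro!: borel_measurable_continuous_onI continuous_intros)
  have gm: "(\<lambda>p. f (fst p, to_torus (snd p)) * indicator ({0<..<T} \<times> cell) p) \<in> borel_measurable (lborel \<Otimes>\<^sub>M (lborel :: (real ^ 'd) measure))"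
  proof -
    have [measurable]: "(\<lambda>p. f (fst p, to_torus (snd p))) \<in> borel_measurable (lborel \<Otimes>\<^sub>M (lborel :: (real ^ 'd) measure))"
      by (rule measurable_compose[OF _ assms]) (simp add: borel_prod[symmetric])
    show ?thesis by measurable
  qed
  have "(\<integral>\<^sup>+t. \<integral>\<^sup>+x. f (t, x) \<partial>torus_vol \<partial>time_vol T) = (\<integral>\<^sup>+t. (\<integral>\<^sup>+x. f (t, x) \<partial>torus_vol) * indicator {0<..<T} t \<partial>lborel)"
    by (rule nn_integral_restrict_space) simp
  also have "\<dots> = (\<integral>\<^sup>+t. \<integral>\<^sup>+y. f (t, to_torus y) * indicator ({0<..<T} \<times> cell) (t, y) \<partial>lborel \<partial>lborel)"
  proof (rule nn_integral_cong)
    fix t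
    show "(\<integral>\<^sup>+x. f (t, x) \<partial>torus_vol) * indicator {0<..<T} t = (\<integral>\<^sup>+y. f (t, to_torus y) * indicator ({0<..<T} \<times> cell) (t, y) \<partial>lborel)"
    proof (cases "t \<in> {0<..<T}")
      case True
      then have "indicator ({0<..<T} \<times> cell) (t, y) = (indicator cell y :: ennreal)" for y :: "real ^ 'd" by (simp add: indicator_def)
      then show ?thesis using True by (simp add: nn_integral_torus[OF ft])
    next
      case False
      then have "indicator ({0<..<T} \<times> cell) (t, y) = (0 :: ennreal)" for y :: "real ^ 'd" by (auto simp: indicator_def)
      then show ?thesis using False by simp
    qed
  qed
  also have "\<dots> = (\<integral>\<^sup>+p. f (fst p, to_torus (snd p)) * indicator ({0<..<T} \<times> cell) p \<partial>(lborel \<Otimes>\<^sub>M (lborel :: (real ^ 'd) measure)))"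
    using lborel.nn_integral_fst[OF gm] by simp
  finally show "(\<integral>\<^sup>+z. f z \<partial>st_vol T) = (\<integral>\<^sup>+p. f (fst p, to_torus (snd p)) * indicator ({0<..<T} \<times> cell) p \<partial>lborel)"
    unfolding * by (simp add: lborel_prod)
qed

text \<open>The cell enlarged by one in every direction: it contains every short translate of the cell, so a
function on the torus can be cut off here before it is translated as a function on the space.\<close>

definition wide_cell :: "(real ^ 'd::finite) set" where
  "wide_cell = {w. \<forall>i. - 1 \<le> w $ i \<and> w $ i < 2}"

lemma wide_cell_borel[measurable]: "wide_cell \<in> sets (borel :: (real ^ 'd::finite) measure)"
proof -
  have eq: "wide_cell = (\<Inter>i. {w :: real ^ 'd. - 1 \<le> w $ i} \<inter> {w. w $ i < 2})" by (auto simp: wide_cell_def)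
  have m: "{w :: real ^ 'd. - 1 \<le> w $ i} \<inter> {w. w $ i < 2} \<in> sets borel" for i
    by (intro sets.Int borel_closed closed_Collect_le borel_open open_Collect_less continuous_intros)
  show ?thesis unfolding eq by (rule sets.finite_INT) (simp, simp, rule m)
qed

lemma norm_le_card:
  fixes w :: "real ^ 'd::finite"
  assumes "\<And>i. \<bar>w $ i\<bar> \<le> c"
  shows "norm w \<le> real CARD('d) * c"
proof -
  have "norm w \<le> (\<Sum>i\<in>UNIV. \<bar>w $ i\<bar>)" by (rule norm_le_l1_cart)
  also have "\<dots> \<le> (\<Sum>i\<in>(UNIV::'d set). c)" by (intro sum_mono assms)
  finally show ?thesis by simp
qed

lemma eper_wide_cell:
  obtains N :: nat where "\<And>z :: 'd::finite torus. eper (indicator wide_cell) z \<le> of_nat N"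
proof -
  let ?W = "{w \<in> (lattice :: (real ^ 'd) set). norm w \<le> real CARD('d) * 3}"
  show thesis
  proof (rule that[of "card ?W"])
    fix z :: "'d torus"
    have "eper (indicator wide_cell) z = (\<integral>\<^sup>+w. indicator wide_cell (crep z + w) \<partial>count_space lattice)"
      using eper_to_torus[of "indicator wide_cell" "crep z"] by simp
    also have "\<dots> \<le> (\<integral>\<^sup>+w. indicator ?W w \<partial>count_space lattice)"
    proof (rule nn_integral_mono)
      fix w :: "real ^ 'd" assume w: "w \<in> space (count_space lattice)"
      show "indicator wide_cell (crep z + w) \<le> (indicator ?W w :: ennreal)"
      proof (cases "crep z + w \<in> wide_cell")
        case True
        have "\<bar>w $ i\<bar> \<le> 3" for i
        proof -
          have "- 1 \<le> crep z $ i + w $ i" "crep z $ i + w $ i < 2" using True by (auto simp: wide_cell_def)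
          then show ?thesis using crep_range[of z i] by linarith
        qed
        then have "norm w \<le> real CARD('d) * 3" by (rule norm_le_card)
        then show ?thesis using w by (simp add: indicator_def)
      qed simp
    qed
    also have "\<dots> = emeasure (count_space lattice) ?W" by (rule nn_integral_indicator) auto
    also have "\<dots> = of_nat (card ?W)" by (subst emeasure_count_space_finite) (auto intro: finite_lattice_bounded)
    finally show "eper (indicator wide_cell) z \<le> of_nat (card ?W)" .
  qed
qed

lemma torus_shift_small:
  fixes u :: "real \<times> 'd::finite torus \<Rightarrow> real"
  assumes T: "0 < T" and u: "integrable (st_vol T) u" and e: "0 < e"
  shows "\<exists>d>0. \<forall>y. dist y 0 < d \<longrightarrow>
    (\<integral>\<^sup>+z. ennreal \<bar>u (fst z, snd z - y) - u z\<bar> \<partial>st_vol T) \<le> ennreal e"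
proof -
  have um: "u \<in> borel_measurable (st_vol T)" using u by auto
  obtain w where w[measurable]: "w \<in> borel_measurable borel" and wu: "\<And>z. fst z \<in> {0<..<T} \<Longrightarrow> w z = u z"
    using st_vol_borel_version[OF T um] by metis
  have prodm: "(\<lambda>p. w (fst p, to_torus (snd p))) \<in> borel_measurable (borel :: (real \<times> (real ^ 'd)) measure)"
    by (rule measurable_compose[OF _ w]) (simp add: borel_prod[symmetric])
  define U where "U = (\<lambda>p :: real \<times> (real ^ 'd). indicator ({0<..<T} \<times> wide_cell) p * w (fst p, to_torus (snd p)))"
  have iwm[measurable]: "{0<..<T} \<times> wide_cell \<in> sets (borel :: (real \<times> (real ^ 'd)) measure)"
    "{0<..<T} \<times> cell \<in> sets (borel :: (real \<times> (real ^ 'd)) measure)" unfolding borel_prod[symmetric] by (intro pair_measureI; simp)+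
  have Um[measurable]: "U \<in> borel_measurable borel" unfolding U_def using prodm by measurable
  obtain N :: nat where N: "\<And>z :: 'd torus. eper (indicator wide_cell) z \<le> of_nat N" by (rule eper_wide_cell) blast
  have wt[measurable]: "(\<lambda>x. w (t, x)) \<in> borel_measurable borel" for t
    by (rule measurable_compose[OF _ w]) (auto intro!: borel_measurable_continuous_onI continuous_intros)
  have "(\<integral>\<^sup>+p. ennreal (norm (U p)) \<partial>lborel) = (\<integral>\<^sup>+p. ennreal (norm (U p)) \<partial>(lborel \<Otimes>\<^sub>M lborel))"
    by (simp add: lborel_prod)
  also have "\<dots> = (\<integral>\<^sup>+t. \<integral>\<^sup>+y. ennreal (norm (U (t, y))) \<partial>lborel \<partial>lborel)"
  proof (rule lborel.nn_integral_fst[symmetric])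
    have [measurable]: "U \<in> borel_measurable (lborel \<Otimes>\<^sub>M lborel)" using Um by (simp add: lborel_prod)
    show "(\<lambda>p. ennreal (norm (U p))) \<in> borel_measurable (lborel \<Otimes>\<^sub>M lborel)" by measurable
  qed
  also have "\<dots> = (\<integral>\<^sup>+t. (\<integral>\<^sup>+y. ennreal \<bar>w (t, to_torus y)\<bar> * indicator wide_cell y \<partial>lborel) * indicator {0<..<T} t \<partial>lborel)"
    by (intro nn_integral_cong, subst nn_integral_multc[symmetric]) (auto intro!: nn_integral_cong simp: U_def indicator_def)
  also have "\<dots> \<le> (\<integral>\<^sup>+t. (\<integral>\<^sup>+x. ennreal \<bar>w (t, x)\<bar> * of_nat N \<partial>torus_vol) * indicator {0<..<T} t \<partial>lborel)"
    by (intro nn_integral_mono mult_right_mono, subst nn_integral_unfold) (auto intro!: nn_integral_mono mult_left_mono N)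
  also have "\<dots> = (\<integral>\<^sup>+t. \<integral>\<^sup>+x. ennreal \<bar>w (t, x)\<bar> * of_nat N \<partial>torus_vol \<partial>time_vol T)"
    by (rule nn_integral_restrict_space[symmetric]) simp
  also have "\<dots> = (\<integral>\<^sup>+z. ennreal \<bar>w z\<bar> * of_nat N \<partial>st_vol T)" by (subst nn_integral_st_vol(2)) auto
  also have "\<dots> = (\<integral>\<^sup>+z. ennreal \<bar>u z\<bar> \<partial>st_vol T) * of_nat N"
  proof (subst nn_integral_multc[symmetric])
    show "(\<integral>\<^sup>+z. ennreal \<bar>w z\<bar> * of_nat N \<partial>st_vol T) = (\<integral>\<^sup>+z. ennreal \<bar>u z\<bar> * of_nat N \<partial>st_vol T)"
      by (rule nn_integral_cong) (auto simp: space_st_vol wu)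
  qed (use um in measurable)
  also have "\<dots> < \<infinity>" using u by (auto simp: integrable_iff_bounded ennreal_mult_less_top of_nat_less_top)
  finally have U: "integrable lborel U" by (simp add: integrable_iff_bounded)
  obtain d0 where d0: "0 < d0" "\<forall>y. norm y < d0 \<longrightarrow> (\<integral>x. norm (U (x + y) - U x) \<partial>lborel) < e"
    using shift_continuous_small[OF U e] by blast
  show ?thesis
  proof (intro exI[of _ "min d0 1"] conjI allI impI)
    fix y :: "'d torus" assume y: "dist y 0 < min d0 1"
    obtain v where v: "to_torus v = y" "dist y 0 = norm v" using dist_torus_attained[of y 0] by auto
    have sh: "(\<lambda>z. (fst z, snd z - y)) \<in> borel_measurable (borel :: (real \<times> 'd torus) measure)"
      by (intro borel_measurable_continuous_onI continuous_intros)
    from measurable_compose[OF sh w] have [measurable]: "(\<lambda>z. w (fst z, snd z - y)) \<in> borel_measurable borel" .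
    have "(\<integral>\<^sup>+z. ennreal \<bar>u (fst z, snd z - y) - u z\<bar> \<partial>st_vol T) = (\<integral>\<^sup>+z. ennreal \<bar>w (fst z, snd z - y) - w z\<bar> \<partial>st_vol T)"
      by (rule nn_integral_cong) (auto simp: space_st_vol wu)
    also have "\<dots> = (\<integral>\<^sup>+p. ennreal \<bar>w (fst p, to_torus (snd p) - y) - w (fst p, to_torus (snd p))\<bar> * indicator ({0<..<T} \<times> cell) p \<partial>lborel)"
      by (subst nn_integral_st_vol(1)) auto
    also have "\<dots> \<le> (\<integral>\<^sup>+p. ennreal (norm (U (p + (0, - v)) - U p)) \<partial>lborel)"
    proof (rule nn_integral_mono)
      fix p :: "real \<times> (real ^ 'd)"
      show "ennreal \<bar>w (fst p, to_torus (snd p) - y) - w (fst p, to_torus (snd p))\<bar> * indicator ({0<..<T} \<times> cell) p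
          \<le> ennreal (norm (U (p + (0, - v)) - U p))"
      proof (cases "p \<in> {0<..<T} \<times> cell")
        case True
        then obtain t x where p: "p = (t, x)" "t \<in> {0<..<T}" "x \<in> cell" by auto
        have "\<bar>v $ i\<bar> < 1" for i using component_le_norm_cart[of v i] y v(2) by linarith
        then have "x - v \<in> wide_cell" "x \<in> wide_cell" using p(3) by (auto simp: cell_def wide_cell_def abs_less_iff) (smt (verit))+
        then show ?thesis using True p by (simp add: U_def v(1)[symmetric] to_torus_diff)
      qed simp
    qed
    also have "\<dots> = ennreal (\<integral>p. norm (U (p + (0, - v)) - U p) \<partial>lborel)"
      using integrable_lborel_shift(1)[OF U, of "(0, - v)"] U by (intro nn_integral_eq_integral) auto
    also have "\<dots> \<le> ennreal e"
    proof -
      have "norm (0 :: real, - v) < d0" using y v(2) by (simp add: norm_Pair)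
      then show ?thesis using d0(2) by (intro ennreal_leI less_imp_le) blast
    qed
    finally show "(\<integral>\<^sup>+z. ennreal \<bar>u (fst z, snd z - y) - u z\<bar> \<partial>st_vol T) \<le> ennreal e" .
  qed (use d0(1) in simp)
qed

lemma nn_integral_torus_reflect:
  fixes u :: "'d::finite torus \<Rightarrow> ennreal"
  assumes [measurable]: "u \<in> borel_measurable borel"
  shows "(\<integral>\<^sup>+y. u (x - y) \<partial>torus_vol) = (\<integral>\<^sup>+y. u y \<partial>torus_vol)"
proof -
  have "(\<integral>\<^sup>+y. u y \<partial>distr torus_vol borel (\<lambda>y. x - y)) = (\<integral>\<^sup>+y. u (x - y) \<partial>torus_vol)"
    by (rule nn_integral_distr) auto
  then show ?thesis by (simp only: distr_torus_reflect)
qed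

lemma integral_torus_reflect:
  fixes u :: "'d::finite torus \<Rightarrow> real"
  assumes [measurable]: "u \<in> borel_measurable borel"
  shows "(\<integral>y. u (x - y) \<partial>torus_vol) = (\<integral>y. u y \<partial>torus_vol)"
    and "integrable torus_vol (\<lambda>y. u (x - y)) \<longleftrightarrow> integrable torus_vol u"
proof -
  have "(\<integral>y. u y \<partial>distr torus_vol borel (\<lambda>y. x - y)) = (\<integral>y. u (x - y) \<partial>torus_vol)"
    by (rule integral_distr) auto
  then show "(\<integral>y. u (x - y) \<partial>torus_vol) = (\<integral>y. u y \<partial>torus_vol)" by (simp only: distr_torus_reflect)
  have "integrable (distr torus_vol borel (\<lambda>y. x - y)) u \<longleftrightarrow> integrable torus_vol (\<lambda>y. u (x - y))"
    by (rule integrable_distr_eq) auto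
  then show "integrable torus_vol (\<lambda>y. u (x - y)) \<longleftrightarrow> integrable torus_vol u" by (simp only: distr_torus_reflect)
qed

lemma torus_kernel_bounded:
  assumes "torus_kernel s K"
  obtains \<kappa> where "0 \<le> \<kappa>" "\<And>z. K z \<le> \<kappa>"
proof -
  obtain B where "0 \<le> B" "\<And>z. norm (K z) \<le> B" using bounded_torus[OF torus_kernel_continuous[OF assms]] by metis
  then show thesis using that[of B] by (metis abs_le_D1 real_norm_def)
qed

lemma torus_kernel_nn_mass: "torus_kernel s K \<Longrightarrow> (\<integral>\<^sup>+y. ennreal (K y) \<partial>torus_vol) = 1"
proof -
  assume K: "torus_kernel s K"
  obtain \<kappa> where \<kappa>: "0 \<le> \<kappa>" "\<And>z. K z \<le> \<kappa>" using torus_kernel_bounded[OF K] by metis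
  have "integrable torus_vol K" by (rule torus_vol.integrable_const_bound[where B=\<kappa>])
      (use \<kappa> K torus_kernel_measurable[OF K] in \<open>auto simp: torus_kernel_def\<close>)
  then have "(\<integral>\<^sup>+y. ennreal (K y) \<partial>torus_vol) = ennreal (\<integral>y. K y \<partial>torus_vol)"
    using K by (intro nn_integral_eq_integral) (auto simp: torus_kernel_def)
  then show ?thesis using K by (simp add: torus_kernel_def)
qed

lemma (in pair_sigma_finite) AE_fst_pair:
  assumes "AE x in M1. P x"
  shows "AE z in M1 \<Otimes>\<^sub>M M2. P (fst z)"
proof -
  obtain N where N: "{x \<in> space M1. \<not> P x} \<subseteq> N" "emeasure M1 N = 0" "N \<in> sets M1" using assms by (rule AE_E)
  show ?thesis
  proof (rule AE_I[of _ _ "N \<times> space M2"])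
    show "{z \<in> space (M1 \<Otimes>\<^sub>M M2). \<not> P (fst z)} \<subseteq> N \<times> space M2" using N(1) by (auto simp: space_pair_measure)
    show "emeasure (M1 \<Otimes>\<^sub>M M2) (N \<times> space M2) = 0" using N(2,3) by (subst M2.emeasure_pair_measure_Times) auto
    show "N \<times> space M2 \<in> sets (M1 \<Otimes>\<^sub>M M2)" using N(3) by auto
  qed
qed

text \<open>The error is an average, with weights given by the kernel, of errors made by short translations.\<close>

lemma mollify_L1:
  fixes u :: "real \<times> 'd::finite torus \<Rightarrow> real"
  assumes T: "0 < T" and u: "integrable (st_vol T) u" and e: "0 < e"
  shows "\<exists>d>0. \<forall>s K. torus_kernel s K \<and> s \<le> d \<longrightarrow>
    (\<integral>\<^sup>+z. ennreal \<bar>(\<integral>x. u (fst z, x) * K (snd z - x) \<partial>torus_vol) - u z\<bar> \<partial>st_vol T) \<le> ennreal e"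
proof -
  have um: "u \<in> borel_measurable (st_vol T)" using u by auto
  obtain d where d: "0 < d"
    "\<forall>y. dist y 0 < d \<longrightarrow> (\<integral>\<^sup>+z. ennreal \<bar>u (fst z, snd z - y) - u z\<bar> \<partial>st_vol T) \<le> ennreal e"
    using torus_shift_small[OF T u e] by blast
  obtain w where w[measurable]: "w \<in> borel_measurable borel" and wu: "\<And>z. fst z \<in> {0<..<T} \<Longrightarrow> w z = u z"
    using st_vol_borel_version[OF T um] by metis
  interpret P: pair_sigma_finite "time_vol T" "torus_vol :: 'd torus measure" by (rule pair_st_vol)
  interpret S: finite_measure "st_vol T :: (real \<times> 'd torus) measure" by (rule finite_st_vol)
  interpret Q: pair_sigma_finite "torus_vol :: 'd torus measure" "st_vol T :: (real \<times> 'd torus) measure" ..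
  have int_t: "AE z in (st_vol T :: (real \<times> 'd torus) measure). integrable torus_vol (\<lambda>x. u (fst z, x))"
  proof -
    have "AE t in time_vol T. integrable torus_vol (\<lambda>x. u (t, x))" using P.AE_integrable_fst'[OF u[unfolded st_vol_def]] .
    from P.AE_fst_pair[OF this] show ?thesis unfolding st_vol_def .
  qed
  have "(\<integral>\<^sup>+z. ennreal \<bar>(\<integral>x. u (fst z, x) * K (snd z - x) \<partial>torus_vol) - u z\<bar> \<partial>st_vol T) \<le> ennreal e"
    if K: "torus_kernel s (K :: 'd torus \<Rightarrow> real)" and s: "s \<le> d" for s K
  proof -
    note Km[measurable] = torus_kernel_measurable[OF K]
    have K0: "0 \<le> K z" for z using K by (simp add: torus_kernel_def)
    obtain \<kappa> where \<kappa>: "0 \<le> \<kappa>" "\<And>z. K z \<le> \<kappa>" using torus_kernel_bounded[OF K] by metis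
    have iK: "integrable torus_vol K" by (rule torus_vol.integrable_const_bound[where B=\<kappa>]) (use \<kappa> K0 in auto)
    let ?g = "\<lambda>y z. ennreal \<bar>u (fst z, snd z - y) - u z\<bar>"
    have bound: "ennreal \<bar>(\<integral>x. u (fst z, x) * K (snd z - x) \<partial>torus_vol) - u z\<bar> \<le> (\<integral>\<^sup>+y. ?g y z * ennreal (K y) \<partial>torus_vol)"
      if z: "z \<in> space (st_vol T)" and iz: "integrable torus_vol (\<lambda>x. u (fst z, x))" for z
    proof -
      let ?v = "\<lambda>x. u (fst z, x)"
      have [measurable]: "?v \<in> borel_measurable borel" using iz by auto
      have "(\<integral>x. ?v x * K (snd z - x) \<partial>torus_vol) = (\<integral>y. ?v (snd z - y) * K (snd z - (snd z - y)) \<partial>torus_vol)"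
        by (rule integral_torus_reflect(1)[symmetric]) measurable
      also have "\<dots> = (\<integral>y. ?v (snd z - y) * K y \<partial>torus_vol)" by simp
      finally have eq: "(\<integral>x. ?v x * K (snd z - x) \<partial>torus_vol) = (\<integral>y. ?v (snd z - y) * K y \<partial>torus_vol)" .
      have i1: "integrable torus_vol (\<lambda>y. ?v (snd z - y) * K y)"
      proof (rule Bochner_Integration.integrable_bound)
        show "integrable torus_vol (\<lambda>y. \<kappa> * ?v (snd z - y))"
          using iz integral_torus_reflect(2)[of ?v "snd z"] by (intro integrable_mult_right) simp
        show "AE y in torus_vol. norm (?v (snd z - y) * K y) \<le> norm (\<kappa> * ?v (snd z - y))"
          using \<kappa> K0 by (intro AE_I2) (simp add: abs_mult mult.commute mult_right_mono)
      qed simp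
      have "(\<integral>x. ?v x * K (snd z - x) \<partial>torus_vol) - u z = (\<integral>y. (?v (snd z - y) - u z) * K y \<partial>torus_vol)"
        unfolding eq using i1 iK K by (simp add: left_diff_distrib torus_kernel_def)
      also have "ennreal \<bar>\<dots>\<bar> \<le> (\<integral>\<^sup>+y. ennreal (norm ((?v (snd z - y) - u z) * K y)) \<partial>torus_vol)"
        using i1 iK by (subst real_norm_def[symmetric], intro integral_norm_bound_ennreal) (simp add: left_diff_distrib)
      also have "\<dots> = (\<integral>\<^sup>+y. ?g y z * ennreal (K y) \<partial>torus_vol)"
        by (intro nn_integral_cong) (simp add: abs_mult ennreal_mult K0)
      finally show ?thesis .
    qed
    have "(\<integral>\<^sup>+z. ennreal \<bar>(\<integral>x. u (fst z, x) * K (snd z - x) \<partial>torus_vol) - u z\<bar> \<partial>st_vol T)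
        \<le> (\<integral>\<^sup>+z. \<integral>\<^sup>+y. ?g y z * ennreal (K y) \<partial>torus_vol \<partial>st_vol T)"
      by (rule nn_integral_mono_AE) (use int_t bound in \<open>auto elim: AE_mp\<close>)
    also have "\<dots> = (\<integral>\<^sup>+z. \<integral>\<^sup>+y. ennreal \<bar>w (fst z, snd z - y) - w z\<bar> * ennreal (K y) \<partial>torus_vol \<partial>st_vol T)"
      by (intro nn_integral_cong) (auto simp: space_st_vol wu)
    also have "\<dots> = (\<integral>\<^sup>+y. \<integral>\<^sup>+z. ennreal \<bar>w (fst z, snd z - y) - w z\<bar> * ennreal (K y) \<partial>st_vol T \<partial>torus_vol)"
    proof (rule Q.Fubini')
      have a: "(\<lambda>q. (fst (snd q), snd (snd q) - fst q)) \<in> (torus_vol \<Otimes>\<^sub>M st_vol T) \<rightarrow>\<^sub>M (borel \<Otimes>\<^sub>M (borel :: 'd torus measure))"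
        by measurable
      have b: "(\<lambda>q. snd q) \<in> (torus_vol \<Otimes>\<^sub>M st_vol T) \<rightarrow>\<^sub>M (borel :: (real \<times> 'd torus) measure)"
        by (rule measurable_compose[OF measurable_snd ident_st_vol])
      have [measurable]: "(\<lambda>q. w (fst (snd q), snd (snd q) - fst q)) \<in> borel_measurable (torus_vol \<Otimes>\<^sub>M st_vol T)"
        "(\<lambda>q. w (snd q)) \<in> borel_measurable (torus_vol \<Otimes>\<^sub>M st_vol T)"
        using measurable_compose[OF a[unfolded borel_prod] w] measurable_compose[OF b w] by simp_all
      show "(\<lambda>(y, z). ennreal \<bar>w (fst z, snd z - y) - w z\<bar> * ennreal (K y)) \<in> borel_measurable (torus_vol \<Otimes>\<^sub>M st_vol T)"
        unfolding case_prod_unfold by measurable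
    qed
    also have "\<dots> = (\<integral>\<^sup>+y. (\<integral>\<^sup>+z. ?g y z \<partial>st_vol T) * ennreal (K y) \<partial>torus_vol)"
    proof (rule nn_integral_cong)
      fix y
      have sh: "(\<lambda>z. (fst z, snd z - y)) \<in> borel_measurable (borel :: (real \<times> 'd torus) measure)"
        by (intro borel_measurable_continuous_onI continuous_intros)
      have [measurable]: "(\<lambda>z. w (fst z, snd z - y)) \<in> borel_measurable (st_vol T)" "w \<in> borel_measurable (st_vol T)"
        by (rule st_vol_borel_measurable measurable_compose[OF sh w] w)+
      have "(\<integral>\<^sup>+z. ennreal \<bar>w (fst z, snd z - y) - w z\<bar> * ennreal (K y) \<partial>st_vol T) = (\<integral>\<^sup>+z. ennreal \<bar>w (fst z, snd z - y) - w z\<bar> \<partial>st_vol T) * ennreal (K y)"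
        by (rule nn_integral_multc) measurable
      also have "(\<integral>\<^sup>+z. ennreal \<bar>w (fst z, snd z - y) - w z\<bar> \<partial>st_vol T) = (\<integral>\<^sup>+z. ?g y z \<partial>st_vol T)"
        by (rule nn_integral_cong) (auto simp: space_st_vol wu)
      finally show "(\<integral>\<^sup>+z. ennreal \<bar>w (fst z, snd z - y) - w z\<bar> * ennreal (K y) \<partial>st_vol T) = (\<integral>\<^sup>+z. ?g y z \<partial>st_vol T) * ennreal (K y)" .
    qed
    also have "\<dots> \<le> (\<integral>\<^sup>+y. ennreal e * ennreal (K y) \<partial>torus_vol)"
    proof (rule nn_integral_mono)
      fix y
      show "(\<integral>\<^sup>+z. ?g y z \<partial>st_vol T) * ennreal (K y) \<le> ennreal e * ennreal (K y)"
      proof (cases "K y = 0")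
        case False
        then have "dist y 0 < d" using K s by (auto simp: torus_kernel_def intro: less_le_trans)
        then show ?thesis using d(2) by (intro mult_right_mono) auto
      qed simp
    qed
    also have "\<dots> = ennreal e" by (subst nn_integral_cmult) (auto simp: torus_kernel_nn_mass[OF K])
    finally show ?thesis .
  qed
  then show ?thesis using d(1) by blast
qed

lemma powr_mult_le_max:
  fixes a b p :: real
  assumes "0 \<le> a" "0 \<le> b" "1 < p"
  shows "a powr (p - 1) * b \<le> max a b powr p"
proof -
  have "a powr (p - 1) * b \<le> max a b powr (p - 1) * max a b" using assms by (intro mult_mono powr_mono2) auto
  also have "\<dots> = max a b powr p" using assms powr_mult_base[of "max a b" "p - 1"] by (simp add: mult.commute)
  finally show ?thesis .
qed

lemma nn_integral_st_shift:
  fixes u :: "real \<times> 'd::finite torus \<Rightarrow> ennreal"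
  assumes u[measurable]: "u \<in> borel_measurable borel"
  shows "(\<integral>\<^sup>+z. u (fst z, snd z - y) \<partial>st_vol T) = (\<integral>\<^sup>+z. u z \<partial>st_vol T)"
proof -
  have sh: "(\<lambda>z. (fst z, snd z - y)) \<in> borel_measurable (borel :: (real \<times> 'd torus) measure)"
    by (intro borel_measurable_continuous_onI continuous_intros)
  have ut: "(\<lambda>x. u (t, x)) \<in> borel_measurable borel" for t
    by (rule measurable_compose[OF _ u]) (auto intro!: borel_measurable_continuous_onI continuous_intros)
  show ?thesis unfolding nn_integral_st_vol(2)[OF u] nn_integral_st_vol(2)[OF measurable_compose[OF sh u]]
    using nn_integral_torus_translate[OF ut, of _ "- y"] by simp
qed

lemma tail_integral_small:
  fixes u :: "'a \<Rightarrow> real" and g :: "'a \<Rightarrow> real"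
  assumes g: "integrable M g" and u[measurable]: "u \<in> borel_measurable M" and e: "0 < e"
  shows "\<exists>n::nat. 1 \<le> n \<and> (\<integral>\<^sup>+z. ennreal (\<bar>g z\<bar> * indicator {a. real n < a} (u z)) \<partial>M) \<le> ennreal e"
proof -
  have "(\<lambda>n::nat. \<integral>z. \<bar>g z\<bar> * indicator {a. real n < a} (u z) \<partial>M) \<longlonglongrightarrow> (\<integral>z. 0 \<partial>M)"
  proof (rule integral_dominated_convergence[where w="\<lambda>z. \<bar>g z\<bar>"])
    show "AE z in M. (\<lambda>n::nat. \<bar>g z\<bar> * indicator {a. real n < a} (u z)) \<longlonglongrightarrow> 0"
    proof (rule AE_I2)
      fix z
      obtain n0 :: nat where n0: "u z < real n0" using reals_Archimedean2 by blast
      have "\<forall>\<^sub>F n :: nat in sequentially. \<bar>g z\<bar> * indicator {a. real n < a} (u z) = 0"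
        using eventually_ge_at_top[of n0] by (rule eventually_mono) (use n0 in \<open>auto simp: indicator_def\<close>)
      then show "(\<lambda>n::nat. \<bar>g z\<bar> * indicator {a. real n < a} (u z)) \<longlonglongrightarrow> 0" by (rule tendsto_eventually)
    qed
    show "AE z in M. norm (\<bar>g z\<bar> * indicator {a. real n < a} (u z)) \<le> \<bar>g z\<bar>" for n :: nat by (auto simp: indicator_def)
    show "(\<lambda>z. \<bar>g z\<bar> * indicator {a. real n < a} (u z)) \<in> borel_measurable M" for n :: nat using g by measurable
  qed (use g in auto)
  then have "(\<lambda>n::nat. \<integral>z. \<bar>g z\<bar> * indicator {a. real n < a} (u z) \<partial>M) \<longlonglongrightarrow> 0" by simp
  from LIMSEQ_D[OF this e] obtain n0 where n0: "\<forall>n\<ge>n0. norm ((\<integral>z. \<bar>g z\<bar> * indicator {a. real n < a} (u z) \<partial>M) - 0) < e" by blast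
  let ?n = "max 1 n0"
  have i: "integrable M (\<lambda>z. \<bar>g z\<bar> * indicator {a. real ?n < a} (u z))"
    by (rule Bochner_Integration.integrable_bound[OF g]) (use g in \<open>auto simp: indicator_def\<close>)
  have "norm ((\<integral>z. \<bar>g z\<bar> * indicator {a. real ?n < a} (u z) \<partial>M) - 0) < e" using n0 by (metis max.cobounded2)
  then have "(\<integral>z. \<bar>g z\<bar> * indicator {a. real ?n < a} (u z) \<partial>M) \<le> e" by simp
  moreover have "(\<integral>\<^sup>+z. ennreal (\<bar>g z\<bar> * indicator {a. real ?n < a} (u z)) \<partial>M) = ennreal (\<integral>z. \<bar>g z\<bar> * indicator {a. real ?n < a} (u z) \<partial>M)"
    by (intro nn_integral_eq_integral i) auto
  ultimately show ?thesis by (intro exI[of _ ?n]) (auto intro: ennreal_leI)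
qed

text \<open>The product of \<open>F z\<close>, which grows like \<open>m z powr (q - 1)\<close>, with a value of \<open>m\<close> elsewhere is at most
the sum of the values of \<open>a \<mapsto> C * (a powr q + a)\<close> at both densities. Where one of them exceeds a high
level \<open>n\<close> this sum is small in the mean; where neither does, \<open>F\<close> is bounded and continuity of
translations applies to the truncated density.\<close>

lemma shifted_pairing:
  fixes m F :: "real \<times> 'd::finite torus \<Rightarrow> real"
  assumes T: "0 < T" and q: "1 < q" and m: "integrable (st_vol T) m" and mq: "integrable (st_vol T) (\<lambda>z. m z powr q)"
    and m0: "\<And>z. 0 \<le> m z" and F: "F \<in> borel_measurable (st_vol T)"
    and F0: "\<And>z. 0 \<le> F z" and FC: "\<And>z. F z \<le> C * m z powr (q - 1) + C" and C: "0 < C" and e: "0 < e"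
  shows "\<exists>d>0. \<forall>y. dist y 0 < d \<longrightarrow>
    (\<integral>\<^sup>+z. ennreal (F z * m (fst z, snd z - y)) \<partial>st_vol T) \<le> (\<integral>\<^sup>+z. ennreal (F z * m z) \<partial>st_vol T) + ennreal e"
proof -
  note [measurable] = F
  have mm[measurable]: "m \<in> borel_measurable (st_vol T)" using m by auto
  define g where "g = (\<lambda>a. C * (a powr q + a))"
  have "integrable (st_vol T) (\<lambda>z. g (m z))" unfolding g_def using m mq by simp
  moreover have "0 < e / 4" using e by simp
  ultimately obtain n :: nat where n: "1 \<le> n"
    "(\<integral>\<^sup>+z. ennreal (\<bar>g (m z)\<bar> * indicator {a. real n < a} (m z)) \<partial>st_vol T) \<le> ennreal (e / 4)"
    using tail_integral_small[OF _ mm] by blast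
  have g0: "0 \<le> g a" if "0 \<le> a" for a using that C by (simp add: g_def)
  define G where "G = (\<lambda>z. g (m z) * indicator {a. real n < a} (m z))"
  define mt where "mt = (\<lambda>z. if m z \<le> real n then m z else 0)"
  define Mn where "Mn = C * real n powr (q - 1) + C"
  have Mn: "0 < Mn" using C by (simp add: Mn_def add_nonneg_pos)
  have imt: "integrable (st_vol T) mt" by (rule Bochner_Integration.integrable_bound[OF m]) (auto simp: mt_def m0)
  have "0 < e / (4 * Mn)" using e Mn by simp
  from torus_shift_small[OF T imt this]
  obtain d where d: "0 < d" "\<forall>y. dist y 0 < d \<longrightarrow>
      (\<integral>\<^sup>+z. ennreal \<bar>mt (fst z, snd z - y) - mt z\<bar> \<partial>st_vol T) \<le> ennreal (e / (4 * Mn))" by blast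
  have g_mono: "C * max a b powr q + C * b \<le> g a * indicator {a. real n < a} a + g b * indicator {a. real n < a} b"
    if ab: "0 \<le> a" "0 \<le> b" "real n < max a b" for a b
  proof (cases "b \<le> a")
    case True
    then have "C * max a b powr q + C * b \<le> g a" using C by (simp add: g_def max_absorb1 algebra_simps)
    moreover have "0 \<le> g b * indicator {a. real n < a} b" using g0[OF ab(2)] by simp
    ultimately show ?thesis using True ab by (simp add: max_absorb1)
  next
    case False
    then have "C * max a b powr q + C * b \<le> g b" using C by (simp add: g_def max_absorb2 algebra_simps)
    moreover have "0 \<le> g a * indicator {a. real n < a} a" using g0[OF ab(1)] by simp
    ultimately show ?thesis using False ab by (simp add: max_absorb2)
  qed
  have point: "F z * m w \<le> F z * m z + Mn * \<bar>mt w - mt z\<bar> + G z + G w" for z w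
  proof (cases "real n < max (m z) (m w)")
    case True
    have "F z * m w \<le> (C * m z powr (q - 1) + C) * m w" using FC m0 by (intro mult_right_mono) auto
    also have "\<dots> = C * (m z powr (q - 1) * m w) + C * m w" by (simp add: algebra_simps)
    also have "\<dots> \<le> C * max (m z) (m w) powr q + C * m w" using powr_mult_le_max[OF m0 m0 q] C by (intro add_mono mult_left_mono) auto
    also have "\<dots> \<le> G z + G w" unfolding G_def by (rule g_mono[OF m0 m0 True])
    finally have "F z * m w \<le> G z + G w" .
    moreover have "0 \<le> F z * m z" using F0[of z] m0[of z] by simp
    moreover have "0 \<le> Mn * \<bar>mt w - mt z\<bar>" using Mn by simp
    ultimately show ?thesis by linarith
  next
    case False
    then have mz: "m z \<le> real n" "m w \<le> real n" by auto
    have "F z \<le> Mn"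
    proof -
      have "m z powr (q - 1) \<le> real n powr (q - 1)" using q mz m0 by (intro powr_mono2) auto
      then have "C * m z powr (q - 1) \<le> C * real n powr (q - 1)" using C by (intro mult_left_mono) auto
      then show ?thesis using FC[of z] by (simp add: Mn_def)
    qed
    then have "F z * (m w - m z) \<le> Mn * \<bar>m w - m z\<bar>"
      using F0[of z] by (meson abs_ge_self abs_ge_zero mult_left_mono mult_right_mono order_trans)
    moreover have "0 \<le> G z" "0 \<le> G w" using g0[OF m0] by (simp_all add: G_def)
    ultimately show ?thesis using mz by (simp add: mt_def algebra_simps)
  qed
  have "(\<integral>\<^sup>+z. ennreal (F z * m (fst z, snd z - y)) \<partial>st_vol T) \<le> (\<integral>\<^sup>+z. ennreal (F z * m z) \<partial>st_vol T) + ennreal e"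
    if y: "dist y 0 < d" for y
  proof -
    have Gm: "G \<in> borel_measurable (st_vol T)" unfolding G_def g_def by measurable
    obtain G' where G'[measurable]: "G' \<in> borel_measurable borel" and GG': "\<And>z. fst z \<in> {0<..<T} \<Longrightarrow> G' z = G z"
      using st_vol_borel_version[OF T Gm] by metis
    have mtm[measurable]: "mt \<in> borel_measurable (st_vol T)" using imt by auto
    obtain m' where m'[measurable]: "m' \<in> borel_measurable borel" and mm': "\<And>z. fst z \<in> {0<..<T} \<Longrightarrow> m' z = mt z"
      using st_vol_borel_version[OF T mtm] by metis
    have sh: "(\<lambda>z. (fst z, snd z - y)) \<in> borel_measurable (borel :: (real \<times> 'd torus) measure)"
      by (intro borel_measurable_continuous_onI continuous_intros)
    have [measurable]: "(\<lambda>z. G' (fst z, snd z - y)) \<in> borel_measurable (st_vol T)" "G' \<in> borel_measurable (st_vol T)"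
      "(\<lambda>z. m' (fst z, snd z - y)) \<in> borel_measurable (st_vol T)"
      by (rule st_vol_borel_measurable measurable_compose[OF sh G'] measurable_compose[OF sh m'] G')+
    have "(\<integral>\<^sup>+z. ennreal (F z * m (fst z, snd z - y)) \<partial>st_vol T)
        \<le> (\<integral>\<^sup>+z. ennreal (F z * m z) + ennreal Mn * ennreal \<bar>m' (fst z, snd z - y) - mt z\<bar> + ennreal (G z) + ennreal (G' (fst z, snd z - y)) \<partial>st_vol T)"
    proof (rule nn_integral_mono)
      fix z :: "real \<times> 'd torus" assume "z \<in> space (st_vol T)"
      then have z: "fst z \<in> {0<..<T}" by (auto simp: space_st_vol)
      have G0: "0 \<le> G w" for w using g0[OF m0] by (simp add: G_def)
      let ?w = "(fst z, snd z - y)"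
      have w: "m' ?w = mt ?w" "G' ?w = G ?w" using z by (simp_all add: mm' GG')
      have "ennreal (F z * m ?w) \<le> ennreal (F z * m z + Mn * \<bar>mt ?w - mt z\<bar> + G z + G ?w)" by (intro ennreal_leI point)
      also have "\<dots> = ennreal (F z * m z) + ennreal Mn * ennreal \<bar>mt ?w - mt z\<bar> + ennreal (G z) + ennreal (G ?w)"
        using F0[of z] m0[of z] Mn G0 by (simp add: ennreal_plus ennreal_mult add_nonneg_nonneg)
      finally show "ennreal (F z * m ?w) \<le> ennreal (F z * m z) + ennreal Mn * ennreal \<bar>m' ?w - mt z\<bar> + ennreal (G z) + ennreal (G' ?w)"
        unfolding w .
    qed
    also have "\<dots> = (\<integral>\<^sup>+z. ennreal (F z * m z) \<partial>st_vol T) + ennreal Mn * (\<integral>\<^sup>+z. ennreal \<bar>m' (fst z, snd z - y) - mt z\<bar> \<partial>st_vol T)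
        + (\<integral>\<^sup>+z. ennreal (G z) \<partial>st_vol T) + (\<integral>\<^sup>+z. ennreal (G' (fst z, snd z - y)) \<partial>st_vol T)"
      using Gm by (simp add: nn_integral_add nn_integral_cmult)
    also have "(\<integral>\<^sup>+z. ennreal \<bar>m' (fst z, snd z - y) - mt z\<bar> \<partial>st_vol T) = (\<integral>\<^sup>+z. ennreal \<bar>mt (fst z, snd z - y) - mt z\<bar> \<partial>st_vol T)"
      by (rule nn_integral_cong) (auto simp: space_st_vol mm')
    also have "(\<integral>\<^sup>+z. ennreal (G' (fst z, snd z - y)) \<partial>st_vol T) = (\<integral>\<^sup>+z. ennreal (G' z) \<partial>st_vol T)"
      by (rule nn_integral_st_shift) measurable
    also have "(\<integral>\<^sup>+z. ennreal (G' z) \<partial>st_vol T) = (\<integral>\<^sup>+z. ennreal (G z) \<partial>st_vol T)"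
      by (rule nn_integral_cong) (auto simp: space_st_vol GG')
    also have "(\<integral>\<^sup>+z. ennreal (G z) \<partial>st_vol T) \<le> ennreal (e / 4)" using n(2) g0[OF m0] by (simp add: G_def)
    also have "ennreal Mn * (\<integral>\<^sup>+z. ennreal \<bar>mt (fst z, snd z - y) - mt z\<bar> \<partial>st_vol T) \<le> ennreal Mn * ennreal (e / (4 * Mn))"
      using d(2) y by (intro mult_left_mono) auto
    also have "ennreal Mn * ennreal (e / (4 * Mn)) = ennreal (e / 4)" using Mn e by (simp add: ennreal_mult'[symmetric])
    finally have "(\<integral>\<^sup>+z. ennreal (F z * m (fst z, snd z - y)) \<partial>st_vol T)
        \<le> (\<integral>\<^sup>+z. ennreal (F z * m z) \<partial>st_vol T) + ennreal (e / 4) + ennreal (e / 4) + ennreal (e / 4)"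
      by (simp add: add_mono)
    also have "\<dots> = (\<integral>\<^sup>+z. ennreal (F z * m z) \<partial>st_vol T) + ennreal (3 * e / 4)"
      using e by (simp add: add.assoc ennreal_plus[symmetric] del: ennreal_plus)
    also have "\<dots> \<le> (\<integral>\<^sup>+z. ennreal (F z * m z) \<partial>st_vol T) + ennreal e"
      using e by (intro add_left_mono ennreal_leI) simp
    finally show ?thesis .
  qed
  then show ?thesis using d(1) by blast
qed

section \<open>The Lagrangian\<close>

text \<open>The momentum \<open>0\<close> gives the lower bound, and Young's inequality turns the lower growth bound of \<open>H\<close> of
order \<open>r\<close> into an upper bound of the conjugate order.\<close>

lemma lagrangian_bounds:
  fixes H :: "'d::finite torus \<Rightarrow> real ^ 'd \<Rightarrow> real"
  assumes H: "hamiltonian_cond q r H" and r': "1 / r + 1 / r' = 1"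
  obtains C where "0 \<le> C" "\<And>x p v. - inner p v - H x p \<le> lagrangian H x v"
    "\<And>x v. - C \<le> lagrangian H x v" "\<And>x v. lagrangian H x v \<le> C * norm v powr r' + C"
proof -
  obtain C where C: "C > 0" "\<And>x p. norm p powr r / (r * C) - C \<le> H x p" "\<And>x p. H x p \<le> C / r * norm p powr r + C"
    using H unfolding hamiltonian_cond_def by blast
  have r: "1 < r" using H unfolding hamiltonian_cond_def by auto
  have r'1: "1 < r'"
  proof -
    have "1 / r < 1" "0 < 1 / r" using r by auto
    then have "0 < 1 / r'" "1 / r' < 1" using r' by linarith+
    then show ?thesis by (auto simp: zero_less_divide_iff divide_less_eq_1)
  qed
  define lam where "lam = (1 / C) powr (1 / r)"
  have lam: "0 < lam" "lam powr r = 1 / C" using C(1) r by (simp_all add: lam_def powr_powr)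
  define D where "D = (1 / lam) powr r' / r'"
  have D: "0 \<le> D" using r'1 by (simp add: D_def)
  have up: "inner p (- v) - H x p \<le> D * norm v powr r' + C" for p v x
  proof -
    have "inner p (- v) \<le> norm p * norm v" using norm_cauchy_schwarz[of p "- v"] by simp
    also have "\<dots> = (lam * norm p) * (norm v / lam)" using lam(1) by simp
    also have "\<dots> \<le> (lam * norm p) powr r / r + (norm v / lam) powr r' / r'" using lam(1) by (intro Youngs_inequality r r'1 r') auto
    also have "(lam * norm p) powr r / r = norm p powr r / (r * C)" using lam by (simp add: powr_mult)
    also have "(norm v / lam) powr r' / r' = D * norm v powr r'" using lam(1) by (simp add: D_def powr_divide)
    finally show ?thesis using C(2)[of p x] by linarith
  qed
  have bdd: "bdd_above (range (\<lambda>p. inner p (- v) - H x p))" for x v by (rule bdd_aboveI2[OF up])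
  have fen: "- inner p v - H x p \<le> lagrangian H x v" for x p v
    unfolding lagrangian_def convex_conj_def using cSUP_upper[OF UNIV_I bdd, of p] by simp
  show thesis
  proof (rule that[of "max C D"])
    show "0 \<le> max C D" using D by simp
    show "- inner p v - H x p \<le> lagrangian H x v" for x p v by (rule fen)
    fix x v
    have "H x 0 \<le> C" using C(3)[of x 0] by simp
    then show "- max C D \<le> lagrangian H x v" using fen[of 0 v x] by simp
    have "lagrangian H x v \<le> D * norm v powr r' + C" unfolding lagrangian_def convex_conj_def by (rule cSUP_least) (use up in auto)
    also have "\<dots> \<le> max C D * norm v powr r' + max C D" by (intro add_mono mult_right_mono) auto
    finally show "lagrangian H x v \<le> max C D * norm v powr r' + max C D" .
  qed
qed

lemma lagrangian_measurable:
  fixes H :: "'d::finite torus \<Rightarrow> real ^ 'd \<Rightarrow> real"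
  assumes H: "hamiltonian_cond q r H" and r': "1 / r + 1 / r' = 1"
  shows "(\<lambda>z. lagrangian H (fst z) (snd z)) \<in> borel_measurable borel"
proof (rule borel_measurableI_greater)
  fix a
  obtain C where C: "0 \<le> C" "\<And>x p v. - inner p v - H x p \<le> lagrangian H x v"
    "\<And>x v. - C \<le> lagrangian H x v" "\<And>x v. lagrangian H x v \<le> C * norm v powr r' + C" using lagrangian_bounds[OF H r'] by metis
  have bdd: "bdd_above (range (\<lambda>p. inner p (- v) - H x p))" for x v
    by (rule bdd_aboveI2[of _ _ "lagrangian H x v"]) (use C(2)[of _ v x] in simp)
  have "{z \<in> space borel. a < lagrangian H (fst z) (snd z)} = (\<Union>p. {z. a < inner p (- snd z) - H (fst z) p})"
  proof -
    have "a < lagrangian H x v \<longleftrightarrow> (\<exists>p. a < inner p (- v) - H x p)" for x v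
      unfolding lagrangian_def convex_conj_def by (subst less_cSUP_iff[OF UNIV_not_empty bdd]) simp
    then show ?thesis by auto
  qed
  moreover have "open {z. a < inner p (- snd z) - H (fst z) p}" for p
  proof -
    have Hc: "continuous_on UNIV (\<lambda>(x, p). H x p)" using H by (simp add: hamiltonian_cond_def)
    have "continuous_on UNIV (\<lambda>z :: 'd torus \<times> (real ^ 'd). H (fst z) p)"
      using continuous_on_compose2[OF Hc, of UNIV "\<lambda>z. (fst z, p)"] by (simp add: continuous_intros)
    then show ?thesis by (intro open_Collect_less continuous_intros)
  qed
  ultimately show "{z \<in> space borel. a < lagrangian H (fst z) (snd z)} \<in> sets borel" by (simp add: open_UN)
qed

section \<open>The law of the open-loop trajectories\<close>

lemma prob_space_rand_space: "prob_space rand_space"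
  by (rule prob_spaceI) (simp add: rand_space_def emeasure_restrict_space space_restrict_space)

lemma space_rand_space: "space rand_space = {0..1}"
  by (simp add: rand_space_def space_restrict_space)

lemma sets_init_law[simp, measurable_cong]: "sets (init_law m0) = sets borel"
  by (simp add: init_law_def)

lemma prob_space_init_law:
  assumes "data_cond \<phi>T m0"
  shows "prob_space (init_law m0)"
proof (rule prob_spaceI)
  have c: "continuous_on UNIV m0" and n: "\<And>x. 0 \<le> m0 x" and i: "(\<integral>x. m0 x \<partial>torus_vol) = 1"
    using assms by (auto simp: data_cond_def)
  have [measurable]: "m0 \<in> borel_measurable borel" by (rule borel_measurable_continuous_onI[OF c])
  have "integrable torus_vol m0" using i not_integrable_integral_eq by fastforce
  then have "(\<integral>\<^sup>+x. ennreal (m0 x) \<partial>torus_vol) = ennreal 1" using i n by (subst nn_integral_eq_integral) auto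
  then show "emeasure (init_law m0) (space (init_law m0)) = 1" by (simp add: init_law_def emeasure_density)
qed

text \<open>Two measures that agree on bounded continuous functions agree on closed sets, whose indicators are
limits of such functions; the closed sets generate the Borel sets and are stable under
intersections.\<close>

lemma law_of_realization:
  fixes \<eta> :: "'d::finite curve measure"
  assumes D: "data_cond \<phi>T m0" and \<eta>: "\<eta> \<in> curve_measures T q r'" and b: "realizes T m0 \<eta> b"
  shows "b \<in> rand_space \<Otimes>\<^sub>M init_law m0 \<rightarrow>\<^sub>M curve_space T"
    and "\<eta> = distr (rand_space \<Otimes>\<^sub>M init_law m0) (curve_space T) b"
proof -
  let ?P = "rand_space \<Otimes>\<^sub>M init_law m0"
  have pe: "prob_space \<eta>" and se: "sets \<eta> = sets (curve_space T)" using \<eta> by (auto simp: curve_measures_def)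
  interpret E: prob_space \<eta> by (rule pe)
  interpret A: prob_space rand_space by (rule prob_space_rand_space)
  interpret B: prob_space "init_law m0" by (rule prob_space_init_law[OF D])
  interpret P: pair_prob_space rand_space "init_law m0" ..
  have "sets ?P = sets (rand_space \<Otimes>\<^sub>M borel)" by (intro sets_pair_measure_cong) auto
  then show bm: "b \<in> ?P \<rightarrow>\<^sub>M curve_space T" using b unfolding realizes_def by (simp cong: measurable_cong_sets)
  have int: "(\<integral>\<gamma>. h \<gamma> \<partial>\<eta>) = (\<integral>z. h (b z) \<partial>?P)" if "continuous_on (curves T) h" "bounded (h ` curves T)" for h :: "_ \<Rightarrow> real"
    using b that unfolding realizes_def by blast
  have ident: "(\<lambda>\<gamma>. \<gamma>) \<in> curve_space T \<rightarrow>\<^sub>M borel" unfolding curve_space_def by (rule measurable_restrict_space1) simp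
  have identE: "(\<lambda>\<gamma>. \<gamma>) \<in> \<eta> \<rightarrow>\<^sub>M borel" using ident se by (simp cong: measurable_cong_sets)
  have bB: "b \<in> ?P \<rightarrow>\<^sub>M borel" using measurable_compose[OF bm ident] by simp
  have spE: "space \<eta> = curves T" using sets_eq_imp_space_eq[OF se] by (simp add: space_curve_space)
  have bc: "b z \<in> curves T" if "z \<in> space ?P" for z using measurable_space[OF bm that] by (simp add: space_curve_space)
  have closed_eq: "emeasure (distr \<eta> borel (\<lambda>\<gamma>. \<gamma>)) C = emeasure (distr ?P borel b) C" if C: "closed C" for C
  proof (cases "C = {}")
    case False
    define h where "h = (\<lambda>(n::nat) \<gamma>. max 0 (1 - real n * infdist \<gamma> C))"
    have hc: "continuous_on UNIV (h n)" for n unfolding h_def by (intro continuous_intros continuous_on_infdist)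
    have hb: "0 \<le> h n \<gamma>" "h n \<gamma> \<le> 1" for n \<gamma> by (auto simp: h_def infdist_nonneg)
    have hm: "h n \<in> borel_measurable borel" for n by (rule borel_measurable_continuous_onI[OF hc])
    have hl: "(\<lambda>n. h n \<gamma>) \<longlonglongrightarrow> indicator C \<gamma>" for \<gamma>
    proof (cases "\<gamma> \<in> C")
      case True
      then show ?thesis by (simp add: h_def)
    next
      case False
      then have "0 < infdist \<gamma> C" using C \<open>C \<noteq> {}\<close> in_closed_iff_infdist_zero infdist_nonneg[of \<gamma> C] by fastforce
      moreover obtain n0 :: nat where "1 / infdist \<gamma> C < real n0" using reals_Archimedean2 by blast
      ultimately have n0: "1 < real n0 * infdist \<gamma> C" by (simp add: field_simps)
      have "\<forall>\<^sub>F n in sequentially. h n \<gamma> = 0" using eventually_ge_at_top[of n0]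
      proof (rule eventually_mono)
        fix n assume "n0 \<le> n"
        then have "real n0 * infdist \<gamma> C \<le> real n * infdist \<gamma> C" by (intro mult_right_mono infdist_nonneg) simp
        then show "h n \<gamma> = 0" using n0 by (simp add: h_def)
      qed
      then show ?thesis using False by (simp add: tendsto_eventually)
    qed
    have Cm[measurable]: "C \<in> sets borel" using C by simp
    have l1: "(\<lambda>n. \<integral>\<gamma>. h n \<gamma> \<partial>\<eta>) \<longlonglongrightarrow> (\<integral>\<gamma>. indicator C \<gamma> \<partial>\<eta>)"
      by (rule integral_dominated_convergence[where w="\<lambda>_. 1"])
        (use hl hb measurable_compose[OF identE hm] measurable_compose[OF identE borel_measurable_indicator[OF Cm]] in auto)
    have l2: "(\<lambda>n. \<integral>z. h n (b z) \<partial>?P) \<longlonglongrightarrow> (\<integral>z. indicator C (b z) \<partial>?P)"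
      by (rule integral_dominated_convergence[where w="\<lambda>_. 1"])
        (use hl hb measurable_compose[OF bB hm] measurable_compose[OF bB borel_measurable_indicator[OF Cm]] in auto)
    have "(\<integral>\<gamma>. h n \<gamma> \<partial>\<eta>) = (\<integral>z. h n (b z) \<partial>?P)" for n
    proof (rule int)
      show "continuous_on (curves T) (h n)" by (rule continuous_on_subset[OF hc]) simp
      show "bounded (h n ` curves T)" unfolding bounded_iff using hb by (intro exI[of _ 1]) auto
    qed
    then have eq: "(\<integral>\<gamma>. indicator C \<gamma> \<partial>\<eta>) = (\<integral>z. indicator C (b z) \<partial>?P :: real)"
      using LIMSEQ_unique[OF l1] l2 by simp
    have "measure (distr \<eta> borel (\<lambda>\<gamma>. \<gamma>)) C = (\<integral>\<gamma>. indicator C \<gamma> \<partial>distr \<eta> borel (\<lambda>\<gamma>. \<gamma>))" by simp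
    also have "\<dots> = (\<integral>\<gamma>. indicator C \<gamma> \<partial>\<eta>)" by (rule integral_distr[OF identE]) simp
    also have "\<dots> = (\<integral>\<gamma>. indicator C \<gamma> \<partial>distr ?P borel b)" unfolding eq by (rule integral_distr[OF bB, symmetric]) simp
    also have "\<dots> = measure (distr ?P borel b) C" by simp
    finally show ?thesis using prob_space.prob_space_distr[OF pe identE] P.prob_space_distr[OF bB]
      by (simp add: finite_measure.emeasure_eq_measure prob_space_def)
  qed simp
  have ext: "distr \<eta> borel (\<lambda>\<gamma>. \<gamma>) = distr ?P borel b"
  proof (rule measure_eqI_generator_eq[where E="Collect closed" and \<Omega>=UNIV and A="\<lambda>_. UNIV"])
    show "Int_stable (Collect (closed :: 'd curve set \<Rightarrow> bool))" by (auto simp: Int_stable_def)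
    show "emeasure (distr \<eta> borel (\<lambda>\<gamma>. \<gamma>)) X = emeasure (distr ?P borel b) X" if "X \<in> Collect closed" for X
      using that closed_eq by simp
    show "sets (distr \<eta> borel (\<lambda>\<gamma>. \<gamma>)) = sigma_sets UNIV (Collect closed)" by (simp add: borel_eq_closed)
    show "sets (distr ?P borel b) = sigma_sets UNIV (Collect closed)" by (simp add: borel_eq_closed)
    show "emeasure (distr \<eta> borel (\<lambda>\<gamma>. \<gamma>)) UNIV \<noteq> \<infinity>"
      using prob_space.emeasure_space_1[OF E.prob_space_distr[OF identE]] by simp
  qed auto
  show "\<eta> = distr ?P (curve_space T) b"
  proof (rule measure_eqI)
    show "sets \<eta> = sets (distr ?P (curve_space T) b)" using se by simp
    fix A assume A: "A \<in> sets \<eta>"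
    then obtain X where X: "X \<in> sets borel" "A = curves T \<inter> X" using se by (auto simp: curve_space_def sets_restrict_space)
    have "emeasure \<eta> A = emeasure (distr \<eta> borel (\<lambda>\<gamma>. \<gamma>)) X"
      using X by (subst emeasure_distr[OF identE]) (auto simp: spE Int_commute)
    also have "\<dots> = emeasure ?P (b -` X \<inter> space ?P)" unfolding ext using X by (subst emeasure_distr[OF bB]) auto
    also have "b -` X \<inter> space ?P = b -` A \<inter> space ?P" using X bc by auto
    also have "emeasure ?P (b -` A \<inter> space ?P) = emeasure (distr ?P (curve_space T) b) A" using A se by (subst emeasure_distr[OF bm]) auto
    finally show "emeasure \<eta> A = emeasure (distr ?P (curve_space T) b) A" .
  qed
qed

section \<open>The law of large numbers\<close>

text \<open>The game draws the seeds of all players and their initial positions separately. The pairs of seed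
and position of the different players are nevertheless independent, with law \<open>A \<Otimes>\<^sub>M B\<close>.\<close>

locale sampled_pairs =
  fixes A :: "'a measure" and B :: "'b measure" and I :: "nat set"
  assumes pA: "prob_space A" and pB: "prob_space B" and finI: "finite I"
begin

abbreviation "PP \<equiv> PiM I (\<lambda>_. A) \<Otimes>\<^sub>M PiM I (\<lambda>_. B)"

sublocale A: prob_space A by (rule pA)
sublocale B: prob_space B by (rule pB)
sublocale AB: pair_prob_space A B ..
sublocale PA: product_prob_space "\<lambda>_. A" I by unfold_locales
sublocale PB: product_prob_space "\<lambda>_. B" I by unfold_locales
sublocale PPs: pair_prob_space "PiM I (\<lambda>_. A)" "PiM I (\<lambda>_. B)" ..

lemma coordinate_measurable:
  assumes "l \<in> I"
  shows "(\<lambda>\<omega>. (fst \<omega> l, snd \<omega> l)) \<in> PP \<rightarrow>\<^sub>M A \<Otimes>\<^sub>M B"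
  by (intro measurable_Pair measurable_compose[OF measurable_fst measurable_component_singleton[OF assms]]
      measurable_compose[OF measurable_snd measurable_component_singleton[OF assms]])

lemma expectation_prod:
  fixes g :: "nat \<Rightarrow> 'a \<times> 'b \<Rightarrow> real"
  assumes gm: "\<And>l. g l \<in> borel_measurable (A \<Otimes>\<^sub>M B)" and gb: "\<And>l z. \<bar>g l z\<bar> \<le> c"
  shows "integrable PP (\<lambda>\<omega>. \<Prod>l\<in>I. g l (fst \<omega> l, snd \<omega> l))"
    and "(\<integral>\<omega>. (\<Prod>l\<in>I. g l (fst \<omega> l, snd \<omega> l)) \<partial>PP) = (\<Prod>l\<in>I. \<integral>z. g l z \<partial>(A \<Otimes>\<^sub>M B))"
proof -
  have ga: "integrable (A \<Otimes>\<^sub>M B) (g l)" for l by (rule AB.P.integrable_const_bound[where B=c]) (use gb gm in auto)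
  have sec: "(\<lambda>y. g l (x, y)) \<in> borel_measurable B" if "x \<in> space A" for l x by (rule measurable_compose[OF _ gm]) (use that in simp)
  have isec: "integrable B (\<lambda>y. g l (x, y))" if "x \<in> space A" for l x
    by (rule B.integrable_const_bound[where B=c]) (use gb sec[OF that] in auto)
  have mprod: "(\<lambda>\<omega>. \<Prod>l\<in>I. g l (fst \<omega> l, snd \<omega> l)) \<in> borel_measurable PP"
    by (intro borel_measurable_prod measurable_compose[OF coordinate_measurable gm])
  show i: "integrable PP (\<lambda>\<omega>. \<Prod>l\<in>I. g l (fst \<omega> l, snd \<omega> l))"
  proof (rule PPs.P.integrable_const_bound[where B="c ^ card I"])
    show "AE \<omega> in PP. norm (\<Prod>l\<in>I. g l (fst \<omega> l, snd \<omega> l)) \<le> c ^ card I"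
    proof (rule AE_I2)
      fix \<omega>
      have "(\<Prod>l\<in>I. \<bar>g l (fst \<omega> l, snd \<omega> l)\<bar>) \<le> (\<Prod>l\<in>I. c)" by (intro prod_mono) (use gb in auto)
      then show "norm (\<Prod>l\<in>I. g l (fst \<omega> l, snd \<omega> l)) \<le> c ^ card I" by (simp add: abs_prod)
    qed
  qed (rule mprod)
  have "(\<integral>\<omega>. (\<Prod>l\<in>I. g l (fst \<omega> l, snd \<omega> l)) \<partial>PP)
      = (\<integral>w. \<integral>x. (\<Prod>l\<in>I. g l (w l, x l)) \<partial>PiM I (\<lambda>_. B) \<partial>PiM I (\<lambda>_. A))"
    using PPs.integral_fst'[OF i] by simp
  also have "\<dots> = (\<integral>w. (\<Prod>l\<in>I. \<integral>y. g l (w l, y) \<partial>B) \<partial>PiM I (\<lambda>_. A))"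
  proof (rule Bochner_Integration.integral_cong[OF refl])
    fix w assume w: "w \<in> space (PiM I (\<lambda>_. A))"
    show "(\<integral>x. (\<Prod>l\<in>I. g l (w l, x l)) \<partial>PiM I (\<lambda>_. B)) = (\<Prod>l\<in>I. \<integral>y. g l (w l, y) \<partial>B)"
      by (rule PB.product_integral_prod[OF finI]) (use isec w in \<open>auto simp: space_PiM PiE_iff\<close>)
  qed
  also have "\<dots> = (\<Prod>l\<in>I. \<integral>x. \<integral>y. g l (x, y) \<partial>B \<partial>A)"
    by (rule PA.product_integral_prod[OF finI]) (rule AB.integrable_fst'[OF ga])
  also have "\<dots> = (\<Prod>l\<in>I. \<integral>z. g l z \<partial>(A \<Otimes>\<^sub>M B))" by (intro prod.cong refl AB.integral_fst' ga)
  finally show "(\<integral>\<omega>. (\<Prod>l\<in>I. g l (fst \<omega> l, snd \<omega> l)) \<partial>PP) = (\<Prod>l\<in>I. \<integral>z. g l z \<partial>(A \<Otimes>\<^sub>M B))" .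
qed

lemma expectation_coordinate:
  fixes g :: "'a \<times> 'b \<Rightarrow> real"
  assumes "j \<in> I" "g \<in> borel_measurable (A \<Otimes>\<^sub>M B)"
  shows "(\<integral>\<omega>. g (fst \<omega> j, snd \<omega> j) \<partial>PP) = (\<integral>z. g z \<partial>(A \<Otimes>\<^sub>M B))"
    and "integrable PP (\<lambda>\<omega>. g (fst \<omega> j, snd \<omega> j)) \<longleftrightarrow> integrable (A \<Otimes>\<^sub>M B) g"
    and "distr PP (A \<Otimes>\<^sub>M B) (\<lambda>\<omega>. (fst \<omega> j, snd \<omega> j)) = A \<Otimes>\<^sub>M B"
proof -
  show d: "distr PP (A \<Otimes>\<^sub>M B) (\<lambda>\<omega>. (fst \<omega> j, snd \<omega> j)) = A \<Otimes>\<^sub>M B"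
  proof (rule measure_eqI)
    fix X assume "X \<in> sets (distr PP (A \<Otimes>\<^sub>M B) (\<lambda>\<omega>. (fst \<omega> j, snd \<omega> j)))"
    then have X: "X \<in> sets (A \<Otimes>\<^sub>M B)" by simp
    let ?g = "\<lambda>l. if l = j then indicator X else (\<lambda>_. 1 :: real)"
    have prod: "(\<Prod>l\<in>I. u l) = (u j :: real)" if "\<And>l. l \<noteq> j \<Longrightarrow> u l = 1" for u
      using assms(1) finI that by (subst prod.remove[of I j]) (auto intro!: prod.neutral)
    have "(\<integral>\<omega>. (\<Prod>l\<in>I. ?g l (fst \<omega> l, snd \<omega> l)) \<partial>PP) = (\<Prod>l\<in>I. \<integral>z. ?g l z \<partial>(A \<Otimes>\<^sub>M B))"
      by (rule expectation_prod(2)[where c=1]) (use X in \<open>auto simp: indicator_def\<close>)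
    also have "(\<Prod>l\<in>I. \<integral>z. ?g l z \<partial>(A \<Otimes>\<^sub>M B)) = (\<integral>z. indicator X z \<partial>(A \<Otimes>\<^sub>M B))"
      by (subst prod) (auto simp: AB.P.prob_space)
    also have "(\<lambda>\<omega>. \<Prod>l\<in>I. ?g l (fst \<omega> l, snd \<omega> l)) = (\<lambda>\<omega>. indicator X (fst \<omega> j, snd \<omega> j))"
      by (intro ext, subst prod) auto
    finally have eq: "(\<integral>\<omega>. indicator X (fst \<omega> j, snd \<omega> j) \<partial>PP) = (\<integral>z. indicator X z \<partial>(A \<Otimes>\<^sub>M B) :: real)" .
    have "measure (distr PP (A \<Otimes>\<^sub>M B) (\<lambda>\<omega>. (fst \<omega> j, snd \<omega> j))) X = (\<integral>z. indicator X z \<partial>distr PP (A \<Otimes>\<^sub>M B) (\<lambda>\<omega>. (fst \<omega> j, snd \<omega> j)))"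
      using X sets.sets_into_space[OF X] by (simp add: Int_absorb2)
    also have "\<dots> = (\<integral>\<omega>. indicator X (fst \<omega> j, snd \<omega> j) \<partial>PP)"
      by (rule integral_distr[OF coordinate_measurable[OF assms(1)]]) (use X in simp)
    also have "\<dots> = measure (A \<Otimes>\<^sub>M B) X" unfolding eq using X sets.sets_into_space[OF X] by (simp add: Int_absorb2)
    finally show "emeasure (distr PP (A \<Otimes>\<^sub>M B) (\<lambda>\<omega>. (fst \<omega> j, snd \<omega> j))) X = emeasure (A \<Otimes>\<^sub>M B) X"
      using PPs.P.prob_space_distr[OF coordinate_measurable[OF assms(1)]]
      by (simp add: finite_measure.emeasure_eq_measure AB.P.emeasure_eq_measure prob_space_def)
  qed simp
  have "(\<integral>z. g z \<partial>distr PP (A \<Otimes>\<^sub>M B) (\<lambda>\<omega>. (fst \<omega> j, snd \<omega> j))) = (\<integral>\<omega>. g (fst \<omega> j, snd \<omega> j) \<partial>PP)"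
    by (rule integral_distr[OF coordinate_measurable[OF assms(1)] assms(2)])
  then show "(\<integral>\<omega>. g (fst \<omega> j, snd \<omega> j) \<partial>PP) = (\<integral>z. g z \<partial>(A \<Otimes>\<^sub>M B))" by (simp only: d)
  have "integrable (distr PP (A \<Otimes>\<^sub>M B) (\<lambda>\<omega>. (fst \<omega> j, snd \<omega> j))) g \<longleftrightarrow> integrable PP (\<lambda>\<omega>. g (fst \<omega> j, snd \<omega> j))"
    by (rule integrable_distr_eq[OF coordinate_measurable[OF assms(1)] assms(2)])
  then show "integrable PP (\<lambda>\<omega>. g (fst \<omega> j, snd \<omega> j)) \<longleftrightarrow> integrable (A \<Otimes>\<^sub>M B) g" by (simp only: d)
qed

text \<open>Distinct players have uncorrelated samples, so the second moment of the deviation is at most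
\<open>\<kappa>\<^sup>2 / card J\<close>, and it dominates the square of the first moment.\<close>

lemma mean_deviation:
  fixes Y :: "'a \<times> 'b \<Rightarrow> real"
  assumes Ym[measurable]: "Y \<in> borel_measurable (A \<Otimes>\<^sub>M B)" and Y: "\<And>z. 0 \<le> Y z" "\<And>z. Y z \<le> \<kappa>"
    and J: "J \<subseteq> I" "J \<noteq> {}"
  shows "(\<integral>\<omega>. \<bar>(\<Sum>j\<in>J. Y (fst \<omega> j, snd \<omega> j)) / card J - (\<integral>z. Y z \<partial>(A \<Otimes>\<^sub>M B))\<bar> \<partial>PP) \<le> \<kappa> / sqrt (card J)"
proof -
  define c where "c = (\<integral>z. Y z \<partial>(A \<Otimes>\<^sub>M B))"
  have iY: "integrable (A \<Otimes>\<^sub>M B) Y" by (rule AB.P.integrable_const_bound[where B=\<kappa>]) (use Y in auto)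
  have c: "0 \<le> c" "c \<le> \<kappa>"
  proof -
    show "0 \<le> c" unfolding c_def using Y by simp
    have "c \<le> (\<integral>z. \<kappa> \<partial>(A \<Otimes>\<^sub>M B))" unfolding c_def using iY Y by (intro integral_mono) auto
    then show "c \<le> \<kappa>" by (simp add: AB.P.prob_space)
  qed
  have \<kappa>: "0 \<le> \<kappa>" using c by linarith
  define W where "W = (\<lambda>z. Y z - c)"
  have Wm[measurable]: "W \<in> borel_measurable (A \<Otimes>\<^sub>M B)" unfolding W_def by measurable
  have W: "\<bar>W z\<bar> \<le> \<kappa>" for z using Y[of z] c unfolding W_def by (auto simp: abs_le_iff)
  have W0: "(\<integral>z. W z \<partial>(A \<Otimes>\<^sub>M B)) = 0" unfolding W_def using iY by (simp add: c_def AB.P.prob_space)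
  have finJ: "finite J" using J finI finite_subset by blast
  let ?n = "real (card J)"
  have n: "0 < ?n" using J finJ by (simp add: card_gt_0_iff)
  let ?W = "\<lambda>j \<omega>. W (fst \<omega> j, snd \<omega> j)"
  have mW: "?W j \<in> borel_measurable PP" if "j \<in> J" for j using measurable_compose[OF coordinate_measurable Wm] that J by blast
  have WW: "\<bar>W z * W z'\<bar> \<le> \<kappa> * \<kappa>" for z z' unfolding abs_mult by (intro mult_mono W \<kappa>) auto
  have iWW: "integrable PP (\<lambda>\<omega>. ?W j \<omega> * ?W k \<omega>)" if "j \<in> J" "k \<in> J" for j k
    by (rule PPs.P.integrable_const_bound[where B="\<kappa> * \<kappa>"]) (use WW mW that in auto)
  have cov: "(\<integral>\<omega>. ?W j \<omega> * ?W k \<omega> \<partial>PP) \<le> (if j = k then \<kappa> * \<kappa> else 0)" if jk: "j \<in> J" "k \<in> J" for j k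
  proof (cases "j = k")
    case True
    have "(\<integral>\<omega>. ?W j \<omega> * ?W k \<omega> \<partial>PP) \<le> (\<integral>\<omega>. \<kappa> * \<kappa> \<partial>PP)"
      using iWW[OF jk] WW by (intro integral_mono) (auto intro: abs_le_D1)
    then show ?thesis using True by (simp add: PPs.P.prob_space)
  next
    case False
    let ?g = "\<lambda>l. if l = j \<or> l = k then W else (\<lambda>_. 1)"
    have split: "(\<Prod>l\<in>I. u l) = (u j * u k :: real)" if "\<And>l. l \<noteq> j \<Longrightarrow> l \<noteq> k \<Longrightarrow> u l = 1" for u
    proof -
      have "(\<Prod>l\<in>I. u l) = (\<Prod>l\<in>{j, k}. u l)" using finI J jk that by (intro prod.mono_neutral_right) auto
      then show ?thesis using False by simp
    qed
    have "(\<integral>\<omega>. (\<Prod>l\<in>I. ?g l (fst \<omega> l, snd \<omega> l)) \<partial>PP) = (\<Prod>l\<in>I. \<integral>z. ?g l z \<partial>(A \<Otimes>\<^sub>M B))"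
    proof (rule expectation_prod(2)[where c="max \<kappa> 1"])
      show "\<bar>?g l z\<bar> \<le> max \<kappa> 1" for l z using W[of z] by (auto simp: le_max_iff_disj)
    qed auto
    also have "\<dots> = (\<integral>z. ?g j z \<partial>(A \<Otimes>\<^sub>M B)) * (\<integral>z. ?g k z \<partial>(A \<Otimes>\<^sub>M B))"
      by (rule split) (simp add: AB.P.prob_space)
    also have "\<dots> = 0" by (simp add: W0)
    also have "(\<lambda>\<omega>. \<Prod>l\<in>I. ?g l (fst \<omega> l, snd \<omega> l)) = (\<lambda>\<omega>. ?W j \<omega> * ?W k \<omega>)"
      by (intro ext, subst split) auto
    finally show ?thesis using False by simp
  qed
  define S where "S = (\<lambda>\<omega>. (\<Sum>j\<in>J. ?W j \<omega>) / ?n)"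
  have Sm: "S \<in> borel_measurable PP" unfolding S_def using mW by (intro borel_measurable_divide borel_measurable_sum) auto
  have S2: "(S \<omega>)\<^sup>2 = (\<Sum>j\<in>J. \<Sum>k\<in>J. ?W j \<omega> * ?W k \<omega>) / ?n\<^sup>2" for \<omega>
    by (simp add: S_def power_divide power2_eq_square sum_product)
  have iS2: "integrable PP (\<lambda>\<omega>. (S \<omega>)\<^sup>2)"
    unfolding S2 by (intro integrable_divide_zero Bochner_Integration.integrable_sum iWW)
  have "(\<integral>\<omega>. (S \<omega>)\<^sup>2 \<partial>PP) = (\<Sum>j\<in>J. \<Sum>k\<in>J. \<integral>\<omega>. ?W j \<omega> * ?W k \<omega> \<partial>PP) / ?n\<^sup>2"
    unfolding S2 using iWW by (simp add: Bochner_Integration.integral_sum)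
  also have "\<dots> \<le> (\<Sum>j\<in>J. \<Sum>k\<in>J. if j = k then \<kappa> * \<kappa> else 0) / ?n\<^sup>2"
    by (intro divide_right_mono sum_mono cov) auto
  also have "\<dots> = \<kappa>\<^sup>2 / ?n" using finJ n by (simp add: power2_eq_square)
  finally have var: "(\<integral>\<omega>. (S \<omega>)\<^sup>2 \<partial>PP) \<le> \<kappa>\<^sup>2 / ?n" .
  have Sb: "\<bar>S \<omega>\<bar> \<le> \<kappa>" for \<omega>
  proof -
    have "\<bar>\<Sum>j\<in>J. ?W j \<omega>\<bar> \<le> (\<Sum>j\<in>J. \<kappa>)" by (rule order_trans[OF sum_abs sum_mono]) (rule W)
    then show ?thesis using n by (simp add: S_def field_simps)
  qed
  have iS: "integrable PP (\<lambda>\<omega>. \<bar>S \<omega>\<bar>)" by (rule PPs.P.integrable_const_bound[where B=\<kappa>]) (use Sb Sm in auto)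
  define e where "e = (\<integral>\<omega>. \<bar>S \<omega>\<bar> \<partial>PP)"
  have "0 \<le> (\<integral>\<omega>. (\<bar>S \<omega>\<bar> - e)\<^sup>2 \<partial>PP)" by simp
  also have "\<dots> = (\<integral>\<omega>. (S \<omega>)\<^sup>2 - 2 * e * \<bar>S \<omega>\<bar> + e\<^sup>2 \<partial>PP)"
    by (intro Bochner_Integration.integral_cong refl) (simp add: power2_diff algebra_simps)
  also have "\<dots> = (\<integral>\<omega>. (S \<omega>)\<^sup>2 \<partial>PP) - 2 * e * e + e\<^sup>2"
    using iS2 iS by (simp add: e_def[symmetric] PPs.P.prob_space)
  finally have "e\<^sup>2 \<le> (\<integral>\<omega>. (S \<omega>)\<^sup>2 \<partial>PP)" by (simp add: power2_eq_square)
  with var have "e\<^sup>2 \<le> \<kappa>\<^sup>2 / ?n" by linarith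
  then have "e \<le> sqrt (\<kappa>\<^sup>2 / ?n)" by (rule real_le_rsqrt)
  also have "\<dots> = \<kappa> / sqrt ?n" using \<kappa> by (simp add: real_sqrt_divide)
  finally have "e \<le> \<kappa> / sqrt ?n" .
  moreover have "S \<omega> = (\<Sum>j\<in>J. Y (fst \<omega> j, snd \<omega> j)) / ?n - c" for \<omega>
    using n by (simp add: S_def W_def sum_subtractf diff_divide_distrib)
  ultimately show ?thesis by (simp add: e_def c_def)
qed

end

section \<open>The setting\<close>

locale mean_field_game =
  fixes T q r r' :: real
    and f :: "'d::finite torus \<Rightarrow> real \<Rightarrow> real"
    and H :: "'d torus \<Rightarrow> real ^ 'd \<Rightarrow> real"
    and \<phi>T m0 :: "'d torus \<Rightarrow> real"
    and \<xi> :: "real ^ 'd \<Rightarrow> real"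
    and m \<phi> :: "real \<times> 'd torus \<Rightarrow> real"
    and \<mu> :: "real \<Rightarrow> 'd torus measure"
    and \<eta> :: "'d curve measure"
    and b :: "real \<times> 'd torus \<Rightarrow> 'd curve"
    and Kl :: real
  assumes T: "0 < T" and coupling: "coupling_cond q f" and hamiltonian: "hamiltonian_cond q r H"
    and conj_exp: "1 / r + 1 / r' = 1" and x_dependence: "x_dependence_cond r H"
    and data: "data_cond \<phi>T m0" and kernel: "reg_kernel \<xi>"
    and lipschitz: "\<And>x. Kl-lipschitz_on {0..} (f x)"
    and weak: "weak_solution T q r f H \<phi>T m0 m \<phi>" and rep: "continuous_rep T m \<mu>"
    and curves: "\<eta> \<in> curve_measures T q r'" and C1: "\<forall>t\<in>{0..T}. \<mu> t = eval_law \<eta> t"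
    and C2: "ereal (\<integral>x. \<phi> (0, x) \<partial>\<mu> 0) = ereal (\<integral>x. \<phi>T x \<partial>\<mu> T)
      + ext_integral \<eta> (path_integral T r' (\<lambda>s. lagrangian H))
      + ereal (\<integral>z. f (snd z) (max 0 (m z)) * m z \<partial>st_vol T)"
    and realizes: "realizes T m0 \<eta> b"
begin

lemma Kl: "0 \<le> Kl"
  using lipschitz lipschitz_on_nonneg by blast

text \<open>The coupling is extended by \<open>0\<close> to negative arguments, because the density is nonnegative only
almost everywhere; it stays Lipschitz continuous.\<close>

definition fp :: "'d torus \<Rightarrow> real \<Rightarrow> real" where "fp x a = f x (max 0 a)"

lemma fp_eq: "0 \<le> a \<Longrightarrow> fp x a = f x a" by (simp add: fp_def max_absorb2)

lemma fp_0: "fp x 0 = 0" using coupling by (simp add: fp_def coupling_cond_def)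

lemma fp_nonneg: "0 \<le> fp x a"
proof (cases "0 < a")
  case True
  have mono: "strict_mono_on {0..} (f x)" and "f x 0 = 0" using coupling unfolding coupling_cond_def by blast+
  have "f x 0 < f x a" using True by (intro strict_mono_onD[OF mono]) auto
  then have "0 < f x a" using \<open>f x 0 = 0\<close> by simp
  then show ?thesis using True by (simp add: fp_def max_absorb2)
next
  case False
  then have "max 0 a = 0" by simp
  then show ?thesis using coupling by (simp add: fp_def coupling_cond_def)
qed

lemma fp_lipschitz: "\<bar>fp x a - fp x c\<bar> \<le> Kl * \<bar>a - c\<bar>"
proof -
  have "dist (f x (max 0 a)) (f x (max 0 c)) \<le> Kl * dist (max 0 a) (max 0 c)" by (rule lipschitz_onD[OF lipschitz]) auto
  also have "\<dots> \<le> Kl * \<bar>a - c\<bar>" using Kl by (intro mult_left_mono) (auto simp: dist_real_def)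
  finally show ?thesis by (simp add: fp_def dist_real_def)
qed

lemma fp_le: "fp x a \<le> Kl * \<bar>a\<bar>"
  using fp_lipschitz[of x a 0] fp_0[of x] fp_nonneg[of x a] by simp

lemma fp_measurable: "(\<lambda>z. fp (fst z) (snd z)) \<in> borel_measurable borel"
proof (rule borel_measurable_continuous_onI)
  have c: "continuous_on (UNIV \<times> {0..}) (\<lambda>(x, m). f x m)" using coupling by (simp add: coupling_cond_def)
  have "continuous_on UNIV (\<lambda>z :: 'd torus \<times> real. (\<lambda>(x, m). f x m) (fst z, max 0 (snd z)))"
    by (rule continuous_on_compose2[OF c]) (auto intro!: continuous_intros)
  then show "continuous_on UNIV (\<lambda>z :: 'd torus \<times> real. fp (fst z) (snd z))" by (simp add: fp_def)
qed

lemma fp_growth: obtains C where "0 < C" "\<And>x a. fp x a \<le> C * max 0 a powr (q - 1) + C"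
proof -
  obtain C where C: "C > 0" "\<forall>x. \<forall>m\<ge>0. m powr (q - 1) / C - C \<le> f x m \<and> f x m \<le> C * m powr (q - 1) + C"
    using coupling unfolding coupling_cond_def by blast
  show thesis
  proof (rule that[OF C(1)])
    show "fp x a \<le> C * max 0 a powr (q - 1) + C" for x a using C(2)[rule_format, of "max 0 a" x] by (simp add: fp_def)
  qed
qed

lemma q1: "1 < q" using coupling by (simp add: coupling_cond_def)

section \<open>Density and coupling along the solution\<close>

definition mp :: "real \<times> 'd torus \<Rightarrow> real" where "mp z = max 0 (m z)"
definition F :: "real \<times> 'd torus \<Rightarrow> real" where "F z = fp (snd z) (m z)"

lemma F_eq: "F z = f (snd z) (max 0 (m z))" by (simp add: F_def fp_def)

lemma F_mp: "F z = fp (snd z) (mp z)" by (simp add: F_def fp_def mp_def)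

lemma F_nonneg: "0 \<le> F z" by (simp add: F_def fp_nonneg)

lemma mp_nonneg: "0 \<le> mp z" by (simp add: mp_def)

lemma m_measurable[measurable]: "m \<in> borel_measurable (st_vol T)"
  using weak by (simp add: weak_solution_def Lp_def)

lemma mp_measurable[measurable]: "mp \<in> borel_measurable (st_vol T)"
  unfolding mp_def by measurable

lemma m_power_integrable: "integrable (st_vol T) (\<lambda>z. \<bar>m z\<bar> powr q)"
  using weak by (simp add: weak_solution_def Lp_def)

lemma mp_power_integrable: "integrable (st_vol T) (\<lambda>z. mp z powr q)"
proof (rule Bochner_Integration.integrable_bound[OF m_power_integrable])
  show "AE z in st_vol T. norm (mp z powr q) \<le> norm (\<bar>m z\<bar> powr q)"
  proof (rule AE_I2)
    fix z
    have "mp z powr q \<le> \<bar>m z\<bar> powr q" using q1 by (intro powr_mono2) (auto simp: mp_def)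
    then show "norm (mp z powr q) \<le> norm (\<bar>m z\<bar> powr q)" by simp
  qed
qed measurable

lemma mp_integrable: "integrable (st_vol T) mp"
proof (rule Bochner_Integration.integrable_bound)
  show "integrable (st_vol T) (\<lambda>z. 1 + mp z powr q)"
    using mp_power_integrable integrable_st_vol_const by (intro Bochner_Integration.integrable_add) auto
  show "AE z in st_vol T. norm (mp z) \<le> norm (1 + mp z powr q)"
  proof (rule AE_I2)
    fix z
    have "mp z \<le> 1 + mp z powr q"
    proof (cases "mp z \<le> 1")
      case False
      then have "mp z powr 1 \<le> mp z powr q" using q1 by (intro powr_mono) auto
      then show ?thesis using False mp_nonneg[of z] by simp
    qed (simp add: add_increasing2)
    then show "norm (mp z) \<le> norm (1 + mp z powr q)" using mp_nonneg[of z] by simp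
  qed
qed measurable

lemma F_measurable[measurable]: "F \<in> borel_measurable (st_vol T)"
proof -
  have "(\<lambda>z. (snd z, m z)) \<in> borel_measurable (st_vol T)" by (intro borel_measurable_Pair) measurable
  from measurable_compose[OF this fp_measurable] show ?thesis by (simp add: F_def[abs_def])
qed

lemma F_integrable: "integrable (st_vol T) F"
proof (rule Bochner_Integration.integrable_bound)
  show "integrable (st_vol T) (\<lambda>z. Kl * mp z)" using mp_integrable by simp
  show "AE z in st_vol T. norm (F z) \<le> norm (Kl * mp z)"
  proof (rule AE_I2)
    fix z show "norm (F z) \<le> norm (Kl * mp z)" using fp_le[of "snd z" "mp z"] F_nonneg[of z] mp_nonneg[of z] Kl by (simp add: F_mp)
  qed
qed measurable

lemma F_growth: obtains C where "0 < C" "\<And>z. F z \<le> C * mp z powr (q - 1) + C"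
  using fp_growth by (metis F_def mp_def)

lemma F_mp_integrable: "integrable (st_vol T) (\<lambda>z. F z * mp z)"
proof -
  obtain C where C: "0 < C" "\<And>z. F z \<le> C * mp z powr (q - 1) + C" using F_growth by metis
  show ?thesis
  proof (rule Bochner_Integration.integrable_bound)
    show "integrable (st_vol T) (\<lambda>z. C * mp z powr q + C * mp z)" using mp_integrable mp_power_integrable by simp
    show "AE z in st_vol T. norm (F z * mp z) \<le> norm (C * mp z powr q + C * mp z)"
    proof (rule AE_I2)
      fix z
      have "F z * mp z \<le> (C * mp z powr (q - 1) + C) * mp z" by (intro mult_right_mono C mp_nonneg)
      also have "\<dots> = C * (mp z powr (q - 1) * mp z) + C * mp z" by (simp add: algebra_simps)
      also have "\<dots> \<le> C * mp z powr q + C * mp z" using powr_mult_le_max[OF mp_nonneg mp_nonneg q1, of z z] C(1) by simp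
      finally show "norm (F z * mp z) \<le> norm (C * mp z powr q + C * mp z)" using F_nonneg[of z] mp_nonneg[of z] by simp
    qed
  qed measurable
qed

lemma integral_F_m: "(\<integral>z. f (snd z) (max 0 (m z)) * m z \<partial>st_vol T) = (\<integral>z. F z * mp z \<partial>st_vol T)"
proof (rule integral_cong_AE)
  have "AE z in st_vol T. 0 \<le> m z" using weak by (simp add: weak_solution_def)
  then show "AE z in st_vol T. f (snd z) (max 0 (m z)) * m z = F z * mp z" by (rule AE_mp) (auto simp: F_eq mp_def max_absorb2)
  show "(\<lambda>z. f (snd z) (max 0 (m z)) * m z) \<in> borel_measurable (st_vol T)" unfolding F_eq[symmetric] by measurable
qed measurable

section \<open>The value function lies below the cost of every curve\<close>

lemma \<phi>_continuous: "continuous_on ({0..T} \<times> UNIV) \<phi>"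
  using weak by (simp add: weak_solution_def)

lemma \<phi>T_continuous: "continuous_on UNIV \<phi>T"
  using data unfolding data_cond_def continuous_torus_iff by (meson Ck_on.simps(1) Ck_on_le le0)

lemma terminal_value: "\<phi> (T, x) = \<phi>T x"
  using weak by (intro trace_value[OF T \<phi>_continuous _ \<phi>T_continuous kernel]) (auto simp: weak_solution_def)

lemma subsolution_exists: "\<exists>G Cx. subsolution T r Cx H \<phi> F G"
proof -
  obtain g G \<mu>' where G: "weak_grad T \<phi> G" "Lp r (st_vol T) G"
    and sub: "\<forall>\<psi>\<in>test_funs T. (\<forall>z. \<psi> z \<ge> 0) \<longrightarrow>
          (\<integral>z. \<phi> z * dt \<psi> z \<partial>st_vol T) + (\<integral>z. H (snd z) (G z) * \<psi> z \<partial>st_vol T)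
            \<le> (\<integral>z. f (snd z) (max 0 (m z)) * \<psi> z \<partial>st_vol T)" using weak unfolding weak_solution_def by blast
  obtain \<theta> C where \<theta>: "0 \<le> \<theta>" "\<theta> < r / (real CARD('d) + 1)" "C > 0"
    "\<forall>x y p. \<bar>H x p - H y p\<bar> \<le> C * dist x y * max (norm p) 1 powr \<theta>"
    using x_dependence unfolding x_dependence_cond_def by blast
  obtain CL where CL: "\<And>x p v. - inner p v - H x p \<le> lagrangian H x v" using lagrangian_bounds[OF hamiltonian conj_exp] by metis
  obtain Ch where Ch: "Ch > 0" "\<forall>x p. norm p powr r / (r * Ch) - Ch \<le> H x p \<and> H x p \<le> Ch / r * norm p powr r + Ch"
    using hamiltonian unfolding hamiltonian_cond_def by blast
  have r1: "1 < r" using hamiltonian by (auto simp: hamiltonian_cond_def)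
  have [measurable]: "G \<in> borel_measurable (st_vol T)" and Gp: "integrable (st_vol T) (\<lambda>z. norm (G z) powr r)"
    using G(2) by (auto simp: Lp_def)
  have Hm: "(\<lambda>z. H (snd z) (G z)) \<in> borel_measurable (st_vol T)"
  proof -
    have Hb: "(\<lambda>z. (\<lambda>(x, p). H x p) z) \<in> borel_measurable borel"
      using hamiltonian by (intro borel_measurable_continuous_onI) (simp add: hamiltonian_cond_def)
    have "(\<lambda>z. (snd z, G z)) \<in> borel_measurable (st_vol T)" by (intro borel_measurable_Pair) measurable
    from measurable_compose[OF this Hb] show ?thesis by simp
  qed
  have one: "integrable (st_vol T) (\<lambda>z :: real \<times> 'd torus. 1 :: real)" by (rule integrable_st_vol_const)
  have "subsolution T r C H \<phi> F G"
  proof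
    show "integrable (st_vol T) G" using G(1) by (simp add: weak_grad_def)
    show "integrable (st_vol T) (\<lambda>z. max (norm (G z)) 1 powr r)"
    proof (rule Bochner_Integration.integrable_bound)
      show "integrable (st_vol T) (\<lambda>z. norm (G z) powr r + 1)" using Gp one by simp
      show "AE z in st_vol T. norm (max (norm (G z)) 1 powr r) \<le> norm (norm (G z) powr r + 1)"
      proof (rule AE_I2)
        fix z show "norm (max (norm (G z)) 1 powr r) \<le> norm (norm (G z) powr r + 1)" by (cases "norm (G z) \<le> 1") (auto simp: max_def)
      qed
    qed measurable
    show "integrable (st_vol T) (\<lambda>z. H (snd z) (G z))"
    proof (rule Bochner_Integration.integrable_bound[OF _ Hm])
      show "integrable (st_vol T) (\<lambda>z. Ch / r * norm (G z) powr r + Ch)"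
        by (intro Bochner_Integration.integrable_add integrable_st_vol_const Bochner_Integration.integrable_mult_right Gp)
      show "AE z in st_vol T. norm (H (snd z) (G z)) \<le> norm (Ch / r * norm (G z) powr r + Ch)"
      proof (rule AE_I2)
        fix z
        have h: "norm (G z) powr r / (r * Ch) - Ch \<le> H (snd z) (G z)" "H (snd z) (G z) \<le> Ch / r * norm (G z) powr r + Ch" using Ch(2) by auto
        have "0 \<le> norm (G z) powr r / (r * Ch)" "0 \<le> Ch / r * norm (G z) powr r" using Ch(1) r1 by auto
        with h show "norm (H (snd z) (G z)) \<le> norm (Ch / r * norm (G z) powr r + Ch)" using Ch(1) by (simp add: abs_le_iff)
      qed
    qed
    show "\<bar>H x p - H y p\<bar> \<le> C * dist x y * max (norm p) 1 powr (r / (real CARD('d) + 1))" for x y p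
    proof -
      have "\<bar>H x p - H y p\<bar> \<le> C * dist x y * max (norm p) 1 powr \<theta>" using \<theta>(4) by blast
      also have "\<dots> \<le> C * dist x y * max (norm p) 1 powr (r / (real CARD('d) + 1))" using \<theta> by (intro mult_left_mono powr_mono) auto
      finally show ?thesis .
    qed
    show "(\<integral>z. \<phi> z * Dx \<psi> z $ i \<partial>st_vol T) = - (\<integral>z. G z $ i * \<psi> z \<partial>st_vol T)" if "\<psi> \<in> test_funs T" for \<psi> i
      using G(1) that by (simp add: weak_grad_def)
    show "(\<integral>z. \<phi> z * dt \<psi> z \<partial>st_vol T) + (\<integral>z. H (snd z) (G z) * \<psi> z \<partial>st_vol T) \<le> (\<integral>z. F z * \<psi> z \<partial>st_vol T)"
      if "\<psi> \<in> test_funs T" "\<And>z. 0 \<le> \<psi> z" for \<psi> using sub that by (simp add: F_eq)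
  qed (use T \<phi>_continuous CL \<theta>(3) F_integrable F_nonneg in auto)
  then show ?thesis by blast
qed

text \<open>A substitute for the integral of \<open>F\<close> along the curve, which would depend on the values of \<open>F\<close> on a
null set: \<open>F\<close> is averaged over a neighbourhood of the curve.\<close>

definition coupling_cost :: "('d torus \<Rightarrow> real) \<Rightarrow> 'd curve \<Rightarrow> real" where
  "coupling_cost K \<gamma> = (\<integral>z. F z * K (snd z - apply_bcontfun \<gamma> (fst z)) \<partial>st_vol T)"

abbreviation action :: "'d curve \<Rightarrow> real" where
  "action \<gamma> \<equiv> LINT s:{0..T}|lborel. lagrangian H (apply_bcontfun \<gamma> s) (velocity T \<gamma> s)"

lemma action_integrable:
  assumes sob: "sobolev_curve T r' \<gamma>"
  shows "set_integrable lborel {0..T} (\<lambda>s. lagrangian H (apply_bcontfun \<gamma> s) (velocity T \<gamma> s))"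
proof -
  obtain C where C: "0 \<le> C" "\<And>x v. - C \<le> lagrangian H x v" "\<And>x v. lagrangian H x v \<le> C * norm v powr r' + C"
    using lagrangian_bounds[OF hamiltonian conj_exp] by metis
  have vi: "integrable (closed_time T) (velocity T \<gamma>)"
    using sobolev_has_velocity[OF sob] by (simp add: has_velocity_def set_integrable_closed_time)
  then have vm[measurable]: "velocity T \<gamma> \<in> borel_measurable (closed_time T)" by auto
  have pi: "integrable (closed_time T) (\<lambda>s. norm (velocity T \<gamma> s) powr r')"
    using sob by (simp add: sobolev_curve_def set_integrable_closed_time)
  have e1: "apply_bcontfun \<gamma> \<in> borel_measurable (closed_time T)"
    by (intro closed_time_measurable borel_measurable_continuous_onI continuous_curve)
  have lm: "(\<lambda>s. lagrangian H (apply_bcontfun \<gamma> s) (velocity T \<gamma> s)) \<in> borel_measurable (closed_time T)"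
    using measurable_compose[OF borel_measurable_Pair[OF e1 vm] lagrangian_measurable[OF hamiltonian conj_exp]] by simp
  interpret finite_measure "closed_time T" by (rule finite_restrict_lborel) auto
  show ?thesis unfolding set_integrable_closed_time
  proof (rule Bochner_Integration.integrable_bound[OF _ lm])
    show "integrable (closed_time T) (\<lambda>s. C * norm (velocity T \<gamma> s) powr r' + C)" using pi by simp
    show "AE s in closed_time T. norm (lagrangian H (apply_bcontfun \<gamma> s) (velocity T \<gamma> s)) \<le> norm (C * norm (velocity T \<gamma> s) powr r' + C)"
    proof (rule AE_I2)
      fix s
      have "0 \<le> C * norm (velocity T \<gamma> s) powr r'" using C(1) by simp
      then show "norm (lagrangian H (apply_bcontfun \<gamma> s) (velocity T \<gamma> s)) \<le> norm (C * norm (velocity T \<gamma> s) powr r' + C)"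
        using C(1) C(2,3)[of "apply_bcontfun \<gamma> s" "velocity T \<gamma> s"] unfolding real_norm_def by linarith
    qed
  qed
qed

text \<open>The bound of \<open>uniform_curve_bound\<close> for the lift that starts at the canonical representative.\<close>

lemma value_below_cost:
  assumes \<epsilon>: "0 < \<epsilon>"
  shows "\<exists>\<sigma>0>0. \<forall>\<sigma> \<gamma>. 0 < \<sigma> \<and> \<sigma> < \<sigma>0 \<and> sobolev_curve T r' \<gamma> \<longrightarrow>
    \<phi> (0, apply_bcontfun \<gamma> 0) \<le> \<phi>T (apply_bcontfun \<gamma> T) + action \<gamma> + coupling_cost (periodize (scaled_kernel \<xi> \<sigma>)) \<gamma> + \<epsilon>"
proof -
  obtain G Cx where "subsolution T r Cx H \<phi> F G" using subsolution_exists by blast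
  then interpret subsolution T r Cx H \<phi> F G .
  obtain C where C: "\<And>x v. - C \<le> lagrangian H x v" by (rule lagrangian_bounds[OF hamiltonian conj_exp]) blast
  show ?thesis
  proof (rule uniform_curve_bound[OF kernel C \<epsilon>], goal_cases)
  case (1 \<sigma>0)
  have "\<phi> (0, apply_bcontfun \<gamma> 0) \<le> \<phi>T (apply_bcontfun \<gamma> T) + action \<gamma> + coupling_cost (periodize (scaled_kernel \<xi> \<sigma>)) \<gamma> + \<epsilon>"
    if \<sigma>: "0 < \<sigma>" "\<sigma> < \<sigma>0" and sob: "sobolev_curve T r' \<gamma>" for \<sigma> \<gamma>
  proof -
    define v where "v = velocity T \<gamma>"
    define c where "c = (\<lambda>t. crep (apply_bcontfun \<gamma> 0) + integral {0..t} v)"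
    have hv: "set_integrable lborel {0..T} v"
      "\<And>t. t \<in> {0..T} \<Longrightarrow> apply_bcontfun \<gamma> t = apply_bcontfun \<gamma> 0 + to_torus (LINT s:{0..t}|lborel. v s)"
      using sobolev_has_velocity[OF sob, folded v_def] unfolding has_velocity_def by blast+
    have \<gamma>c: "apply_bcontfun \<gamma> t = to_torus (c t)" if t: "t \<in> {0..T}" for t
    proof -
      have "(LINT s:{0..t}|lborel. v s) = integral {0..t} v"
        by (rule set_borel_integral_eq_integral(2), rule set_integrable_subset[OF hv(1)]) (use t in auto)
      then show ?thesis using hv(2)[OF t] by (simp add: c_def to_torus_add)
    qed
    have c0: "c t = c 0 + integral {0..t} v" for t by (simp add: c_def)
    note ai = action_integrable[OF sob, folded v_def]
    have ai2: "set_integrable lborel {0..T} (\<lambda>t. lagrangian H (to_torus (c t)) (v t))"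
      using ai by (rule set_integrable_cong[THEN iffD1, rotated -1]) (use \<gamma>c in auto)
    note main = 1(2)[of \<sigma> v c, OF \<sigma> hv(1) c0 ai2]
    have "integral {0..T} (\<lambda>t. lagrangian H (to_torus (c t)) (v t)) = integral {0..T} (\<lambda>t. lagrangian H (apply_bcontfun \<gamma> t) (v t))"
      by (rule Henstock_Kurzweil_Integration.integral_cong) (simp add: \<gamma>c)
    also have "\<dots> = action \<gamma>" using set_borel_integral_eq_integral(2)[OF ai] by (simp add: v_def)
    finally have a: "integral {0..T} (\<lambda>t. lagrangian H (to_torus (c t)) (v t)) = action \<gamma>" .
    have k: "(\<integral>z. F z * periodize (scaled_kernel \<xi> \<sigma>) (snd z - to_torus (c (fst z))) \<partial>st_vol T) = coupling_cost (periodize (scaled_kernel \<xi> \<sigma>)) \<gamma>"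
      unfolding coupling_cost_def by (rule Bochner_Integration.integral_cong[OF refl]) (auto simp: space_st_vol \<gamma>c)
    show ?thesis using main T unfolding a k terminal_value[symmetric] by (simp add: \<gamma>c)
  qed
  then show ?case using 1(1) by blast
  qed
qed

section \<open>The regularised coupling along a curve\<close>

definition smear :: "real \<Rightarrow> (real \<Rightarrow> 'd torus measure) \<Rightarrow> real \<times> 'd torus \<Rightarrow> real" where
  "smear \<delta> \<nu> z = conv_measure (scaled_kernel \<xi> \<delta>) (\<nu> (fst z)) (snd z)"

lemma kernel_data:
  assumes "0 < \<sigma>"
  obtains R where "torus_kernel (R * \<sigma>) (periodize (scaled_kernel \<xi> \<sigma>))" "0 < R"
    "\<And>u x. u \<in> borel_measurable borel \<Longrightarrow> (\<And>z. 0 \<le> u z) \<Longrightarrow>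
      conv_fun u (scaled_kernel \<xi> \<sigma>) x = (\<integral>z. u z * periodize (scaled_kernel \<xi> \<sigma>) (x - z) \<partial>torus_vol)"
proof -
  obtain R where R: "R > 0" "\<And>x. \<xi> x \<noteq> 0 \<Longrightarrow> norm x < R" using reg_kernel_support[OF kernel] by blast
  interpret ball_kernel "scaled_kernel \<xi> \<sigma>" "R * \<sigma>" by (rule scaled_kernel_ball_kernel[OF kernel R(2) assms])
  show thesis by (rule that[OF torus_kernel_periodize R(1) conv_fun_periodize])
qed

text \<open>\<open>f\<close> is Lipschitz continuous and the kernel of width \<open>\<sigma>\<close> is bounded by \<open>\<kappa>\<close>: a mean error of the density over
space-time controls the error along the curve, uniformly in the curve.\<close>

lemma coupling_along_curve:
  fixes \<gamma> :: "'d curve" and \<nu> :: "real \<Rightarrow> 'd torus measure"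
  assumes \<sigma>: "0 < \<sigma>" and \<delta>: "0 < \<delta>"
    and \<kappa>: "\<And>z. periodize (scaled_kernel \<xi> \<sigma>) z \<le> \<kappa>"
    and sm[measurable]: "smear \<delta> \<nu> \<in> borel_measurable borel" and s0: "\<And>z. 0 \<le> smear \<delta> \<nu> z" and sb: "\<And>z. smear \<delta> \<nu> z \<le> B"
  shows "set_integrable lborel {0..T} (\<lambda>s. reg_coupling2 f \<xi> \<delta> \<sigma> (apply_bcontfun \<gamma> s) (\<nu> s))"
    and "\<bar>(LINT s:{0..T}|lborel. reg_coupling2 f \<xi> \<delta> \<sigma> (apply_bcontfun \<gamma> s) (\<nu> s)) - coupling_cost (periodize (scaled_kernel \<xi> \<sigma>)) \<gamma>\<bar>
      \<le> Kl * \<kappa> * (\<integral>z. \<bar>smear \<delta> \<nu> z - mp z\<bar> \<partial>st_vol T)"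
proof -
  let ?K = "periodize (scaled_kernel \<xi> \<sigma>)"
  let ?R = "\<lambda>s. reg_coupling2 f \<xi> \<delta> \<sigma> (apply_bcontfun \<gamma> s) (\<nu> s)"
  obtain R where K: "torus_kernel (R * \<sigma>) ?K"
    and conv: "\<And>u x. u \<in> borel_measurable borel \<Longrightarrow> (\<And>z. 0 \<le> u z) \<Longrightarrow>
      conv_fun u (scaled_kernel \<xi> \<sigma>) x = (\<integral>z. u z * ?K (x - z) \<partial>torus_vol)" using kernel_data[OF \<sigma>] by metis
  note [measurable] = torus_kernel_measurable[OF K]
  have K0: "0 \<le> ?K z" "?K (- z) = ?K z" for z using K by (auto simp: torus_kernel_def)
  have \<kappa>0: "0 \<le> \<kappa>" using K0(1)[of 0] \<kappa>[of 0] by linarith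
  have B0: "0 \<le> B" using s0[of undefined] sb[of undefined] by linarith
  have gb: "apply_bcontfun \<gamma> \<in> borel_measurable borel" by (intro borel_measurable_continuous_onI continuous_curve)
  have fs[measurable]: "(\<lambda>z. fp (snd z) (smear \<delta> \<nu> z)) \<in> borel_measurable borel"
  proof -
    have "(\<lambda>z. (snd z, smear \<delta> \<nu> z)) \<in> borel_measurable borel"
      by (intro borel_measurable_Pair sm borel_measurable_continuous_onI continuous_intros)
    from measurable_compose[OF this fp_measurable] show ?thesis by simp
  qed
  have sec: "(\<lambda>x. fp x (smear \<delta> \<nu> (s, x))) \<in> borel_measurable borel" for s
  proof -
    have "(\<lambda>x. (s, x)) \<in> borel_measurable borel" by (intro borel_measurable_continuous_onI continuous_intros)
    from measurable_compose[OF this fs] show ?thesis by simp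
  qed
  have fb: "fp x (smear \<delta> \<nu> z) \<le> Kl * B" for x z
  proof -
    have "fp x (smear \<delta> \<nu> z) \<le> Kl * \<bar>smear \<delta> \<nu> z\<bar>" by (rule fp_le)
    also have "\<dots> \<le> Kl * B" using s0[of z] sb[of z] Kl by (intro mult_left_mono) auto
    finally show ?thesis .
  qed
  let ?g = "\<lambda>z. fp (snd z) (smear \<delta> \<nu> z) * ?K (snd z - apply_bcontfun \<gamma> (fst z))"
  have R: "?R s = (\<integral>x. ?g (s, x) \<partial>torus_vol)" for s
  proof -
    have eq: "reg_coupling f \<xi> \<delta> z (\<nu> s) = fp z (smear \<delta> \<nu> (s, z))" for z
      unfolding reg_coupling_def fp_eq[OF s0] by (simp add: smear_def)
    have "?R s = (\<integral>z. fp z (smear \<delta> \<nu> (s, z)) * ?K (apply_bcontfun \<gamma> s - z) \<partial>torus_vol)"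
      unfolding reg_coupling2_def eq by (rule conv[OF sec fp_nonneg])
    also have "\<dots> = (\<integral>x. ?g (s, x) \<partial>torus_vol)" using K0(2)[of "_ - apply_bcontfun \<gamma> s"] by (simp add: minus_diff_eq)
    finally show ?thesis .
  qed
  have Kg: "(\<lambda>z. ?K (snd z - apply_bcontfun \<gamma> (fst z))) \<in> borel_measurable borel"
    by (intro borel_measurable_continuous_onI continuous_on_compose2[OF torus_kernel_continuous[OF K]] continuous_intros
        continuous_on_compose2[OF continuous_curve]) auto
  have gm: "?g \<in> borel_measurable borel" using fs Kg by (rule borel_measurable_times)
  have gbd: "\<bar>?g z\<bar> \<le> Kl * B * \<kappa>" for z
    using fb[of "snd z" z] fp_nonneg[of "snd z"] K0(1) \<kappa> Kl B0 by (simp add: abs_mult) (intro mult_mono, auto)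
  have Rm: "?R \<in> borel_measurable borel" unfolding R[abs_def]
  proof (rule torus_vol.borel_measurable_lebesgue_integral)
    have "?g \<in> borel_measurable (borel \<Otimes>\<^sub>M borel)" using gm by (simp only: borel_prod)
    then show "(\<lambda>(s, x). ?g (s, x)) \<in> borel_measurable (borel \<Otimes>\<^sub>M torus_vol)"
      by (simp add: case_prod_unfold cong: measurable_cong_sets)
  qed
  have Rb: "\<bar>?R s\<bar> \<le> Kl * B * \<kappa>" for s
  proof -
    have "\<bar>?R s\<bar> \<le> (\<integral>x. \<bar>?g (s, x)\<bar> \<partial>torus_vol)" unfolding R by (rule integral_abs_bound)
    also have "\<dots> \<le> (\<integral>x. Kl * B * \<kappa> \<partial>(torus_vol :: 'd torus measure))"
    proof (rule integral_mono)
      have "(\<lambda>x. (s, x)) \<in> borel_measurable borel" by (intro borel_measurable_continuous_onI continuous_intros)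
      from measurable_compose[OF this gm] have "(\<lambda>x. ?g (s, x)) \<in> borel_measurable torus_vol" by simp
      then show "integrable torus_vol (\<lambda>x. \<bar>?g (s, x)\<bar>)"
        using gbd by (intro torus_vol.integrable_const_bound[where B="Kl * B * \<kappa>"]) auto
    qed (use gbd in auto)
    also have "\<dots> = Kl * B * \<kappa>" by (simp add: torus_vol.prob_space[simplified])
    finally show ?thesis .
  qed
  interpret C: finite_measure "closed_time T" by (rule finite_restrict_lborel) auto
  show si: "set_integrable lborel {0..T} ?R" unfolding set_integrable_closed_time
    by (rule C.integrable_const_bound[where B="Kl * B * \<kappa>"]) (use Rb closed_time_measurable[OF Rm] in auto)
  interpret P: pair_sigma_finite "time_vol T" "torus_vol :: 'd torus measure" by (rule pair_st_vol)
  interpret S: finite_measure "st_vol T :: (real \<times> 'd torus) measure" by (rule finite_st_vol)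
  have ig: "integrable (st_vol T) ?g" by (rule S.integrable_const_bound[where B="Kl * B * \<kappa>"]) (use gbd st_vol_borel_measurable[OF gm] in auto)
  have "(LINT s:{0..T}|lborel. ?R s) = (\<integral>s. indicator {0<..<T} s *\<^sub>R ?R s \<partial>lborel)" unfolding set_lebesgue_integral_def
  proof (rule integral_cong_AE)
    have "AE s in lborel. s \<noteq> 0 \<and> s \<noteq> T" using AE_lborel_singleton[of 0] AE_lborel_singleton[of T] by auto
    then show "AE s in lborel. indicator {0..T} s *\<^sub>R ?R s = indicator {0<..<T} s *\<^sub>R ?R s" by (rule AE_mp) (auto simp: indicator_def)
  qed (use Rm in auto)
  also have "\<dots> = (\<integral>s. ?R s \<partial>time_vol T)" by (simp add: integral_restrict_space)
  also have "\<dots> = (\<integral>z. ?g z \<partial>st_vol T)" unfolding R st_vol_def by (rule P.integral_fst'[OF ig[unfolded st_vol_def]])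
  finally have eq: "(LINT s:{0..T}|lborel. ?R s) = (\<integral>z. ?g z \<partial>st_vol T)" .
  have iF: "integrable (st_vol T) (\<lambda>z. F z * ?K (snd z - apply_bcontfun \<gamma> (fst z)))"
    by (rule integrable_st_vol_bounded[OF F_integrable st_vol_borel_measurable[OF Kg], of \<kappa>]) (use K0 \<kappa> in auto)
  have id: "integrable (st_vol T) (\<lambda>z. \<bar>smear \<delta> \<nu> z - mp z\<bar>)"
  proof -
    have "integrable (st_vol T) (smear \<delta> \<nu>)"
      by (rule S.integrable_const_bound[where B=B]) (use s0 sb st_vol_borel_measurable[OF sm] in auto)
    then show ?thesis using mp_integrable by simp
  qed
  have "\<bar>(\<integral>z. ?g z \<partial>st_vol T) - coupling_cost ?K \<gamma>\<bar> = \<bar>\<integral>z. ?g z - F z * ?K (snd z - apply_bcontfun \<gamma> (fst z)) \<partial>st_vol T\<bar>"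
    unfolding coupling_cost_def using ig iF by simp
  also have "\<dots> \<le> (\<integral>z. Kl * \<kappa> * \<bar>smear \<delta> \<nu> z - mp z\<bar> \<partial>st_vol T)"
  proof (rule order_trans[OF integral_abs_bound integral_mono])
    fix z
    have "\<bar>?g z - F z * ?K (snd z - apply_bcontfun \<gamma> (fst z))\<bar> = \<bar>fp (snd z) (smear \<delta> \<nu> z) - fp (snd z) (mp z)\<bar> * ?K (snd z - apply_bcontfun \<gamma> (fst z))"
      using K0(1) by (simp add: F_mp left_diff_distrib[symmetric] abs_mult)
    also have "\<dots> \<le> (Kl * \<bar>smear \<delta> \<nu> z - mp z\<bar>) * \<kappa>" using Kl by (intro mult_mono fp_lipschitz \<kappa> K0) auto
    finally show "\<bar>?g z - F z * ?K (snd z - apply_bcontfun \<gamma> (fst z))\<bar> \<le> Kl * \<kappa> * \<bar>smear \<delta> \<nu> z - mp z\<bar>"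
      by (simp add: mult_ac)
  qed (use ig iF id in auto)
  finally show "\<bar>(LINT s:{0..T}|lborel. ?R s) - coupling_cost ?K \<gamma>\<bar> \<le> Kl * \<kappa> * (\<integral>z. \<bar>smear \<delta> \<nu> z - mp z\<bar> \<partial>st_vol T)"
    unfolding eq by simp
qed

end

section \<open>Integrals of extended-real costs\<close>

text \<open>The costs in the game are only ever compared with integrable functions: from below everywhere, and
from above almost everywhere, as a path outside \<open>W\<^sup>1\<^sup>,\<^sup>p\<close> has infinite cost.\<close>

lemma ext_integral_ge:
  assumes Y: "integrable M Y" and le: "\<And>x. x \<in> space M \<Longrightarrow> ereal (Y x) \<le> X x"
  shows "ereal (\<integral>x. Y x \<partial>M) \<le> ext_integral M X"
proof -
  let ?p = "\<integral>\<^sup>+x. ennreal (Y x) \<partial>M" and ?n = "\<integral>\<^sup>+x. ennreal (- Y x) \<partial>M"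
  have fin: "?p \<noteq> \<infinity>" "?n \<noteq> \<infinity>" using Y by (auto simp: real_integrable_def)
  have e: "enn2ereal a = ereal (enn2real a)" if "a \<noteq> \<infinity>" for a using that by (cases a) (auto simp: enn2ereal_ennreal)
  have "ereal (\<integral>x. Y x \<partial>M) = enn2ereal ?p - enn2ereal ?n"
    unfolding e[OF fin(1)] e[OF fin(2)] by (simp add: real_lebesgue_integral_def[OF Y])
  also have "\<dots> \<le> ext_integral M X" unfolding ext_integral_def
  proof (rule ereal_minus_mono)
    have "?p \<le> (\<integral>\<^sup>+x. e2ennreal (X x) \<partial>M)" using e2ennreal_mono[OF le] by (intro nn_integral_mono) simp
    then show "enn2ereal ?p \<le> enn2ereal (\<integral>\<^sup>+x. e2ennreal (X x) \<partial>M)" by (simp add: less_eq_ennreal.rep_eq)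
    have "(\<integral>\<^sup>+x. e2ennreal (- X x) \<partial>M) \<le> ?n"
    proof (rule nn_integral_mono)
      fix x assume "x \<in> space M"
      then have "- X x \<le> ereal (- Y x)" using le[of x] ereal_minus_le_minus[of "X x" "ereal (Y x)"] by simp
      from e2ennreal_mono[OF this] show "e2ennreal (- X x) \<le> ennreal (- Y x)" by simp
    qed
    then show "enn2ereal (\<integral>\<^sup>+x. e2ennreal (- X x) \<partial>M) \<le> enn2ereal ?n" by (simp add: less_eq_ennreal.rep_eq)
  qed
  finally show ?thesis .
qed

lemma ext_integral_le:
  assumes Y: "integrable M Y" and le: "AE x in M. X x \<le> ereal (Y x)"
  shows "ext_integral M X \<le> ereal (\<integral>x. Y x \<partial>M)"
proof -
  let ?p = "\<integral>\<^sup>+x. ennreal (Y x) \<partial>M" and ?n = "\<integral>\<^sup>+x. ennreal (- Y x) \<partial>M"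
  have fin: "?p \<noteq> \<infinity>" "?n \<noteq> \<infinity>" using Y by (auto simp: real_integrable_def)
  have e: "enn2ereal a = ereal (enn2real a)" if "a \<noteq> \<infinity>" for a using that by (cases a) (auto simp: enn2ereal_ennreal)
  have "ext_integral M X \<le> enn2ereal ?p - enn2ereal ?n" unfolding ext_integral_def
  proof (rule ereal_minus_mono)
    have "(\<integral>\<^sup>+x. e2ennreal (X x) \<partial>M) \<le> ?p"
    proof (rule nn_integral_mono_AE, rule AE_mp[OF le], rule AE_I2, rule impI)
      fix x assume "X x \<le> ereal (Y x)"
      from e2ennreal_mono[OF this] show "e2ennreal (X x) \<le> ennreal (Y x)" by simp
    qed
    then show "enn2ereal (\<integral>\<^sup>+x. e2ennreal (X x) \<partial>M) \<le> enn2ereal ?p" by (simp add: less_eq_ennreal.rep_eq)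
    have "?n \<le> (\<integral>\<^sup>+x. e2ennreal (- X x) \<partial>M)"
    proof (rule nn_integral_mono_AE, rule AE_mp[OF le], rule AE_I2, rule impI)
      fix x assume "X x \<le> ereal (Y x)"
      then have "ereal (- Y x) \<le> - X x" using ereal_minus_le_minus[of "ereal (Y x)" "X x"] by simp
      from e2ennreal_mono[OF this] show "ennreal (- Y x) \<le> e2ennreal (- X x)" by simp
    qed
    then show "enn2ereal ?n \<le> enn2ereal (\<integral>\<^sup>+x. e2ennreal (- X x) \<partial>M)" by (simp add: less_eq_ennreal.rep_eq)
  qed
  also have "\<dots> = ereal (\<integral>x. Y x \<partial>M)" unfolding e[OF fin(1)] e[OF fin(2)] by (simp add: real_lebesgue_integral_def[OF Y])
  finally show ?thesis .
qed

lemma ext_integral_finite: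
  assumes M: "finite_measure M" and Xm[measurable]: "X \<in> borel_measurable M" and c: "\<And>x. ereal c \<le> X x"
    and v: "ext_integral M X = ereal v"
  shows "AE x in M. X x \<noteq> \<infinity>" and "integrable M (\<lambda>x. real_of_ereal (X x))"
    and "(\<integral>x. real_of_ereal (X x) \<partial>M) = v"
proof -
  interpret finite_measure M by (rule M)
  let ?p = "\<integral>\<^sup>+x. e2ennreal (X x) \<partial>M" and ?n = "\<integral>\<^sup>+x. e2ennreal (- X x) \<partial>M"
  have "?n \<le> (\<integral>\<^sup>+x. ennreal (- c) \<partial>M)"
  proof (rule nn_integral_mono)
    fix x
    have "- X x \<le> ereal (- c)" using c[of x] ereal_minus_le_minus[of "X x" "ereal c"] by simp
    from e2ennreal_mono[OF this] show "e2ennreal (- X x) \<le> ennreal (- c)" by simp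
  qed
  also have "\<dots> < \<infinity>" by (simp add: ennreal_mult_eq_top_iff less_top[symmetric])
  finally have n: "?n \<noteq> \<infinity>" by simp
  have p: "?p \<noteq> \<infinity>"
  proof
    assume "?p = \<infinity>"
    then have "ext_integral M X = \<infinity>" using n by (cases ?n) (auto simp: ext_integral_def enn2ereal_ennreal)
    with v show False by simp
  qed
  have "AE x in M. e2ennreal (X x) \<noteq> \<infinity>" by (rule nn_integral_PInf_AE[OF _ p]) measurable
  then show fin: "AE x in M. X x \<noteq> \<infinity>" by (rule AE_mp) (auto intro!: AE_I2)
  have r: "ereal (real_of_ereal (X x)) = X x" if "X x \<noteq> \<infinity>" for x using that c[of x] by (cases "X x") auto
  have p2: "(\<integral>\<^sup>+x. ennreal (real_of_ereal (X x)) \<partial>M) = ?p"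
  proof (rule nn_integral_cong_AE, rule AE_mp[OF fin], rule AE_I2, rule impI)
    fix x assume "X x \<noteq> \<infinity>"
    from r[OF this] show "ennreal (real_of_ereal (X x)) = e2ennreal (X x)" by (metis e2ennreal_ereal)
  qed
  have n2: "(\<integral>\<^sup>+x. ennreal (- real_of_ereal (X x)) \<partial>M) = ?n"
  proof (rule nn_integral_cong_AE, rule AE_mp[OF fin], rule AE_I2, rule impI)
    fix x assume "X x \<noteq> \<infinity>"
    from r[OF this] show "ennreal (- real_of_ereal (X x)) = e2ennreal (- X x)" by (metis e2ennreal_ereal uminus_ereal.simps(1))
  qed
  show i: "integrable M (\<lambda>x. real_of_ereal (X x))" unfolding real_integrable_def p2 n2 using p n by simp
  have e: "enn2ereal a = ereal (enn2real a)" if "a \<noteq> \<infinity>" for a using that by (cases a) (auto simp: enn2ereal_ennreal)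
  have "ereal (\<integral>x. real_of_ereal (X x) \<partial>M) = ext_integral M X"
    unfolding ext_integral_def e[OF p] e[OF n] real_lebesgue_integral_def[OF i] p2 n2 by simp
  then show "(\<integral>x. real_of_ereal (X x) \<partial>M) = v" using v by simp
qed

context mean_field_game
begin

section \<open>The optimal measure on curves\<close>

lemma prob_\<eta>: "prob_space \<eta>" and sets_\<eta>[measurable_cong, simp]: "sets \<eta> = sets (curve_space T)"
  using curves by (auto simp: curve_measures_def)

lemma space_\<eta>: "space \<eta> = Defs.curves T"
  using sets_eq_imp_space_eq[OF sets_\<eta>] by (simp add: space_curve_space)

lemma eval_\<eta>: "(\<lambda>\<gamma>. apply_bcontfun \<gamma> s) \<in> borel_measurable \<eta>"
  using eval_measurable by (simp cong: measurable_cong_sets)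

lemma integral_law:
  fixes h :: "'d torus \<Rightarrow> real"
  assumes t: "t \<in> {0..T}" and h: "h \<in> borel_measurable borel"
  shows "(\<integral>x. h x \<partial>\<mu> t) = (\<integral>\<gamma>. h (apply_bcontfun \<gamma> t) \<partial>\<eta>)"
proof -
  have "\<mu> t = eval_law \<eta> t" using C1 t by blast
  then show ?thesis unfolding eval_law_def by (simp only: integral_distr[OF eval_\<eta> h])
qed

lemma action_lower_bound: "\<exists>c. \<forall>\<gamma>. ereal c \<le> path_integral T r' (\<lambda>s. lagrangian H) \<gamma>"
proof -
  obtain C where C: "0 \<le> C" "\<And>x v. - C \<le> lagrangian H x v" using lagrangian_bounds[OF hamiltonian conj_exp] by metis
  interpret finite_measure "closed_time T" by (rule finite_restrict_lborel) auto
  have "ereal (\<integral>s. - C \<partial>closed_time T) \<le> path_integral T r' (\<lambda>s. lagrangian H) \<gamma>" for \<gamma> :: "'d curve"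
  proof (cases "sobolev_curve T r' \<gamma>")
    case True
    note ai = action_integrable[OF True]
    have "(\<integral>s. - C \<partial>closed_time T) \<le> (\<integral>s. lagrangian H (apply_bcontfun \<gamma> s) (velocity T \<gamma> s) \<partial>closed_time T)"
      by (rule integral_mono) (use ai C(2) in \<open>auto simp: set_integrable_closed_time\<close>)
    then show ?thesis using True by (simp add: path_integral_def set_integral_closed_time)
  qed (simp add: path_integral_def)
  then show ?thesis by blast
qed

text \<open>All terms of \<open>C2\<close> other than the action are finite, so the action is integrable and \<open>\<eta>\<close>-almost every
curve belongs to \<open>W\<^sup>1\<^sup>,\<^sup>p\<close>.\<close>

lemma action_law:
  shows "AE \<gamma> in \<eta>. sobolev_curve T r' \<gamma>"
    and "integrable \<eta> (\<lambda>\<gamma>. real_of_ereal (path_integral T r' (\<lambda>s. lagrangian H) \<gamma>))"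
    and "(\<integral>\<gamma>. real_of_ereal (path_integral T r' (\<lambda>s. lagrangian H) \<gamma>) \<partial>\<eta>)
      = (\<integral>x. \<phi> (0, x) \<partial>\<mu> 0) - (\<integral>x. \<phi>T x \<partial>\<mu> T) - (\<integral>z. F z * mp z \<partial>st_vol T)"
proof -
  let ?X = "path_integral T r' (\<lambda>s. lagrangian H)"
  obtain c where c: "\<And>\<gamma>. ereal c \<le> ?X \<gamma>" using action_lower_bound by blast
  have Xm: "?X \<in> borel_measurable \<eta>"
    using path_integral_measurable[OF T lagrangian_measurable[OF hamiltonian conj_exp]] by (simp cong: measurable_cong_sets)
  have v: "ext_integral \<eta> ?X = ereal ((\<integral>x. \<phi> (0, x) \<partial>\<mu> 0) - (\<integral>x. \<phi>T x \<partial>\<mu> T) - (\<integral>z. F z * mp z \<partial>st_vol T))"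
    using C2 unfolding integral_F_m by (cases "ext_integral \<eta> ?X") auto
  note fin = ext_integral_finite[OF prob_space.finite_measure[OF prob_\<eta>] Xm c v]
  show "AE \<gamma> in \<eta>. sobolev_curve T r' \<gamma>" by (rule AE_mp[OF fin(1)], rule AE_I2) (simp add: path_integral_def split: if_splits)
  show "integrable \<eta> (\<lambda>\<gamma>. real_of_ereal (?X \<gamma>))" by (rule fin(2))
  show "(\<integral>\<gamma>. real_of_ereal (?X \<gamma>) \<partial>\<eta>) = (\<integral>x. \<phi> (0, x) \<partial>\<mu> 0) - (\<integral>x. \<phi>T x \<partial>\<mu> T) - (\<integral>z. F z * mp z \<partial>st_vol T)"
    by (rule fin(3))
qed

lemma density_section: "s \<in> {0<..<T} \<Longrightarrow> (\<lambda>x. mp (s, x)) \<in> borel_measurable torus_vol"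
proof -
  assume s: "s \<in> {0<..<T}"
  have "(\<lambda>x. (s, x)) \<in> torus_vol \<rightarrow>\<^sub>M st_vol T"
    unfolding st_vol_def by (rule measurable_Pair1') (use s in \<open>simp add: space_restrict_space\<close>)
  from measurable_compose[OF this mp_measurable] show ?thesis .
qed

lemma law_density: "AE s in time_vol T. eval_law \<eta> s = density torus_vol (\<lambda>x. ennreal (mp (s, x)))"
proof -
  have "AE s in time_vol T. \<mu> s = density torus_vol (\<lambda>x. ennreal (m (s, x)))" using rep by (simp add: continuous_rep_def)
  then show ?thesis
  proof (rule AE_mp, intro AE_I2 impI)
    fix s assume s: "s \<in> space (time_vol T)" and \<mu>: "\<mu> s = density torus_vol (\<lambda>x. ennreal (m (s, x)))"
    have "eval_law \<eta> s = \<mu> s" using C1 s by (auto simp: space_restrict_space)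
    then show "eval_law \<eta> s = density torus_vol (\<lambda>x. ennreal (mp (s, x)))" unfolding \<mu> mp_def by (simp add: ennreal_max_0)
  qed
qed

text \<open>\<open>C1\<close> says that the curves drawn from \<open>\<eta>\<close> are spread at almost every time with the density of the
solution; this holds simultaneously for all points of space.\<close>

lemma law_density_AE: "AE z in (st_vol T :: (real \<times> 'd torus) measure). fst z \<in> {0<..<T} \<and> eval_law \<eta> (fst z) = density torus_vol (\<lambda>x. ennreal (mp (fst z, x)))"
proof -
  interpret P: pair_sigma_finite "time_vol T" "torus_vol :: 'd torus measure" by (rule pair_st_vol)
  have "AE s in time_vol T. s \<in> {0<..<T} \<and> eval_law \<eta> s = density torus_vol (\<lambda>x. ennreal (mp (s, x)))"
    by (rule AE_mp[OF law_density], rule AE_I2) (simp add: space_restrict_space)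
  from P.AE_fst_pair[OF this] show ?thesis unfolding st_vol_def .
qed

lemma kernel_eval_measurable:
  fixes K :: "'d torus \<Rightarrow> real"
  assumes K: "torus_kernel s K"
  shows "(\<lambda>(\<gamma>, z). K (snd z - apply_bcontfun \<gamma> (fst z))) \<in> borel_measurable (curve_space T \<Otimes>\<^sub>M (st_vol T :: (real \<times> 'd torus) measure))"
proof -
  have e: "(\<lambda>p. apply_bcontfun (fst p) (fst (snd p))) \<in> borel_measurable (curve_space T \<Otimes>\<^sub>M (st_vol T :: (real \<times> 'd torus) measure))"
    by (rule eval_joint_measurable[OF fst_curve]) measurable
  have "(\<lambda>p. snd (snd p) - apply_bcontfun (fst p) (fst (snd p))) \<in> borel_measurable (curve_space T \<Otimes>\<^sub>M (st_vol T :: (real \<times> 'd torus) measure))"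
    by (rule torus_diff_measurable[OF _ e]) measurable
  from measurable_compose[OF this torus_kernel_measurable[OF K]] show ?thesis by (simp add: case_prod_unfold)
qed

lemma coupling_cost_bounds:
  fixes K :: "'d torus \<Rightarrow> real"
  assumes K: "torus_kernel s K"
  shows "coupling_cost K \<in> borel_measurable (curve_space T)" and "integrable \<eta> (coupling_cost K)"
    and "\<gamma> \<in> Defs.curves T \<Longrightarrow> integrable (st_vol T) (\<lambda>z. F z * K (snd z - apply_bcontfun \<gamma> (fst z)))"
    and "0 \<le> coupling_cost K \<gamma>"
proof -
  obtain \<kappa> where \<kappa>: "0 \<le> \<kappa>" "\<And>z. K z \<le> \<kappa>" using torus_kernel_bounded[OF K] by metis
  have K0: "0 \<le> K z" for z using K by (simp add: torus_kernel_def)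
  interpret S: finite_measure "st_vol T :: (real \<times> 'd torus) measure" by (rule finite_st_vol)
  interpret E: prob_space \<eta> by (rule prob_\<eta>)
  note [measurable] = kernel_eval_measurable[OF K]
  have fm: "(\<lambda>(\<gamma>, z). F z * K (snd z - apply_bcontfun \<gamma> (fst z))) \<in> borel_measurable (curve_space T \<Otimes>\<^sub>M st_vol T)"
  proof -
    have "(\<lambda>p. F (snd p) * (\<lambda>(\<gamma>, z). K (snd z - apply_bcontfun \<gamma> (fst z))) p) \<in> borel_measurable (curve_space T \<Otimes>\<^sub>M st_vol T)"
      by measurable
    then show ?thesis by (simp add: case_prod_unfold)
  qed
  show cm: "coupling_cost K \<in> borel_measurable (curve_space T)"
    unfolding coupling_cost_def[abs_def] by (rule S.borel_measurable_lebesgue_integral[OF fm])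
  show i: "integrable (st_vol T) (\<lambda>z. F z * K (snd z - apply_bcontfun \<gamma> (fst z)))" if g: "\<gamma> \<in> Defs.curves T" for \<gamma>
  proof (rule integrable_st_vol_bounded[OF F_integrable, of _ \<kappa>])
    have "(\<lambda>z. (\<gamma>, z)) \<in> st_vol T \<rightarrow>\<^sub>M curve_space T \<Otimes>\<^sub>M (st_vol T :: (real \<times> 'd torus) measure)"
      by (rule measurable_Pair1') (use g in \<open>simp add: space_curve_space\<close>)
    from measurable_compose[OF this kernel_eval_measurable[OF K]]
    show "(\<lambda>z. K (snd z - apply_bcontfun \<gamma> (fst z))) \<in> borel_measurable (st_vol T)" by simp
  qed (use \<kappa> K0 in auto)
  show n: "0 \<le> coupling_cost K \<gamma>" for \<gamma>
    unfolding coupling_cost_def by (intro integral_nonneg_AE AE_I2 mult_nonneg_nonneg F_nonneg K0)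
  show "integrable \<eta> (coupling_cost K)"
  proof (rule E.integrable_const_bound[where B="(\<integral>z. F z * \<kappa> \<partial>st_vol T)"])
    show "AE \<gamma> in \<eta>. norm (coupling_cost K \<gamma>) \<le> (\<integral>z. F z * \<kappa> \<partial>st_vol T)"
    proof (rule AE_I2)
      fix \<gamma> assume "\<gamma> \<in> space \<eta>"
      then have "coupling_cost K \<gamma> \<le> (\<integral>z. F z * \<kappa> \<partial>st_vol T)"
        unfolding coupling_cost_def by (intro integral_mono i mult_left_mono \<kappa> F_nonneg) (auto simp: space_\<eta> F_integrable)
      then show "norm (coupling_cost K \<gamma>) \<le> (\<integral>z. F z * \<kappa> \<partial>st_vol T)" using n[of \<gamma>] by simp
    qed
    show "coupling_cost K \<in> borel_measurable \<eta>" using cm by (simp cong: measurable_cong_sets)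
  qed
qed

text \<open>Averaged over \<open>\<eta>\<close>, the kernel no longer sits on a curve but on the density. The result is the pairing of
\<open>F\<close> with the density translated by \<open>y\<close>, averaged over \<open>y\<close> with weight \<open>K y\<close>, so \<open>shifted_pairing\<close>
applies.\<close>

lemma expected_coupling_cost:
  assumes \<epsilon>: "0 < \<epsilon>"
  shows "\<exists>d>0. \<forall>s K. torus_kernel s K \<and> s \<le> d \<longrightarrow> (\<integral>\<gamma>. coupling_cost K \<gamma> \<partial>\<eta>) \<le> (\<integral>z. F z * mp z \<partial>st_vol T) + \<epsilon>"
proof -
  obtain C where C: "0 < C" "\<And>z. F z \<le> C * mp z powr (q - 1) + C" using F_growth by metis
  obtain d where d: "0 < d" "\<forall>y. dist y 0 < d \<longrightarrow>
    (\<integral>\<^sup>+z. ennreal (F z * mp (fst z, snd z - y)) \<partial>st_vol T) \<le> (\<integral>\<^sup>+z. ennreal (F z * mp z) \<partial>st_vol T) + ennreal \<epsilon>"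
    using shifted_pairing[OF T q1 mp_integrable mp_power_integrable mp_nonneg F_measurable F_nonneg C(2) C(1) \<epsilon>] by blast
  interpret S: finite_measure "st_vol T :: (real \<times> 'd torus) measure" by (rule finite_st_vol)
  interpret E: prob_space \<eta> by (rule prob_\<eta>)
  interpret ES: pair_sigma_finite \<eta> "st_vol T :: (real \<times> 'd torus) measure" ..
  interpret ST: pair_sigma_finite "st_vol T :: (real \<times> 'd torus) measure" "torus_vol :: 'd torus measure" ..
  let ?I = "\<integral>z. F z * mp z \<partial>st_vol T"
  have I0: "0 \<le> ?I" by (intro integral_nonneg_AE AE_I2 mult_nonneg_nonneg F_nonneg mp_nonneg)
  have Ie: "(\<integral>\<^sup>+z. ennreal (F z * mp z) \<partial>st_vol T) = ennreal ?I"
    by (rule nn_integral_eq_integral[OF F_mp_integrable]) (use F_nonneg mp_nonneg in auto)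
  have "(\<integral>\<gamma>. coupling_cost K \<gamma> \<partial>\<eta>) \<le> ?I + \<epsilon>" if K: "torus_kernel s K" and s: "s \<le> d" for s and K :: "'d torus \<Rightarrow> real"
  proof -
    have K0: "0 \<le> K z" and Kd: "K z \<noteq> 0 \<Longrightarrow> dist z 0 < d" for z using K s by (auto simp: torus_kernel_def)
    note Km[measurable] = torus_kernel_measurable[OF K]
    have Kt[measurable]: "K \<in> borel_measurable torus_vol" using Km by (simp cong: measurable_cong_sets)
    note km = kernel_eval_measurable[OF K]
    have fm: "(\<lambda>(\<gamma>, z). ennreal (F z * K (snd z - apply_bcontfun \<gamma> (fst z)))) \<in> borel_measurable (\<eta> \<Otimes>\<^sub>M st_vol T)"
    proof -
      have "(\<lambda>p. ennreal (F (snd p) * (\<lambda>(\<gamma>, z). K (snd z - apply_bcontfun \<gamma> (fst z))) p)) \<in> borel_measurable (curve_space T \<Otimes>\<^sub>M st_vol T)"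
        using km by measurable
      moreover have "sets (\<eta> \<Otimes>\<^sub>M st_vol T) = sets (curve_space T \<Otimes>\<^sub>M (st_vol T :: (real \<times> 'd torus) measure))"
        by (rule sets_pair_measure_cong) auto
      ultimately show ?thesis by (simp add: case_prod_unfold cong: measurable_cong_sets)
    qed
    have shift: "(\<lambda>p. mp (fst (fst p), snd (fst p) - snd p)) \<in> borel_measurable (st_vol T \<Otimes>\<^sub>M torus_vol)"
    proof (rule measurable_compose[OF _ mp_measurable])
      have f: "(\<lambda>p. fst (fst p)) \<in> (st_vol T :: (real \<times> 'd torus) measure) \<Otimes>\<^sub>M (torus_vol :: 'd torus measure) \<rightarrow>\<^sub>M time_vol T"
        unfolding st_vol_def by measurable
      have g: "(\<lambda>p. snd (fst p) - snd p) \<in> (st_vol T :: (real \<times> 'd torus) measure) \<Otimes>\<^sub>M (torus_vol :: 'd torus measure) \<rightarrow>\<^sub>M torus_vol"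
        unfolding measurable_cong_sets[OF refl sets_torus_vol] by measurable
      show "(\<lambda>p. (fst (fst p), snd (fst p) - snd p)) \<in> (st_vol T :: (real \<times> 'd torus) measure) \<Otimes>\<^sub>M (torus_vol :: 'd torus measure) \<rightarrow>\<^sub>M st_vol T"
        using measurable_Pair[OF f g] by (simp only: st_vol_def[symmetric])
    qed
    have gm: "(\<lambda>(z, y). ennreal (K y * (F z * mp (fst z, snd z - y)))) \<in> borel_measurable (st_vol T \<Otimes>\<^sub>M torus_vol)"
    proof -
      have "(\<lambda>p. ennreal (K (snd p) * (F (fst p) * mp (fst (fst p), snd (fst p) - snd p)))) \<in> borel_measurable (st_vol T \<Otimes>\<^sub>M torus_vol)"
        using shift by measurable
      then show ?thesis by (simp add: case_prod_unfold)
    qed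
    have inner: "(\<integral>\<^sup>+\<gamma>. ennreal (F z * K (snd z - apply_bcontfun \<gamma> (fst z))) \<partial>\<eta>)
        = (\<integral>\<^sup>+y. ennreal (K y * (F z * mp (fst z, snd z - y))) \<partial>torus_vol)"
      if z: "fst z \<in> {0<..<T}" and den: "eval_law \<eta> (fst z) = density torus_vol (\<lambda>x. ennreal (mp (fst z, x)))" for z
    proof -
      have sm[measurable]: "(\<lambda>x. mp (fst z, x)) \<in> borel_measurable borel" using density_section[OF z] by (simp cong: measurable_cong_sets)
      let ?h = "\<lambda>x. ennreal (F z * K (snd z - x))"
      have "(\<integral>\<^sup>+\<gamma>. ?h (apply_bcontfun \<gamma> (fst z)) \<partial>\<eta>) = (\<integral>\<^sup>+x. ?h x \<partial>eval_law \<eta> (fst z))"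
        unfolding eval_law_def by (rule nn_integral_distr[OF eval_\<eta>, symmetric]) measurable
      also have "\<dots> = (\<integral>\<^sup>+x. ennreal (mp (fst z, x)) * ?h x \<partial>torus_vol)"
        unfolding den by (rule nn_integral_density) measurable
      also have "\<dots> = (\<integral>\<^sup>+y. ennreal (mp (fst z, snd z - y)) * ?h (snd z - y) \<partial>torus_vol)"
        by (rule nn_integral_torus_reflect[symmetric]) measurable
      also have "\<dots> = (\<integral>\<^sup>+y. ennreal (K y * (F z * mp (fst z, snd z - y))) \<partial>torus_vol)"
        unfolding ennreal_mult'[OF mp_nonneg, symmetric] by (simp add: mult_ac)
      finally show ?thesis .
    qed
    have "ennreal (\<integral>\<gamma>. coupling_cost K \<gamma> \<partial>\<eta>) = (\<integral>\<^sup>+\<gamma>. ennreal (coupling_cost K \<gamma>) \<partial>\<eta>)"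
      by (rule nn_integral_eq_integral[symmetric, OF coupling_cost_bounds(2)[OF K]]) (use coupling_cost_bounds(4)[OF K] in auto)
    also have "\<dots> = (\<integral>\<^sup>+\<gamma>. \<integral>\<^sup>+z. ennreal (F z * K (snd z - apply_bcontfun \<gamma> (fst z))) \<partial>st_vol T \<partial>\<eta>)"
    proof (rule nn_integral_cong)
      fix \<gamma> assume "\<gamma> \<in> space \<eta>"
      then show "ennreal (coupling_cost K \<gamma>) = (\<integral>\<^sup>+z. ennreal (F z * K (snd z - apply_bcontfun \<gamma> (fst z))) \<partial>st_vol T)"
        unfolding coupling_cost_def by (intro nn_integral_eq_integral[symmetric] coupling_cost_bounds(3)[OF K] AE_I2 mult_nonneg_nonneg F_nonneg K0)
          (simp add: space_\<eta>)
    qed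
    also have "\<dots> = (\<integral>\<^sup>+z. \<integral>\<^sup>+\<gamma>. ennreal (F z * K (snd z - apply_bcontfun \<gamma> (fst z))) \<partial>\<eta> \<partial>st_vol T)"
      by (rule ES.Fubini'[symmetric, OF fm])
    also have "\<dots> = (\<integral>\<^sup>+z. \<integral>\<^sup>+y. ennreal (K y * (F z * mp (fst z, snd z - y))) \<partial>torus_vol \<partial>st_vol T)"
      by (rule nn_integral_cong_AE, rule AE_mp[OF law_density_AE], rule AE_I2) (use inner in blast)
    also have "\<dots> = (\<integral>\<^sup>+y. \<integral>\<^sup>+z. ennreal (K y * (F z * mp (fst z, snd z - y))) \<partial>st_vol T \<partial>torus_vol)"
      by (rule ST.Fubini'[symmetric, OF gm])
    also have "\<dots> \<le> (\<integral>\<^sup>+y. ennreal (K y) * ennreal (?I + \<epsilon>) \<partial>torus_vol)"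
    proof (rule nn_integral_mono)
      fix y :: "'d torus"
      have sec: "(\<lambda>z. ennreal (F z * mp (fst z, snd z - y))) \<in> borel_measurable (st_vol T)"
      proof -
        have "(\<lambda>z. (z, y)) \<in> (st_vol T :: (real \<times> 'd torus) measure) \<rightarrow>\<^sub>M st_vol T \<Otimes>\<^sub>M torus_vol"
          by (rule measurable_Pair2') simp
        from measurable_compose[OF this shift] have "(\<lambda>z. mp (fst z, snd z - y)) \<in> borel_measurable (st_vol T)" by simp
        then show ?thesis by measurable
      qed
      have "(\<integral>\<^sup>+z. ennreal (K y * (F z * mp (fst z, snd z - y))) \<partial>st_vol T) = ennreal (K y) * (\<integral>\<^sup>+z. ennreal (F z * mp (fst z, snd z - y)) \<partial>st_vol T)"
        unfolding ennreal_mult'[OF K0] by (rule nn_integral_cmult[OF sec])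
      also have "\<dots> \<le> ennreal (K y) * ennreal (?I + \<epsilon>)"
      proof (cases "K y = 0")
        case False
        from d(2)[rule_format, OF Kd[OF False]] show ?thesis unfolding Ie using I0 \<epsilon> by (intro mult_left_mono) (auto simp: ennreal_plus)
      qed simp
      finally show "(\<integral>\<^sup>+z. ennreal (K y * (F z * mp (fst z, snd z - y))) \<partial>st_vol T) \<le> ennreal (K y) * ennreal (?I + \<epsilon>)" .
    qed
    also have "\<dots> = (\<integral>\<^sup>+y. ennreal (K y) \<partial>torus_vol) * ennreal (?I + \<epsilon>)" by (rule nn_integral_multc) measurable
    also have "\<dots> = ennreal (?I + \<epsilon>)" using torus_kernel_nn_mass[OF K] by simp
    finally have "ennreal (\<integral>\<gamma>. coupling_cost K \<gamma> \<partial>\<eta>) \<le> ennreal (?I + \<epsilon>)" .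
    moreover have "0 \<le> ?I + \<epsilon>" using I0 \<epsilon> by simp
    ultimately show ?thesis using ennreal_le_iff by blast
  qed
  then show ?thesis using d(1) by blast
qed

section \<open>The coupling seen by a player\<close>

lemma kernel_torus: "\<exists>R>0. \<forall>\<sigma>>0. torus_kernel (R * \<sigma>) (periodize (scaled_kernel \<xi> \<sigma>))"
proof -
  obtain R where R: "R > 0" "\<And>x. \<xi> x \<noteq> 0 \<Longrightarrow> norm x < R" using reg_kernel_support[OF kernel] by blast
  have "torus_kernel (R * \<sigma>) (periodize (scaled_kernel \<xi> \<sigma>))" if "0 < \<sigma>" for \<sigma>
  proof -
    interpret ball_kernel "scaled_kernel \<xi> \<sigma>" "R * \<sigma>" by (rule scaled_kernel_ball_kernel[OF kernel R(2) that])
    show ?thesis by (rule torus_kernel_periodize)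
  qed
  then show ?thesis using R(1) by blast
qed

definition crowd :: "('d torus \<Rightarrow> real) \<Rightarrow> nat \<Rightarrow> nat \<Rightarrow> (nat \<Rightarrow> 'd curve) \<Rightarrow> real \<times> 'd torus \<Rightarrow> real" where
  "crowd K N i g z = (\<Sum>j\<in>{1..N} - {i}. K (snd z - apply_bcontfun (g j) (fst z))) / card ({1..N} - {i})"

lemma smear_empirical:
  assumes K: "torus_kernel s (periodize (scaled_kernel \<xi> \<delta>))"
  shows "smear \<delta> (empirical N i g) = crowd (periodize (scaled_kernel \<xi> \<delta>)) N i g"
proof
  fix z :: "real \<times> 'd torus"
  let ?J = "{1..N} - {i}" and ?K = "periodize (scaled_kernel \<xi> \<delta>)"
  note [measurable] = torus_kernel_measurable[OF K]
  have m: "(\<lambda>j. apply_bcontfun (g j) (fst z)) \<in> uniform_count_measure ?J \<rightarrow>\<^sub>M borel"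
    by (auto simp: measurable_def space_uniform_count_measure sets_uniform_count_measure)
  have "smear \<delta> (empirical N i g) z = (\<integral>y. ?K (snd z - y) \<partial>distr (uniform_count_measure ?J) borel (\<lambda>j. apply_bcontfun (g j) (fst z)))"
    by (simp add: smear_def conv_measure_def empirical_def)
  also have "\<dots> = (\<integral>j. ?K (snd z - apply_bcontfun (g j) (fst z)) \<partial>uniform_count_measure ?J)"
    by (rule integral_distr[OF m]) measurable
  also have "\<dots> = crowd ?K N i g z" unfolding crowd_def by (rule integral_uniform_count_measure) simp
  finally show "smear \<delta> (empirical N i g) z = crowd ?K N i g z" .
qed

lemma crowd_bounds:
  assumes K: "torus_kernel s K" and \<kappa>: "\<And>z. K z \<le> \<kappa>"
  shows "crowd K N i g \<in> borel_measurable borel" and "0 \<le> crowd K N i g z" and "crowd K N i g z \<le> \<kappa>"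
proof -
  have K0: "0 \<le> K z" for z using K by (simp add: torus_kernel_def)
  have \<kappa>0: "0 \<le> \<kappa>" using order_trans[OF K0 \<kappa>] .
  have "continuous_on UNIV (\<lambda>z. K (snd z - apply_bcontfun (g j) (fst z)))" for j
    by (intro continuous_on_compose2[OF torus_kernel_continuous[OF K]] continuous_intros
        continuous_on_compose2[OF continuous_curve]) auto
  then have "(\<lambda>z. K (snd z - apply_bcontfun (g j) (fst z))) \<in> borel_measurable borel" for j by (rule borel_measurable_continuous_onI)
  then show "crowd K N i g \<in> borel_measurable borel" unfolding crowd_def[abs_def] by (intro borel_measurable_divide borel_measurable_sum) auto
  show "0 \<le> crowd K N i g z" unfolding crowd_def by (intro divide_nonneg_nonneg sum_nonneg K0) simp
  have "(\<Sum>j\<in>{1..N} - {i}. K (snd z - apply_bcontfun (g j) (fst z))) \<le> card ({1..N} - {i}) * \<kappa>"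
    using \<kappa> by (rule sum_bounded_above)
  moreover have "a / n \<le> \<kappa>" if "a \<le> n * \<kappa>" "0 \<le> n" for a n :: real
    using that \<kappa>0 by (cases "n = 0") (simp_all add: divide_le_eq mult.commute)
  ultimately show "crowd K N i g z \<le> \<kappa>" unfolding crowd_def by simp
qed

text \<open>How far the smoothed empirical density of the players other than \<open>i\<close> is from the density of the
solution. The curve of player \<open>i\<close> does not enter.\<close>

definition spread :: "('d torus \<Rightarrow> real) \<Rightarrow> nat \<Rightarrow> nat \<Rightarrow> (nat \<Rightarrow> 'd curve) \<Rightarrow> real" where
  "spread K N i g = (\<integral>z. \<bar>crowd K N i g z - mp z\<bar> \<partial>st_vol T)"

text \<open>Since \<open>spread\<close> involves the other players only, the same error bound holds whatever player \<open>i\<close> does.\<close>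

lemma player_cost_between:
  fixes g :: "nat \<Rightarrow> 'd curve" and N i :: nat
  assumes \<sigma>: "0 < \<sigma>" and \<delta>: "0 < \<delta>" and \<kappa>: "\<And>z. periodize (scaled_kernel \<xi> \<sigma>) z \<le> \<kappa>"
  defines "E \<equiv> Kl * \<kappa> * spread (periodize (scaled_kernel \<xi> \<delta>)) N i g"
    and "c \<equiv> coupling_cost (periodize (scaled_kernel \<xi> \<sigma>)) (g i) + \<phi>T (apply_bcontfun (g i) T)"
    and "J \<equiv> player_cost T r' f H \<phi>T \<xi> \<delta> \<sigma> N i g"
    and "P \<equiv> path_integral T r' (\<lambda>s. lagrangian H) (g i)"
  shows "P + ereal (c - E) \<le> J" and "J \<le> P + ereal (c + E)"
proof -
  obtain R where K: "torus_kernel (R * \<delta>) (periodize (scaled_kernel \<xi> \<delta>))" using kernel_torus \<delta> by blast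
  obtain B where B: "\<And>z. periodize (scaled_kernel \<xi> \<delta>) z \<le> B" using torus_kernel_bounded[OF K] by metis
  let ?R = "\<lambda>s. reg_coupling2 f \<xi> \<delta> \<sigma> (apply_bcontfun (g i) s) (empirical N i g s)"
  note se = smear_empirical[OF K, of N i g]
  note cb = crowd_bounds[OF K B, of N i g]
  have int: "set_integrable lborel {0..T} ?R"
    and diff: "\<bar>(LINT s:{0..T}|lborel. ?R s) - coupling_cost (periodize (scaled_kernel \<xi> \<sigma>)) (g i)\<bar> \<le> E"
    using coupling_along_curve[OF \<sigma> \<delta> \<kappa>, of "empirical N i g" B "g i"] cb unfolding se E_def spread_def by blast+
  have "P + ereal (c - E) \<le> J \<and> J \<le> P + ereal (c + E)"
  proof (cases "sobolev_curve T r' (g i)")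
    case True
    have "(LINT s:{0..T}|lborel. lagrangian H (apply_bcontfun (g i) s) (velocity T (g i) s) + ?R s)
        = action (g i) + (LINT s:{0..T}|lborel. ?R s)" by (rule set_integral_add(2)[OF action_integrable[OF True] int])
    then show ?thesis using True diff by (simp add: J_def P_def c_def player_cost_def path_integral_def abs_le_iff)
  qed (simp add: J_def P_def player_cost_def path_integral_def)
  then show "P + ereal (c - E) \<le> J" and "J \<le> P + ereal (c + E)" by auto
qed

section \<open>Expectations over the players\<close>

abbreviation players :: "nat \<Rightarrow> ((nat \<Rightarrow> real) \<times> (nat \<Rightarrow> 'd torus)) measure" where
  "players N \<equiv> (\<Pi>\<^sub>M j\<in>{1..N}. rand_space) \<Otimes>\<^sub>M (\<Pi>\<^sub>M j\<in>{1..N}. init_law m0)"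

abbreviation route :: "((nat \<Rightarrow> real) \<times> (nat \<Rightarrow> 'd torus)) \<Rightarrow> nat \<Rightarrow> 'd curve" where
  "route \<omega> j \<equiv> b (fst \<omega> j, snd \<omega> j)"

lemma sampled: "sampled_pairs rand_space (init_law m0) {1..N}"
  unfolding sampled_pairs_def using prob_space_rand_space prob_space_init_law[OF data] by blast

lemmas b_measurable = law_of_realization(1)[OF data curves realizes]
lemmas \<eta>_eq = law_of_realization(2)[OF data curves realizes]

lemma player_expectation:
  fixes G :: "'d curve \<Rightarrow> real"
  assumes i: "i \<in> {1..N}" and G: "integrable \<eta> G"
  shows "integrable (players N) (\<lambda>\<omega>. G (route \<omega> i))" and "(\<integral>\<omega>. G (route \<omega> i) \<partial>players N) = (\<integral>\<gamma>. G \<gamma> \<partial>\<eta>)"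
proof -
  interpret S: sampled_pairs rand_space "init_law m0" "{1..N}" by (rule sampled)
  have Gm: "G \<in> borel_measurable (curve_space T)" using G by (auto cong: measurable_cong_sets)
  have gm: "(\<lambda>z. G (b z)) \<in> borel_measurable (rand_space \<Otimes>\<^sub>M init_law m0)" by (rule measurable_compose[OF b_measurable Gm])
  have "integrable (rand_space \<Otimes>\<^sub>M init_law m0) (\<lambda>z. G (b z))"
    using integrable_distr_eq[OF b_measurable Gm] G by (simp only: \<eta>_eq[symmetric])
  then show "integrable (players N) (\<lambda>\<omega>. G (route \<omega> i))" using S.expectation_coordinate(2)[OF i gm] by simp
  have "(\<integral>\<gamma>. G \<gamma> \<partial>\<eta>) = (\<integral>z. G (b z) \<partial>(rand_space \<Otimes>\<^sub>M init_law m0))"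
    using integral_distr[OF b_measurable Gm] by (simp only: \<eta>_eq[symmetric])
  then show "(\<integral>\<omega>. G (route \<omega> i) \<partial>players N) = (\<integral>\<gamma>. G \<gamma> \<partial>\<eta>)"
    using S.expectation_coordinate(1)[OF i gm] by simp
qed

lemma player_AE:
  assumes i: "i \<in> {1..N}" and Q: "AE \<gamma> in \<eta>. Q \<gamma>"
  shows "AE \<omega> in players N. Q (route \<omega> i)"
proof -
  interpret S: sampled_pairs rand_space "init_law m0" "{1..N}" by (rule sampled)
  have "AE z in rand_space \<Otimes>\<^sub>M init_law m0. Q (b z)" using AE_distrD[OF b_measurable, of Q] Q by (simp only: \<eta>_eq[symmetric])
  then have "AE z in distr (players N) (rand_space \<Otimes>\<^sub>M init_law m0) (\<lambda>\<omega>. (fst \<omega> i, snd \<omega> i)). Q (b z)"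
    by (subst S.expectation_coordinate(3)[OF i, of "\<lambda>_. 0"]) auto
  from AE_distrD[OF S.coordinate_measurable[OF i] this] show ?thesis .
qed

lemma path_in_curves:
  assumes "\<omega> \<in> space (players N)" "j \<in> {1..N}"
  shows "route \<omega> j \<in> Defs.curves T" and "fst \<omega> j \<in> {0..1}" and "apply_bcontfun (route \<omega> j) 0 = snd \<omega> j"
proof -
  show w: "fst \<omega> j \<in> {0..1}" using assms by (auto simp: space_pair_measure space_PiM space_rand_space PiE_iff)
  have "b (fst \<omega> j, snd \<omega> j) \<in> space (curve_space T)" by (rule measurable_space[OF b_measurable])
      (use w in \<open>simp add: space_pair_measure space_rand_space init_law_def\<close>)
  then show "route \<omega> j \<in> Defs.curves T" by (simp add: space_curve_space)
  show "apply_bcontfun (route \<omega> j) 0 = snd \<omega> j" using realizes w unfolding realizes_def by blast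
qed

lemma initial_value:
  shows "integrable \<eta> (\<lambda>\<gamma>. \<phi> (0, apply_bcontfun \<gamma> 0))"
    and "(\<integral>\<gamma>. \<phi> (0, apply_bcontfun \<gamma> 0) \<partial>\<eta>) = (\<integral>x. \<phi> (0, x) \<partial>\<mu> 0)"
    and "(\<integral>x. \<phi> (0, x) \<partial>\<mu> 0) = (\<integral>x. \<phi> (0, x) * m0 x \<partial>torus_vol)"
proof -
  let ?h = "\<lambda>x. \<phi> (0, x)"
  have hc: "continuous_on UNIV ?h" by (rule continuous_on_compose2[OF \<phi>_continuous]) (use T in \<open>auto intro!: continuous_intros\<close>)
  note hm[measurable] = borel_measurable_continuous_onI[OF hc]
  obtain B where B: "\<And>x. norm (?h x) \<le> B" using bounded_torus[OF hc] by metis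
  interpret E: prob_space \<eta> by (rule prob_\<eta>)
  interpret A: prob_space rand_space by (rule prob_space_rand_space)
  interpret L: prob_space "init_law m0" by (rule prob_space_init_law[OF data])
  interpret P: pair_prob_space rand_space "init_law m0" ..
  show i: "integrable \<eta> (\<lambda>\<gamma>. ?h (apply_bcontfun \<gamma> 0))"
    by (rule E.integrable_const_bound[where B=B]) (use B measurable_compose[OF eval_\<eta> hm] in auto)
  show e: "(\<integral>\<gamma>. ?h (apply_bcontfun \<gamma> 0) \<partial>\<eta>) = (\<integral>x. ?h x \<partial>\<mu> 0)"
    by (rule integral_law[symmetric, OF _ hm]) (use T in auto)
  have gm: "(\<lambda>\<gamma>. ?h (apply_bcontfun \<gamma> 0)) \<in> borel_measurable (curve_space T)"
    by (rule measurable_compose[OF eval_measurable hm])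
  have "(\<integral>\<gamma>. ?h (apply_bcontfun \<gamma> 0) \<partial>\<eta>) = (\<integral>z. ?h (apply_bcontfun (b z) 0) \<partial>(rand_space \<Otimes>\<^sub>M init_law m0))"
    using integral_distr[OF b_measurable gm] by (simp only: \<eta>_eq[symmetric])
  also have "\<dots> = (\<integral>z. ?h (snd z) \<partial>(rand_space \<Otimes>\<^sub>M init_law m0))"
  proof (rule Bochner_Integration.integral_cong[OF refl])
    fix z assume "z \<in> space (rand_space \<Otimes>\<^sub>M init_law m0)"
    then have "fst z \<in> {0..1}" by (auto simp: space_pair_measure space_rand_space)
    then have "apply_bcontfun (b (fst z, snd z)) 0 = snd z" using realizes unfolding realizes_def by blast
    then show "?h (apply_bcontfun (b z) 0) = ?h (snd z)" by simp
  qed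
  also have "\<dots> = (\<integral>w. \<integral>x. ?h x \<partial>init_law m0 \<partial>rand_space)"
  proof -
    have "integrable (rand_space \<Otimes>\<^sub>M init_law m0) (\<lambda>z. ?h (snd z))"
      by (rule P.P.integrable_const_bound[where B=B]) (use B in \<open>auto intro!: measurable_compose[OF measurable_snd] simp: init_law_def\<close>)
    from P.integral_fst'[OF this] show ?thesis by simp
  qed
  also have "\<dots> = (\<integral>x. ?h x \<partial>init_law m0)" by (simp add: A.prob_space)
  also have "\<dots> = (\<integral>x. m0 x *\<^sub>R ?h x \<partial>torus_vol)" unfolding init_law_def
  proof (rule integral_density)
    show "?h \<in> borel_measurable torus_vol" "m0 \<in> borel_measurable torus_vol"
      using data hm borel_measurable_continuous_onI[of m0] by (auto simp: data_cond_def cong: measurable_cong_sets)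
    show "AE x in torus_vol. 0 \<le> m0 x" using data by (simp add: data_cond_def)
  qed
  finally show "(\<integral>x. ?h x \<partial>\<mu> 0) = (\<integral>x. \<phi> (0, x) * m0 x \<partial>torus_vol)" using e by (simp add: mult_ac)
qed

lemma emeasure_st_vol: "(\<integral>\<^sup>+z. ennreal c \<partial>(st_vol T :: (real \<times> 'd torus) measure)) = ennreal (T * c)" if "0 \<le> c"
proof -
  have "(\<integral>\<^sup>+z. ennreal c \<partial>(st_vol T :: (real \<times> 'd torus) measure)) = (\<integral>\<^sup>+t. \<integral>\<^sup>+x. ennreal c \<partial>(torus_vol :: 'd torus measure) \<partial>time_vol T)"
    by (rule nn_integral_st_vol(2)) simp
  also have "\<dots> = (\<integral>\<^sup>+t. ennreal c \<partial>time_vol T)" by (simp add: torus_vol.emeasure_space_1[simplified])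
  also have "\<dots> = ennreal c * emeasure lborel {0<..<T}" by (simp add: emeasure_restrict_space space_restrict_space)
  also have "\<dots> = ennreal (T * c)" using T that by (simp add: ennreal_mult[symmetric] mult_ac)
  finally show ?thesis .
qed

text \<open>At each point of space-time the empirical density deviates from its mean by \<open>\<kappa> / sqrt (N - 1)\<close> on
average; the mean is the mollified density, whose distance from the density is at most \<open>e\<close>.\<close>

lemma expected_spread:
  assumes K: "torus_kernel s K" and \<kappa>: "\<And>z. K z \<le> \<kappa>" and e: "0 \<le> e"
    and moll: "(\<integral>\<^sup>+z. ennreal \<bar>(\<integral>x. mp (fst z, x) * K (snd z - x) \<partial>torus_vol) - mp z\<bar> \<partial>st_vol T) \<le> ennreal e"
    and N: "2 \<le> N" and i: "i \<in> {1..N}"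
  shows "integrable (players N) (\<lambda>\<omega>. spread K N i (route \<omega>))"
    and "(\<integral>\<omega>. spread K N i (route \<omega>) \<partial>players N) \<le> T * (\<kappa> / sqrt (real N - 1)) + e"
proof -
  let ?J = "{1..N} - {i}"
  have cardJ: "card ?J = N - 1" using i by simp
  then have J: "?J \<noteq> {}" using N by (metis One_nat_def Suc_1 card.empty diff_is_0_eq not_less_eq_eq)
  have K0: "0 \<le> K z" for z using K by (simp add: torus_kernel_def)
  have \<kappa>0: "0 \<le> \<kappa>" using order_trans[OF K0 \<kappa>] .
  note cb = crowd_bounds[OF K \<kappa>]
  note km = kernel_eval_measurable[OF K]
  interpret S: sampled_pairs rand_space "init_law m0" "{1..N}" by (rule sampled)
  interpret V: finite_measure "st_vol T :: (real \<times> 'd torus) measure" by (rule finite_st_vol)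
  interpret E: prob_space \<eta> by (rule prob_\<eta>)
  interpret Q: pair_sigma_finite "players N" "st_vol T :: (real \<times> 'd torus) measure" ..
  have pm: "(\<lambda>\<omega>. route \<omega> j) \<in> players N \<rightarrow>\<^sub>M curve_space T" if "j \<in> {1..N}" for j
    using measurable_compose[OF S.coordinate_measurable[OF that] b_measurable] by simp
  have cm: "(\<lambda>p. crowd K N i (route (fst p)) (snd p)) \<in> borel_measurable (players N \<Otimes>\<^sub>M st_vol T)" unfolding crowd_def
  proof (intro borel_measurable_divide borel_measurable_sum)
    fix j assume j: "j \<in> ?J"
    have "(\<lambda>p. (route (fst p) j, snd p)) \<in> players N \<Otimes>\<^sub>M (st_vol T :: (real \<times> 'd torus) measure) \<rightarrow>\<^sub>M curve_space T \<Otimes>\<^sub>M st_vol T"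
      by (intro measurable_Pair measurable_compose[OF measurable_fst pm] measurable_snd) (use j in auto)
    from measurable_compose[OF this km]
    show "(\<lambda>p. K (snd (snd p) - apply_bcontfun (route (fst p) j) (fst (snd p)))) \<in> borel_measurable (players N \<Otimes>\<^sub>M st_vol T)"
      by simp
  qed simp
  have dm: "(\<lambda>(\<omega>, z). \<bar>crowd K N i (route \<omega>) z - mp z\<bar>) \<in> borel_measurable (players N \<Otimes>\<^sub>M st_vol T)"
  proof -
    have "(\<lambda>p. \<bar>crowd K N i (route (fst p)) (snd p) - mp (snd p)\<bar>) \<in> borel_measurable (players N \<Otimes>\<^sub>M st_vol T)"
      using cm by measurable
    then show ?thesis by (simp add: case_prod_unfold)
  qed
  have dn: "(\<lambda>(\<omega>, z). ennreal \<bar>crowd K N i (route \<omega>) z - mp z\<bar>) \<in> borel_measurable (players N \<Otimes>\<^sub>M st_vol T)"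
    using measurable_compose[OF dm measurable_ennreal] by (simp add: case_prod_unfold)
  have iz: "integrable (st_vol T) (\<lambda>z. \<bar>crowd K N i g z - mp z\<bar>)" for g
  proof -
    have "integrable (st_vol T) (crowd K N i g)"
      by (rule V.integrable_const_bound[where B=\<kappa>]) (use cb(2,3) st_vol_borel_measurable[OF cb(1)] in auto)
    then show ?thesis using mp_integrable by simp
  qed
  have sp: "ennreal (spread K N i g) = (\<integral>\<^sup>+z. ennreal \<bar>crowd K N i g z - mp z\<bar> \<partial>st_vol T)" for g
    unfolding spread_def by (rule nn_integral_eq_integral[symmetric, OF iz]) simp
  have sp0: "0 \<le> spread K N i g" for g unfolding spread_def by simp
  have sm: "(\<lambda>\<omega>. spread K N i (route \<omega>)) \<in> borel_measurable (players N)"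
    unfolding spread_def by (rule V.borel_measurable_lebesgue_integral[OF dm])
  define c where "c = (\<lambda>z. \<integral>\<gamma>. K (snd z - apply_bcontfun \<gamma> (fst z)) \<partial>\<eta>)"
  have c_m[measurable]: "c \<in> borel_measurable (st_vol T)" unfolding c_def
  proof (rule E.borel_measurable_lebesgue_integral)
    have "(\<lambda>(z, \<gamma>). (\<lambda>(\<gamma>, z). K (snd z - apply_bcontfun \<gamma> (fst z))) (\<gamma>, z)) \<in> borel_measurable (st_vol T \<Otimes>\<^sub>M curve_space T)"
      by (rule measurable_pair_swap[OF km])
    moreover have "sets (st_vol T \<Otimes>\<^sub>M \<eta>) = sets ((st_vol T :: (real \<times> 'd torus) measure) \<Otimes>\<^sub>M curve_space T)"
      by (rule sets_pair_measure_cong) auto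
    ultimately show "(\<lambda>(z, \<gamma>). K (snd z - apply_bcontfun \<gamma> (fst z))) \<in> borel_measurable (st_vol T \<Otimes>\<^sub>M \<eta>)"
      by (simp cong: measurable_cong_sets)
  qed
  have c_eq: "c z = (\<integral>x. mp (fst z, x) * K (snd z - x) \<partial>torus_vol)"
    if z: "fst z \<in> {0<..<T}" and den: "eval_law \<eta> (fst z) = density torus_vol (\<lambda>x. ennreal (mp (fst z, x)))" for z
  proof -
    have Kz: "(\<lambda>x. K (snd z - x)) \<in> borel_measurable borel" using torus_kernel_measurable[OF K] by measurable
    have "c z = (\<integral>x. K (snd z - x) \<partial>eval_law \<eta> (fst z))"
      unfolding c_def eval_law_def by (rule integral_distr[OF eval_\<eta> Kz, symmetric])
    also have "\<dots> = (\<integral>x. mp (fst z, x) *\<^sub>R K (snd z - x) \<partial>torus_vol)"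
      unfolding den by (rule integral_density) (use Kz density_section[OF z] mp_nonneg in \<open>auto cong: measurable_cong_sets\<close>)
    finally show ?thesis by simp
  qed
  have fluct: "(\<integral>\<^sup>+\<omega>. ennreal \<bar>crowd K N i (route \<omega>) z - mp z\<bar> \<partial>players N) \<le> ennreal (\<kappa> / sqrt (real N - 1)) + ennreal \<bar>c z - mp z\<bar>"
    if z: "z \<in> space (st_vol T)" for z
  proof -
    let ?Y = "\<lambda>w. K (snd z - apply_bcontfun (b w) (fst z))"
    have Yc: "(\<lambda>\<gamma>. K (snd z - apply_bcontfun \<gamma> (fst z))) \<in> borel_measurable (curve_space T)"
      by (rule measurable_compose[OF torus_diff_measurable[OF _ eval_measurable] torus_kernel_measurable[OF K]]) simp
    have Ym: "?Y \<in> borel_measurable (rand_space \<Otimes>\<^sub>M init_law m0)" by (rule measurable_compose[OF b_measurable Yc])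
    have cz: "(\<integral>w. ?Y w \<partial>(rand_space \<Otimes>\<^sub>M init_law m0)) = c z"
      using integral_distr[OF b_measurable Yc] unfolding c_def by (simp only: \<eta>_eq[symmetric])
    have sec: "(\<lambda>\<omega>. crowd K N i (route \<omega>) z) \<in> borel_measurable (players N)"
    proof -
      have "(\<lambda>\<omega>. (\<omega>, z)) \<in> players N \<rightarrow>\<^sub>M players N \<Otimes>\<^sub>M st_vol T" by (rule measurable_Pair2'[OF z])
      from measurable_compose[OF this cm] show ?thesis by simp
    qed
    have dev: "(\<integral>\<omega>. \<bar>crowd K N i (route \<omega>) z - c z\<bar> \<partial>players N) \<le> \<kappa> / sqrt (card ?J)"
      unfolding cz[symmetric] crowd_def by (rule S.mean_deviation[OF Ym K0 \<kappa> _ J]) auto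
    have idev: "integrable (players N) (\<lambda>\<omega>. \<bar>crowd K N i (route \<omega>) z - c z\<bar>)"
    proof -
      have "integrable (players N) (\<lambda>\<omega>. crowd K N i (route \<omega>) z)"
        by (rule S.PPs.P.integrable_const_bound[where B=\<kappa>]) (use cb sec in auto)
      then show ?thesis by (intro integrable_abs Bochner_Integration.integrable_diff S.PPs.P.integrable_const)
    qed
    have "(\<integral>\<^sup>+\<omega>. ennreal \<bar>crowd K N i (route \<omega>) z - mp z\<bar> \<partial>players N)
        \<le> (\<integral>\<^sup>+\<omega>. ennreal \<bar>crowd K N i (route \<omega>) z - c z\<bar> + ennreal \<bar>c z - mp z\<bar> \<partial>players N)"
      by (intro nn_integral_mono) (simp add: ennreal_plus[symmetric] del: ennreal_plus)
    also have "\<dots> = (\<integral>\<^sup>+\<omega>. ennreal \<bar>crowd K N i (route \<omega>) z - c z\<bar> \<partial>players N) + (\<integral>\<^sup>+\<omega>. ennreal \<bar>c z - mp z\<bar> \<partial>players N)"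
      by (rule nn_integral_add) (use sec in measurable)
    also have "(\<integral>\<^sup>+\<omega>. ennreal \<bar>c z - mp z\<bar> \<partial>players N) = ennreal \<bar>c z - mp z\<bar>"
      by (simp only: nn_integral_const S.PPs.P.emeasure_space_1 mult_1_right)
    also have "(\<integral>\<^sup>+\<omega>. ennreal \<bar>crowd K N i (route \<omega>) z - c z\<bar> \<partial>players N) = ennreal (\<integral>\<omega>. \<bar>crowd K N i (route \<omega>) z - c z\<bar> \<partial>players N)"
      by (rule nn_integral_eq_integral[OF idev]) simp
    also have "\<dots> + ennreal \<bar>c z - mp z\<bar> \<le> ennreal (\<kappa> / sqrt (real N - 1)) + ennreal \<bar>c z - mp z\<bar>"
      using dev N unfolding cardJ by (intro add_right_mono ennreal_leI) (simp add: of_nat_diff)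
    finally show ?thesis .
  qed
  have "(\<integral>\<^sup>+\<omega>. ennreal (spread K N i (route \<omega>)) \<partial>players N)
      = (\<integral>\<^sup>+z. \<integral>\<^sup>+\<omega>. ennreal \<bar>crowd K N i (route \<omega>) z - mp z\<bar> \<partial>players N \<partial>st_vol T)"
    unfolding sp by (rule Q.Fubini'[symmetric, OF dn])
  also have "\<dots> \<le> (\<integral>\<^sup>+z. ennreal (\<kappa> / sqrt (real N - 1)) + ennreal \<bar>c z - mp z\<bar> \<partial>st_vol T)"
    by (rule nn_integral_mono[OF fluct])
  also have "\<dots> = (\<integral>\<^sup>+z. ennreal (\<kappa> / sqrt (real N - 1)) \<partial>(st_vol T :: (real \<times> 'd torus) measure)) + (\<integral>\<^sup>+z. ennreal \<bar>c z - mp z\<bar> \<partial>st_vol T)"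
    by (rule nn_integral_add) measurable
  also have "(\<integral>\<^sup>+z. ennreal (\<kappa> / sqrt (real N - 1)) \<partial>(st_vol T :: (real \<times> 'd torus) measure)) = ennreal (T * (\<kappa> / sqrt (real N - 1)))"
    by (rule emeasure_st_vol) (use \<kappa>0 N in simp)
  also have "(\<integral>\<^sup>+z. ennreal \<bar>c z - mp z\<bar> \<partial>st_vol T) = (\<integral>\<^sup>+z. ennreal \<bar>(\<integral>x. mp (fst z, x) * K (snd z - x) \<partial>torus_vol) - mp z\<bar> \<partial>st_vol T)"
  proof (rule nn_integral_cong_AE, rule AE_mp[OF law_density_AE], intro AE_I2 impI)
    fix z :: "real \<times> 'd torus"
    assume "fst z \<in> {0<..<T} \<and> eval_law \<eta> (fst z) = density torus_vol (\<lambda>x. ennreal (mp (fst z, x)))"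
    then have "c z = (\<integral>x. mp (fst z, x) * K (snd z - x) \<partial>torus_vol)" using c_eq by blast
    then show "ennreal \<bar>c z - mp z\<bar> = ennreal \<bar>(\<integral>x. mp (fst z, x) * K (snd z - x) \<partial>torus_vol) - mp z\<bar>"
      by (simp only:)
  qed
  also have "ennreal (T * (\<kappa> / sqrt (real N - 1))) + \<dots> \<le> ennreal (T * (\<kappa> / sqrt (real N - 1))) + ennreal e"
    by (intro add_left_mono moll)
  also have "\<dots> = ennreal (T * (\<kappa> / sqrt (real N - 1)) + e)" using T \<kappa>0 N e by (intro ennreal_plus[symmetric]) auto
  finally have bd: "(\<integral>\<^sup>+\<omega>. ennreal (spread K N i (route \<omega>)) \<partial>players N) \<le> ennreal (T * (\<kappa> / sqrt (real N - 1)) + e)" .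
  show i: "integrable (players N) (\<lambda>\<omega>. spread K N i (route \<omega>))"
    by (rule integrableI_nonneg[OF sm]) (use sp0 bd in \<open>auto intro: le_less_trans\<close>)
  have "ennreal (\<integral>\<omega>. spread K N i (route \<omega>) \<partial>players N) \<le> ennreal (T * (\<kappa> / sqrt (real N - 1)) + e)"
    using bd by (subst (asm) nn_integral_eq_integral[OF i]) (use sp0 in auto)
  moreover have "0 \<le> T * (\<kappa> / sqrt (real N - 1)) + e" using T \<kappa>0 N e by simp
  ultimately show "(\<integral>\<omega>. spread K N i (route \<omega>) \<partial>players N) \<le> T * (\<kappa> / sqrt (real N - 1)) + e"
    using ennreal_le_iff by blast
qed

section \<open>The trajectories of the game\<close>

lemma open_loop_strategy: "open_loop b \<in> strategies T N i"
proof -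
  have bm: "b \<in> rand_space \<Otimes>\<^sub>M borel \<rightarrow>\<^sub>M curve_space T"
    and b0: "\<And>\<omega> x. \<omega> \<in> {0..1} \<Longrightarrow> apply_bcontfun (b (\<omega>, x)) 0 = x"
    using realizes unfolding realizes_def by blast+
  have eq: "open_loop b = (\<lambda>p. b (fst p, fst (snd p)))" by (auto simp: open_loop_def case_prod_unfold)
  have "(\<lambda>p. b (fst p, fst (snd p))) \<in> rand_space \<Otimes>\<^sub>M borel \<Otimes>\<^sub>M (\<Pi>\<^sub>M j\<in>{1..N} - {i}. curve_space T) \<rightarrow>\<^sub>M curve_space T"
    by (rule measurable_compose[OF _ bm]) measurable
  then show ?thesis unfolding strategies_def eq using b0 gt_ex[of "0 :: real"] by (intro CollectI conjI) auto
qed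

text \<open>Open-loop players ignore what they see, so their curves are determined first; the curve of player \<open>i\<close>
is the response to them.\<close>

lemma outcome_deviation:
  assumes \<beta>: "\<beta> \<in> strategies T N i" and i: "i \<in> {1..N}" and \<omega>: "\<omega> \<in> space (players N)"
  defines "g \<equiv> outcome T N ((\<lambda>j. open_loop b)(i := \<beta>)) (fst \<omega>) (snd \<omega>)"
  shows "\<And>j. j \<in> {1..N} - {i} \<Longrightarrow> g j = route \<omega> j"
    and "g i = \<beta> (fst \<omega> i, snd \<omega> i, restrict g ({1..N} - {i}))"
    and "apply_bcontfun (g i) 0 = snd \<omega> i"
proof -
  let ?J = "{1..N} - {i}"
  define h where "h = restrict (route \<omega>) ?J"
  define k where "k = (\<lambda>j\<in>{1..N}. if j = i then \<beta> (fst \<omega> i, snd \<omega> i, h) else route \<omega> j)"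
  have hE: "h \<in> ?J \<rightarrow>\<^sub>E Defs.curves T" unfolding h_def using path_in_curves(1)[OF \<omega>] by auto
  have wi: "fst \<omega> i \<in> {0..1}" by (rule path_in_curves(2)[OF \<omega> i])
  have bm: "\<beta> \<in> rand_space \<Otimes>\<^sub>M borel \<Otimes>\<^sub>M (\<Pi>\<^sub>M j\<in>?J. curve_space T) \<rightarrow>\<^sub>M curve_space T"
    using \<beta> unfolding strategies_def by blast
  have "\<beta> (fst \<omega> i, snd \<omega> i, h) \<in> space (curve_space T)"
    by (rule measurable_space[OF bm]) (use wi hE in \<open>simp add: space_pair_measure space_rand_space space_PiM space_curve_space\<close>)
  then have bc: "\<beta> (fst \<omega> i, snd \<omega> i, h) \<in> Defs.curves T" by (simp add: space_curve_space)
  have kE: "k \<in> {1..N} \<rightarrow>\<^sub>E Defs.curves T" unfolding k_def using bc path_in_curves(1)[OF \<omega>] by auto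
  have kr: "restrict k ?J = h" unfolding k_def h_def by (auto simp: restrict_def fun_eq_iff)
  have gk: "g = k" unfolding g_def outcome_def
  proof (rule the_equality)
    have "((\<lambda>j. open_loop b)(i := \<beta>)) l (fst \<omega> l, snd \<omega> l, restrict k ({1..N} - {l})) = k l" if l: "l \<in> {1..N}" for l
    proof (cases "l = i")
      case True
      have "restrict k ({1..N} - {l}) = h" using True kr by simp
      then show ?thesis using True l by (simp add: k_def)
    next
      case False
      then show ?thesis using l by (simp add: k_def open_loop_def)
    qed
    then show "k \<in> {1..N} \<rightarrow>\<^sub>E Defs.curves T \<and> (\<forall>l\<in>{1..N}. ((\<lambda>j. open_loop b)(i := \<beta>)) l (fst \<omega> l, snd \<omega> l, restrict k ({1..N} - {l})) = k l)"
      using kE by blast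
  next
    fix k' assume k': "k' \<in> {1..N} \<rightarrow>\<^sub>E Defs.curves T \<and> (\<forall>l\<in>{1..N}. ((\<lambda>j. open_loop b)(i := \<beta>)) l (fst \<omega> l, snd \<omega> l, restrict k' ({1..N} - {l})) = k' l)"
    have other: "k' l = route \<omega> l" if "l \<in> ?J" for l
    proof -
      have "((\<lambda>j. open_loop b)(i := \<beta>)) l (fst \<omega> l, snd \<omega> l, restrict k' ({1..N} - {l})) = k' l" using k' that by blast
      then show ?thesis using that by (simp add: open_loop_def)
    qed
    have "restrict k' ?J = h" unfolding h_def by (rule restrict_ext) (rule other)
    moreover have "((\<lambda>j. open_loop b)(i := \<beta>)) i (fst \<omega> i, snd \<omega> i, restrict k' ?J) = k' i" using k' i by blast
    ultimately have "k' i = \<beta> (fst \<omega> i, snd \<omega> i, h)" by simp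
    then show "k' = k" using k' kE other by (intro PiE_ext[of k' "{1..N}" "\<lambda>_. Defs.curves T" k]) (auto simp: k_def)
  qed
  show "g j = route \<omega> j" if "j \<in> ?J" for j using that by (simp add: gk k_def)
  show gi: "g i = \<beta> (fst \<omega> i, snd \<omega> i, restrict g ?J)" unfolding gk kr using i by (simp add: k_def)
  have "apply_bcontfun (\<beta> (fst \<omega> i, snd \<omega> i, h)) 0 = snd \<omega> i" using \<beta> wi hE unfolding strategies_def by blast
  then show "apply_bcontfun (g i) 0 = snd \<omega> i" using i by (simp add: gk k_def)
qed

lemma outcome_open_loop:
  assumes i: "i \<in> {1..N}" and \<omega>: "\<omega> \<in> space (players N)" and j: "j \<in> {1..N}"
  shows "outcome T N (\<lambda>j. open_loop b) (fst \<omega>) (snd \<omega>) j = route \<omega> j"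
proof -
  have "(\<lambda>j. open_loop b)(i := open_loop b) = (\<lambda>j. open_loop b)" by auto
  note dev = outcome_deviation[OF open_loop_strategy i \<omega>, unfolded this]
  show ?thesis
  proof (cases "j = i")
    case True
    then show ?thesis by (subst True, subst dev(2)) (simp add: open_loop_def)
  qed (use dev(1) j in auto)
qed

lemma spread_cong:
  assumes "\<And>j. j \<in> {1..N} - {i} \<Longrightarrow> g j = h j"
  shows "spread K N i g = spread K N i h"
proof -
  have "crowd K N i g = crowd K N i h" unfolding crowd_def fun_eq_iff using assms by (auto intro!: sum.cong)
  then show ?thesis by (simp add: spread_def)
qed

section \<open>The approximate equilibrium\<close>

text \<open>The parameters are chosen in the order \<open>\<sigma>\<close>, \<open>\<delta>\<close>, \<open>N\<close>: the width \<open>\<sigma>\<close> fixes the factor \<open>L\<close> in front of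
\<open>spread\<close>; then \<open>\<delta>\<close> makes the mollification error \<open>e\<close> small compared with \<open>1 / L\<close>; finally \<open>N\<close>
makes the sampling error small compared with the height of the kernel of width \<open>\<delta>\<close>. Every
strategy costs at least \<open>V - \<epsilon> / 2\<close>, and the open-loop strategy costs at most \<open>V + \<epsilon> / 2\<close>.\<close>

theorem approximate_equilibrium:
  assumes \<epsilon>: "0 < \<epsilon>"
  shows "\<exists>N0. \<exists>\<delta>>0. \<exists>\<sigma>>0. \<forall>N\<ge>N0. \<forall>i\<in>{1..N}.
    (\<forall>\<beta>\<in>strategies T N i.
       expected_cost T r' f H \<phi>T m0 \<xi> \<delta> \<sigma> N i ((\<lambda>j. open_loop b)(i := \<beta>))
         \<ge> expected_cost T r' f H \<phi>T m0 \<xi> \<delta> \<sigma> N i (\<lambda>j. open_loop b) - ereal \<epsilon>) \<and>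
    \<bar>expected_cost T r' f H \<phi>T m0 \<xi> \<delta> \<sigma> N i (\<lambda>j. open_loop b)
       - ereal (\<integral>x. \<phi> (0, x) * m0 x \<partial>torus_vol)\<bar> \<le> ereal \<epsilon>"
proof -
  define V where "V = (\<integral>x. \<phi> (0, x) * m0 x \<partial>torus_vol)"
  have e8: "0 < \<epsilon> / 8" using \<epsilon> by simp
  obtain \<sigma>0 where \<sigma>0: "0 < \<sigma>0" "\<forall>\<sigma> \<gamma>. 0 < \<sigma> \<and> \<sigma> < \<sigma>0 \<and> sobolev_curve T r' \<gamma> \<longrightarrow>
    \<phi> (0, apply_bcontfun \<gamma> 0) \<le> \<phi>T (apply_bcontfun \<gamma> T) + action \<gamma> + coupling_cost (periodize (scaled_kernel \<xi> \<sigma>)) \<gamma> + \<epsilon> / 8"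
    using value_below_cost[OF e8] by blast
  obtain d1 where d1: "0 < d1" "\<forall>s K. torus_kernel s K \<and> s \<le> d1 \<longrightarrow> (\<integral>\<gamma>. coupling_cost K \<gamma> \<partial>\<eta>) \<le> (\<integral>z. F z * mp z \<partial>st_vol T) + \<epsilon> / 8"
    using expected_coupling_cost[OF e8] by blast
  obtain R where R: "0 < R" "\<forall>\<sigma>>0. torus_kernel (R * \<sigma>) (periodize (scaled_kernel \<xi> \<sigma>))" using kernel_torus by blast
  define \<sigma> where "\<sigma> = min (\<sigma>0 / 2) (d1 / R)"
  have \<sigma>: "0 < \<sigma>" "\<sigma> < \<sigma>0" using \<sigma>0(1) d1(1) R(1) by (auto simp: \<sigma>_def)
  have "\<sigma> \<le> d1 / R" by (simp add: \<sigma>_def)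
  then have R\<sigma>: "R * \<sigma> \<le> d1" using R(1) by (simp add: field_simps)
  let ?K = "periodize (scaled_kernel \<xi> \<sigma>)"
  have K: "torus_kernel (R * \<sigma>) ?K" using R(2) \<sigma>(1) by blast
  obtain \<kappa> where \<kappa>: "0 \<le> \<kappa>" "\<And>z. ?K z \<le> \<kappa>" using torus_kernel_bounded[OF K] by metis
  define L where "L = Kl * \<kappa>"
  have L: "0 \<le> L" using Kl \<kappa> by (simp add: L_def)
  define e where "e = \<epsilon> / (8 * (L + 1))"
  have e: "0 < e" using \<epsilon> L by (simp add: e_def)
  have "L * e \<le> (L + 1) * e" using e by (intro mult_right_mono) auto
  also have "\<dots> = \<epsilon> / 8" using L by (simp add: e_def field_simps)
  finally have Le: "L * e \<le> \<epsilon> / 8" .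
  obtain d2 where d2: "0 < d2" "\<forall>s K. torus_kernel s K \<and> s \<le> d2 \<longrightarrow>
    (\<integral>\<^sup>+z. ennreal \<bar>(\<integral>x. mp (fst z, x) * K (snd z - x) \<partial>torus_vol) - mp z\<bar> \<partial>st_vol T) \<le> ennreal e"
    using mollify_L1[OF T mp_integrable e] by blast
  define \<delta> where "\<delta> = d2 / R"
  have \<delta>: "0 < \<delta>" "R * \<delta> \<le> d2" using d2(1) R(1) by (auto simp: \<delta>_def)
  let ?D = "periodize (scaled_kernel \<xi> \<delta>)"
  have D: "torus_kernel (R * \<delta>) ?D" using R(2) \<delta>(1) by blast
  obtain \<kappa>' where \<kappa>': "0 \<le> \<kappa>'" "\<And>z. ?D z \<le> \<kappa>'" using torus_kernel_bounded[OF D] by metis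
  define X where "X = 8 * (L * T * \<kappa>') / \<epsilon>"
  have X: "0 \<le> X" using L T \<kappa>'(1) \<epsilon> by (simp add: X_def)
  define N0 where "N0 = nat \<lceil>X\<^sup>2\<rceil> + 2"
  let ?cost = "expected_cost T r' f H \<phi>T m0 \<xi> \<delta> \<sigma>"
  have main: "(\<forall>\<beta>\<in>strategies T N i. ?cost N i ((\<lambda>j. open_loop b)(i := \<beta>)) \<ge> ?cost N i (\<lambda>j. open_loop b) - ereal \<epsilon>) \<and>
      \<bar>?cost N i (\<lambda>j. open_loop b) - ereal V\<bar> \<le> ereal \<epsilon>"
    if N: "N0 \<le> N" and i: "i \<in> {1..N}" for N i
  proof -
    have N2: "2 \<le> N" using N by (simp add: N0_def)
    have "X\<^sup>2 \<le> real N - 1"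
    proof -
      have "X\<^sup>2 \<le> real (nat \<lceil>X\<^sup>2\<rceil>)" by (rule real_nat_ceiling_ge)
      also have "\<dots> \<le> real N - 1" using N by (simp add: N0_def)
      finally show ?thesis .
    qed
    then have sX: "X \<le> sqrt (real N - 1)" by (rule real_le_rsqrt)
    have s0: "0 < sqrt (real N - 1)" using N2 by simp
    have "L * (T * (\<kappa>' / sqrt (real N - 1))) = (X * \<epsilon> / 8) / sqrt (real N - 1)" using \<epsilon> by (simp add: X_def)
    also have "\<dots> \<le> \<epsilon> / 8"
    proof -
      have "X * \<epsilon> / 8 \<le> \<epsilon> / 8 * sqrt (real N - 1)" using mult_right_mono[OF sX, of "\<epsilon> / 8"] \<epsilon> by (simp add: mult_ac)
      then show ?thesis using s0 by (simp add: pos_divide_le_eq)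
    qed
    finally have LT: "L * (T * (\<kappa>' / sqrt (real N - 1))) \<le> \<epsilon> / 8" .
    let ?S = "\<lambda>\<omega>. spread ?D N i (route \<omega>)"
    have moll: "(\<integral>\<^sup>+z. ennreal \<bar>(\<integral>x. mp (fst z, x) * ?D (snd z - x) \<partial>torus_vol) - mp z\<bar> \<partial>st_vol T) \<le> ennreal e"
      using d2(2) D \<delta>(2) by blast
    note es = expected_spread[OF D \<kappa>'(2) less_imp_le[OF e] moll N2 i]
    have "L * (\<integral>\<omega>. ?S \<omega> \<partial>players N) \<le> L * (T * (\<kappa>' / sqrt (real N - 1)) + e)"
      by (rule mult_left_mono[OF es(2) L])
    then have ES: "L * (\<integral>\<omega>. ?S \<omega> \<partial>players N) \<le> \<epsilon> / 4" using LT Le unfolding distrib_left by linarith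
    note pc = player_cost_between[OF \<sigma>(1) \<delta>(1) \<kappa>(2), where N=N and i=i, folded L_def]
    have lower: "ereal (V - \<epsilon> / 2) \<le> ?cost N i ((\<lambda>j. open_loop b)(i := \<beta>))" if \<beta>: "\<beta> \<in> strategies T N i" for \<beta>
    proof -
      let ?Y = "\<lambda>\<omega>. \<phi> (0, apply_bcontfun (route \<omega> i) 0) - \<epsilon> / 8 - L * ?S \<omega>"
      interpret S: sampled_pairs rand_space "init_law m0" "{1..N}" by (rule sampled)
      note ini = player_expectation[OF i initial_value(1)]
      have iY: "integrable (players N) ?Y" by (intro Bochner_Integration.integrable_diff ini(1) S.PPs.P.integrable_const integrable_mult_right es(1))
      have "(\<integral>\<omega>. ?Y \<omega> \<partial>players N) = (\<integral>\<omega>. \<phi> (0, apply_bcontfun (route \<omega> i) 0) \<partial>players N) - \<epsilon> / 8 - L * (\<integral>\<omega>. ?S \<omega> \<partial>players N)"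
        using ini(1) es(1) S.PPs.P.prob_space by (simp del: One_nat_def)
      also have "(\<integral>\<omega>. \<phi> (0, apply_bcontfun (route \<omega> i) 0) \<partial>players N) = V"
        unfolding ini(2) initial_value(2) initial_value(3) V_def ..
      finally have "V - \<epsilon> / 2 \<le> (\<integral>\<omega>. ?Y \<omega> \<partial>players N)" using ES \<epsilon> by linarith
      then have "ereal (V - \<epsilon> / 2) \<le> ereal (\<integral>\<omega>. ?Y \<omega> \<partial>players N)" by simp
      also have "\<dots> \<le> ?cost N i ((\<lambda>j. open_loop b)(i := \<beta>))" unfolding expected_cost_def
      proof (rule ext_integral_ge[OF iY])
        fix \<omega> assume \<omega>: "\<omega> \<in> space (players N)"
        define g where "g = outcome T N ((\<lambda>j. open_loop b)(i := \<beta>)) (fst \<omega>) (snd \<omega>)"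
        note out = outcome_deviation[OF \<beta> i \<omega>, folded g_def]
        have Sg: "spread ?D N i g = ?S \<omega>" by (rule spread_cong) (rule out(1))
        have g0: "apply_bcontfun (g i) 0 = apply_bcontfun (route \<omega> i) 0" unfolding out(3) path_in_curves(3)[OF \<omega> i] ..
        have "ereal (?Y \<omega>) \<le> path_integral T r' (\<lambda>s. lagrangian H) (g i)
          + ereal (coupling_cost ?K (g i) + \<phi>T (apply_bcontfun (g i) T) - L * spread ?D N i g)"
        proof (cases "sobolev_curve T r' (g i)")
          case True
          then have "\<phi> (0, apply_bcontfun (g i) 0) \<le> \<phi>T (apply_bcontfun (g i) T) + action (g i) + coupling_cost ?K (g i) + \<epsilon> / 8"
            using \<sigma>0(2) \<sigma> by blast
          then show ?thesis using True unfolding Sg g0 by (simp add: path_integral_def)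
        qed (simp add: path_integral_def)
        also have "\<dots> \<le> player_cost T r' f H \<phi>T \<xi> \<delta> \<sigma> N i g" by (rule pc(1))
        finally show "ereal (?Y \<omega>) \<le> (case \<omega> of (\<omega>, x0) \<Rightarrow> player_cost T r' f H \<phi>T \<xi> \<delta> \<sigma> N i (outcome T N ((\<lambda>j. open_loop b)(i := \<beta>)) \<omega> x0))"
          by (simp add: g_def case_prod_unfold)
      qed
      finally show ?thesis .
    qed
    have upper: "?cost N i (\<lambda>j. open_loop b) \<le> ereal (V + \<epsilon> / 2)"
    proof -
      let ?A = "\<lambda>\<gamma>. real_of_ereal (path_integral T r' (\<lambda>s. lagrangian H) \<gamma>)"
      let ?Y = "\<lambda>\<omega>. ?A (route \<omega> i) + coupling_cost ?K (route \<omega> i) + \<phi>T (apply_bcontfun (route \<omega> i) T) + L * ?S \<omega>"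
      interpret E: prob_space \<eta> by (rule prob_\<eta>)
      note hm = borel_measurable_continuous_onI[OF \<phi>T_continuous]
      obtain B where B: "\<And>x. norm (\<phi>T x) \<le> B" using bounded_torus[OF \<phi>T_continuous] by metis
      have it: "integrable \<eta> (\<lambda>\<gamma>. \<phi>T (apply_bcontfun \<gamma> T))"
        by (rule E.integrable_const_bound[where B=B]) (use B measurable_compose[OF eval_\<eta> hm] in auto)
      have lt: "(\<integral>\<gamma>. \<phi>T (apply_bcontfun \<gamma> T) \<partial>\<eta>) = (\<integral>x. \<phi>T x \<partial>\<mu> T)"
        by (rule integral_law[symmetric, OF _ hm]) (use T in auto)
      note a = player_expectation[OF i action_law(2)]
      note k = player_expectation[OF i coupling_cost_bounds(2)[OF K]]
      note t = player_expectation[OF i it]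
      have iY: "integrable (players N) ?Y" by (intro Bochner_Integration.integrable_add a(1) k(1) t(1) integrable_mult_right es(1))
      have le: "?cost N i (\<lambda>j. open_loop b) \<le> ereal (\<integral>\<omega>. ?Y \<omega> \<partial>players N)" unfolding expected_cost_def
      proof (rule ext_integral_le[OF iY], rule AE_mp[OF player_AE[OF i action_law(1)]], intro AE_I2 impI)
        fix \<omega> assume \<omega>: "\<omega> \<in> space (players N)" and sob: "sobolev_curve T r' (route \<omega> i)"
        define g where "g = outcome T N (\<lambda>j. open_loop b) (fst \<omega>) (snd \<omega>)"
        note out = outcome_open_loop[OF i \<omega>, folded g_def]
        have Sg: "spread ?D N i g = ?S \<omega>" by (rule spread_cong) (simp add: out)
        have gi: "g i = route \<omega> i" by (rule out[OF i])
        have "player_cost T r' f H \<phi>T \<xi> \<delta> \<sigma> N i g \<le> path_integral T r' (\<lambda>s. lagrangian H) (g i)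
          + ereal (coupling_cost ?K (g i) + \<phi>T (apply_bcontfun (g i) T) + L * spread ?D N i g)" by (rule pc(2))
        also have "\<dots> = ereal (?Y \<omega>)" using sob unfolding Sg gi by (simp add: path_integral_def)
        finally show "(case \<omega> of (\<omega>, x0) \<Rightarrow> player_cost T r' f H \<phi>T \<xi> \<delta> \<sigma> N i (outcome T N (\<lambda>j. open_loop b) \<omega> x0)) \<le> ereal (?Y \<omega>)"
          by (simp add: g_def case_prod_unfold)
      qed
      have "(\<integral>\<omega>. ?Y \<omega> \<partial>players N) = (\<integral>\<omega>. ?A (route \<omega> i) \<partial>players N) + (\<integral>\<omega>. coupling_cost ?K (route \<omega> i) \<partial>players N)
          + (\<integral>\<omega>. \<phi>T (apply_bcontfun (route \<omega> i) T) \<partial>players N) + L * (\<integral>\<omega>. ?S \<omega> \<partial>players N)"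
        using a(1) k(1) t(1) es(1) by (simp del: One_nat_def)
      also have "\<dots> = (V - (\<integral>x. \<phi>T x \<partial>\<mu> T) - (\<integral>z. F z * mp z \<partial>st_vol T)) + (\<integral>\<gamma>. coupling_cost ?K \<gamma> \<partial>\<eta>)
          + (\<integral>x. \<phi>T x \<partial>\<mu> T) + L * (\<integral>\<omega>. ?S \<omega> \<partial>players N)"
        unfolding a(2) k(2) t(2) lt action_law(3) initial_value(3) V_def ..
      also have "\<dots> \<le> V + \<epsilon> / 2"
      proof -
        have "(\<integral>\<gamma>. coupling_cost ?K \<gamma> \<partial>\<eta>) \<le> (\<integral>z. F z * mp z \<partial>st_vol T) + \<epsilon> / 8" using d1(2) K R\<sigma> by blast
        then show ?thesis using ES \<epsilon> by linarith
      qed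
      finally have "(\<integral>\<omega>. ?Y \<omega> \<partial>players N) \<le> V + \<epsilon> / 2" .
      then have "ereal (\<integral>\<omega>. ?Y \<omega> \<partial>players N) \<le> ereal (V + \<epsilon> / 2)" by simp
      with le show ?thesis by (rule order_trans)
    qed
    have "(\<lambda>j. open_loop b)(i := open_loop b) = (\<lambda>j. open_loop b)" by auto
    with lower[OF open_loop_strategy] have lo: "ereal (V - \<epsilon> / 2) \<le> ?cost N i (\<lambda>j. open_loop b)" by simp
    then obtain c where c: "?cost N i (\<lambda>j. open_loop b) = ereal c" "V - \<epsilon> / 2 \<le> c" "c \<le> V + \<epsilon> / 2"
      using upper by (cases "?cost N i (\<lambda>j. open_loop b)") auto
    show ?thesis
    proof (intro conjI ballI)
      fix \<beta> :: "'d strategy" assume "\<beta> \<in> strategies T N i"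
      have "ereal c - ereal \<epsilon> \<le> ereal (V - \<epsilon> / 2)" using c by simp
      also note lower[OF \<open>\<beta> \<in> strategies T N i\<close>]
      finally show "?cost N i (\<lambda>j. open_loop b) - ereal \<epsilon> \<le> ?cost N i ((\<lambda>j. open_loop b)(i := \<beta>))" unfolding c(1) .
    next
      show "\<bar>?cost N i (\<lambda>j. open_loop b) - ereal V\<bar> \<le> ereal \<epsilon>" unfolding c(1) using c(2,3) \<epsilon> by simp
    qed
  qed
  show ?thesis unfolding V_def[symmetric] using main \<sigma>(1) \<delta>(1) by blast
qed

end

theorem theorem5p1:
  fixes T q r r' :: real
    and f :: "'d::finite torus \<Rightarrow> real \<Rightarrow> real"
    and H :: "'d torus \<Rightarrow> real ^ 'd \<Rightarrow> real"
    and \<phi>T m0 :: "'d torus \<Rightarrow> real"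
    and \<xi> :: "real ^ 'd \<Rightarrow> real"
    and m \<phi> :: "real \<times> 'd torus \<Rightarrow> real"
    and \<mu> :: "real \<Rightarrow> 'd torus measure"
    and \<eta> :: "'d curve measure"
    and b :: "real \<times> 'd torus \<Rightarrow> 'd curve"
  assumes "T > 0"
    and "coupling_cond q f"
    and "hamiltonian_cond q r H"
    and "1 / r + 1 / r' = 1"
    and "x_dependence_cond r H"
    and "data_cond \<phi>T m0"
    and "reg_kernel \<xi>"
    and lipschitz: "\<exists>K. \<forall>x. K-lipschitz_on {0..} (f x)"
    and "weak_solution T q r f H \<phi>T m0 m \<phi>"
    and "viscosity_supersolution T H \<phi>"
    and "continuous_rep T m \<mu>"
    and "\<eta> \<in> curve_measures T q r'"
    and C1: "\<forall>t\<in>{0..T}. \<mu> t = eval_law \<eta> t"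
    and C2: "ereal (\<integral>x. \<phi> (0, x) \<partial>\<mu> 0) =
      ereal (\<integral>x. \<phi>T x \<partial>\<mu> T)
      + ext_integral \<eta> (path_integral T r' (\<lambda>s. lagrangian H))
      + ereal (\<integral>z. f (snd z) (max 0 (m z)) * m z \<partial>st_vol T)"
    and "realizes T m0 \<eta> b"
  shows "\<forall>\<epsilon>>0. \<exists>N0. \<exists>\<delta>>0. \<exists>\<sigma>>0. \<forall>N\<ge>N0. \<forall>i\<in>{1..N}.
    (\<forall>\<beta>\<in>strategies T N i.
       expected_cost T r' f H \<phi>T m0 \<xi> \<delta> \<sigma> N i ((\<lambda>j. open_loop b)(i := \<beta>))
         \<ge> expected_cost T r' f H \<phi>T m0 \<xi> \<delta> \<sigma> N i (\<lambda>j. open_loop b) - ereal \<epsilon>) \<and>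
    \<bar>expected_cost T r' f H \<phi>T m0 \<xi> \<delta> \<sigma> N i (\<lambda>j. open_loop b)
       - ereal (\<integral>x. \<phi> (0, x) * m0 x \<partial>torus_vol)\<bar> \<le> ereal \<epsilon>"
proof -
  obtain K where "\<And>x. K-lipschitz_on {0..} (f x)" using lipschitz by blast
  then interpret mean_field_game T q r r' f H \<phi>T m0 \<xi> m \<phi> \<mu> \<eta> b K using assms by unfold_locales blast+
  show ?thesis by (intro allI impI approximate_equilibrium)
qed

end
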